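(* Let $(b^i:[0,T]\times\mathcal P(\mathbb T^d)\times\mathbb T^d\to\mathbb R^d)_{i\ge1}$ be a collection of uniformly bounded (i.e. $\sup_i\|b^i\|_\infty<\infty$) and measurable functions, $t_0\in[0,T)$ and $\mathfrak m$ a Borel probability measure on $T_o^\infty\times(\mathbb T^d)_o^\infty$. Then there exists a weak solution to the infinite system $$dX^i_t=b^i_t(\mu^\infty_t,X^i_t)\,dt+\sqrt{\tfrac{2}{s_i}}\,dW^i_t,\quad t\in[t_0,T],\qquad X^i_{t_0}=\iota(x_i),\qquad i\ge1,\qquad \mu_t^\infty=\sum_{j\ge1}s_j\delta_{X^j_t},$$ driven by the data $(b^i)_i$, $t_0$, $\mathfrak m$.
   Context: Fix an integer $d\ge2$ and $T>0$. $\mathbb T^d=\mathbb R^d/\mathbb Z^d$; $\mathcal P(\mathbb T^d)$ is the space of Borel probability measures on $\mathbb T^d$ with the weak topology and its Borel $\sigma$-field. $T_o^\infty$ is the set of sequences $\mathbf s=(s_i)_{i\ge1}$ in $[0,1]$ that are strictly decreasing with $\sum_is_i=1$; $(\mathbb T^d)_o^\infty$ is the set of sequences $\mathbf x=(x_i)_i$ of pairwise distinct points of $\mathbb T^d$ (both with the product topology). $\iota:\mathbb T^d\to[0,1)^d\subset\mathbb R^d$ is the map sending a point to its unique representative in $[0,1)^d$, $\varpi:\mathbb R^d\to\mathbb T^d$ the canonical projection. Functions on $\mathbb T^d$ are evaluated at points $y\in\mathbb R^d$ through $\varpi(y)$, and $\delta_y$ for $y\in\mathbb R^d$ denotes $\delta_{\varpi(y)}\in\mathcal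 P(\mathbb T^d)$. A weak solution driven by $(b^i)_i,t_0,\mathfrak m$ is a tuple $(\Omega,\mathcal F,\mathbb Q,\{\mathcal F_t\}_{t\in[t_0,T]},((\mathbf s,\mathbf x),(X^i)_i,(W^i)_i))$ such that: (i) $(W^i)_i$ is a family of independent $d$-dimensional $\{\mathcal F_t\}_{t\in[t_0,T]}$-Brownian motions (on $[t_0,T]$, equal to $0$ at $t_0$) on the filtered probability space; (ii) $(\mathbf s,\mathbf x)$ is a $T_o^\infty\times(\mathbb T^d)_o^\infty$-valued $\mathcal F_{t_0}$-measurable random variable with law $\mathfrak m$ under $\mathbb Q$; (iii) $\mathbb Q$-a.s., for all $i\ge1$ and $t\in[t_0,T]$, $X^i_t=\iota(x_i)+\int_{t_0}^tb^i_r(\mu^\infty_r,X^i_r)dr+\sqrt{2/s_i}\,W^i_t$, with $\mu^\infty_t=\sum_js_j\delta_{X^j_t}$. *)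

theory Defs
  imports "HOL-Probability.Probability"
begin

section \<open>The torus\<close>

definition lattice_equiv :: "real ^ 'd \<Rightarrow> real ^ 'd \<Rightarrow> bool" where
  "lattice_equiv x y \<longleftrightarrow> (\<forall>k. x $ k - y $ k \<in> \<int>)"

lemma equivp_lattice_equiv: "equivp lattice_equiv"
proof (rule equivpI)
  show "reflp lattice_equiv"
    by (simp add: reflp_def lattice_equiv_def)
  show "symp lattice_equiv"
    unfolding symp_def lattice_equiv_def by (metis Ints_minus minus_diff_eq)
  show "transp lattice_equiv"
    unfolding transp_def lattice_equiv_def
  proof (intro allI impI)
    fix x y z :: "real ^ 'd" and k
    assume "\<forall>k. x $ k - y $ k \<in> \<int>" "\<forall>k. y $ k - z $ k \<in> \<int>"
    then have "(x $ k - y $ k) + (y $ k - z $ k) \<in> \<int>" by (intro Ints_add) auto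
    then show "x $ k - z $ k \<in> \<int>" by simp
  qed
qed

quotient_type 'd torus = "real ^ 'd::finite" / lattice_equiv
  by (rule equivp_lattice_equiv)

abbreviation proj_torus :: "real ^ 'd \<Rightarrow> 'd torus" where
  "proj_torus \<equiv> abs_torus"

instantiation torus :: (finite) topological_space
begin

definition open_torus :: "'a torus set \<Rightarrow> bool" where
  "open_torus U \<longleftrightarrow> open (proj_torus -` U)"

instance
  by standard (auto simp: open_torus_def vimage_Int vimage_Union open_Int)

end

definition iota :: "'d::finite torus \<Rightarrow> real ^ 'd" where
  "iota p = (THE y. (\<forall>k. y $ k \<in> {0..<1}) \<and> proj_torus y = p)"

lemma ex1_representative:
  fixes p :: "'d::finite torus"
  shows "\<exists>!y. (\<forall>k. y $ k \<in> {0..<1}) \<and> proj_torus y = p"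
proof -
  obtain x where x: "p = proj_torus x"
    by (metis Quotient3_abs_rep[OF Quotient3_torus])
  show ?thesis
  proof (rule ex1I[of _ "\<chi> k. frac (x $ k)"])
    have "lattice_equiv (\<chi> k. frac (x $ k)) x"
      by (simp add: lattice_equiv_def frac_def)
    then show "(\<forall>k. (\<chi> k. frac (x $ k)) $ k \<in> {0..<1}) \<and> proj_torus (\<chi> k. frac (x $ k)) = p"
      by (simp add: x torus.abs_eq_iff frac_lt_1)
  next
    fix y :: "real ^ 'd"
    assume y: "(\<forall>k. y $ k \<in> {0..<1}) \<and> proj_torus y = p"
    then have "lattice_equiv x y"
      by (metis x torus.abs_eq_iff)
    then have "frac (x $ k) = y $ k" for k
      using y by (auto simp: lattice_equiv_def frac_unique_iff)
    then show "y = (\<chi> k. frac (x $ k))"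
      by (simp add: vec_eq_iff)
  qed
qed

lemma iota_range: "iota (p :: 'd::finite torus) $ k \<in> {0..<1}"
  and proj_torus_iota: "proj_torus (iota p) = p"
  using theI'[OF ex1_representative[of p]] by (simp_all add: iota_def)


section \<open>Borel probability measures with the weak topology\<close>

definition prob_measures :: "'a::topological_space measure set" where
  "prob_measures = {\<mu>. prob_space \<mu> \<and> sets \<mu> = sets borel}"

text \<open>The coarsest topology making integration against every bounded continuous function continuous.\<close>

definition weak_topology :: "'a::topological_space measure topology" where
  "weak_topology = topology_generated_by
     {{\<mu> \<in> prob_measures. (\<integral>x. f x \<partial>\<mu>) \<in> U} | (f :: 'a \<Rightarrow> real) U.
        continuous_on UNIV f \<and> bounded (range f) \<and> open U}"

lemma topspace_weak_topology:
  "topspace (weak_topology :: 'a::topological_space measure topology) = prob_measures"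
proof -
  have "openin weak_topology {\<mu> \<in> prob_measures. (\<integral>x. (0::real) \<partial>(\<mu> :: 'a measure)) \<in> UNIV}"
    unfolding weak_topology_def
    by (rule topology_generated_by_Basis, rule CollectI, rule exI[of _ "\<lambda>_. 0"], rule exI[of _ UNIV])
       (simp add: image_constant_conv)
  then have "prob_measures \<subseteq> topspace (weak_topology :: 'a measure topology)"
    using openin_subset[of weak_topology] by simp
  moreover have "topspace (weak_topology :: 'a measure topology) \<subseteq> prob_measures"
    unfolding weak_topology_def topology_generated_by_topspace by (rule Union_least) force
  ultimately show ?thesis by (rule antisym[rotated])
qed

definition weak_borel :: "'a::topological_space measure measure" where
  "weak_borel = sigma prob_measures {U. openin weak_topology U}"


section \<open>Initial data\<close>

text \<open>Sequences are indexed by the natural numbers from 0, so index \<open>i\<close> here is \<open>i + 1\<close> in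
  the usual notation.\<close>

definition mass_sequences :: "(nat \<Rightarrow> real) set" where
  "mass_sequences = {s. (\<forall>i. s i \<in> {0..1}) \<and> (\<forall>i j. i < j \<longrightarrow> s j < s i) \<and> s sums 1}"

definition distinct_points :: "(nat \<Rightarrow> 'd::finite torus) set" where
  "distinct_points = {x. inj x}"

text \<open>The type \<open>nat \<Rightarrow> _\<close> carries the product topology, so the restriction of \<open>borel\<close> is the
  Borel \<open>\<sigma>\<close>-algebra of the subspace topology of the product topology.\<close>

definition initial_data :: "((nat \<Rightarrow> real) \<times> (nat \<Rightarrow> 'd::finite torus)) measure" where
  "initial_data = restrict_space borel (mass_sequences \<times> distinct_points)"

definition empirical_measure :: "(nat \<Rightarrow> real) \<Rightarrow> (nat \<Rightarrow> real ^ 'd::finite) \<Rightarrow> 'd torus measure" where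
  "empirical_measure s y =
     measure_of UNIV (sets borel) (\<lambda>A. \<Sum>j. ennreal (s j) * emeasure (return borel (proj_torus (y j))) A)"

lemma sets_empirical_measure: "sets (empirical_measure s y) = sets borel"
  unfolding empirical_measure_def using sets.sigma_sets_eq[of borel] by simp

lemma emeasure_empirical_measure:
  fixes y :: "nat \<Rightarrow> real ^ 'a::finite"
  assumes "A \<in> sets borel"
  shows "emeasure (empirical_measure s y) A = (\<Sum>j. ennreal (s j) * indicator A (proj_torus (y j)))"
proof -
  define \<mu> where
    "\<mu> = (\<lambda>A. \<Sum>j. ennreal (s j) * emeasure (return borel (proj_torus (y j))) A)"
  have "countably_additive (sets (borel :: 'a torus measure)) \<mu>"
  proof (rule countably_additiveI)
    fix B :: "nat \<Rightarrow> 'a torus set"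
    assume B: "range B \<subseteq> sets borel" "disjoint_family B"
    let ?f = "\<lambda>i j. ennreal (s j) * emeasure (return borel (proj_torus (y j))) (B i)"
    have "(\<Sum>i. \<mu> (B i)) = (\<Sum>i. \<integral>\<^sup>+j. ?f i j \<partial>count_space UNIV)"
      unfolding \<mu>_def nn_integral_count_space_nat ..
    also have "\<dots> = (\<integral>\<^sup>+j. (\<Sum>i. ?f i j) \<partial>count_space UNIV)"
      by (rule nn_integral_suminf[symmetric]) simp
    also have "\<dots> = (\<Sum>j. \<Sum>i. ?f i j)"
      by (rule nn_integral_count_space_nat)
    also have "\<dots> = \<mu> (\<Union>i. B i)"
      unfolding \<mu>_def ennreal_suminf_cmult
      using B by (subst suminf_emeasure) (auto simp del: emeasure_return)
    finally show "(\<Sum>i. \<mu> (B i)) = \<mu> (\<Union>i. B i)" .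
  qed
  moreover have "positive (sets (borel :: 'a torus measure)) \<mu>"
    by (simp add: positive_def \<mu>_def)
  moreover have "sigma_algebra UNIV (sets (borel :: 'a torus measure))"
    using sets.sigma_algebra_axioms[of "borel :: 'a torus measure"] by simp
  ultimately have "emeasure (empirical_measure s y) A = \<mu> A"
    using assms by (simp add: empirical_measure_def \<mu>_def emeasure_measure_of_sigma)
  then show ?thesis
    using assms by (simp add: \<mu>_def)
qed

lemma empirical_measure_in_prob_measures:
  assumes "s \<in> mass_sequences"
  shows "empirical_measure s y \<in> prob_measures"
proof -
  have s: "\<And>i. 0 \<le> s i" "s sums 1"
    using assms unfolding mass_sequences_def by auto
  have sp: "space (empirical_measure s y) = UNIV"
    using sets_eq_imp_space_eq[OF sets_empirical_measure] by simp
  have "(\<Sum>j. ennreal (s j)) = ennreal (\<Sum>j. s j)"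
    by (rule suminf_ennreal2[OF s(1) sums_summable[OF s(2)]])
  also have "\<dots> = 1"
    unfolding sums_unique[OF s(2), symmetric] by simp
  finally have "emeasure (empirical_measure s y) UNIV = 1"
    by (subst emeasure_empirical_measure) simp_all
  then show ?thesis
    unfolding prob_measures_def using sp by (auto intro: prob_spaceI simp: sets_empirical_measure)
qed


section \<open>Brownian motions and weak solutions\<close>

text \<open>The filtration is indexed by \<open>{t\<^sub>0..T}\<close>, values outside this interval are irrelevant; no usual
  conditions are imposed.\<close>

definition filtered_prob_space :: "real \<Rightarrow> real \<Rightarrow> 'w measure \<Rightarrow> (real \<Rightarrow> 'w measure) \<Rightarrow> bool" where
  "filtered_prob_space t\<^sub>0 T Q F \<longleftrightarrow>
     prob_space Q \<and>
     (\<forall>t\<in>{t\<^sub>0..T}. subalgebra Q (F t)) \<and>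
     (\<forall>r\<in>{t\<^sub>0..T}. \<forall>t\<in>{r..T}. subalgebra (F t) (F r))"

definition brownian_motion ::
  "real \<Rightarrow> real \<Rightarrow> 'w measure \<Rightarrow> (real \<Rightarrow> 'w measure) \<Rightarrow> (real \<Rightarrow> 'w \<Rightarrow> real ^ 'd::finite) \<Rightarrow> bool" where
  "brownian_motion t\<^sub>0 T Q F W \<longleftrightarrow>
     (\<forall>t\<in>{t\<^sub>0..T}. W t \<in> borel_measurable (F t)) \<and>
     (\<forall>\<omega>\<in>space Q. W t\<^sub>0 \<omega> = 0 \<and> continuous_on {t\<^sub>0..T} (\<lambda>t. W t \<omega>)) \<and>
     (\<forall>r t. t\<^sub>0 \<le> r \<and> r < t \<and> t \<le> T \<longrightarrow>
        prob_space.indep_set Q (sets (F r))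
          (sets (vimage_algebra (space Q) (\<lambda>\<omega>. W t \<omega> - W r \<omega>) borel)) \<and>
        distributed Q lborel (\<lambda>\<omega>. W t \<omega> - W r \<omega>)
          (\<lambda>z. ennreal (\<Prod>k\<in>UNIV. normal_density 0 (sqrt (t - r)) (z $ k))))"

definition independent_processes ::
  "real \<Rightarrow> real \<Rightarrow> 'w measure \<Rightarrow> ('i \<Rightarrow> real \<Rightarrow> 'w \<Rightarrow> real ^ 'd::finite) \<Rightarrow> bool" where
  "independent_processes t\<^sub>0 T Q W \<longleftrightarrow>
     prob_space.indep_vars Q (\<lambda>_. \<Pi>\<^sub>M t\<in>{t\<^sub>0..T}. borel) (\<lambda>i \<omega>. \<lambda>t\<in>{t\<^sub>0..T}. W i t \<omega>) UNIV"

text \<open>\<open>Z\<close> is the random initial datum (masses and points). The clause \<open>set_integrable\<close> makes the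
  drift integral meaningful: a Bochner integral defaults to 0 on non-integrable functions. Adaptedness
  of \<open>X\<close> expresses that the \<open>X i\<close> are processes on the filtered probability space; their
  almost sure path continuity follows from the equation. Functions on the torus are evaluated at
  points of \<open>real ^ 'd\<close> through \<^const>\<open>abs_torus\<close>.\<close>

definition weak_solution ::
  "(nat \<Rightarrow> real \<Rightarrow> 'd::finite torus measure \<Rightarrow> 'd torus \<Rightarrow> real ^ 'd) \<Rightarrow> real \<Rightarrow> real \<Rightarrow>
   ((nat \<Rightarrow> real) \<times> (nat \<Rightarrow> 'd torus)) measure \<Rightarrow>
   'w measure \<Rightarrow> (real \<Rightarrow> 'w measure) \<Rightarrow> ('w \<Rightarrow> (nat \<Rightarrow> real) \<times> (nat \<Rightarrow> 'd torus)) \<Rightarrow>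
   (nat \<Rightarrow> real \<Rightarrow> 'w \<Rightarrow> real ^ 'd) \<Rightarrow> (nat \<Rightarrow> real \<Rightarrow> 'w \<Rightarrow> real ^ 'd) \<Rightarrow> bool" where
  "weak_solution b t\<^sub>0 T \<mm> Q F Z X W \<longleftrightarrow>
     filtered_prob_space t\<^sub>0 T Q F \<and>
     (\<forall>i. brownian_motion t\<^sub>0 T Q F (W i)) \<and>
     independent_processes t\<^sub>0 T Q W \<and>
     Z \<in> measurable (F t\<^sub>0) initial_data \<and>
     distr Q initial_data Z = \<mm> \<and>
     (\<forall>i. \<forall>t\<in>{t\<^sub>0..T}. X i t \<in> borel_measurable (F t)) \<and>
     (AE \<omega> in Q. \<forall>i.
        let s = fst (Z \<omega>); x = snd (Z \<omega>);
            drift = (\<lambda>r. b i r (empirical_measure s (\<lambda>j. X j r \<omega>)) (proj_torus (X i r \<omega>)))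
        in set_integrable lborel {t\<^sub>0..T} drift \<and>
           (\<forall>t\<in>{t\<^sub>0..T}.
              X i t \<omega> = iota (x i) + (LINT r:{t\<^sub>0..t}|lborel. drift r) + sqrt (2 / s i) *\<^sub>R W i t \<omega>))"

end

theory Submission
  imports Defs
begin

text \<open>
  Without the drift the system is solved by \<open>X\<^sub>t\<^sup>i = \<iota>(x\<^sub>i) + sqrt (2 / s\<^sub>i) B\<^sup>i\<^sub>t\<close> with independent Brownian
  motions \<open>B\<^sup>i\<close>, and the drift is put in by a change of measure. Measured in units of the noise, the
  drift of particle \<open>i\<close> is \<open>\<theta>\<^sup>i = sqrt (s\<^sub>i / 2) b\<^sup>i\<close>. If \<open>C\<close> bounds every \<open>b\<^sup>i\<close>, then
  \<open>\<Sum>\<^sub>i \<bar>\<theta>\<^sup>i\<bar>\<^sup>2 \<le> C\<^sup>2 / 2 \<cdot> \<Sum>\<^sub>i s\<^sub>i = C\<^sup>2 / 2\<close>: the noise gets stronger for lighter particles, so the total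
  energy of the infinitely many drifts stays bounded, and one Girsanov density serves the whole system.
  Under the new measure \<open>W\<^sup>i = B\<^sup>i - \<integral>\<theta>\<^sup>i\<close> are independent Brownian motions, the processes
  \<open>X\<^sup>i\<close> solve the equation path by path, and the law of the initial datum is the old one, because the
  density has conditional expectation 1 given the initial \<open>\<sigma>\<close>-algebra.

  Being Brownian is expressed here by the characteristic functions of increments, tested against past
  events (locale \<open>brownian_family\<close>); this makes the Girsanov transformation a matter of passing to
  limits and avoids stochastic integrals. For a drift that is constant on the cells of a
  dyadic grid the density is an explicit exponential and the claim is a finite product of Gaussian
  integrals (\<open>gaussian_telescope\<close>, \<open>step_density_char\<close>). Predictable functions are approximated by such
  step functions (\<open>predictable_approximable\<close>), and an estimate of Hellinger type shows that the
  densities then form a Cauchy sequence in \<open>L\<^sup>1\<close>, with constants depending on the energy bound and \<open>T - t\<^sub>0\<close> only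
  (\<open>step_density_L1_dist\<close>). The limit gives the theorem \<open>girsanov\<close>.

  The driftless system needs infinitely many Brownian motions that are independent of the initial
  datum. They come from independent standard Gaussian variables by Levy's series of hat functions
  (\<open>levy_path\<close>), whose dyadic increments are linear images of finitely many of these variables
  (\<open>levy_incr_linear\<close>); \<open>grid_increments\<close> verifies the Brownian property.

  Girsanov requires \<open>\<theta>\<close> to be predictable. The one analytic point is that the empirical
  measure depends continuously on masses and positions for the weak topology
  (\<open>empirical_measure_continuous\<close>), so that \<open>b\<close> composed with the driftless path is measurable.
\<close>

section \<open>Gaussian vectors and characteristic functions\<close>

text \<open>After normalising the weight \<open>f\<close> to a probability density, the hypothesis identifies the
  characteristic function of \<open>Y\<close>, and Levy's uniqueness theorem applies. If \<open>c = 0\<close> the weight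
  vanishes almost everywhere.\<close>

lemma weighted_law_from_char:
  fixes f Y :: "'w \<Rightarrow> real"
  assumes Y[measurable]: "Y \<in> borel_measurable M"
    and f: "integrable M f" and f_nonneg: "\<And>\<omega>. \<omega> \<in> space M \<Longrightarrow> 0 \<le> f \<omega>"
    and \<nu>: "real_distribution \<nu>"
    and char: "\<And>u. (LINT \<omega>|M. f \<omega> *\<^sub>R iexp (u * Y \<omega>)) = c *\<^sub>R char \<nu> u"
    and C[measurable]: "C \<in> sets borel"
  shows "(LINT \<omega>|M. f \<omega> * indicator C (Y \<omega>)) = c * measure \<nu> C"
proof -
  interpret \<nu>: real_distribution \<nu> by fact
  have [measurable]: "f \<in> borel_measurable M" using f by auto
  have "complex_of_real (LINT \<omega>|M. f \<omega>) = complex_of_real c"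
    using char[of 0] \<nu>.char_zero by (simp add: scaleR_conv_of_real)
  then have c: "c = (LINT \<omega>|M. f \<omega>)" by (simp only: of_real_eq_iff)
  have c_nonneg: "0 \<le> c" unfolding c by (intro Bochner_Integration.integral_nonneg_AE AE_I2 f_nonneg)
  show ?thesis
  proof (cases "c = 0")
    case True
    then have "AE \<omega> in M. f \<omega> = 0"
      using integral_nonneg_eq_0_iff_AE[OF f] f_nonneg c by simp
    then have "(LINT \<omega>|M. f \<omega> * indicator C (Y \<omega>)) = (LINT \<omega>|M. 0)"
      by (intro integral_cong_AE) auto
    then show ?thesis using True by simp
  next
    case False
    then have c_pos: "c > 0" using c_nonneg by simp
    define D where "D = density M (\<lambda>\<omega>. ennreal (f \<omega> / c))"
    define N where "N = distr D borel Y"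
    have quot_nonneg: "AE \<omega> in M. 0 \<le> f \<omega> / c" using f_nonneg c_pos by simp
    have "emeasure D (space D) = (\<integral>\<^sup>+\<omega>. ennreal (f \<omega> / c) \<partial>M)"
      unfolding D_def by (simp add: emeasure_density cong: nn_integral_cong)
    also have "\<dots> = ennreal (LINT \<omega>|M. f \<omega> / c)"
      using f quot_nonneg by (intro nn_integral_eq_integral) auto
    also have "\<dots> = 1" using c c_pos by simp
    finally interpret D: prob_space D by (rule prob_spaceI)
    have [measurable]: "Y \<in> borel_measurable D" by (simp add: D_def)
    have N: "real_distribution N"
      unfolding N_def by (rule D.real_distribution_distr) simp
    have "char N u = char \<nu> u" for u
    proof -
      have "char N u = (LINT \<omega>|D. iexp (u * Y \<omega>))"
        unfolding char_def N_def by (subst integral_distr) auto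
      also have "\<dots> = (LINT \<omega>|M. (f \<omega> / c) *\<^sub>R iexp (u * Y \<omega>))"
        unfolding D_def using quot_nonneg by (subst integral_density) auto
      also have "\<dots> = (1 / c) *\<^sub>R (LINT \<omega>|M. f \<omega> *\<^sub>R iexp (u * Y \<omega>))"
        by (subst integral_scaleR_right[symmetric]) (simp add: divide_inverse mult.commute)
      finally show ?thesis using c_pos unfolding char by simp
    qed
    then have "N = \<nu>" using N \<nu> by (intro Levy_uniqueness) auto
    then have "measure \<nu> C = (LINT x|N. indicator C x)"
      using \<nu>.emeasure_eq_measure by simp
    also have "\<dots> = (LINT \<omega>|D. indicator C (Y \<omega>))"
      unfolding N_def by (subst integral_distr) auto
    also have "\<dots> = (LINT \<omega>|M. (f \<omega> / c) *\<^sub>R indicator C (Y \<omega>))"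
      unfolding D_def using quot_nonneg by (subst integral_density) auto
    also have "\<dots> = (LINT \<omega>|M. f \<omega> * indicator C (Y \<omega>)) / c"
      by (simp add: divide_inverse mult.commute mult.left_commute flip: integral_mult_left_zero)
    finally show ?thesis using c_pos by simp
  qed
qed

lemma norm_iexp [simp]: "cmod (iexp x) = 1" by simp

lemma integrable_scaleR_iexp:
  fixes f X :: "'w \<Rightarrow> real"
  assumes "integrable M f" and [measurable]: "X \<in> borel_measurable M"
  shows "integrable M (\<lambda>\<omega>. f \<omega> *\<^sub>R iexp (X \<omega>))"
  by (rule Bochner_Integration.integrable_bound[OF assms(1)])
     (use assms(1)[THEN borel_measurable_integrable] in \<open>auto intro: measurable_compose\<close>)

text \<open>A weighted multivariate form of the uniqueness theorem, by adding one coordinate at a time. The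
  remaining coordinates enter the one-dimensional statement through the nonnegative weights
  \<open>f (1 + cos S)\<close> and \<open>f (1 + sin S)\<close>, where \<open>S\<close> is a linear combination of them; subtracting the
  case of the weight \<open>f\<close> recovers the complex exponential.\<close>

lemma gaussian_vector_from_char:
  fixes f :: "'w \<Rightarrow> real" and Y :: "'i \<Rightarrow> 'w \<Rightarrow> real"
  assumes "finite J"
    and Y[measurable]: "\<And>j. j \<in> J \<Longrightarrow> Y j \<in> borel_measurable M"
    and f: "integrable M f" and f_nonneg: "\<And>\<omega>. \<omega> \<in> space M \<Longrightarrow> 0 \<le> f \<omega>"
    and char: "\<And>l. (LINT \<omega>|M. f \<omega> *\<^sub>R iexp (\<Sum>j\<in>J. l j * Y j \<omega>))
          = complex_of_real (c * exp (- (\<Sum>j\<in>J. (l j)\<^sup>2) / 2))"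
    and C: "\<And>j. j \<in> J \<Longrightarrow> C j \<in> sets borel"
  shows "(LINT \<omega>|M. f \<omega> * (\<Prod>j\<in>J. indicator (C j) (Y j \<omega>)))
          = c * (\<Prod>j\<in>J. measure std_normal_distribution (C j))"
  using assms
proof (induction J arbitrary: f c rule: finite_induct)
  case empty
  have "complex_of_real (LINT \<omega>|M. f \<omega>) = complex_of_real c"
    using empty.prems(4)[of "\<lambda>_. 0"] by (simp add: scaleR_conv_of_real)
  then have "(LINT \<omega>|M. f \<omega>) = c" by (simp only: of_real_eq_iff)
  then show ?case by simp
next
  case (insert a J f c)
  note Ya[measurable] = insert.prems(1)[of a, OF insertI1]
  have Y[measurable]: "\<And>j. j \<in> J \<Longrightarrow> Y j \<in> borel_measurable M" using insert.prems(1) by simp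
  have Ca[measurable]: "C a \<in> sets borel" using insert.prems(5) by simp
  have std: "real_distribution std_normal_distribution"
    by (rule real_dist_normal_dist)
  note f = insert.prems(2)
  have [measurable]: "f \<in> borel_measurable M" using f by auto
  let ?E = "\<lambda>g. LINT \<omega>|M. g \<omega>"
  let ?S = "\<lambda>l \<omega>. \<Sum>j\<in>J. l j * Y j \<omega>"
  define q where "q l = exp (- (\<Sum>j\<in>J. (l j :: real)\<^sup>2) / 2)" for l
  have full: "(LINT \<omega>|M. f \<omega> *\<^sub>R iexp (?S l \<omega> + u * Y a \<omega>)) = complex_of_real (c * q l * exp (- u\<^sup>2 / 2))" for l u
  proof -
    have "(\<Sum>j\<in>J. (if j = a then u else l j) * Y j \<omega>) = ?S l \<omega>" for \<omega>
      using insert.hyps(2) by (intro sum.cong) auto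
    moreover have "(\<Sum>j\<in>J. (if j = a then u else l j)\<^sup>2) = (\<Sum>j\<in>J. (l j)\<^sup>2)"
      using insert.hyps(2) by (intro sum.cong) auto
    ultimately show ?thesis
      using insert.prems(4)[of "\<lambda>j. if j = a then u else l j"] insert.hyps
      by (simp add: q_def add.commute add_divide_distrib mult_exp_exp del: of_real_mult of_real_add)
  qed
  have q_minus: "q (\<lambda>j. - l j) = q l" for l by (simp add: q_def)
  have S_minus: "?S (\<lambda>j. - l j) \<omega> = - ?S l \<omega>" for l \<omega> by (simp add: sum_negf)
  have int_iexp: "integrable M (\<lambda>\<omega>. f \<omega> *\<^sub>R iexp (X \<omega>))" if "X \<in> borel_measurable M" for X
    using f that by (rule integrable_scaleR_iexp)
  have f0: "?E (\<lambda>\<omega>. f \<omega> *\<^sub>R iexp (u * Y a \<omega>)) = complex_of_real (c * exp (- u\<^sup>2 / 2))" for u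
    using full[of "\<lambda>_. 0" u] by (simp add: q_def)
  have int_bounded: "integrable M (\<lambda>\<omega>. f \<omega> * g \<omega>)" if "g \<in> borel_measurable M" "\<And>\<omega>. \<bar>g \<omega>\<bar> \<le> 2" for g
    by (rule Bochner_Integration.integrable_bound[where f="\<lambda>\<omega>. 2 * f \<omega>"])
       (use f that in \<open>auto simp: abs_mult mult.commute intro!: AE_I2 mult_left_mono\<close>)
  have weight: "(LINT \<omega>|M. (f \<omega> * g \<omega>) * indicator (C a) (Y a \<omega>)) = c' * measure std_normal_distribution (C a)"
    if g[measurable]: "g \<in> borel_measurable M" and bnd: "\<And>\<omega>. 0 \<le> g \<omega>" "\<And>\<omega>. g \<omega> \<le> 2"
      and cf: "\<And>u. ?E (\<lambda>\<omega>. (f \<omega> * g \<omega>) *\<^sub>R iexp (u * Y a \<omega>)) = complex_of_real (c' * exp (- u\<^sup>2 / 2))" for g c'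
  proof (rule weighted_law_from_char[OF _ _ _ std])
    show "integrable M (\<lambda>\<omega>. f \<omega> * g \<omega>)" using bnd by (intro int_bounded) auto
    show "0 \<le> f \<omega> * g \<omega>" if "\<omega> \<in> space M" for \<omega> using insert.prems(3) bnd that by simp
    show "?E (\<lambda>\<omega>. (f \<omega> * g \<omega>) *\<^sub>R iexp (u * Y a \<omega>)) = c' *\<^sub>R char std_normal_distribution u" for u
      unfolding cf char_std_normal_distribution by (simp add: scaleR_conv_of_real)
  qed auto
  have E1: "(LINT \<omega>|M. f \<omega> * indicator (C a) (Y a \<omega>)) = c * measure std_normal_distribution (C a)"
    using weight[of "\<lambda>_. 1" c] f0 by simp
  have cos_sin: "(LINT \<omega>|M. (f \<omega> * cos (?S l \<omega>)) * indicator (C a) (Y a \<omega>)) = c * q l * measure std_normal_distribution (C a)"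
    "(LINT \<omega>|M. (f \<omega> * sin (?S l \<omega>)) * indicator (C a) (Y a \<omega>)) = 0" for l
  proof -
    have fp: "complex_of_real (f \<omega> * cos (?S l \<omega>)) * iexp (u * Y a \<omega>)
       = (1/2) * (f \<omega> *\<^sub>R iexp (?S l \<omega> + u * Y a \<omega>) + f \<omega> *\<^sub>R iexp (?S (\<lambda>j. - l j) \<omega> + u * Y a \<omega>))" for \<omega> u
      unfolding S_minus
      by (intro complex_eqI) (simp_all add: Re_exp Im_exp cos_add sin_add cos_diff sin_diff algebra_simps add_divide_distrib diff_divide_distrib)
    have fs: "complex_of_real (f \<omega> * sin (?S l \<omega>)) * iexp (u * Y a \<omega>)
       = (- \<i> / 2) * (f \<omega> *\<^sub>R iexp (?S l \<omega> + u * Y a \<omega>) - f \<omega> *\<^sub>R iexp (?S (\<lambda>j. - l j) \<omega> + u * Y a \<omega>))" for \<omega> u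
      unfolding S_minus
      by (intro complex_eqI) (simp_all add: Re_exp Im_exp cos_add sin_add cos_diff sin_diff algebra_simps add_divide_distrib diff_divide_distrib)
    have cosE: "?E (\<lambda>\<omega>. (f \<omega> * cos (?S l \<omega>)) *\<^sub>R iexp (u * Y a \<omega>)) = complex_of_real (c * q l * exp (- u\<^sup>2 / 2))" for u
      unfolding scaleR_conv_of_real[of "_ * _"] fp
      by (subst integral_mult_right_zero, subst Bochner_Integration.integral_add, (intro int_iexp; measurable)+, simp only: full q_minus, simp)
    have sinE: "?E (\<lambda>\<omega>. (f \<omega> * sin (?S l \<omega>)) *\<^sub>R iexp (u * Y a \<omega>)) = 0" for u
      unfolding scaleR_conv_of_real[of "_ * _"] fs
      by (subst integral_mult_right_zero, subst Bochner_Integration.integral_diff, (intro int_iexp; measurable)+, simp only: full q_minus, simp)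
    have int: "integrable M (\<lambda>\<omega>. (f \<omega> * cos (?S l \<omega>)) *\<^sub>R iexp (u * Y a \<omega>))"
              "integrable M (\<lambda>\<omega>. (f \<omega> * sin (?S l \<omega>)) *\<^sub>R iexp (u * Y a \<omega>))" for u
      by (intro integrable_scaleR_iexp int_bounded; auto intro: order_trans[OF abs_cos_le_one] order_trans[OF abs_sin_le_one])+
    have nn: "0 \<le> 1 + cos x" "1 + cos x \<le> 2" "0 \<le> 1 + sin x" "1 + sin x \<le> 2" for x :: real
      using cos_ge_minus_one[of x] sin_ge_minus_one[of x] cos_le_one[of x] sin_le_one[of x] by linarith+
    have w1: "(LINT \<omega>|M. (f \<omega> * (1 + cos (?S l \<omega>))) * indicator (C a) (Y a \<omega>)) = (c + c * q l) * measure std_normal_distribution (C a)"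
    proof (rule weight)
      show "?E (\<lambda>\<omega>. (f \<omega> * (1 + cos (?S l \<omega>))) *\<^sub>R iexp (u * Y a \<omega>)) = complex_of_real ((c + c * q l) * exp (- u\<^sup>2 / 2))" for u
        using Bochner_Integration.integral_add[OF int_iexp[of "\<lambda>\<omega>. u * Y a \<omega>"] int(1)[of u]]
        by (simp only: cosE f0) (simp add: algebra_simps)
    qed (use nn in auto)
    have w2: "(LINT \<omega>|M. (f \<omega> * (1 + sin (?S l \<omega>))) * indicator (C a) (Y a \<omega>)) = c * measure std_normal_distribution (C a)"
    proof (rule weight)
      show "?E (\<lambda>\<omega>. (f \<omega> * (1 + sin (?S l \<omega>))) *\<^sub>R iexp (u * Y a \<omega>)) = complex_of_real (c * exp (- u\<^sup>2 / 2))" for u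
        using Bochner_Integration.integral_add[OF int_iexp[of "\<lambda>\<omega>. u * Y a \<omega>"] int(2)[of u]]
        by (simp only: sinE f0) (simp add: algebra_simps)
    qed (use nn in auto)
    have i3: "integrable M (\<lambda>\<omega>. f \<omega> * indicator (C a) (Y a \<omega>))"
         "integrable M (\<lambda>\<omega>. f \<omega> * cos (?S l \<omega>) * indicator (C a) (Y a \<omega>))"
         "integrable M (\<lambda>\<omega>. f \<omega> * sin (?S l \<omega>) * indicator (C a) (Y a \<omega>))"
      unfolding mult.assoc
      by (intro int_bounded; auto simp: abs_mult indicator_def intro: order_trans[OF abs_cos_le_one] order_trans[OF abs_sin_le_one])+
    show "(LINT \<omega>|M. (f \<omega> * cos (?S l \<omega>)) * indicator (C a) (Y a \<omega>)) = c * q l * measure std_normal_distribution (C a)"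
      using w1 E1 Bochner_Integration.integral_add[OF i3(1,2)] by (simp add: algebra_simps)
    show "(LINT \<omega>|M. (f \<omega> * sin (?S l \<omega>)) * indicator (C a) (Y a \<omega>)) = 0"
      using w2 E1 Bochner_Integration.integral_add[OF i3(1,3)] by (simp add: algebra_simps)
  qed
  have "(LINT \<omega>|M. (f \<omega> * indicator (C a) (Y a \<omega>)) * (\<Prod>j\<in>J. indicator (C j) (Y j \<omega>)))
      = (c * measure std_normal_distribution (C a)) * (\<Prod>j\<in>J. measure std_normal_distribution (C j))"
  proof (rule insert.IH)
    show int: "integrable M (\<lambda>\<omega>. f \<omega> * indicator (C a) (Y a \<omega>))"
      by (intro int_bounded) (auto simp: indicator_def)
    show "(LINT \<omega>|M. (f \<omega> * indicator (C a) (Y a \<omega>)) *\<^sub>R iexp (?S l \<omega>))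
       = complex_of_real (c * measure std_normal_distribution (C a) * exp (- (\<Sum>j\<in>J. (l j)\<^sup>2) / 2))" for l
    proof (rule complex_eqI)
      have I: "integrable M (\<lambda>\<omega>. (f \<omega> * indicator (C a) (Y a \<omega>)) *\<^sub>R iexp (?S l \<omega>))"
        by (intro integrable_scaleR_iexp int) auto
      have re: "Re (r *\<^sub>R iexp x) = r * cos x" "Im (r *\<^sub>R iexp x) = r * sin x" for r x by (simp_all add: Re_exp Im_exp)
      show "Re (LINT \<omega>|M. (f \<omega> * indicator (C a) (Y a \<omega>)) *\<^sub>R iexp (?S l \<omega>)) = Re (complex_of_real (c * measure std_normal_distribution (C a) * exp (- (\<Sum>j\<in>J. (l j)\<^sup>2) / 2)))"
        unfolding integral_Re[OF I, symmetric] re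
        using cos_sin(1)[of l] unfolding q_def Re_complex_of_real by (simp add: ac_simps)
      show "Im (LINT \<omega>|M. (f \<omega> * indicator (C a) (Y a \<omega>)) *\<^sub>R iexp (?S l \<omega>)) = Im (complex_of_real (c * measure std_normal_distribution (C a) * exp (- (\<Sum>j\<in>J. (l j)\<^sup>2) / 2)))"
        unfolding integral_Im[OF I, symmetric] re
        using cos_sin(2)[of l] unfolding Im_complex_of_real by (simp add: ac_simps)
    qed
  qed (use insert.prems in auto)
  then show ?case using insert.hyps by (simp add: ac_simps)
qed

section \<open>Brownian families\<close>

definition gridpt :: "real \<Rightarrow> real \<Rightarrow> nat \<Rightarrow> nat \<Rightarrow> real" where
  "gridpt t\<^sub>0 T n k = t\<^sub>0 + (T - t\<^sub>0) * real k / 2 ^ n"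

text \<open>The cell of \<open>r\<close> is the index \<open>k\<close> for which \<open>r\<close> lies between grid points \<open>k\<close> and \<open>k + 1\<close>. Cells are
  open on the left, so that a function of the path up to grid point \<open>k\<close>, used on cell \<open>k\<close>, only
  depends on the strict past.\<close>

definition gridcell :: "real \<Rightarrow> real \<Rightarrow> nat \<Rightarrow> real \<Rightarrow> nat" where
  "gridcell t\<^sub>0 T n r = nat (\<lceil>2 ^ n * ((r - t\<^sub>0) / (T - t\<^sub>0))\<rceil> - 1)"

lemma gridpt_0 [simp]: "gridpt t\<^sub>0 T n 0 = t\<^sub>0"
  by (simp add: gridpt_def)

lemma gridpt_end [simp]: "gridpt t\<^sub>0 T n (2 ^ n) = T"
  by (simp add: gridpt_def)

lemma gridpt_mono: "t\<^sub>0 < T \<Longrightarrow> k \<le> m \<Longrightarrow> gridpt t\<^sub>0 T n k \<le> gridpt t\<^sub>0 T n m"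
  by (simp add: gridpt_def divide_right_mono)

lemma gridpt_strict_mono: "t\<^sub>0 < T \<Longrightarrow> k < m \<Longrightarrow> gridpt t\<^sub>0 T n k < gridpt t\<^sub>0 T n m"
  by (simp add: gridpt_def divide_strict_right_mono)

lemma gridpt_refine: "gridpt t\<^sub>0 T (n + p) (2 ^ p * k) = gridpt t\<^sub>0 T n k"
  by (simp add: gridpt_def power_add field_simps)

lemma gridpt_in: "t\<^sub>0 < T \<Longrightarrow> k \<le> 2 ^ n \<Longrightarrow> gridpt t\<^sub>0 T n k \<in> {t\<^sub>0..T}"
  using gridpt_mono[of t\<^sub>0 T 0 k n] gridpt_mono[of t\<^sub>0 T k "2^n" n] by simp

lemma gridpt_diff: "gridpt t\<^sub>0 T n m - gridpt t\<^sub>0 T n k = (T - t\<^sub>0) * (real m - real k) / 2 ^ n"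
  by (simp add: gridpt_def diff_divide_distrib right_diff_distrib)

lemma gridcell:
  assumes "t\<^sub>0 < T" "r \<in> {t\<^sub>0<..T}"
  shows gridcell_less: "gridcell t\<^sub>0 T n r < 2 ^ n"
    and gridcell_lower: "gridpt t\<^sub>0 T n (gridcell t\<^sub>0 T n r) < r"
    and gridcell_upper: "r \<le> gridpt t\<^sub>0 T n (Suc (gridcell t\<^sub>0 T n r))"
proof -
  define v where "v = 2 ^ n * ((r - t\<^sub>0) / (T - t\<^sub>0))"
  have "(r - t\<^sub>0) / (T - t\<^sub>0) \<le> 1" using assms by simp
  then have v: "0 < v" "v \<le> 2 ^ n" using assms by (auto simp: v_def simp del: times_divide_eq_right intro: mult_left_le)
  then have ce: "1 \<le> \<lceil>v\<rceil>" "\<lceil>v\<rceil> \<le> 2 ^ n" by (auto simp: ceiling_le_iff)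
  have c: "real (gridcell t\<^sub>0 T n r) = real_of_int \<lceil>v\<rceil> - 1"
    unfolding gridcell_def v_def[symmetric] using ce by simp
  have r: "r = t\<^sub>0 + (T - t\<^sub>0) * v / 2 ^ n" using assms by (simp add: v_def)
  have "real (gridcell t\<^sub>0 T n r) < 2 ^ n"
    using ce unfolding c by (metis diff_less_eq less_add_one of_int_le_iff of_int_numeral of_int_power order.strict_trans1 zero_less_one less_add_same_cancel1)
  then show "gridcell t\<^sub>0 T n r < 2 ^ n" by (metis of_nat_less_iff of_nat_numeral of_nat_power)
  have "real (gridcell t\<^sub>0 T n r) < v" "v \<le> real (Suc (gridcell t\<^sub>0 T n r))"
    using c by (simp_all, linarith+)
  then show "gridpt t\<^sub>0 T n (gridcell t\<^sub>0 T n r) < r" "r \<le> gridpt t\<^sub>0 T n (Suc (gridcell t\<^sub>0 T n r))"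
    using assms(1) by (subst r, simp add: gridpt_def divide_strict_right_mono divide_right_mono del: of_nat_Suc)+
qed

lemma gridcell_unique:
  assumes "t\<^sub>0 < T" "gridpt t\<^sub>0 T n k < r" "r \<le> gridpt t\<^sub>0 T n (Suc k)" "k < 2 ^ n"
  shows "gridcell t\<^sub>0 T n r = k"
proof -
  have "t\<^sub>0 \<le> gridpt t\<^sub>0 T n k" "gridpt t\<^sub>0 T n (Suc k) \<le> T"
    using gridpt_mono[OF assms(1), of 0 k n] gridpt_mono[OF assms(1), of "Suc k" "2^n" n] assms(4) by auto
  then have r: "r \<in> {t\<^sub>0<..T}" using assms by auto
  let ?c = "gridcell t\<^sub>0 T n r"
  have "\<not> k < ?c" "\<not> ?c < k"
    using gridcell_lower[OF assms(1) r, of n] gridcell_upper[OF assms(1) r, of n] assms(2,3)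
      gridpt_mono[OF assms(1), of "Suc k" ?c n] gridpt_mono[OF assms(1), of "Suc ?c" k n] by auto
  then show ?thesis by simp
qed

lemma gridcell_refine:
  assumes "t\<^sub>0 < T" "r \<in> {t\<^sub>0<..T}"
  shows "gridcell t\<^sub>0 T n r = gridcell t\<^sub>0 T (n + p) r div 2 ^ p"
proof (rule gridcell_unique[OF assms(1)])
  let ?m = "gridcell t\<^sub>0 T (n + p) r"
  have "?m div 2 ^ p * 2 ^ p \<le> ?m" by simp
  have a: "2 ^ p * (?m div 2 ^ p) \<le> ?m" by simp
  have b: "Suc ?m \<le> 2 ^ p * Suc (?m div 2 ^ p)"
    by (metis Suc_leI dividend_less_times_div mult_Suc_right add.commute zero_less_numeral zero_less_power)
  show "gridpt t\<^sub>0 T n (?m div 2 ^ p) < r"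
    unfolding gridpt_refine[of _ _ n p, symmetric]
    using gridcell_lower[OF assms, of "n + p"] gridpt_mono[OF assms(1) a, of "n+p"] by linarith
  show "r \<le> gridpt t\<^sub>0 T n (Suc (?m div 2 ^ p))"
    unfolding gridpt_refine[of _ _ n p, symmetric]
    using gridcell_upper[OF assms, of "n + p"] gridpt_mono[OF assms(1) b, of "n+p"] by linarith
  show "?m div 2 ^ p < 2 ^ n"
    using gridcell_less[OF assms, of "n + p"] by (simp add: less_mult_imp_div_less power_add)
qed

lemma gridpt_cell_tendsto:
  assumes "t\<^sub>0 < T" "r \<in> {t\<^sub>0<..T}"
  shows "(\<lambda>n. gridpt t\<^sub>0 T n (gridcell t\<^sub>0 T n r)) \<longlonglongrightarrow> r"
proof (rule tendsto_sandwich[of "\<lambda>n. r - (T - t\<^sub>0) * (1/2) ^ n"])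
  have "gridpt t\<^sub>0 T n (Suc (gridcell t\<^sub>0 T n r)) = gridpt t\<^sub>0 T n (gridcell t\<^sub>0 T n r) + (T - t\<^sub>0) * (1/2) ^ n" for n
    by (simp add: gridpt_def field_simps power_one_over)
  then have "r - (T - t\<^sub>0) * (1/2) ^ n \<le> gridpt t\<^sub>0 T n (gridcell t\<^sub>0 T n r)" for n
    using gridcell_upper[OF assms, of n] by (simp only: diff_le_eq)
  then show "\<forall>\<^sub>F n in sequentially. r - (T - t\<^sub>0) * (1/2) ^ n \<le> gridpt t\<^sub>0 T n (gridcell t\<^sub>0 T n r)"
    by (intro always_eventually allI)
  show "\<forall>\<^sub>F n in sequentially. gridpt t\<^sub>0 T n (gridcell t\<^sub>0 T n r) \<le> r"
    using gridcell_lower[OF assms] by (intro always_eventually allI less_imp_le)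
  show "(\<lambda>n. r - (T - t\<^sub>0) * (1/2) ^ n) \<longlonglongrightarrow> r"
    by (auto intro!: tendsto_eq_intros LIMSEQ_realpow_zero)
qed auto

lemma upper_gridpt:
  assumes "t\<^sub>0 < T" "r \<in> {t\<^sub>0..T}"
  shows "Suc (gridcell t\<^sub>0 T n r) \<le> 2 ^ n" "r \<le> gridpt t\<^sub>0 T n (Suc (gridcell t\<^sub>0 T n r))"
    "(\<lambda>n. gridpt t\<^sub>0 T n (Suc (gridcell t\<^sub>0 T n r))) \<longlonglongrightarrow> r"
proof -
  have half: "(\<lambda>n. (T - t\<^sub>0) * (1/2) ^ n) \<longlonglongrightarrow> 0"
    by (auto intro!: tendsto_eq_intros LIMSEQ_realpow_zero)
  have "Suc (gridcell t\<^sub>0 T n r) \<le> 2 ^ n \<and> r \<le> gridpt t\<^sub>0 T n (Suc (gridcell t\<^sub>0 T n r))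
    \<and> (\<lambda>n. gridpt t\<^sub>0 T n (Suc (gridcell t\<^sub>0 T n r))) \<longlonglongrightarrow> r"
  proof (cases "r = t\<^sub>0")
    case True
    have c: "gridcell t\<^sub>0 T n t\<^sub>0 = 0" for n by (simp add: gridcell_def)
    have "(\<lambda>n. t\<^sub>0 + (T - t\<^sub>0) * (1/2) ^ n) \<longlonglongrightarrow> t\<^sub>0 + 0"
      by (intro tendsto_add half tendsto_const)
    then show ?thesis using assms(1) by (simp add: True c gridpt_def power_one_over)
  next
    case False
    then have r: "r \<in> {t\<^sub>0<..T}" using assms by auto
    have "(\<lambda>n. gridpt t\<^sub>0 T n (gridcell t\<^sub>0 T n r) + (T - t\<^sub>0) * (1/2) ^ n) \<longlonglongrightarrow> r + 0"
      by (intro tendsto_add half gridpt_cell_tendsto assms r)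
    moreover have "gridpt t\<^sub>0 T n (Suc (gridcell t\<^sub>0 T n r)) = gridpt t\<^sub>0 T n (gridcell t\<^sub>0 T n r) + (T - t\<^sub>0) * (1/2) ^ n" for n
      by (simp add: gridpt_def field_simps power_one_over)
    ultimately show ?thesis using gridcell_upper[OF assms(1) r] gridcell_less[OF assms(1) r] by (simp add: Suc_leI)
  qed
  then show "Suc (gridcell t\<^sub>0 T n r) \<le> 2 ^ n" "r \<le> gridpt t\<^sub>0 T n (Suc (gridcell t\<^sub>0 T n r))"
    "(\<lambda>n. gridpt t\<^sub>0 T n (Suc (gridcell t\<^sub>0 T n r))) \<longlonglongrightarrow> r" by auto
qed

text \<open>For \<open>\<A>\<close> the \<open>\<sigma>\<close>-algebra of the past of \<open>r\<close>, this is the law and the independence of the increments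
  over \<open>[r, t]\<close> in one formula, which is stable under limits. Finite index sets \<open>J\<close>
  suffice to describe an infinite family of independent components.\<close>

definition gaussian_increments ::
  "'w measure \<Rightarrow> 'w set set \<Rightarrow> ('j \<Rightarrow> real \<Rightarrow> 'w \<Rightarrow> real) \<Rightarrow> real \<Rightarrow> real \<Rightarrow> bool" where
  "gaussian_increments M \<A> B r t \<longleftrightarrow> (\<forall>A\<in>\<A>. \<forall>J l. finite J \<longrightarrow>
     (LINT \<omega>|M. indicator A \<omega> *\<^sub>R iexp (\<Sum>j\<in>J. l j * (B j t \<omega> - B j r \<omega>)))
       = complex_of_real (measure M A * exp (- ((t - r) * (\<Sum>j\<in>J. (l j)\<^sup>2)) / 2)))"

locale adapted_family = prob_space M
  for M :: "'w measure" and F :: "real \<Rightarrow> 'w measure" and B :: "'j \<Rightarrow> real \<Rightarrow> 'w \<Rightarrow> real"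
    and t\<^sub>0 T :: real +
  assumes t0T: "t\<^sub>0 < T"
    and filt: "filtered_prob_space t\<^sub>0 T M F"
    and adapted: "t \<in> {t\<^sub>0..T} \<Longrightarrow> B j t \<in> borel_measurable (F t)"
    and start: "\<omega> \<in> space M \<Longrightarrow> B j t\<^sub>0 \<omega> = 0"
    and cont: "\<omega> \<in> space M \<Longrightarrow> continuous_on {t\<^sub>0..T} (\<lambda>t. B j t \<omega>)"
begin

abbreviation "pt \<equiv> gridpt t\<^sub>0 T"
abbreviation "cell \<equiv> gridcell t\<^sub>0 T"

lemma subalg: "t \<in> {t\<^sub>0..T} \<Longrightarrow> subalgebra M (F t)"
  using filt by (auto simp: filtered_prob_space_def)

lemma subalg_mono: "t\<^sub>0 \<le> r \<Longrightarrow> r \<le> t \<Longrightarrow> t \<le> T \<Longrightarrow> subalgebra (F t) (F r)"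
  using filt by (auto simp: filtered_prob_space_def)

lemma sets_mono: "t\<^sub>0 \<le> r \<Longrightarrow> r \<le> t \<Longrightarrow> t \<le> T \<Longrightarrow> sets (F r) \<subseteq> sets (F t)"
  using subalg_mono by (auto simp: subalgebra_def)

lemma sets_F_M: "t \<in> {t\<^sub>0..T} \<Longrightarrow> A \<in> sets (F t) \<Longrightarrow> A \<in> sets M"
  using subalg by (auto simp: subalgebra_def)

lemma measurable_mono: "t\<^sub>0 \<le> r \<Longrightarrow> r \<le> t \<Longrightarrow> t \<le> T \<Longrightarrow> f \<in> measurable (F r) N \<Longrightarrow> f \<in> measurable (F t) N"
  using measurable_from_subalg[OF subalg_mono] by blast

lemma measurable_F_M: "t \<in> {t\<^sub>0..T} \<Longrightarrow> f \<in> measurable (F t) N \<Longrightarrow> f \<in> measurable M N"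
  using measurable_from_subalg[OF subalg] by blast

lemma space_F: "t \<in> {t\<^sub>0..T} \<Longrightarrow> space (F t) = space M"
  using subalg by (auto simp: subalgebra_def)

lemma B_measurable [measurable]: "t \<in> {t\<^sub>0..T} \<Longrightarrow> B j t \<in> borel_measurable M"
  using measurable_F_M adapted by blast

text \<open>Replace \<open>r\<close> and \<open>t\<close> by the next grid points: by path continuity both sides of the defining
  identity converge, and approximating \<open>r\<close> from above keeps \<open>A\<close> in the past.\<close>

lemma gaussian_increments_from_grid:
  assumes grid: "\<And>n a b. a < b \<Longrightarrow> b \<le> 2 ^ n \<Longrightarrow> gaussian_increments M (sets (F (pt n a))) B (pt n a) (pt n b)"
    and rt: "t\<^sub>0 \<le> r" "r < t" "t \<le> T"
  shows "gaussian_increments M (sets (F r)) B r t"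
  unfolding gaussian_increments_def
proof (intro ballI allI impI)
  fix A and J :: "'j set" and l assume A: "A \<in> sets (F r)" and J: "finite J"
  define a where "a n = pt n (Suc (cell n r))" for n
  define b where "b n = pt n (Suc (cell n t))" for n
  have r: "r \<in> {t\<^sub>0..T}" and t: "t \<in> {t\<^sub>0..T}" using rt by auto
  have lim: "a \<longlonglongrightarrow> r" "b \<longlonglongrightarrow> t"
    unfolding a_def b_def using upper_gridpt[OF t0T r] upper_gridpt[OF t0T t] by auto
  have a_in: "a n \<in> {t\<^sub>0..T}" and b_in: "b n \<in> {t\<^sub>0..T}" and ra: "r \<le> a n" for n
    using gridpt_in[OF t0T] upper_gridpt[OF t0T r] upper_gridpt[OF t0T t] by (auto simp: a_def b_def)
  have AM[measurable]: "A \<in> sets M" using A r sets_F_M by blast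
  define h where "h u v \<omega> = indicator A \<omega> *\<^sub>R iexp (\<Sum>j\<in>J. l j * (B j v \<omega> - B j u \<omega>))" for u v \<omega>
  have h_meas: "h u v \<in> borel_measurable M" if [measurable]: "u \<in> {t\<^sub>0..T}" "v \<in> {t\<^sub>0..T}" for u v
    unfolding h_def using that by measurable
  have "\<forall>\<^sub>F n in sequentially. a n < (r + t) / 2" "\<forall>\<^sub>F n in sequentially. (r + t) / 2 < b n"
    using rt by (intro order_tendstoD[OF lim(1)] order_tendstoD[OF lim(2)]; simp)+
  then have ev: "\<forall>\<^sub>F n in sequentially. (LINT \<omega>|M. h (a n) (b n) \<omega>)
      = complex_of_real (prob A * exp (- ((b n - a n) * (\<Sum>j\<in>J. (l j)\<^sup>2)) / 2))"
  proof eventually_elim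
    case (elim n)
    then have "a n < b n" by linarith
    then have "Suc (cell n r) < Suc (cell n t)"
      unfolding a_def b_def using gridpt_mono[OF t0T, of "Suc (cell n t)" "Suc (cell n r)" n] by linarith
    moreover have "A \<in> sets (F (a n))"
      using A sets_mono[OF rt(1) ra] a_in by fastforce
    ultimately show ?case
      using grid[OF _ upper_gridpt(1)[OF t0T t]] J unfolding gaussian_increments_def a_def b_def h_def by blast
  qed
  have lim_lhs: "(\<lambda>n. LINT \<omega>|M. h (a n) (b n) \<omega>) \<longlonglongrightarrow> (LINT \<omega>|M. h r t \<omega>)"
  proof (rule integral_dominated_convergence[where w="\<lambda>_. 1"])
    show "AE \<omega> in M. (\<lambda>n. h (a n) (b n) \<omega>) \<longlonglongrightarrow> h r t \<omega>"
    proof (rule AE_I2)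
      fix \<omega> assume "\<omega> \<in> space M"
      then have c: "continuous_on {t\<^sub>0..T} (\<lambda>t. B j t \<omega>)" for j by (rule cont)
      have "(\<lambda>n. B j (a n) \<omega>) \<longlonglongrightarrow> B j r \<omega>" for j
        by (rule continuous_on_tendsto_compose[OF c lim(1) r]) (simp add: a_in del: atLeastAtMost_iff)
      moreover have "(\<lambda>n. B j (b n) \<omega>) \<longlonglongrightarrow> B j t \<omega>" for j
        by (rule continuous_on_tendsto_compose[OF c lim(2) t]) (simp add: b_in del: atLeastAtMost_iff)
      ultimately show "(\<lambda>n. h (a n) (b n) \<omega>) \<longlonglongrightarrow> h r t \<omega>"
        unfolding h_def by (intro tendsto_intros)
    qed
  qed (use h_meas a_in b_in r t in \<open>auto simp: h_def indicator_def\<close>)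
  have lim_rhs: "(\<lambda>n. complex_of_real (prob A * exp (- ((b n - a n) * (\<Sum>j\<in>J. (l j)\<^sup>2)) / 2)))
      \<longlonglongrightarrow> complex_of_real (prob A * exp (- ((t - r) * (\<Sum>j\<in>J. (l j)\<^sup>2)) / 2))"
    by (intro tendsto_intros lim) auto
  have "(LINT \<omega>|M. h r t \<omega>) = complex_of_real (prob A * exp (- ((t - r) * (\<Sum>j\<in>J. (l j)\<^sup>2)) / 2))"
    by (rule LIMSEQ_unique[OF lim_lhs], rule Lim_transform_eventually[OF lim_rhs])
      (use ev in eventually_elim, simp)
  then show "(LINT \<omega>|M. indicator A \<omega> *\<^sub>R iexp (\<Sum>j\<in>J. l j * (B j t \<omega> - B j r \<omega>)))
       = complex_of_real (prob A * exp (- ((t - r) * (\<Sum>j\<in>J. (l j)\<^sup>2)) / 2))"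
    unfolding h_def .
qed

definition incr :: "nat \<Rightarrow> nat \<Rightarrow> 'j \<Rightarrow> 'w \<Rightarrow> real" where
  "incr n k j \<omega> = B j (pt n (Suc k)) \<omega> - B j (pt n k) \<omega>"

definition mesh :: "nat \<Rightarrow> real" where "mesh n = (T - t\<^sub>0) / 2 ^ n"

lemma mesh_pos: "0 < mesh n" using t0T by (simp add: mesh_def)

lemma pt_diff: "pt n b - pt n a = mesh n * (real b - real a)"
  by (simp add: gridpt_diff mesh_def)

lemma incr_measurable [measurable]: "Suc k \<le> b \<Longrightarrow> b \<le> 2 ^ n \<Longrightarrow> incr n k j \<in> borel_measurable (F (pt n b))"
  unfolding incr_def using t0T gridpt_in[OF t0T] gridpt_mono[OF t0T]
  by (intro borel_measurable_diff measurable_mono[OF _ _ _ adapted[of "pt n _"]]) auto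

lemma incr_measurable_M [measurable]: "k \<in> {..<2 ^ n} \<Longrightarrow> incr n k j \<in> borel_measurable M"
  using gridpt_in[OF t0T, of k n] gridpt_in[OF t0T, of "Suc k" n] unfolding incr_def by measurable

lemma incr_refine: "(\<Sum>m=2 ^ p * k..<2 ^ p * Suc k. incr (n + p) m j \<omega>) = incr n k j \<omega>"
  unfolding incr_def by (subst sum_Suc_diff') (auto simp: gridpt_refine simp del: mult_Suc_right)

lemma mesh_refine: "(\<Sum>m=2 ^ p * k..<2 ^ p * Suc k. c * mesh (n + p)) = c * mesh n"
  by (simp add: mesh_def power_add)

end

locale brownian_family = adapted_family +
  assumes increments: "t\<^sub>0 \<le> r \<Longrightarrow> r < t \<Longrightarrow> t \<le> T \<Longrightarrow> gaussian_increments M (sets (F r)) B r t"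
begin

lemma past_future_rectangle:
  assumes rt: "t\<^sub>0 \<le> r" "r < t" "t \<le> T" and J: "finite J" and A: "A \<in> sets (F r)"
    and C: "\<And>j. j \<in> J \<Longrightarrow> C j \<in> sets borel"
  shows "(LINT \<omega>|M. indicator A \<omega> * (\<Prod>j\<in>J. indicator (C j) ((B j t \<omega> - B j r \<omega>) / sqrt (t - r))))
       = prob A * (\<Prod>j\<in>J. measure std_normal_distribution (C j))"
proof (rule gaussian_vector_from_char[OF J])
  have r: "r \<in> {t\<^sub>0..T}" and t: "t \<in> {t\<^sub>0..T}" using rt by auto
  then show "(\<lambda>\<omega>. (B j t \<omega> - B j r \<omega>) / sqrt (t - r)) \<in> borel_measurable M" for j by measurable
  have AM: "A \<in> sets M" using A r sets_F_M by blast
  then show "integrable M (indicator A :: _ \<Rightarrow> real)" by (simp add: emeasure_eq_measure)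
  show "(LINT \<omega>|M. indicator A \<omega> *\<^sub>R iexp (\<Sum>j\<in>J. l j * ((B j t \<omega> - B j r \<omega>) / sqrt (t - r))))
      = complex_of_real (prob A * exp (- (\<Sum>j\<in>J. (l j)\<^sup>2) / 2))" for l
  proof -
    have "(\<Sum>j\<in>J. (l j / sqrt (t - r))\<^sup>2) = (\<Sum>j\<in>J. (l j)\<^sup>2) / (t - r)"
      using rt by (simp add: power_divide sum_divide_distrib)
    then show ?thesis
      using increments[OF rt] A J rt unfolding gaussian_increments_def
      by (auto dest!: bspec[OF _ A] spec[of _ J] spec[of _ "\<lambda>j. l j / sqrt (t - r)"])
  qed
qed (use C in auto)

text \<open>The past and the normalised increments are independent, as an identity of product measures. In this
  form Fubini's theorem integrates out the future increments while the past is frozen.\<close>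

lemma past_future_law:
  assumes rt: "t\<^sub>0 \<le> r" "r < t" "t \<le> T" and J: "finite J"
  shows "restr_to_subalg M (F r) \<Otimes>\<^sub>M (\<Pi>\<^sub>M j\<in>J. std_normal_distribution)
     = distr M (F r \<Otimes>\<^sub>M (\<Pi>\<^sub>M j\<in>J. borel)) (\<lambda>\<omega>. (\<omega>, \<lambda>j\<in>J. (B j t \<omega> - B j r \<omega>) / sqrt (t - r)))"
     (is "?R \<Otimes>\<^sub>M ?N = distr M ?S ?f")
proof -
  have r: "r \<in> {t\<^sub>0..T}" and t: "t \<in> {t\<^sub>0..T}" using rt by auto
  interpret R: prob_space ?R by (rule prob_space_restr_to_subalg[OF subalg[OF r]]) (rule prob_space_axioms)
  interpret std: prob_space std_normal_distribution by (simp add: prob_space_normal_density)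
  interpret P: product_prob_space "\<lambda>_. std_normal_distribution" J ..
  interpret N: prob_space ?N by (rule prob_space_PiM) (rule std.prob_space_axioms)
  have setsR: "sets ?R = sets (F r)" by (rule sets_restr_to_subalg[OF subalg[OF r]])
  have id: "(\<lambda>\<omega>. \<omega>) \<in> measurable M (F r)" using subalg[OF r] by (auto simp: measurable_def subalgebra_def)
  have Y: "(\<lambda>\<omega>. \<lambda>j\<in>J. (B j t \<omega> - B j r \<omega>) / sqrt (t - r)) \<in> measurable M (\<Pi>\<^sub>M j\<in>J. borel)"
    using r t by (intro measurable_restrict) measurable
  have f: "?f \<in> measurable M ?S" by (rule measurable_Pair[OF id Y])
  have setsN: "sets ?N = sets (\<Pi>\<^sub>M j\<in>J. borel)" by (rule sets_PiM_cong) auto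
  have rect: "emeasure M {\<omega>\<in>space M. \<omega> \<in> A \<and> (\<forall>j\<in>J. (B j t \<omega> - B j r \<omega>) / sqrt (t - r) \<in> C j)}
     = ennreal (prob A * (\<Prod>j\<in>J. measure std_normal_distribution (C j)))"
    if A: "A \<in> sets (F r)" and C[measurable]: "\<And>j. j \<in> J \<Longrightarrow> C j \<in> sets borel" for A C
  proof -
    have AM[measurable]: "A \<in> sets M" using A r sets_F_M by blast
    let ?X = "{\<omega>\<in>space M. \<omega> \<in> A \<and> (\<forall>j\<in>J. (B j t \<omega> - B j r \<omega>) / sqrt (t - r) \<in> C j)}"
    have X: "?X \<in> sets M" using r t J by measurable
    have "prob ?X = (LINT \<omega>|M. indicator ?X \<omega>)" using X by simp
    also have "\<dots> = (LINT \<omega>|M. indicator A \<omega> * (\<Prod>j\<in>J. indicator (C j) ((B j t \<omega> - B j r \<omega>) / sqrt (t - r))))"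
      using J by (intro Bochner_Integration.integral_cong refl) (auto simp: indicator_def prod_zero_iff intro!: prod.neutral[symmetric])
    finally show ?thesis using past_future_rectangle[OF rt J A C] X by (simp add: emeasure_eq_measure)
  qed
  show ?thesis
  proof (rule pair_measure_eqI)
    show "sigma_finite_measure ?R" "sigma_finite_measure ?N" by unfold_locales
    show "sets (?R \<Otimes>\<^sub>M ?N) = sets (distr M ?S ?f)" by (simp add: setsR setsN cong: sets_pair_measure_cong)
    fix A D assume A: "A \<in> sets ?R" and D: "D \<in> sets ?N"
    have A': "A \<in> sets (F r)" using A setsR by simp
    have AM[measurable]: "A \<in> sets M" using A' r sets_F_M by blast
    define \<mu> where "\<mu> = distr (density M (indicator A)) (\<Pi>\<^sub>M j\<in>J. borel) (\<lambda>\<omega>. \<lambda>j\<in>J. (B j t \<omega> - B j r \<omega>) / sqrt (t - r))"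
    have \<mu>: "emeasure \<mu> E = emeasure M {\<omega>\<in>space M. \<omega> \<in> A \<and> (\<lambda>j\<in>J. (B j t \<omega> - B j r \<omega>) / sqrt (t - r)) \<in> E}"
      if [measurable]: "E \<in> sets (\<Pi>\<^sub>M j\<in>J. borel)" for E
    proof -
      note Y[measurable]
      show ?thesis unfolding \<mu>_def
        by (subst emeasure_distr, simp, simp, subst emeasure_density)
          (auto simp: indicator_inter_arith[symmetric] intro!: arg_cong[where f="emeasure M"] simp flip: indicator_inter_arith)
    qed
    have "\<mu> = scale_measure (emeasure M A) ?N"
    proof (rule measure_eqI_PiM_finite[OF J])
      show "sets \<mu> = sets (\<Pi>\<^sub>M j\<in>J. borel)" by (simp add: \<mu>_def)
      show "sets (scale_measure (emeasure M A) ?N) = sets (\<Pi>\<^sub>M j\<in>J. borel)" by (simp add: setsN)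
      show "emeasure \<mu> (Pi\<^sub>E J C) = emeasure (scale_measure (emeasure M A) ?N) (Pi\<^sub>E J C)"
        if C: "\<And>j. j \<in> J \<Longrightarrow> C j \<in> sets borel" for C
      proof -
        have "emeasure \<mu> (Pi\<^sub>E J C) = ennreal (prob A * (\<Prod>j\<in>J. measure std_normal_distribution (C j)))"
          using C J by (subst \<mu>, force intro!: sets_PiM_I_finite, subst rect[OF A' C, symmetric])
            (auto intro!: arg_cong[where f="emeasure M"] simp: PiE_def Pi_def)
        also have "\<dots> = emeasure M A * (\<Prod>j\<in>J. emeasure std_normal_distribution (C j))"
          by (simp add: emeasure_eq_measure std.emeasure_eq_measure ennreal_mult prod_nonneg prod_ennreal)
        finally show ?thesis using C J by (simp add: P.emeasure_PiM)
      qed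
      show "range (\<lambda>_::nat. space (\<Pi>\<^sub>M j\<in>J. borel)) \<subseteq> prod_algebra J (\<lambda>_. borel :: real measure)"
        using J by (auto simp: space_PiM intro!: prod_algebraI_finite)
      show "emeasure \<mu> (space (\<Pi>\<^sub>M j\<in>J. borel)) \<noteq> \<infinity>" by (subst \<mu>) (auto simp: emeasure_eq_measure)
    qed auto
    then have "emeasure M {\<omega>\<in>space M. \<omega> \<in> A \<and> (\<lambda>j\<in>J. (B j t \<omega> - B j r \<omega>) / sqrt (t - r)) \<in> D} = emeasure M A * emeasure ?N D"
      using \<mu>[of D] D setsN by (simp add: \<mu>_def)
    moreover have "?f -` (A \<times> D) \<inter> space M
        = {\<omega>\<in>space M. \<omega> \<in> A \<and> (\<lambda>j\<in>J. (B j t \<omega> - B j r \<omega>) / sqrt (t - r)) \<in> D}" by auto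
    moreover have "emeasure (distr M ?S ?f) (A \<times> D) = emeasure M (?f -` (A \<times> D) \<inter> space M)"
      using A' D setsN by (intro emeasure_distr f) auto
    moreover have "emeasure ?R A = emeasure M A"
      by (rule emeasure_restr_to_subalg[OF subalg[OF r] A'])
    ultimately show "emeasure ?R A * emeasure ?N D = emeasure (distr M ?S ?f) (A \<times> D)" by simp
  qed
qed

end

section \<open>Tilting a Gaussian increment\<close>

text \<open>One factor of a Girsanov density times one factor of the characteristic function of the compensated
  increment \<open>y - b h\<close>, for a drift \<open>b\<close> over a time step of length \<open>h\<close>.\<close>

definition shifted_factor :: "real \<Rightarrow> real \<Rightarrow> real \<Rightarrow> real \<Rightarrow> complex" where
  "shifted_factor h b l y = exp (b * y - b\<^sup>2 * h / 2) *\<^sub>R iexp (l * (y - b * h))"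

lemma shifted_factor_measurable [measurable]:
  assumes [measurable]: "b \<in> borel_measurable N" "y \<in> borel_measurable N"
  shows "(\<lambda>x. shifted_factor h (b x) l (y x)) \<in> borel_measurable N"
  unfolding shifted_factor_def by measurable

lemma norm_shifted_factor: "norm (shifted_factor h b l y) = exp (b * y - b\<^sup>2 * h / 2)"
  by (simp add: shifted_factor_def)

text \<open>Completing the square: if \<open>y\<close> is centred Gaussian with variance \<open>h\<close>, then tilting by
  \<open>exp (b y - b\<^sup>2 h / 2)\<close> moves its mean to \<open>b h\<close>, so \<open>y - b h\<close> is again centred with variance \<open>h\<close>.\<close>

lemma gaussian_shift:
  assumes h: "0 \<le> h"
  shows shifted_factor_integrable: "integrable std_normal_distribution (\<lambda>x. shifted_factor h b l (sqrt h * x))"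
    and shifted_factor_integral:
      "(LINT x|std_normal_distribution. shifted_factor h b l (sqrt h * x)) = complex_of_real (exp (- h * l\<^sup>2 / 2))"
    and shifted_factor_integral_norm:
      "(LINT x|std_normal_distribution. norm (shifted_factor h b l (sqrt h * x))) = 1"
proof -
  define s where "s = sqrt h"
  have ss: "h = s\<^sup>2" using h by (simp add: s_def)
  have dens: "std_normal_density x * exp (b * (s * x) - b\<^sup>2 * h / 2) = std_normal_density (x - b * s)" for x
    unfolding normal_density_def by (simp add: exp_add[symmetric] ss power2_eq_square algebra_simps flip: exp_add) (simp add: field_simps)?
  have shift: "std_normal_density x *\<^sub>R shifted_factor h b l (s * x)
      = std_normal_density (x - b * s) *\<^sub>R iexp (l * s * (x - b * s))" for x
    unfolding shifted_factor_def scaleR_scaleR dens by (simp add: ss power2_eq_square algebra_simps)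
  have int0: "integrable lborel (\<lambda>x. std_normal_density x *\<^sub>R iexp (l * s * x))"
    by (intro integrable_scaleR_iexp integrable_normal_density) auto
  have aff: "(\<lambda>x. std_normal_density (b * s + 1 * x - b * s) *\<^sub>R iexp (l * s * (b * s + 1 * x - b * s)))
     = (\<lambda>x. std_normal_density x *\<^sub>R iexp (l * s * x))" by (simp add: algebra_simps)
  have aff': "(\<lambda>x. std_normal_density (b * s + 1 * x - b * s)) = std_normal_density" by (simp add: algebra_simps)
  have int1: "integrable lborel (\<lambda>x. std_normal_density (x - b * s) *\<^sub>R iexp (l * s * (x - b * s)))"
    using lborel_integrable_real_affine_iff[of 1 "\<lambda>x. std_normal_density (x - b * s) *\<^sub>R iexp (l * s * (x - b * s))" "b * s"] int0
    unfolding aff by simp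
  have std: "AE x in lborel. 0 \<le> std_normal_density x" by (simp add: normal_density_nonneg)
  show "integrable std_normal_distribution (\<lambda>x. shifted_factor h b l (sqrt h * x))"
    unfolding s_def[symmetric] using int1 std by (subst integrable_density) (auto simp: shift)
  have "(LINT x|std_normal_distribution. shifted_factor h b l (s * x))
      = (LINT x|lborel. std_normal_density (x - b * s) *\<^sub>R iexp (l * s * (x - b * s)))"
    using std by (subst integral_density) (auto simp: shift)
  also have "\<dots> = (LINT x|lborel. std_normal_density x *\<^sub>R iexp (l * s * x))"
    by (subst lborel_integral_real_affine[of 1 _ "b * s"]) (simp_all only: aff, auto)
  also have "\<dots> = char std_normal_distribution (l * s)"
    using std unfolding char_def by (subst integral_density) (auto simp: mult.assoc)
  also have "\<dots> = complex_of_real (exp (- h * l\<^sup>2 / 2))"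
    unfolding char_std_normal_distribution by (simp add: ss power_mult_distrib mult.commute)
  finally show "(LINT x|std_normal_distribution. shifted_factor h b l (sqrt h * x)) = complex_of_real (exp (- h * l\<^sup>2 / 2))"
    unfolding s_def .
  have "(LINT x|std_normal_distribution. norm (shifted_factor h b l (s * x))) = (LINT x|lborel. std_normal_density (x - b * s))"
    using std by (subst integral_density) (auto simp: norm_shifted_factor dens)
  also have "\<dots> = (LINT x|lborel. std_normal_density x)"
    by (subst lborel_integral_real_affine[of 1 _ "b * s"]) (simp_all only: aff', auto)
  also have "\<dots> = 1" by (rule integral_normal_density) simp
  finally show "(LINT x|std_normal_distribution. norm (shifted_factor h b l (sqrt h * x))) = 1"
    unfolding s_def .
qed

context brownian_family
begin

text \<open>The coefficients \<open>\<beta>\<close> may be random as long as they belong to the past: by \<open>past_future_law\<close> they are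
  constants when the increments over \<open>[r, t]\<close> are integrated out.\<close>

lemma gaussian_step:
  fixes G :: "'a \<Rightarrow> complex"
  assumes rt: "t\<^sub>0 \<le> r" "r < t" "t \<le> T" and J: "finite J"
    and G: "G \<in> borel_measurable (F r)" "integrable M G"
    and \<beta>: "\<And>j. j \<in> J \<Longrightarrow> \<beta> j \<in> borel_measurable (F r)"
  shows gaussian_step_integrable:
      "integrable M (\<lambda>\<omega>. G \<omega> * (\<Prod>j\<in>J. shifted_factor (t - r) (\<beta> j \<omega>) (l j) (B j t \<omega> - B j r \<omega>)))" (is ?I)
    and gaussian_step_integral:
      "(LINT \<omega>|M. G \<omega> * (\<Prod>j\<in>J. shifted_factor (t - r) (\<beta> j \<omega>) (l j) (B j t \<omega> - B j r \<omega>)))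
        = (LINT \<omega>|M. G \<omega>) * complex_of_real (exp (- (t - r) * (\<Sum>j\<in>J. (l j)\<^sup>2) / 2))" (is ?E)
proof -
  have r: "r \<in> {t\<^sub>0..T}" using rt by auto
  define h where "h = t - r"
  have h: "0 < h" using rt by (simp add: h_def)
  let ?R = "restr_to_subalg M (F r)" and ?N = "\<Pi>\<^sub>M j\<in>J. std_normal_distribution"
  let ?f = "\<lambda>\<omega>. (\<omega>, \<lambda>j\<in>J. (B j t \<omega> - B j r \<omega>) / sqrt (t - r))"
  interpret R: prob_space ?R by (rule prob_space_restr_to_subalg[OF subalg[OF r]]) (rule prob_space_axioms)
  interpret std: prob_space std_normal_distribution by (simp add: prob_space_normal_density)
  interpret P: product_prob_space "\<lambda>_. std_normal_distribution" J ..
  interpret N: prob_space ?N by (rule prob_space_PiM) (rule std.prob_space_axioms)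
  interpret PP: pair_sigma_finite ?R ?N ..
  define g where "g = (\<lambda>(\<omega>, y). G \<omega> * (\<Prod>j\<in>J. shifted_factor h (\<beta> j \<omega>) (l j) (sqrt h * y j)))"
  have setsR: "sets ?R = sets (F r)" by (rule sets_restr_to_subalg[OF subalg[OF r]])
  have setsN: "sets ?N = sets (\<Pi>\<^sub>M j\<in>J. borel)" by (rule sets_PiM_cong) auto
  have sets_pair: "sets (?R \<Otimes>\<^sub>M ?N) = sets (F r \<Otimes>\<^sub>M (\<Pi>\<^sub>M j\<in>J. borel))"
    by (intro sets_pair_measure_cong setsR setsN)
  note [measurable] = G(1) \<beta>
  have g_meas': "g \<in> borel_measurable (F r \<Otimes>\<^sub>M (\<Pi>\<^sub>M j\<in>J. borel))"
    unfolding g_def by measurable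
  then have g_meas: "g \<in> borel_measurable (?R \<Otimes>\<^sub>M ?N)"
    using measurable_cong_sets[OF sets_pair refl] by blast
  have GR: "integrable ?R G" by (rule integrable_in_subalg[OF subalg[OF r] G])
  have inner_int: "integrable ?N (\<lambda>y. g (\<omega>, y))" for \<omega>
    unfolding g_def using J by (auto intro!: P.product_integrable_prod shifted_factor_integrable less_imp_le[OF h])
  have inner: "(LINT y|?N. g (\<omega>, y)) = G \<omega> * complex_of_real (exp (- h * (\<Sum>j\<in>J. (l j)\<^sup>2) / 2))" for \<omega>
  proof -
    have "(LINT y|?N. g (\<omega>, y)) = G \<omega> * (\<Prod>j\<in>J. (LINT x|std_normal_distribution. shifted_factor h (\<beta> j \<omega>) (l j) (sqrt h * x)))"
      unfolding g_def using h
      by (simp add: P.product_integral_prod[OF J, of "\<lambda>j x. shifted_factor h (\<beta> j \<omega>) (l j) (sqrt h * x)"] shifted_factor_integrable)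
    also have "\<dots> = G \<omega> * (\<Prod>j\<in>J. complex_of_real (exp (- h * (l j)\<^sup>2 / 2)))"
      using h by (simp add: shifted_factor_integral)
    also have "\<dots> = G \<omega> * complex_of_real (exp (\<Sum>j\<in>J. - h * (l j)\<^sup>2 / 2))"
      using J by (simp add: exp_sum)
    finally show ?thesis by (simp add: sum_distrib_left sum_divide_distrib sum_negf)
  qed
  have inner_norm: "(LINT y|?N. norm (g (\<omega>, y))) = norm (G \<omega>)" for \<omega>
  proof -
    have "(LINT y|?N. norm (g (\<omega>, y)))
      = norm (G \<omega>) * (\<Prod>j\<in>J. (LINT x|std_normal_distribution. norm (shifted_factor h (\<beta> j \<omega>) (l j) (sqrt h * x))))"
      unfolding g_def using h
      by (simp add: norm_mult prod_norm[symmetric] shifted_factor_integrable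
          P.product_integral_prod[OF J, of "\<lambda>j x. norm (shifted_factor h (\<beta> j \<omega>) (l j) (sqrt h * x))"])
    then show ?thesis using h by (simp add: shifted_factor_integral_norm)
  qed
  have gi: "integrable (?R \<Otimes>\<^sub>M ?N) g"
    by (rule PP.Fubini_integrable[OF g_meas]) (use GR inner_int in \<open>auto simp: inner_norm\<close>)
  have "(LINT z|(?R \<Otimes>\<^sub>M ?N). g z) = (LINT \<omega>|?R. (LINT y|?N. g (\<omega>, y)))"
    using PP.integral_fst'[OF gi] by simp
  also have "\<dots> = (LINT \<omega>|?R. G \<omega>) * complex_of_real (exp (- h * (\<Sum>j\<in>J. (l j)\<^sup>2) / 2))"
    unfolding inner by simp
  also have "(LINT \<omega>|?R. G \<omega>) = (LINT \<omega>|M. G \<omega>)" by (rule integral_subalgebra2[OF subalg[OF r] G(1)])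
  finally have gE: "(LINT z|(?R \<Otimes>\<^sub>M ?N). g z) = (LINT \<omega>|M. G \<omega>) * complex_of_real (exp (- h * (\<Sum>j\<in>J. (l j)\<^sup>2) / 2))" .
  have t: "t \<in> {t\<^sub>0..T}" using rt by auto
  have id: "(\<lambda>\<omega>. \<omega>) \<in> measurable M (F r)" using subalg[OF r] by (auto simp: measurable_def subalgebra_def)
  have Y: "(\<lambda>\<omega>. \<lambda>j\<in>J. (B j t \<omega> - B j r \<omega>) / sqrt (t - r)) \<in> measurable M (\<Pi>\<^sub>M j\<in>J. borel)"
    using r t by (intro measurable_restrict) measurable
  have f: "?f \<in> measurable M (F r \<Otimes>\<^sub>M (\<Pi>\<^sub>M j\<in>J. borel))" by (rule measurable_Pair[OF id Y])
  have gf: "g (?f \<omega>) = G \<omega> * (\<Prod>j\<in>J. shifted_factor (t - r) (\<beta> j \<omega>) (l j) (B j t \<omega> - B j r \<omega>))" for \<omega>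
    unfolding g_def using h by (auto simp: h_def intro!: prod.cong)
  show ?I using integrable_distr[OF f] gi unfolding past_future_law[OF rt J] gf[symmetric] by blast
  show ?E using gE unfolding past_future_law[OF rt J] h_def integral_distr[OF f g_meas'] gf .
qed

text \<open>Integrating out the last time step first removes its factor by \<open>gaussian_step\<close>; the three claims
  are proved together because each step needs the product of the earlier factors to be an integrable
  function of the past.\<close>

lemma gaussian_telescope:
  fixes G :: "'a \<Rightarrow> complex"
  assumes ab: "a \<le> b" "b \<le> 2 ^ n" and J: "finite J"
    and G: "G \<in> borel_measurable (F (pt n a))" "integrable M G"
    and \<beta>: "\<And>k j. a \<le> k \<Longrightarrow> k < b \<Longrightarrow> j \<in> J \<Longrightarrow> \<beta> k j \<in> borel_measurable (F (pt n k))"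
  shows "(\<lambda>\<omega>. G \<omega> * (\<Prod>k=a..<b. \<Prod>j\<in>J. shifted_factor (mesh n) (\<beta> k j \<omega>) (l k j) (incr n k j \<omega>))) \<in> borel_measurable (F (pt n b))
    \<and> integrable M (\<lambda>\<omega>. G \<omega> * (\<Prod>k=a..<b. \<Prod>j\<in>J. shifted_factor (mesh n) (\<beta> k j \<omega>) (l k j) (incr n k j \<omega>)))
    \<and> (LINT \<omega>|M. G \<omega> * (\<Prod>k=a..<b. \<Prod>j\<in>J. shifted_factor (mesh n) (\<beta> k j \<omega>) (l k j) (incr n k j \<omega>)))
       = (LINT \<omega>|M. G \<omega>) * complex_of_real (exp (- mesh n * (\<Sum>k=a..<b. \<Sum>j\<in>J. (l k j)\<^sup>2) / 2))"
  using ab \<beta>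
proof (induction b rule: dec_induct)
  case base
  then show ?case using G by simp
next
  case (step b)
  let ?P = "\<lambda>b \<omega>. G \<omega> * (\<Prod>k=a..<b. \<Prod>j\<in>J. shifted_factor (mesh n) (\<beta> k j \<omega>) (l k j) (incr n k j \<omega>))"
  have IH: "?P b \<in> borel_measurable (F (pt n b))" "integrable M (?P b)"
    "(LINT \<omega>|M. ?P b \<omega>) = (LINT \<omega>|M. G \<omega>) * complex_of_real (exp (- mesh n * (\<Sum>k=a..<b. \<Sum>j\<in>J. (l k j)\<^sup>2) / 2))"
    using step.IH step.prems by auto
  have rt: "t\<^sub>0 \<le> pt n b" "pt n b < pt n (Suc b)" "pt n (Suc b) \<le> T"
    using gridpt_in[OF t0T, of b n] gridpt_in[OF t0T, of "Suc b" n] gridpt_strict_mono[OF t0T, of b "Suc b" n] step.prems by auto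
  have m: "pt n (Suc b) - pt n b = mesh n" by (simp add: pt_diff)
  have \<beta>b: "\<And>j. j \<in> J \<Longrightarrow> \<beta> b j \<in> borel_measurable (F (pt n b))" using step by auto
  note S = gaussian_step[OF rt J IH(1,2) \<beta>b, where l="l b", unfolded m, folded incr_def]
  have split: "?P (Suc b) \<omega> = ?P b \<omega> * (\<Prod>j\<in>J. shifted_factor (mesh n) (\<beta> b j \<omega>) (l b j) (incr n b j \<omega>))" for \<omega>
    using step.hyps by (simp add: mult.assoc)
  have [measurable]: "?P b \<in> borel_measurable (F (pt n (Suc b)))"
    by (rule measurable_mono[OF rt(1) less_imp_le[OF rt(2)] rt(3) IH(1)])
  have [measurable]: "\<And>j. j \<in> J \<Longrightarrow> \<beta> b j \<in> borel_measurable (F (pt n (Suc b)))"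
    by (rule measurable_mono[OF rt(1) less_imp_le[OF rt(2)] rt(3) \<beta>b])
  have [measurable]: "incr n b j \<in> borel_measurable (F (pt n (Suc b)))" for j using step.prems by simp
  have "(\<lambda>\<omega>. ?P b \<omega> * (\<Prod>j\<in>J. shifted_factor (mesh n) (\<beta> b j \<omega>) (l b j) (incr n b j \<omega>))) \<in> borel_measurable (F (pt n (Suc b)))"
    by measurable
  moreover have "complex_of_real (exp (- mesh n * (\<Sum>k=a..<Suc b. \<Sum>j\<in>J. (l k j)\<^sup>2) / 2))
     = complex_of_real (exp (- mesh n * (\<Sum>k=a..<b. \<Sum>j\<in>J. (l k j)\<^sup>2) / 2)) * complex_of_real (exp (- mesh n * (\<Sum>j\<in>J. (l b j)\<^sup>2) / 2))"
  proof -
    have "(\<Sum>k=a..<Suc b. \<Sum>j\<in>J. (l k j)\<^sup>2) = (\<Sum>k=a..<b. \<Sum>j\<in>J. (l k j)\<^sup>2) + (\<Sum>j\<in>J. (l b j)\<^sup>2)"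
      using step.hyps by simp
    then show ?thesis by (simp only: distrib_left add_divide_distrib exp_add of_real_mult)
  qed
  ultimately show ?case unfolding split using S IH(3) by simp
qed

end

section \<open>Girsanov densities of step processes\<close>

lemma prod_shifted_factor:
  assumes "finite I" "finite J"
  shows "(\<Prod>k\<in>I. \<Prod>j\<in>J. shifted_factor h (b k j) (l k j) (y k j))
    = exp (\<Sum>k\<in>I. \<Sum>j\<in>J. b k j * y k j - (b k j)\<^sup>2 * h / 2) *\<^sub>R iexp (\<Sum>k\<in>I. \<Sum>j\<in>J. l k j * (y k j - b k j * h))"
  using assms by (simp add: shifted_factor_def scaleR_conv_of_real prod.distrib exp_sum sum_distrib_left)

text \<open>For densities \<open>a\<close>, \<open>b\<close> with \<open>sqrt (a b) = c exp (- S / 8)\<close> this bounds \<open>\<bar>a - b\<bar>\<close> by quantities whose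
  integrals are known. It splits \<open>\<bar>a - b\<bar> = \<bar>sqrt a - sqrt b\<bar> (sqrt a + sqrt b)\<close> with weight \<open>e\<close>, uses
  \<open>(sqrt a - sqrt b)\<^sup>2 = a + b - 2 sqrt (a b)\<close> and \<open>exp (- S / 8) \<ge> 1 - S / 8\<close>, and splits the
  remaining product \<open>c S\<close> once more.\<close>

lemma hellinger_pointwise:
  fixes a b c S L e :: real
  assumes nn: "0 \<le> a" "0 \<le> b" "0 \<le> c" "0 \<le> S" and root: "sqrt (a * b) = c * exp (- S / 8)"
    and L: "S \<le> L" and e: "0 < e"
  shows "\<bar>a - b\<bar> \<le> (a + b - 2 * c) / (2 * e) + e * (a + b) + e / 16 * c\<^sup>2 + L / 16 / e ^ 3 * S"
proof -
  define u v where "u = sqrt a" and "v = sqrt b"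
  have uv: "a = u\<^sup>2" "b = v\<^sup>2" "0 \<le> u" "0 \<le> v" "sqrt (a * b) = u * v"
    using nn by (simp_all add: u_def v_def real_sqrt_mult)
  have "0 \<le> (\<bar>u - v\<bar> / e - (u + v))\<^sup>2" by simp
  then have "2 * \<bar>u - v\<bar> * (u + v) / e \<le> (u - v)\<^sup>2 / e\<^sup>2 + (u + v)\<^sup>2"
    by (simp add: power2_diff power_divide)
  then have "e / 2 * (2 * \<bar>u - v\<bar> * (u + v) / e) \<le> e / 2 * ((u - v)\<^sup>2 / e\<^sup>2 + (u + v)\<^sup>2)"
    using e by (intro mult_left_mono) auto
  moreover have "e / 2 * (2 * \<bar>u - v\<bar> * (u + v) / e) = \<bar>u - v\<bar> * (u + v)" using e by simp
  moreover have "e / 2 * (X / e\<^sup>2 + Y) = X / (2 * e) + e / 2 * Y" for X Y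
    using e by (simp add: distrib_left power2_eq_square)
  ultimately have "\<bar>u - v\<bar> * (u + v) \<le> (u - v)\<^sup>2 / (2 * e) + e / 2 * (u + v)\<^sup>2"
    by metis
  moreover have "\<bar>a - b\<bar> = \<bar>u - v\<bar> * (u + v)"
    using uv(3,4) by (simp add: uv(1,2) power2_eq_square square_diff_square_factored abs_mult)
  moreover have "(u + v)\<^sup>2 \<le> 2 * (a + b)"
    using zero_le_power2[of "u - v"] unfolding uv(1,2) by (simp add: power2_eq_square algebra_simps)
  then have "e / 2 * (u + v)\<^sup>2 \<le> e * (a + b)" using e mult_left_mono[of "(u+v)\<^sup>2" "2 * (a+b)" "e/2"] by simp
  moreover have "(u - v)\<^sup>2 = a + b - 2 * (c * exp (- S / 8))"
    unfolding root[symmetric] uv(5) by (simp add: uv(1,2) power2_diff)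
  moreover have "c * (1 - S / 8) \<le> c * exp (- S / 8)"
    using nn(3) exp_ge_add_one_self[of "- S / 8"] by (intro mult_left_mono) auto
  ultimately have 1: "\<bar>a - b\<bar> \<le> (a + b - 2 * (c * (1 - S / 8))) / (2 * e) + e * (a + b)"
    using e by (smt (verit) divide_right_mono)
  have "0 \<le> (e * c - S / e)\<^sup>2" by simp
  then have "2 * (c * S) \<le> e\<^sup>2 * c\<^sup>2 + S\<^sup>2 / e\<^sup>2"
    using e by (simp add: power2_diff power_divide power_mult_distrib)
  moreover have "S\<^sup>2 / e\<^sup>2 \<le> L * S / e\<^sup>2"
    using nn(4) L by (intro divide_right_mono) (auto simp: power2_eq_square mult_right_mono)
  ultimately have "(2 * (c * S)) / (16 * e) \<le> (e\<^sup>2 * c\<^sup>2 + L * S / e\<^sup>2) / (16 * e)"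
    using e by (intro divide_right_mono) auto
  also have "\<dots> = e / 16 * c\<^sup>2 + L / 16 / e ^ 3 * S"
    using e by (simp add: field_simps power2_eq_square power3_eq_cube)
  finally have 2: "c * S / (8 * e) \<le> e / 16 * c\<^sup>2 + L / 16 / e ^ 3 * S" by (simp add: mult.commute)
  have "(a + b - 2 * (c * (1 - S / 8))) / (2 * e) = (a + b - 2 * c) / (2 * e) + c * S / (8 * e)"
    using e by (simp add: field_simps)
  then show ?thesis using 1 2 by linarith
qed

context brownian_family
begin

definition step_process :: "nat \<Rightarrow> 'b set \<Rightarrow> (nat \<Rightarrow> 'b \<Rightarrow> 'a \<Rightarrow> real) \<Rightarrow> bool" where
  "step_process n J \<beta> \<longleftrightarrow> finite J \<and> (\<forall>k<2^n. \<forall>j\<in>J. \<beta> k j \<in> borel_measurable (F (pt n k)))"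

text \<open>The stochastic exponential of the step process \<open>\<beta>\<close>.\<close>

definition step_density :: "nat \<Rightarrow> 'b set \<Rightarrow> (nat \<Rightarrow> 'b \<Rightarrow> 'a \<Rightarrow> real) \<Rightarrow> 'a \<Rightarrow> real" where
  "step_density n J \<beta> \<omega> = exp (\<Sum>k<2^n. \<Sum>j\<in>J. \<beta> k j \<omega> * incr n k j \<omega> - (\<beta> k j \<omega>)\<^sup>2 * mesh n / 2)"

definition step_dist :: "nat \<Rightarrow> 'b set \<Rightarrow> (nat \<Rightarrow> 'b \<Rightarrow> 'a \<Rightarrow> real) \<Rightarrow> (nat \<Rightarrow> 'b \<Rightarrow> 'a \<Rightarrow> real) \<Rightarrow> 'a \<Rightarrow> real" where
  "step_dist n J \<beta> \<gamma> \<omega> = mesh n * (\<Sum>k<2^n. \<Sum>j\<in>J. (\<beta> k j \<omega> - \<gamma> k j \<omega>)\<^sup>2)"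

lemma step_process_finite: "step_process n J \<beta> \<Longrightarrow> finite J"
  by (simp add: step_process_def)

lemma step_process_measurable: "step_process n J \<beta> \<Longrightarrow> k < 2^n \<Longrightarrow> j \<in> J \<Longrightarrow> \<beta> k j \<in> borel_measurable (F (pt n k))"
  by (simp add: step_process_def)

lemma step_process_measurable_M:
  "step_process n J \<beta> \<Longrightarrow> k \<in> {..<2^n} \<Longrightarrow> j \<in> J \<Longrightarrow> \<beta> k j \<in> borel_measurable M"
  using gridpt_in[OF t0T] by (intro measurable_F_M[of "pt n k"] step_process_measurable) auto

lemma step_process_combine:
  assumes "step_process n J \<beta>" "step_process n J \<gamma>"
  shows "step_process n J (\<lambda>k j \<omega>. x * \<beta> k j \<omega> + y * \<gamma> k j \<omega>)"
  using assms by (auto simp: step_process_def intro!: borel_measurable_add borel_measurable_times)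

lemma step_density_measurable [measurable]:
  assumes "step_process n J \<beta>" shows "step_density n J \<beta> \<in> borel_measurable M"
  unfolding step_density_def
  using step_process_measurable_M[OF assms] by measurable

lemma step_density_pos: "0 < step_density n J \<beta> \<omega>"
  by (simp add: step_density_def)

lemma step_density_eq_prod:
  assumes "finite J"
  shows "complex_of_real (step_density n J \<beta> \<omega>)
      = (\<Prod>k=0..<2^n. \<Prod>j\<in>J. shifted_factor (mesh n) (\<beta> k j \<omega>) 0 (incr n k j \<omega>))"
  using assms by (subst prod_shifted_factor) (auto simp: step_density_def scaleR_conv_of_real atLeast0LessThan)

text \<open>This is the mean-one property conditional on the initial \<open>\<sigma>\<close>-algebra, which makes the
  change of measure leave the law of the initial datum alone.\<close>

lemma step_density_past:
  assumes sp: "step_process n J \<beta>" and A: "A \<in> sets (F t\<^sub>0)"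
  shows "integrable M (step_density n J \<beta>)"
    and "(LINT \<omega>|M. step_density n J \<beta> \<omega> * indicator A \<omega>) = prob A"
    and "(LINT \<omega>|M. step_density n J \<beta> \<omega>) = 1"
proof -
  note J = step_process_finite[OF sp]
  have tele: "integrable M (\<lambda>\<omega>. complex_of_real (indicator A \<omega>) * complex_of_real (step_density n J \<beta> \<omega>)) \<and>
     (LINT \<omega>|M. complex_of_real (indicator A \<omega>) * complex_of_real (step_density n J \<beta> \<omega>)) = complex_of_real (prob A)"
    if A: "A \<in> sets (F t\<^sub>0)" for A
  proof -
    have AM: "A \<in> sets M" using A sets_F_M[of t\<^sub>0 A] t0T by auto
    have "integrable M (indicat_real A)" using AM by (simp add: emeasure_eq_measure)
    then have i: "integrable M (\<lambda>\<omega>. complex_of_real (indicator A \<omega>))" by simp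
    have m: "(\<lambda>\<omega>. complex_of_real (indicator A \<omega>)) \<in> borel_measurable (F (pt n 0))" using A by simp
    have "\<And>k j. 0 \<le> k \<Longrightarrow> k < 2^n \<Longrightarrow> j \<in> J \<Longrightarrow> \<beta> k j \<in> borel_measurable (F (pt n k))"
      using step_process_measurable[OF sp] by simp
    note T = gaussian_telescope[where \<beta>=\<beta> and l="\<lambda>_ _. 0", OF _ order_refl J m i this,
        unfolded step_density_eq_prod[OF J, symmetric], simplified]
    have "(LINT \<omega>|M. complex_of_real (indicator A \<omega>)) = complex_of_real (prob A)" using AM by simp
    with T show ?thesis by simp
  qed
  have SM: "space M \<in> sets (F t\<^sub>0)" using space_F[of t\<^sub>0] t0T sets.top[of "F t\<^sub>0"] by auto
  have ind: "(LINT \<omega>|M. g \<omega> * indicator (space M) \<omega>) = (LINT \<omega>|M. g \<omega>)" for g :: "'a \<Rightarrow> real"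
    by (intro Bochner_Integration.integral_cong) auto
  have "integrable M (\<lambda>\<omega>. Re (complex_of_real (indicator (space M) \<omega>) * complex_of_real (step_density n J \<beta> \<omega>)))"
    by (rule integrable_Re[OF conjunct1[OF tele[OF SM]]])
  also have "?this \<longleftrightarrow> integrable M (step_density n J \<beta>)"
    by (intro Bochner_Integration.integrable_cong refl) simp
  finally show "integrable M (step_density n J \<beta>)" .
  have E: "(LINT \<omega>|M. step_density n J \<beta> \<omega> * indicator A \<omega>) = prob A" if "A \<in> sets (F t\<^sub>0)" for A
  proof -
    have "complex_of_real (LINT \<omega>|M. step_density n J \<beta> \<omega> * indicator A \<omega>) = complex_of_real (prob A)"
      unfolding integral_complex_of_real[symmetric] using tele[OF that] by (simp add: mult.commute)
    then show ?thesis by (simp only: of_real_eq_iff)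
  qed
  show "(LINT \<omega>|M. step_density n J \<beta> \<omega> * indicator A \<omega>) = prob A" by (rule E[OF A])
  show "(LINT \<omega>|M. step_density n J \<beta> \<omega>) = 1" using E[OF SM] by (simp add: ind prob_space)
qed

lemma step_density_integrable:
  assumes sp: "step_process n J \<beta>"
  shows "integrable M (step_density n J \<beta>)" "(LINT \<omega>|M. step_density n J \<beta> \<omega>) = 1"
  using step_density_past[OF sp sets.empty_sets] by auto

text \<open>Under the density, the compensated increments over \<open>[a, b)\<close> have the right Gaussian
  characteristic function given the past of \<open>a\<close>. The time steps after \<open>b\<close> integrate to 1, those
  in \<open>[a, b)\<close> give the exponential, and the earlier ones stay in the weight.\<close>

lemma step_density_char:
  assumes sp: "step_process n J \<beta>" and ab: "a \<le> b" "b \<le> 2 ^ n" and A: "A \<in> sets (F (pt n a))"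
  shows "(LINT \<omega>|M. (step_density n J \<beta> \<omega> * indicator A \<omega>) *\<^sub>R
            iexp (\<Sum>j\<in>J. l j * (\<Sum>k=a..<b. incr n k j \<omega> - \<beta> k j \<omega> * mesh n)))
     = complex_of_real ((LINT \<omega>|M. step_density n J \<beta> \<omega> * indicator A \<omega>) *
          exp (- ((pt n b - pt n a) * (\<Sum>j\<in>J. (l j)\<^sup>2)) / 2))"
proof -
  note J = step_process_finite[OF sp] and meas = step_process_measurable[OF sp]
  have pta: "pt n a \<in> {t\<^sub>0..T}" using ab by (intro gridpt_in[OF t0T]) auto
  have AM[measurable]: "A \<in> sets M" using A sets_F_M[OF pta] by auto
  define Pr where "Pr c d l \<omega> = (\<Prod>k=c..<d. \<Prod>j\<in>J. shifted_factor (mesh n) (\<beta> k j \<omega>) (l k j) (incr n k j \<omega>))"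
    for c d :: nat and l \<omega>
  define G where "G \<omega> = complex_of_real (indicator A \<omega>) * Pr 0 a (\<lambda>_ _. 0) \<omega>" for \<omega>
  have T1: "Pr 0 a (\<lambda>_ _. 0) \<in> borel_measurable (F (pt n a))" "integrable M (Pr 0 a (\<lambda>_ _. 0))"
  proof -
    have one: "(\<lambda>_. 1::complex) \<in> borel_measurable (F (pt n 0))" "integrable M (\<lambda>_. 1::complex)" by simp_all
    have "\<And>k j. 0 \<le> k \<Longrightarrow> k < a \<Longrightarrow> j \<in> J \<Longrightarrow> \<beta> k j \<in> borel_measurable (F (pt n k))"
      using meas ab by simp
    note T = gaussian_telescope[where \<beta>=\<beta> and l="\<lambda>_ _. 0", OF le0 order_trans[OF ab] J one this]
    show "Pr 0 a (\<lambda>_ _. 0) \<in> borel_measurable (F (pt n a))" "integrable M (Pr 0 a (\<lambda>_ _. 0))"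
      using T unfolding mult_1 Pr_def by auto
  qed
  have G: "G \<in> borel_measurable (F (pt n a))" "integrable M G"
    using T1 A AM unfolding G_def[abs_def]
    by (simp_all add: integrable_mult_indicator scaleR_conv_of_real[symmetric])
  have T2: "(LINT \<omega>|M. G \<omega> * Pr a (2^n) l \<omega>) = (LINT \<omega>|M. G \<omega>) * complex_of_real (exp (- mesh n * (\<Sum>k=a..<2^n. \<Sum>j\<in>J. (l k j)\<^sup>2) / 2))" for l
  proof -
    have "\<And>k j. a \<le> k \<Longrightarrow> k < 2^n \<Longrightarrow> j \<in> J \<Longrightarrow> \<beta> k j \<in> borel_measurable (F (pt n k))"
      using meas by simp
    from gaussian_telescope[where \<beta>=\<beta> and l=l, OF order_trans[OF ab] order_refl J G this]
    show ?thesis unfolding Pr_def by blast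
  qed
  define l' where "l' k j = (if k < b then l j else 0)" for k :: nat and j
  have GP: "G \<omega> * Pr a (2^n) m \<omega> = (step_density n J \<beta> \<omega> * indicator A \<omega>) *\<^sub>R
       iexp (\<Sum>k=a..<2^n. \<Sum>j\<in>J. m k j * (incr n k j \<omega> - \<beta> k j \<omega> * mesh n))" for m \<omega>
  proof -
    let ?e = "\<lambda>k. \<Sum>j\<in>J. \<beta> k j \<omega> * incr n k j \<omega> - (\<beta> k j \<omega>)\<^sup>2 * mesh n / 2"
    have "(\<Sum>k<2^n. ?e k) = (\<Sum>k=0..<a. ?e k) + (\<Sum>k=a..<2^n. ?e k)"
      using ab by (simp add: sum.atLeastLessThan_concat lessThan_atLeast0)
    then show ?thesis
      unfolding G_def Pr_def step_density_def using J
      by (simp add: prod_shifted_factor exp_add scaleR_conv_of_real mult_ac)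
  qed
  have inner: "(\<Sum>k=a..<2^n. \<Sum>j\<in>J. l' k j * (incr n k j \<omega> - \<beta> k j \<omega> * mesh n))
     = (\<Sum>j\<in>J. l j * (\<Sum>k=a..<b. incr n k j \<omega> - \<beta> k j \<omega> * mesh n))" for \<omega>
  proof -
    have "(\<Sum>k=a..<2^n. \<Sum>j\<in>J. l' k j * (incr n k j \<omega> - \<beta> k j \<omega> * mesh n))
       = (\<Sum>k=a..<b. \<Sum>j\<in>J. l j * (incr n k j \<omega> - \<beta> k j \<omega> * mesh n))"
      using ab J by (intro sum.mono_neutral_cong_right) (auto simp: l'_def)
    also have "\<dots> = (\<Sum>j\<in>J. \<Sum>k=a..<b. l j * (incr n k j \<omega> - \<beta> k j \<omega> * mesh n))" by (rule sum.swap)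
    finally show ?thesis by (simp add: sum_distrib_left)
  qed
  have sq: "(\<Sum>k=a..<2^n. \<Sum>j\<in>J. (l' k j)\<^sup>2) = (real b - real a) * (\<Sum>j\<in>J. (l j)\<^sup>2)"
  proof -
    have "(\<Sum>k=a..<2^n. \<Sum>j\<in>J. (l' k j)\<^sup>2) = (\<Sum>k=a..<b. \<Sum>j\<in>J. (l j)\<^sup>2)"
      using ab J by (intro sum.mono_neutral_cong_right) (auto simp: l'_def)
    then show ?thesis using ab by simp
  qed
  have "(LINT \<omega>|M. G \<omega>) = complex_of_real (LINT \<omega>|M. step_density n J \<beta> \<omega> * indicator A \<omega>)"
    using T2[of "\<lambda>_ _. 0"] unfolding GP integral_complex_of_real[symmetric] by (simp add: scaleR_conv_of_real)
  then show ?thesis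
    using T2[of l'] unfolding GP inner sq pt_diff by (simp add: mult.assoc)
qed

text \<open>The square of the density of \<open>\<beta>\<close> is the density of \<open>2 \<beta>\<close> times the exponential of the energy of
  \<open>\<beta>\<close>.\<close>

lemma step_density_sq:
  assumes sp: "step_process n J \<beta>" and K: "\<And>\<omega> k. \<omega> \<in> space M \<Longrightarrow> k < 2^n \<Longrightarrow> (\<Sum>j\<in>J. (\<beta> k j \<omega>)\<^sup>2) \<le> K"
  shows "integrable M (\<lambda>\<omega>. (step_density n J \<beta> \<omega>)\<^sup>2)"
    and "(LINT \<omega>|M. (step_density n J \<beta> \<omega>)\<^sup>2) \<le> exp (K * (T - t\<^sub>0))"
proof -
  let ?D2 = "step_density n J (\<lambda>k j \<omega>. 2 * \<beta> k j \<omega>)"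
  have sp2: "step_process n J (\<lambda>k j \<omega>. 2 * \<beta> k j \<omega>)"
    using step_process_combine[OF sp sp, of 2 0] by simp
  note D2 = step_density_integrable[OF sp2]
  have le: "(step_density n J \<beta> \<omega>)\<^sup>2 \<le> exp (K * (T - t\<^sub>0)) * ?D2 \<omega>" if "\<omega> \<in> space M" for \<omega>
  proof -
    have "(\<Sum>k<2^n. \<Sum>j\<in>J. (\<beta> k j \<omega>)\<^sup>2) \<le> (\<Sum>k<(2::nat)^n. K)"
      using K that by (intro sum_mono) auto
    then have "mesh n * (\<Sum>k<2^n. \<Sum>j\<in>J. (\<beta> k j \<omega>)\<^sup>2) \<le> mesh n * (2^n * K)"
      using mesh_pos by (intro mult_left_mono) (auto intro: less_imp_le)
    also have "\<dots> = K * (T - t\<^sub>0)" by (simp add: mesh_def)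
    finally have le: "mesh n * (\<Sum>k<2^n. \<Sum>j\<in>J. (\<beta> k j \<omega>)\<^sup>2) \<le> K * (T - t\<^sub>0)" .
    have "2 * (\<Sum>k<2^n. \<Sum>j\<in>J. \<beta> k j \<omega> * incr n k j \<omega> - (\<beta> k j \<omega>)\<^sup>2 * mesh n / 2)
      = mesh n * (\<Sum>k<2^n. \<Sum>j\<in>J. (\<beta> k j \<omega>)\<^sup>2) + (\<Sum>k<2^n. \<Sum>j\<in>J. (2 * \<beta> k j \<omega>) * incr n k j \<omega> - (2 * \<beta> k j \<omega>)\<^sup>2 * mesh n / 2)"
      unfolding sum_distrib_left sum.distrib[symmetric]
      by (intro sum.cong refl) (simp add: field_simps power2_eq_square)
    then have "(step_density n J \<beta> \<omega>)\<^sup>2 = exp (mesh n * (\<Sum>k<2^n. \<Sum>j\<in>J. (\<beta> k j \<omega>)\<^sup>2)) * ?D2 \<omega>"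
      unfolding step_density_def exp_double[symmetric] exp_add[symmetric] by simp
    also have "\<dots> \<le> exp (K * (T - t\<^sub>0)) * ?D2 \<omega>"
      using le step_density_pos by (intro mult_right_mono) (auto intro: less_imp_le)
    finally show ?thesis .
  qed
  note [measurable] = step_density_measurable[OF sp]
  show i: "integrable M (\<lambda>\<omega>. (step_density n J \<beta> \<omega>)\<^sup>2)"
    by (rule Bochner_Integration.integrable_bound[where f="\<lambda>\<omega>. exp (K * (T - t\<^sub>0)) * ?D2 \<omega>"])
       (use D2 le step_density_pos in \<open>auto simp: abs_mult abs_of_pos intro!: AE_I2\<close>)
  have "(LINT \<omega>|M. (step_density n J \<beta> \<omega>)\<^sup>2) \<le> (LINT \<omega>|M. exp (K * (T - t\<^sub>0)) * ?D2 \<omega>)"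
    using D2 le by (intro integral_mono i) auto
  then show "(LINT \<omega>|M. (step_density n J \<beta> \<omega>)\<^sup>2) \<le> exp (K * (T - t\<^sub>0))" using D2 by simp
qed

lemma step_dist_bound:
  assumes K: "\<And>k. k < 2^n \<Longrightarrow> (\<Sum>j\<in>J. (\<beta> k j \<omega>)\<^sup>2) \<le> K" "\<And>k. k < 2^n \<Longrightarrow> (\<Sum>j\<in>J. (\<gamma> k j \<omega>)\<^sup>2) \<le> K"
  shows "0 \<le> step_dist n J \<beta> \<gamma> \<omega>" "step_dist n J \<beta> \<gamma> \<omega> \<le> 4 * K * (T - t\<^sub>0)"
proof -
  show "0 \<le> step_dist n J \<beta> \<gamma> \<omega>"
    using mesh_pos[of n] by (simp add: step_dist_def sum_nonneg)
  have "(\<Sum>j\<in>J. (\<beta> k j \<omega> - \<gamma> k j \<omega>)\<^sup>2) \<le> 4 * K" if "k < 2^n" for k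
  proof -
    have pw: "(x - y)\<^sup>2 \<le> 2 * x\<^sup>2 + 2 * y\<^sup>2" for x y :: real
      using zero_le_power2[of "x + y"] by (simp add: power2_eq_square algebra_simps)
    have "(\<Sum>j\<in>J. (\<beta> k j \<omega> - \<gamma> k j \<omega>)\<^sup>2) \<le> (\<Sum>j\<in>J. 2 * (\<beta> k j \<omega>)\<^sup>2 + 2 * (\<gamma> k j \<omega>)\<^sup>2)"
      by (intro sum_mono pw)
    also have "\<dots> = 2 * (\<Sum>j\<in>J. (\<beta> k j \<omega>)\<^sup>2) + 2 * (\<Sum>j\<in>J. (\<gamma> k j \<omega>)\<^sup>2)"
      by (simp add: sum.distrib sum_distrib_left)
    finally show ?thesis using K[OF that] by linarith
  qed
  then have "(\<Sum>k<2^n. \<Sum>j\<in>J. (\<beta> k j \<omega> - \<gamma> k j \<omega>)\<^sup>2) \<le> (\<Sum>k<(2::nat)^n. 4 * K)"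
    by (intro sum_mono) auto
  then have "step_dist n J \<beta> \<gamma> \<omega> \<le> mesh n * (2^n * (4 * K))"
    unfolding step_dist_def using mesh_pos[of n] by (intro mult_left_mono) auto
  also have "\<dots> = 4 * K * (T - t\<^sub>0)" by (simp add: mesh_def)
  finally show "step_dist n J \<beta> \<gamma> \<omega> \<le> 4 * K * (T - t\<^sub>0)" .
qed

text \<open>The geometric mean of the densities of \<open>\<beta>\<close> and \<open>\<gamma>\<close> is the density of \<open>(\<beta> + \<gamma>) / 2\<close> times
  \<open>exp (- S / 8)\<close> with \<open>S\<close> the squared distance of the two step processes, so \<open>hellinger_pointwise\<close>
  can be integrated. The constant depends on \<open>K\<close> but not on the grid or the number of components.\<close>

lemma step_density_L1_dist:
  assumes sp: "step_process n J \<beta>" "step_process n J \<gamma>"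
    and K: "\<And>\<omega> k. \<omega> \<in> space M \<Longrightarrow> k < 2^n \<Longrightarrow> (\<Sum>j\<in>J. (\<beta> k j \<omega>)\<^sup>2) \<le> K"
           "\<And>\<omega> k. \<omega> \<in> space M \<Longrightarrow> k < 2^n \<Longrightarrow> (\<Sum>j\<in>J. (\<gamma> k j \<omega>)\<^sup>2) \<le> K"
    and e: "0 < e" and dist: "(LINT \<omega>|M. step_dist n J \<beta> \<gamma> \<omega>) \<le> e ^ 4"
  shows "(LINT \<omega>|M. \<bar>step_density n J \<beta> \<omega> - step_density n J \<gamma> \<omega>\<bar>)
     \<le> e * (2 + (exp (K * (T - t\<^sub>0)) + 4 * K * (T - t\<^sub>0)) / 16)"
proof -
  define L where "L = 4 * K * (T - t\<^sub>0)"
  define \<mu> where "\<mu> k j \<omega> = 1/2 * \<beta> k j \<omega> + 1/2 * \<gamma> k j \<omega>" for k j \<omega>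
  define D where "D = step_density n J"
  define S where "S = step_dist n J \<beta> \<gamma>"
  have sp\<mu>: "step_process n J \<mu>" unfolding \<mu>_def[abs_def] by (rule step_process_combine[OF sp])
  have K\<mu>: "(\<Sum>j\<in>J. (\<mu> k j \<omega>)\<^sup>2) \<le> K" if "\<omega> \<in> space M" "k < 2^n" for \<omega> k
  proof -
    have pw: "(1/2 * x + 1/2 * y)\<^sup>2 \<le> 1/2 * x\<^sup>2 + 1/2 * y\<^sup>2" for x y :: real
      using zero_le_power2[of "x - y"] by (simp add: power2_eq_square algebra_simps)
    have "(\<Sum>j\<in>J. (\<mu> k j \<omega>)\<^sup>2) \<le> (\<Sum>j\<in>J. 1/2 * (\<beta> k j \<omega>)\<^sup>2 + 1/2 * (\<gamma> k j \<omega>)\<^sup>2)"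
      unfolding \<mu>_def by (intro sum_mono pw)
    also have "\<dots> = 1/2 * (\<Sum>j\<in>J. (\<beta> k j \<omega>)\<^sup>2) + 1/2 * (\<Sum>j\<in>J. (\<gamma> k j \<omega>)\<^sup>2)"
      by (simp only: sum.distrib sum_distrib_left)
    finally show ?thesis using K[OF that] by linarith
  qed
  have S_bnd: "0 \<le> S \<omega>" "S \<omega> \<le> L" if "\<omega> \<in> space M" for \<omega>
    unfolding S_def L_def using step_dist_bound[where n=n and J=J and \<beta>=\<beta> and \<omega>=\<omega> and K=K and \<gamma>=\<gamma>] K that by auto
  note [measurable] = step_process_measurable_M[OF sp(1)] step_process_measurable_M[OF sp(2)]
  have [measurable]: "S \<in> borel_measurable M" unfolding S_def step_dist_def[abs_def] by measurable
  have Sint: "integrable M S" using S_bnd by (intro integrable_const_bound[where B=L]) auto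
  note D1 = step_density_integrable[OF sp(1), folded D_def] and D2 = step_density_integrable[OF sp(2), folded D_def]
    and D\<mu> = step_density_integrable[OF sp\<mu>, folded D_def] and D\<mu>2 = step_density_sq[OF sp\<mu> K\<mu>, folded D_def]
  have root: "sqrt (D \<beta> \<omega> * D \<gamma> \<omega>) = D \<mu> \<omega> * exp (- S \<omega> / 8)" for \<omega>
  proof -
    let ?e = "\<lambda>\<beta>. \<Sum>k<2^n. \<Sum>j\<in>J. \<beta> k j \<omega> * incr n k j \<omega> - (\<beta> k j \<omega>)\<^sup>2 * mesh n / 2"
    have "1/2 * (?e \<beta> + ?e \<gamma>) = ?e \<mu> + (- 1/8) * S \<omega>"
      unfolding S_def step_dist_def sum_distrib_left sum.distrib[symmetric]
      by (intro sum.cong refl) (simp add: \<mu>_def field_simps power2_eq_square)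
    then have "?e \<beta> + ?e \<gamma> = 2 * (?e \<mu> + (- S \<omega> / 8))" by simp
    then have "D \<beta> \<omega> * D \<gamma> \<omega> = (D \<mu> \<omega> * exp (- S \<omega> / 8))\<^sup>2"
      unfolding D_def step_density_def exp_add[symmetric] exp_double[symmetric] by simp
    then show ?thesis using step_density_pos[of n J \<mu> \<omega>] by (simp add: D_def real_sqrt_mult)
  qed
  have "(LINT \<omega>|M. \<bar>D \<beta> \<omega> - D \<gamma> \<omega>\<bar>)
     \<le> (LINT \<omega>|M. (D \<beta> \<omega> + D \<gamma> \<omega> - 2 * D \<mu> \<omega>) / (2 * e) + e * (D \<beta> \<omega> + D \<gamma> \<omega>) + e / 16 * (D \<mu> \<omega>)\<^sup>2 + L / 16 / e ^ 3 * S \<omega>)"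
  proof (rule integral_mono)
    show "\<bar>D \<beta> \<omega> - D \<gamma> \<omega>\<bar> \<le> (D \<beta> \<omega> + D \<gamma> \<omega> - 2 * D \<mu> \<omega>) / (2 * e) + e * (D \<beta> \<omega> + D \<gamma> \<omega>) + e / 16 * (D \<mu> \<omega>)\<^sup>2 + L / 16 / e ^ 3 * S \<omega>"
      if "\<omega> \<in> space M" for \<omega>
      by (rule hellinger_pointwise[OF _ _ _ _ root])
         (use S_bnd[OF that] e step_density_pos in \<open>auto simp: D_def less_imp_le\<close>)
  qed (use D1 D2 D\<mu> D\<mu>2 Sint in auto)
  also have "\<dots> = 2 * e + e / 16 * (LINT \<omega>|M. (D \<mu> \<omega>)\<^sup>2) + L / 16 / e ^ 3 * (LINT \<omega>|M. S \<omega>)"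
    using D1 D2 D\<mu> D\<mu>2 Sint by simp
  also have "\<dots> \<le> 2 * e + e / 16 * exp (K * (T - t\<^sub>0)) + L / 16 / e ^ 3 * e ^ 4"
  proof (intro add_mono mult_left_mono order_refl)
    have "space M \<noteq> {}" by (rule not_empty)
    then have "0 \<le> L" using S_bnd by fastforce
    then show "0 \<le> L / 16 / e ^ 3" using e by simp
  qed (use D\<mu>2 e dist in \<open>auto simp: S_def\<close>)
  also have "\<dots> = e * (2 + (exp (K * (T - t\<^sub>0)) + L) / 16)"
    using e by (simp add: field_simps power3_eq_cube power4_eq_xxxx)
  finally show ?thesis by (simp add: D_def L_def)
qed

lemma sum_refine:
  fixes f :: "nat \<Rightarrow> nat \<Rightarrow> real"
  shows "(\<Sum>k<2 ^ (n + p). f (k div 2 ^ p) k) = (\<Sum>k<2 ^ n. \<Sum>m=2 ^ p * k..<2 ^ p * Suc k. f k m)"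
proof -
  have "(\<Sum>k<N. \<Sum>m=2 ^ p * k..<2 ^ p * Suc k. f k m) = (\<Sum>k<2 ^ p * N. f (k div 2 ^ p) k)" for N
  proof (induction N)
    case (Suc N)
    have "(\<Sum>m=2 ^ p * N..<2 ^ p * Suc N. f N m) = (\<Sum>m=2 ^ p * N..<2 ^ p * Suc N. f (m div 2 ^ p) m)"
    proof (intro sum.cong refl)
      fix m assume m: "m \<in> {2 ^ p * N..<2 ^ p * Suc N}"
      then have "m div 2 ^ p = N" by (intro div_nat_eqI) (auto simp: mult.commute)
      then show "f N m = f (m div 2 ^ p) m" by simp
    qed
    moreover have "(\<Sum>k<2 ^ p * Suc N. f (k div 2 ^ p) k) = (\<Sum>k<2 ^ p * N. f (k div 2 ^ p) k) + (\<Sum>m=2 ^ p * N..<2 ^ p * Suc N. f (m div 2 ^ p) m)"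
      unfolding lessThan_atLeast0 by (subst sum.atLeastLessThan_concat) auto
    ultimately show ?case using Suc by simp
  qed simp
  from this[of "2 ^ n"] show ?thesis by (simp add: power_add mult.commute)
qed

lemma step_density_refine:
  "step_density (n + p) J (\<lambda>k. \<beta> (k div 2 ^ p)) \<omega> = step_density n J \<beta> \<omega>"
proof -
  have "(\<Sum>k<2^(n+p). \<Sum>j\<in>J. \<beta> (k div 2^p) j \<omega> * incr (n+p) k j \<omega> - (\<beta> (k div 2^p) j \<omega>)\<^sup>2 * mesh (n+p) / 2)
    = (\<Sum>k<2^n. \<Sum>m=2^p*k..<2^p*Suc k. \<Sum>j\<in>J. \<beta> k j \<omega> * incr (n+p) m j \<omega> - (\<beta> k j \<omega>)\<^sup>2 * mesh (n+p) / 2)"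
    by (rule sum_refine[of "\<lambda>k m. \<Sum>j\<in>J. \<beta> k j \<omega> * incr (n+p) m j \<omega> - (\<beta> k j \<omega>)\<^sup>2 * mesh (n+p) / 2"])
  also have "\<dots> = (\<Sum>k<2^n. \<Sum>j\<in>J. \<beta> k j \<omega> * (\<Sum>m=2^p*k..<2^p*Suc k. incr (n+p) m j \<omega>)
        - (\<Sum>m=2^p*k..<2^p*Suc k. (\<beta> k j \<omega>)\<^sup>2 / 2 * mesh (n+p)))"
    by (intro sum.cong refl, subst sum.swap) (simp only: sum_subtractf sum_distrib_left times_divide_eq_left)
  finally show ?thesis unfolding incr_refine mesh_refine by (simp add: step_density_def)
qed

end

section \<open>Predictable functions and their step approximations\<close>

context adapted_family
begin

text \<open>A step process read as a function of time and \<open>\<omega>\<close>.\<close>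

definition step_fun :: "nat \<Rightarrow> (nat \<Rightarrow> 'w \<Rightarrow> 'c) \<Rightarrow> real \<times> 'w \<Rightarrow> 'c" where
  "step_fun n \<eta> = (\<lambda>(r, \<omega>). \<eta> (cell n r) \<omega>)"

text \<open>Rectangles over a single dyadic cell suffice to generate the predictable \<open>\<sigma>\<close>-algebra, and step
  functions are built from exactly these.\<close>

definition predictable_rects :: "(real \<times> 'w) set set" where
  "predictable_rects = {{r\<in>{t\<^sub>0<..T}. cell n r = k} \<times> A | n k A. k < 2 ^ n \<and> A \<in> sets (F (pt n k))}"

definition predictable :: "(real \<times> 'w) measure" where
  "predictable = sigma ({t\<^sub>0<..T} \<times> space M) predictable_rects"

definition time_measure :: "real measure" where
  "time_measure = restrict_space lborel {t\<^sub>0<..T}"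

definition cylinder :: "(real \<times> 'w) measure" where
  "cylinder = time_measure \<Otimes>\<^sub>M M"

lemma cell_set: "k < 2 ^ n \<Longrightarrow> {r\<in>{t\<^sub>0<..T}. cell n r = k} = {pt n k<..pt n (Suc k)}"
  using gridpt_in[OF t0T, of k n] gridpt_in[OF t0T, of "Suc k" n]
  by (auto simp: gridcell_unique[OF t0T] intro: gridcell_lower[OF t0T, unfolded greaterThanAtMost_iff, OF conjI]
      gridcell_upper[OF t0T, unfolded greaterThanAtMost_iff, OF conjI])

lemma space_time_measure: "space time_measure = {t\<^sub>0<..T}"
  by (simp add: time_measure_def space_restrict_space)

lemma space_cylinder: "space cylinder = {t\<^sub>0<..T} \<times> space M"
  by (simp add: cylinder_def space_pair_measure space_time_measure)

lemma predictable_rects_closed: "predictable_rects \<subseteq> Pow ({t\<^sub>0<..T} \<times> space M)"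
proof
  fix E assume "E \<in> predictable_rects"
  then obtain n k A where E: "E = {r\<in>{t\<^sub>0<..T}. cell n r = k} \<times> A" "k < 2 ^ n" "A \<in> sets (F (pt n k))"
    by (auto simp: predictable_rects_def)
  have "A \<subseteq> space M"
    using sets.sets_into_space[OF E(3)] space_F[OF gridpt_in[OF t0T, of k n]] E(2) by simp
  then show "E \<in> Pow ({t\<^sub>0<..T} \<times> space M)" unfolding E(1) by blast
qed

lemma space_predictable: "space predictable = {t\<^sub>0<..T} \<times> space M"
  using predictable_rects_closed by (simp add: predictable_def space_measure_of)

lemma sets_predictable: "sets predictable = sigma_sets ({t\<^sub>0<..T} \<times> space M) predictable_rects"
  using predictable_rects_closed by (simp add: predictable_def sets_measure_of)

lemma rect_predictable:
  "k < 2 ^ n \<Longrightarrow> A \<in> sets (F (pt n k)) \<Longrightarrow> {r\<in>{t\<^sub>0<..T}. cell n r = k} \<times> A \<in> sets predictable"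
  unfolding sets_predictable by (rule sigma_sets.Basic) (auto simp: predictable_rects_def)

lemma finite_time_measure: "finite_measure time_measure"
proof
  have "emeasure time_measure (space time_measure) = ennreal (T - t\<^sub>0)"
    unfolding space_time_measure unfolding time_measure_def using t0T by (subst emeasure_restrict_space) auto
  then show "emeasure time_measure (space time_measure) \<noteq> \<infinity>" by simp
qed

lemma pair_time: "pair_sigma_finite time_measure M"
proof -
  interpret tm: finite_measure time_measure by (rule finite_time_measure)
  show ?thesis ..
qed

lemma finite_cylinder: "finite_measure cylinder"
  unfolding cylinder_def by (intro finite_measure_pair_measure finite_time_measure finite_measure_axioms)

lemma cell_set_time: "k < 2 ^ n \<Longrightarrow> {r\<in>{t\<^sub>0<..T}. cell n r = k} \<in> sets time_measure"
  using gridpt_in[OF t0T, of k n] gridpt_in[OF t0T, of "Suc k" n]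
  unfolding cell_set time_measure_def by (subst sets_restrict_space_iff) auto

lemma subalgebra_predictable: "subalgebra cylinder predictable"
proof -
  have "predictable_rects \<subseteq> sets cylinder"
    using gridpt_in[OF t0T] cell_set_time
    by (auto simp: predictable_rects_def cylinder_def intro!: pair_measureI sets_F_M[of "pt _ _"])
  then have "sigma_sets (space cylinder) predictable_rects \<subseteq> sets cylinder"
    by (rule sets.sigma_sets_subset)
  then show ?thesis
    by (simp add: subalgebra_def space_predictable space_cylinder sets_predictable)
qed

lemma predictable_cylinder: "f \<in> measurable predictable N \<Longrightarrow> f \<in> measurable cylinder N"
  by (rule measurable_from_subalg[OF subalgebra_predictable])

lemma step_fun_predictable:
  assumes \<eta>: "\<And>k. k < 2 ^ n \<Longrightarrow> \<eta> k \<in> measurable (F (pt n k)) N"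
  shows "step_fun n \<eta> \<in> measurable predictable N"
proof (rule measurableI)
  fix z assume "z \<in> space predictable"
  then obtain r \<omega> where z: "z = (r, \<omega>)" "r \<in> {t\<^sub>0<..T}" "\<omega> \<in> space M" by (auto simp: space_predictable)
  have c: "cell n r < 2 ^ n" using z by (intro gridcell_less[OF t0T]) auto
  have "\<omega> \<in> space (F (pt n (cell n r)))" using z gridpt_in[OF t0T, of "cell n r" n] c by (simp add: space_F)
  then show "step_fun n \<eta> z \<in> space N"
    using measurable_space[OF \<eta>[OF c]] by (simp add: z step_fun_def)
next
  fix C assume C: "C \<in> sets N"
  have "step_fun n \<eta> -` C \<inter> space predictable
      = (\<Union>k<2^n. {r\<in>{t\<^sub>0<..T}. cell n r = k} \<times> (\<eta> k -` C \<inter> space (F (pt n k))))"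
    using gridcell_less[OF t0T] gridpt_in[OF t0T]
    by (auto simp: step_fun_def space_predictable space_F)
  also have "\<dots> \<in> sets predictable"
    using \<eta> C by (intro sets.finite_UN rect_predictable measurable_sets) auto
  finally show "step_fun n \<eta> -` C \<inter> space predictable \<in> sets predictable" .
qed

lemma initial_predictable:
  assumes "g \<in> measurable (F t\<^sub>0) N"
  shows "(\<lambda>(r, \<omega>). g \<omega>) \<in> measurable predictable N"
  using step_fun_predictable[of 0 "\<lambda>_. g" N] assms by (simp add: step_fun_def)

lemma time_predictable: "fst \<in> borel_measurable predictable"
proof (rule borel_measurable_LIMSEQ_real)
  show "step_fun n (\<lambda>k \<omega>. pt n k) \<in> borel_measurable predictable" for n
    by (rule step_fun_predictable) simp
  show "(\<lambda>n. step_fun n (\<lambda>k \<omega>. pt n k) z) \<longlonglongrightarrow> fst z" if "z \<in> space predictable" for z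
    using that gridpt_cell_tendsto[OF t0T, of "fst z"] by (auto simp: step_fun_def space_predictable)
qed

text \<open>By continuity the path is the limit of the step functions that freeze it at the left end of each
  cell.\<close>

lemma B_predictable: "(\<lambda>(r, \<omega>). B j r \<omega>) \<in> borel_measurable predictable"
proof (rule borel_measurable_LIMSEQ_real)
  show "step_fun n (\<lambda>k. B j (pt n k)) \<in> borel_measurable predictable" for n
    using gridpt_in[OF t0T] by (intro step_fun_predictable adapted) auto
  show "(\<lambda>n. step_fun n (\<lambda>k. B j (pt n k)) z) \<longlonglongrightarrow> (case z of (r, \<omega>) \<Rightarrow> B j r \<omega>)"
    if zs: "z \<in> space predictable" for z
  proof -
    obtain r \<omega> where z: "z = (r, \<omega>)" "r \<in> {t\<^sub>0<..T}" "\<omega> \<in> space M"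
      using zs by (cases z) (auto simp: space_predictable)
    have "(\<lambda>n. B j (pt n (cell n r)) \<omega>) \<longlonglongrightarrow> B j r \<omega>"
    proof (rule continuous_on_tendsto_compose[OF cont[OF z(3)] gridpt_cell_tendsto[OF t0T z(2)]])
      show "r \<in> {t\<^sub>0..T}" using z by auto
      show "\<forall>\<^sub>F n in sequentially. pt n (cell n r) \<in> {t\<^sub>0..T}"
        using gridcell_less[OF t0T z(2)] by (intro always_eventually allI gridpt_in[OF t0T]) (simp add: less_imp_le)
    qed
    then show ?thesis by (simp add: step_fun_def z)
  qed
qed

text \<open>A generating rectangle over cell \<open>k\<close> meets \<open>(t\<^sub>0, t]\<close> only if cell \<open>k\<close> starts before \<open>t\<close>, and then its
  base is an event of time \<open>t\<close>.\<close>

lemma predictable_progressive: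
  assumes f: "f \<in> measurable predictable N" and t: "t \<in> {t\<^sub>0..T}"
  shows "f \<in> measurable (restrict_space borel {t\<^sub>0<..t} \<Otimes>\<^sub>M F t) N"
proof -
  have "(\<lambda>x. x) \<in> measurable (restrict_space borel {t\<^sub>0<..t} \<Otimes>\<^sub>M F t) predictable"
    unfolding predictable_def
  proof (rule measurable_measure_of[OF predictable_rects_closed])
    show "(\<lambda>x. x) \<in> space (restrict_space borel {t\<^sub>0<..t} \<Otimes>\<^sub>M F t) \<rightarrow> {t\<^sub>0<..T} \<times> space M"
      using t by (auto simp: space_pair_measure space_restrict_space space_F)
    fix E assume "E \<in> predictable_rects"
    then obtain n k A where E: "E = {r\<in>{t\<^sub>0<..T}. cell n r = k} \<times> A" and k: "k < 2 ^ n" and A: "A \<in> sets (F (pt n k))"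
      by (auto simp: predictable_rects_def)
    have pk: "t\<^sub>0 \<le> pt n k" "pt n k \<le> T" using gridpt_in[OF t0T, of k n] k by auto
    have A': "A \<subseteq> space M" using sets.sets_into_space[OF A] pk by (simp add: space_F)
    have "E \<inter> space (restrict_space borel {t\<^sub>0<..t} \<Otimes>\<^sub>M F t) = ({pt n k<..pt n (Suc k)} \<inter> {t\<^sub>0<..t}) \<times> A"
      unfolding E cell_set[OF k] using t A' by (auto simp: space_pair_measure space_restrict_space space_F)
    also have "\<dots> \<in> sets (restrict_space borel {t\<^sub>0<..t} \<Otimes>\<^sub>M F t)"
    proof (cases "pt n k \<le> t")
      case True
      then have "A \<in> sets (F t)" using A sets_mono[OF pk(1), of t] t by auto
      moreover have "{pt n k<..pt n (Suc k)} \<inter> {t\<^sub>0<..t} \<in> sets (restrict_space borel {t\<^sub>0<..t})"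
        by (subst sets_restrict_space_iff) auto
      ultimately show ?thesis by (intro pair_measureI)
    next
      case False
      then have "{pt n k<..pt n (Suc k)} \<inter> {t\<^sub>0<..t} = {}" by auto
      then show ?thesis by (simp only: Sigma_empty1 sets.empty_sets)
    qed
    finally show "(\<lambda>x. x) -` E \<inter> space (restrict_space borel {t\<^sub>0<..t} \<Otimes>\<^sub>M F t)
        \<in> sets (restrict_space borel {t\<^sub>0<..t} \<Otimes>\<^sub>M F t)"
      by (simp only: vimage_ident)
  qed
  from measurable_compose[OF this f] show ?thesis by simp
qed

lemma predictable_integral_adapted:
  fixes f :: "real \<times> 'w \<Rightarrow> 'c::euclidean_space"
  assumes f: "f \<in> borel_measurable predictable" and t: "t \<in> {t\<^sub>0..T}"
  shows "(\<lambda>\<omega>. LINT r:{t\<^sub>0<..t}|lborel. f (r, \<omega>)) \<in> borel_measurable (F t)"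
proof -
  let ?N = "restrict_space lborel {t\<^sub>0<..t}"
  interpret N: finite_measure ?N
  proof
    show "emeasure ?N (space ?N) \<noteq> \<infinity>"
      using t by (subst emeasure_restrict_space) (auto simp: space_restrict_space)
  qed
  have sets: "sets (restrict_space borel {t\<^sub>0<..t} \<Otimes>\<^sub>M F t) = sets (?N \<Otimes>\<^sub>M F t)"
    by (intro sets_pair_measure_cong sets_restrict_space_cong) auto
  have "f \<in> borel_measurable (?N \<Otimes>\<^sub>M F t)"
    using predictable_progressive[OF f t] measurable_cong_sets[OF sets refl] by blast
  then have "(\<lambda>(\<omega>, r). f (r, \<omega>)) \<in> borel_measurable (F t \<Otimes>\<^sub>M ?N)"
    by (subst measurable_pair_swap_iff) (simp add: case_prod_beta)
  then have "(\<lambda>\<omega>. LINT r|?N. f (r, \<omega>)) \<in> borel_measurable (F t)"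
    by (rule N.borel_measurable_lebesgue_integral)
  then show ?thesis
    by (simp add: integral_restrict_space set_lebesgue_integral_def)
qed

text \<open>Approximation by adapted step functions in \<open>L\<^sup>1\<close> of time and probability.\<close>

definition approximable :: "(real \<times> 'w \<Rightarrow> real) \<Rightarrow> bool" where
  "approximable f \<longleftrightarrow> (\<forall>e>0. \<exists>n \<eta>. (\<forall>k<2^n. \<eta> k \<in> borel_measurable (F (pt n k)))
     \<and> integrable cylinder (step_fun n \<eta>) \<and> (LINT z|cylinder. \<bar>f z - step_fun n \<eta> z\<bar>) < e)"

lemma step_fun_refine:
  assumes "z \<in> space cylinder"
  shows "step_fun (n + p) (\<lambda>k. \<eta> (k div 2 ^ p)) z = step_fun n \<eta> z"
  using assms gridcell_refine[OF t0T, of "fst z" n p] by (auto simp: step_fun_def space_cylinder)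

lemma adapted_refine:
  assumes "\<And>k. k < 2 ^ n \<Longrightarrow> \<eta> k \<in> measurable (F (pt n k)) N" "k < 2 ^ (n + p)"
  shows "\<eta> (k div 2 ^ p) \<in> measurable (F (pt (n + p) k)) N"
proof -
  have k: "k div 2 ^ p < 2 ^ n" using assms by (simp add: less_mult_imp_div_less power_add)
  have le: "pt n (k div 2 ^ p) \<le> pt (n + p) k"
    unfolding gridpt_refine[of _ _ n p, symmetric] by (rule gridpt_mono[OF t0T]) simp
  show ?thesis
    by (rule measurable_mono[OF _ le _ assms(1)[OF k]])
      (use gridpt_in[OF t0T, of "k div 2 ^ p" n] gridpt_in[OF t0T, of k "n + p"] k assms in auto)
qed

lemma approximable_rect:
  assumes "E \<in> predictable_rects"
  shows "approximable (indicator E)"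
proof -
  obtain n k A where E: "E = {r\<in>{t\<^sub>0<..T}. cell n r = k} \<times> A" and k: "k < 2 ^ n" and A: "A \<in> sets (F (pt n k))"
    using assms by (auto simp: predictable_rects_def)
  interpret C: finite_measure cylinder by (rule finite_cylinder)
  define \<eta> where "\<eta> m \<omega> = (if m = k then indicator A \<omega> else (0::real))" for m \<omega>
  have \<eta>: "\<eta> m \<in> borel_measurable (F (pt n m))" for m using A by (cases "m = k") (auto simp: \<eta>_def[abs_def])
  have eq: "step_fun n \<eta> z = indicator E z" if "z \<in> space cylinder" for z
    using that by (auto simp: step_fun_def \<eta>_def E indicator_def space_cylinder split: if_splits)
  have "step_fun n \<eta> \<in> borel_measurable cylinder"
    using \<eta> by (intro predictable_cylinder step_fun_predictable) auto
  then have int: "integrable cylinder (step_fun n \<eta>)"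
    by (intro C.integrable_const_bound[where B=1] AE_I2) (auto simp: eq)
  have "(LINT z|cylinder. \<bar>indicator E z - step_fun n \<eta> z\<bar>) = (LINT z|cylinder. 0)"
    by (intro Bochner_Integration.integral_cong refl) (simp add: eq)
  then show ?thesis unfolding approximable_def using \<eta> int by (metis integral_zero)
qed

lemma approximable_add:
  assumes f: "integrable cylinder f" "approximable f" and g: "integrable cylinder g" "approximable g"
  shows "approximable (\<lambda>z. f z + g z)"
  unfolding approximable_def
proof (intro allI impI)
  fix e :: real assume e: "0 < e"
  then have e2: "0 < e / 2" by simp
  obtain n \<eta> where 1: "\<And>k. k < 2^n \<Longrightarrow> \<eta> k \<in> borel_measurable (F (pt n k))"
     "integrable cylinder (step_fun n \<eta>)" "(LINT z|cylinder. \<bar>f z - step_fun n \<eta> z\<bar>) < e / 2"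
    using f(2) e2 unfolding approximable_def by blast
  obtain m \<theta> where 2: "\<And>k. k < 2^m \<Longrightarrow> \<theta> k \<in> borel_measurable (F (pt m k))"
     "integrable cylinder (step_fun m \<theta>)" "(LINT z|cylinder. \<bar>g z - step_fun m \<theta> z\<bar>) < e / 2"
    using g(2) e2 unfolding approximable_def by blast
  define \<xi> where "\<xi> k \<omega> = \<eta> (k div 2 ^ m) \<omega> + \<theta> (k div 2 ^ n) \<omega>" for k \<omega>
  have meas: "\<xi> k \<in> borel_measurable (F (pt (n + m) k))" if "k < 2 ^ (n + m)" for k
    using adapted_refine[of n \<eta> borel k m] adapted_refine[of m \<theta> borel k n] 1(1) 2(1) that
    unfolding \<xi>_def[abs_def] by (intro borel_measurable_add) (auto simp: add.commute)
  have eq: "step_fun (n + m) \<xi> z = step_fun n \<eta> z + step_fun m \<theta> z" if "z \<in> space cylinder" for z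
    using step_fun_refine[OF that, of n m \<eta>] step_fun_refine[OF that, of m n \<theta>]
    by (simp add: \<xi>_def step_fun_def case_prod_beta add.commute)
  have int: "integrable cylinder (step_fun (n + m) \<xi>)"
    using Bochner_Integration.integrable_add[OF 1(2) 2(2)] by (subst Bochner_Integration.integrable_cong[OF refl eq]) auto
  have "(LINT z|cylinder. \<bar>(f z + g z) - step_fun (n + m) \<xi> z\<bar>)
     \<le> (LINT z|cylinder. \<bar>f z - step_fun n \<eta> z\<bar> + \<bar>g z - step_fun m \<theta> z\<bar>)"
    using f(1) g(1) int 1(2) 2(2) by (intro integral_mono) (auto simp: eq)
  also have "\<dots> < e" using f(1) g(1) 1 2 by simp
  finally show "\<exists>n \<eta>. (\<forall>k<2^n. \<eta> k \<in> borel_measurable (F (pt n k)))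
     \<and> integrable cylinder (step_fun n \<eta>) \<and> (LINT z|cylinder. \<bar>(f z + g z) - step_fun n \<eta> z\<bar>) < e"
    using meas int by blast
qed

lemma approximable_scale:
  assumes f: "integrable cylinder f" "approximable f"
  shows "approximable (\<lambda>z. f z * c)"
  unfolding approximable_def
proof (intro allI impI)
  fix e :: real assume e: "0 < e"
  then have "0 < e / (\<bar>c\<bar> + 1)" by simp
  then obtain n \<eta> where 1: "\<And>k. k < 2^n \<Longrightarrow> \<eta> k \<in> borel_measurable (F (pt n k))"
     "integrable cylinder (step_fun n \<eta>)" "(LINT z|cylinder. \<bar>f z - step_fun n \<eta> z\<bar>) < e / (\<bar>c\<bar> + 1)"
    using f(2) unfolding approximable_def by blast
  let ?\<xi> = "\<lambda>k \<omega>. \<eta> k \<omega> * c"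
  have eq: "step_fun n ?\<xi> z = step_fun n \<eta> z * c" for z by (simp add: step_fun_def case_prod_beta)
  have int: "integrable cylinder (step_fun n ?\<xi>)"
    unfolding eq[abs_def] using 1(2) by simp
  have "(LINT z|cylinder. \<bar>f z * c - step_fun n ?\<xi> z\<bar>) = (LINT z|cylinder. \<bar>f z - step_fun n \<eta> z\<bar>) * \<bar>c\<bar>"
    unfolding eq left_diff_distrib[symmetric] abs_mult by simp
  also have "\<dots> \<le> (LINT z|cylinder. \<bar>f z - step_fun n \<eta> z\<bar>) * (\<bar>c\<bar> + 1)"
    by (intro mult_left_mono) auto
  also have "\<dots> < e" using 1(3) by (simp add: pos_less_divide_eq)
  finally show "\<exists>n \<eta>. (\<forall>k<2^n. \<eta> k \<in> borel_measurable (F (pt n k)))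
     \<and> integrable cylinder (step_fun n \<eta>) \<and> (LINT z|cylinder. \<bar>f z * c - step_fun n \<eta> z\<bar>) < e"
    using 1(1) int by (intro exI[of _ n] exI[of _ ?\<xi>]) auto
qed

lemma approximable_closed:
  assumes f: "integrable cylinder f"
    and lim: "\<And>e. e > 0 \<Longrightarrow> \<exists>g. integrable cylinder g \<and> approximable g \<and> (LINT z|cylinder. \<bar>f z - g z\<bar>) < e"
  shows "approximable f"
  unfolding approximable_def
proof (intro allI impI)
  fix e :: real assume e: "0 < e"
  then have e2: "0 < e / 2" by simp
  then obtain g where g: "integrable cylinder g" "approximable g" "(LINT z|cylinder. \<bar>f z - g z\<bar>) < e / 2"
    using lim by blast
  obtain n \<eta> where 1: "\<And>k. k < 2^n \<Longrightarrow> \<eta> k \<in> borel_measurable (F (pt n k))"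
     "integrable cylinder (step_fun n \<eta>)" "(LINT z|cylinder. \<bar>g z - step_fun n \<eta> z\<bar>) < e / 2"
    using g(2) e2 unfolding approximable_def by blast
  have "(LINT z|cylinder. \<bar>f z - step_fun n \<eta> z\<bar>) \<le> (LINT z|cylinder. \<bar>f z - g z\<bar> + \<bar>g z - step_fun n \<eta> z\<bar>)"
    using f g(1) 1(2) by (intro integral_mono) auto
  also have "\<dots> < e" using f g 1 by simp
  finally show "\<exists>n \<eta>. (\<forall>k<2^n. \<eta> k \<in> borel_measurable (F (pt n k)))
     \<and> integrable cylinder (step_fun n \<eta>) \<and> (LINT z|cylinder. \<bar>f z - step_fun n \<eta> z\<bar>) < e"
    using 1 by blast
qed

text \<open>Two dyadic cells are nested or disjoint, and the finer one starts no earlier, so the intersection of two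
  generating rectangles is again one.\<close>

lemma Int_stable_predictable_rects: "Int_stable predictable_rects"
proof (rule Int_stableI)
  fix E E' assume "E \<in> predictable_rects" "E' \<in> predictable_rects"
  then obtain n k A m l A' where
    E: "E = {r\<in>{t\<^sub>0<..T}. cell n r = k} \<times> A" and k: "k < 2 ^ n" and A: "A \<in> sets (F (pt n k))" and
    E': "E' = {r\<in>{t\<^sub>0<..T}. cell m r = l} \<times> A'" and l: "l < 2 ^ m" and A': "A' \<in> sets (F (pt m l))"
    by (auto simp: predictable_rects_def)
  have main: "{r\<in>{t\<^sub>0<..T}. cell n r = k} \<times> A \<inter> {r\<in>{t\<^sub>0<..T}. cell (n+p) r = l} \<times> A' \<in> predictable_rects"
    if k: "k < 2 ^ n" and A: "A \<in> sets (F (pt n k))" and l: "l < 2 ^ (n+p)" and A': "A' \<in> sets (F (pt (n+p) l))"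
    for n k A p l A'
  proof (cases "l div 2 ^ p = k")
    case True
    have "A \<in> sets (F (pt (n + p) l))"
    proof -
      have "pt n k \<le> pt (n + p) l"
        unfolding True[symmetric] gridpt_refine[of _ _ n p, symmetric] by (rule gridpt_mono[OF t0T]) simp
      then show ?thesis
        using A sets_mono[of "pt n k" "pt (n+p) l"] gridpt_in[OF t0T, of k n] gridpt_in[OF t0T, of l "n+p"] k l by auto
    qed
    moreover have "{r\<in>{t\<^sub>0<..T}. cell n r = k} \<times> A \<inter> {r\<in>{t\<^sub>0<..T}. cell (n+p) r = l} \<times> A'
        = {r\<in>{t\<^sub>0<..T}. cell (n+p) r = l} \<times> (A \<inter> A')"
      using gridcell_refine[OF t0T, of _ n p] True by auto
    ultimately show ?thesis using l A' by (auto simp: predictable_rects_def)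
  next
    case False
    then have "{r\<in>{t\<^sub>0<..T}. cell n r = k} \<times> A \<inter> {r\<in>{t\<^sub>0<..T}. cell (n+p) r = l} \<times> A'
      = {r\<in>{t\<^sub>0<..T}. cell n r = k} \<times> {}"
      using gridcell_refine[OF t0T, of _ n p] by auto
    then show ?thesis using k by (auto simp: predictable_rects_def intro!: exI[of _ "{}"])
  qed
  show "E \<inter> E' \<in> predictable_rects"
  proof (cases "n \<le> m")
    case True
    then show ?thesis using main[of k n A l "m - n" A'] k A l A' by (simp add: E E')
  next
    case False
    then show ?thesis using main[of l m A' k "n - m" A] k A l A' by (simp add: E E' Int_commute)
  qed
qed

text \<open>A Dynkin system argument; countable unions are handled by \<open>approximable_closed\<close>.\<close>

lemma approximable_indicator:
  assumes "E \<in> sets predictable"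
  shows "approximable (indicator E)"
proof -
  interpret C: finite_measure cylinder by (rule finite_cylinder)
  have sub: "sigma_sets ({t\<^sub>0<..T} \<times> space M) predictable_rects \<subseteq> sets cylinder"
    using subalgebra_predictable by (simp add: subalgebra_def sets_predictable)
  have int: "integrable cylinder (indicator E :: _ \<Rightarrow> real)" if "E \<in> sigma_sets ({t\<^sub>0<..T} \<times> space M) predictable_rects" for E
    using that sub by (auto simp: C.emeasure_eq_measure)
  have zero: "approximable (indicator {})"
  proof (rule approximable_rect)
    have "{} = {r\<in>{t\<^sub>0<..T}. cell 0 r = 0} \<times> {} \<and> 0 < (2::nat) ^ 0 \<and> {} \<in> sets (F (pt 0 0))" by simp
    then show "{} \<in> predictable_rects" unfolding predictable_rects_def by blast
  qed
  from Int_stable_predictable_rects predictable_rects_closed assms[unfolded sets_predictable]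
  show ?thesis
  proof (induction E rule: sigma_sets_induct_disjoint)
    case (basic A)
    then show ?case by (rule approximable_rect)
  next
    case empty
    then show ?case by (rule zero)
  next
    case (compl A)
    let ?\<Omega> = "{t\<^sub>0<..T} \<times> space M"
    have "?\<Omega> = {r\<in>{t\<^sub>0<..T}. cell 0 r = 0} \<times> space M"
      using gridcell_less[OF t0T, of _ 0] by auto
    moreover have "space M \<in> sets (F (pt 0 0))" using sets.top[of "F t\<^sub>0"] space_F[of t\<^sub>0] t0T by simp
    ultimately have \<Omega>: "?\<Omega> \<in> predictable_rects" unfolding predictable_rects_def by fastforce
    have "approximable (\<lambda>z. indicator ?\<Omega> z + indicator A z * (- 1))"
      by (rule approximable_add[OF int[OF sigma_sets.Basic[OF \<Omega>]] approximable_rect[OF \<Omega>]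
            integrable_mult_left[OF int[OF compl(1)]] approximable_scale[OF int[OF compl(1)] compl(2)]])
    moreover have "indicator ?\<Omega> z + indicator A z * (- 1) = (indicator (?\<Omega> - A) z :: real)" for z
      using sigma_sets_into_sp[OF predictable_rects_closed compl(1)] by (auto simp: indicator_def)
    ultimately show ?case by (simp only:)
  next
    case (union A)
    have A: "A i \<in> sigma_sets ({t\<^sub>0<..T} \<times> space M) predictable_rects" for i using union by auto
    have AC: "A i \<in> sets cylinder" for i using A sub by auto
    have UA: "(\<Union>i. A i) \<in> sigma_sets ({t\<^sub>0<..T} \<times> space M) predictable_rects"
      using A by (intro sigma_sets.Union)
    have fin: "approximable (indicator (\<Union>i<n. A i))" for n :: nat
    proof (induction n)
      case 0
      then show ?case using zero by (simp only: lessThan_0 UN_empty)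
    next
      case (Suc n)
      have "A i \<inter> A n = {}" if "i < n" for i
        using union(1) that by (simp add: disjoint_family_on_def)
      then have "(\<Union>i<n. A i) \<inter> A n = {}" by blast
      then have eq: "indicator (\<Union>i<n. A i) z + indicator (A n) z = (indicator (\<Union>i<Suc n. A i) z :: real)" for z
        by (auto simp: indicator_def less_Suc_eq)
      have "(\<Union>i<n. A i) \<in> sets cylinder" using AC by auto
      then have "approximable (\<lambda>z. indicator (\<Union>i<n. A i) z + indicator (A n) z)"
        using Suc union(3) int[OF A] by (intro approximable_add) (auto simp: C.emeasure_eq_measure)
      then show ?case unfolding eq .
    qed
    show ?case
    proof (rule approximable_closed[OF int[OF UA]])
      fix e :: real assume e: "0 < e"
      have "(\<lambda>n. LINT z|cylinder. \<bar>indicat_real (\<Union>i. A i) z - indicator (\<Union>i<n. A i) z\<bar>) \<longlonglongrightarrow> (LINT z|cylinder. 0)"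
      proof (rule integral_dominated_convergence[where w="\<lambda>_. 1"])
        show "AE z in cylinder. (\<lambda>n. \<bar>indicat_real (\<Union>i. A i) z - indicator (\<Union>i<n. A i) z :: real\<bar>) \<longlonglongrightarrow> 0"
        proof (rule AE_I2)
          fix z
          have "(\<lambda>n. indicator (\<Union>i<n. A i) z :: real) \<longlonglongrightarrow> indicator (\<Union>i. A i) z"
            by (rule LIMSEQ_indicator_UN)
          then have "(\<lambda>n. \<bar>indicat_real (\<Union>i. A i) z - indicator (\<Union>i<n. A i) z :: real\<bar>) \<longlonglongrightarrow> \<bar>indicat_real (\<Union>i. A i) z - indicator (\<Union>i. A i) z\<bar>"
            by (intro tendsto_intros)
          then show "(\<lambda>n. \<bar>indicat_real (\<Union>i. A i) z - indicator (\<Union>i<n. A i) z :: real\<bar>) \<longlonglongrightarrow> 0" by simp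
        qed
        show "(\<lambda>z. \<bar>indicat_real (\<Union>i. A i) z - indicator (\<Union>i<n. A i) z :: real\<bar>) \<in> borel_measurable cylinder" for n
          using AC by measurable
      qed (auto simp: indicator_def)
      then have "\<forall>\<^sub>F n in sequentially. (LINT z|cylinder. \<bar>indicat_real (\<Union>i. A i) z - indicator (\<Union>i<n. A i) z\<bar>) < e"
        using e by (intro order_tendstoD) auto
      then obtain n where "(LINT z|cylinder. \<bar>indicat_real (\<Union>i. A i) z - indicator (\<Union>i<n. A i) z\<bar>) < e"
        by (auto simp: eventually_sequentially)
      moreover have "(\<Union>i<n. A i) \<in> sets cylinder" using AC by auto
      ultimately show "\<exists>g. integrable cylinder g \<and> approximable g \<and> (LINT z|cylinder. \<bar>indicat_real (\<Union>i. A i) z - g z\<bar>) < e"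
        using fin[of n] by (intro exI[of _ "indicator (\<Union>i<n. A i)"]) (auto simp: C.emeasure_eq_measure)
    qed
  qed
qed

theorem predictable_approximable:
  assumes f: "f \<in> borel_measurable predictable" "integrable cylinder f"
  shows "approximable f"
proof -
  have "integrable (restr_to_subalg cylinder predictable) f"
    by (rule integrable_in_subalg[OF subalgebra_predictable f])
  then show ?thesis
  proof (induction rule: integrable_induct)
    case (base A c)
    interpret C: finite_measure cylinder by (rule finite_cylinder)
    have "A \<in> sets predictable" using base sets_restr_to_subalg[OF subalgebra_predictable] by simp
    moreover then have "A \<in> sets cylinder" using subalgebra_predictable by (auto simp: subalgebra_def)
    ultimately have "approximable (\<lambda>z. indicator A z * c)"
      by (intro approximable_scale approximable_indicator) (auto simp: C.emeasure_eq_measure)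
    then show ?case by simp
  next
    case (add f g)
    then show ?case
      using integrable_from_subalg[OF subalgebra_predictable] by (intro approximable_add) auto
  next
    case (lim f s)
    have int: "integrable cylinder f" "integrable cylinder (s i)" for i
      by (rule integrable_from_subalg[OF subalgebra_predictable lim(4)], rule integrable_from_subalg[OF subalgebra_predictable lim(1)])
    have sp: "space (restr_to_subalg cylinder predictable) = space cylinder" by (rule space_restr_to_subalg)
    show ?case
    proof (rule approximable_closed[OF int(1)])
      fix e :: real assume e: "0 < e"
      have "(\<lambda>n. LINT z|cylinder. \<bar>f z - s n z\<bar>) \<longlonglongrightarrow> (LINT z|cylinder. 0)"
      proof (rule integral_dominated_convergence[where w="\<lambda>z. 3 * \<bar>f z\<bar>"])
        show "AE z in cylinder. (\<lambda>n. \<bar>f z - s n z\<bar>) \<longlonglongrightarrow> 0"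
        proof (rule AE_I2)
          fix z assume "z \<in> space cylinder"
          then have "(\<lambda>n. \<bar>f z - s n z\<bar>) \<longlonglongrightarrow> \<bar>f z - f z\<bar>" using lim(2)[of z] sp by (intro tendsto_intros) auto
          then show "(\<lambda>n. \<bar>f z - s n z\<bar>) \<longlonglongrightarrow> 0" by simp
        qed
        show "AE z in cylinder. norm \<bar>f z - s n z\<bar> \<le> 3 * \<bar>f z\<bar>" for n
        proof (rule AE_I2)
          fix z assume "z \<in> space cylinder"
          then have "\<bar>s n z\<bar> \<le> 2 * \<bar>f z\<bar>" using lim(3)[of z n] sp by simp
          then show "norm \<bar>f z - s n z\<bar> \<le> 3 * \<bar>f z\<bar>" by simp
        qed
      qed (use int in auto)
      then have "\<forall>\<^sub>F n in sequentially. (LINT z|cylinder. \<bar>f z - s n z\<bar>) < e"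
        using e by (intro order_tendstoD) auto
      then obtain n where "(LINT z|cylinder. \<bar>f z - s n z\<bar>) < e" by (auto simp: eventually_sequentially)
      then show "\<exists>g. integrable cylinder g \<and> approximable g \<and> (LINT z|cylinder. \<bar>f z - g z\<bar>) < e"
        using int lim(5) by blast
    qed
  qed
qed

end

section \<open>Drifts with bounded total energy\<close>

context brownian_family
begin

lemma cell_integral:
  fixes \<phi> :: "nat \<Rightarrow> real"
  assumes ab: "a \<le> b" "b \<le> 2 ^ n"
  shows "set_integrable lborel {pt n a<..pt n b} (\<lambda>r. \<phi> (cell n r))"
    and "(LINT r:{pt n a<..pt n b}|lborel. \<phi> (cell n r)) = mesh n * (\<Sum>k=a..<b. \<phi> k)"
proof -
  have eq: "indicator {pt n a<..pt n b} r *\<^sub>R \<phi> (cell n r) = (\<Sum>k=a..<b. indicator {pt n k<..pt n (Suc k)} r * \<phi> k)" for r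
  proof (cases "r \<in> {pt n a<..pt n b}")
    case True
    have r: "r \<in> {t\<^sub>0<..T}" using True gridpt_in[OF t0T, of a n] gridpt_in[OF t0T, of b n] ab by auto
    let ?c = "cell n r"
    have c: "a \<le> ?c" "?c < b"
    proof -
      show "a \<le> ?c"
      proof (rule ccontr)
        assume "\<not> a \<le> ?c"
        then have "pt n (Suc ?c) \<le> pt n a" by (intro gridpt_mono[OF t0T]) simp
        then show False using gridcell_upper[OF t0T r, of n] True by simp
      qed
      show "?c < b"
      proof (rule ccontr)
        assume "\<not> ?c < b"
        then have "pt n b \<le> pt n ?c" by (intro gridpt_mono[OF t0T]) simp
        then show False using gridcell_lower[OF t0T r, of n] True by simp
      qed
    qed
    have "(\<Sum>k=a..<b. indicator {pt n k<..pt n (Suc k)} r * \<phi> k) = (\<Sum>k=a..<b. if k = ?c then \<phi> k else 0)"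
    proof (intro sum.cong refl)
      fix k assume k: "k \<in> {a..<b}"
      then have "k < 2 ^ n" using ab by simp
      have "r \<in> {pt n k<..pt n (Suc k)} \<longleftrightarrow> r \<in> {r\<in>{t\<^sub>0<..T}. cell n r = k}"
        by (simp only: cell_set[OF \<open>k < 2 ^ n\<close>])
      then have "r \<in> {pt n k<..pt n (Suc k)} \<longleftrightarrow> cell n r = k" using r by blast
      then show "indicator {pt n k<..pt n (Suc k)} r * \<phi> k = (if k = ?c then \<phi> k else 0)"
        by (auto simp: indicator_def)
    qed
    then show ?thesis using c True by simp
  next
    case False
    have "indicator {pt n k<..pt n (Suc k)} r * \<phi> k = 0" if "k \<in> {a..<b}" for k
    proof -
      have "pt n a \<le> pt n k" "pt n (Suc k) \<le> pt n b" using that by (auto intro!: gridpt_mono[OF t0T])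
      then show ?thesis using False by (auto simp: indicator_def)
    qed
    then have "(\<Sum>k=a..<b. indicator {pt n k<..pt n (Suc k)} r * \<phi> k) = 0"
      by (intro sum.neutral ballI)
    moreover have "indicator {pt n a<..pt n b} r = (0::real)" using False by (rule indicator_simps(2))
    ultimately show ?thesis by (simp only: scaleR_zero_left)
  qed
  have int: "integrable lborel (\<lambda>r. indicator {pt n k<..pt n (Suc k)} r * \<phi> k)" for k
    using gridpt_mono[OF t0T, of k "Suc k" n] by (intro integrable_mult_left) (simp add: integrable_indicator_iff)
  have val: "(LINT r|lborel. indicator {pt n k<..pt n (Suc k)} r * \<phi> k) = mesh n * \<phi> k" for k
  proof -
    have "measure lborel {pt n k<..pt n (Suc k)} = pt n (Suc k) - pt n k"
      by (rule measure_lborel_Ioc) (rule gridpt_mono[OF t0T], simp)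
    then show ?thesis by (simp add: pt_diff[of n "Suc k" k])
  qed
  show "set_integrable lborel {pt n a<..pt n b} (\<lambda>r. \<phi> (cell n r))"
    unfolding set_integrable_def eq using int by (intro Bochner_Integration.integrable_sum)
  show "(LINT r:{pt n a<..pt n b}|lborel. \<phi> (cell n r)) = mesh n * (\<Sum>k=a..<b. \<phi> k)"
    unfolding set_lebesgue_integral_def eq
    by (subst Bochner_Integration.integral_sum[OF int]) (simp only: val sum_distrib_left)
qed

lemma step_fun_cylinder_measurable:
  assumes "\<And>k. k < 2 ^ n \<Longrightarrow> g k \<in> borel_measurable (F (pt n k))"
  shows "step_fun n g \<in> borel_measurable cylinder"
  using assms by (intro predictable_cylinder step_fun_predictable)

lemma step_fun_integral:
  fixes g :: "nat \<Rightarrow> 'a \<Rightarrow> real"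
  assumes g: "\<And>k. k < 2 ^ n \<Longrightarrow> g k \<in> borel_measurable (F (pt n k))"
    and R: "\<And>k \<omega>. \<omega> \<in> space M \<Longrightarrow> k < 2 ^ n \<Longrightarrow> \<bar>g k \<omega>\<bar> \<le> R"
  shows "(LINT z|cylinder. step_fun n g z) = (LINT \<omega>|M. mesh n * (\<Sum>k<2 ^ n. g k \<omega>))"
proof -
  interpret P: pair_sigma_finite time_measure M by (rule pair_time)
  interpret C: finite_measure cylinder by (rule finite_cylinder)
  have "integrable cylinder (step_fun n g)"
    using step_fun_cylinder_measurable[OF g] gridcell_less[OF t0T] R
    by (intro C.integrable_const_bound[where B=R] AE_I2) (auto simp: step_fun_def space_cylinder)
  then have "(LINT z|cylinder. step_fun n g z) = (LINT \<omega>|M. (LINT r|time_measure. g (cell n r) \<omega>))"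
    unfolding cylinder_def step_fun_def by (rule P.integral_snd[symmetric])
  moreover have "(LINT r|time_measure. g (cell n r) \<omega>) = mesh n * (\<Sum>k<2 ^ n. g k \<omega>)" for \<omega>
    using cell_integral(2)[of 0 "2^n" n "\<lambda>k. g k \<omega>"]
    unfolding time_measure_def by (simp add: integral_restrict_space set_lebesgue_integral_def atLeast0LessThan)
  ultimately show ?thesis by simp
qed

end

text \<open>The components may be infinitely many; what is assumed is a bound on their total energy. The
  dominating \<open>c j\<close> is random but known at the initial time, since in the application it depends on
  the random masses.\<close>

locale bounded_drift = brownian_family +
  fixes \<theta> :: "'b \<Rightarrow> real \<times> 'a \<Rightarrow> real" and c :: "'b \<Rightarrow> 'a \<Rightarrow> real" and K :: real
  assumes \<theta>_predictable: "\<theta> j \<in> borel_measurable predictable"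
    and c_initial: "c j \<in> borel_measurable (F t\<^sub>0)"
    and \<theta>_le_c: "r \<in> {t\<^sub>0<..T} \<Longrightarrow> \<omega> \<in> space M \<Longrightarrow> \<bar>\<theta> j (r, \<omega>)\<bar> \<le> c j \<omega>"
    and c_sum: "finite J \<Longrightarrow> \<omega> \<in> space M \<Longrightarrow> (\<Sum>j\<in>J. (c j \<omega>)\<^sup>2) \<le> K"
begin

sublocale cyl: finite_measure cylinder by (rule finite_cylinder)

lemma \<theta>_measurable [measurable]: "\<theta> j \<in> borel_measurable cylinder"
  by (rule predictable_cylinder[OF \<theta>_predictable])

lemma c_nonneg: "\<omega> \<in> space M \<Longrightarrow> 0 \<le> c j \<omega>"
  using \<theta>_le_c[of T \<omega> j] t0T by simp

lemma K_nonneg: "0 \<le> K"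
proof -
  obtain \<omega> where "\<omega> \<in> space M" using not_empty by blast
  then show ?thesis using c_sum[of "{}" \<omega>] by simp
qed

lemma c_le: "\<omega> \<in> space M \<Longrightarrow> c j \<omega> \<le> sqrt K"
  using c_sum[of "{j}" \<omega>] by (intro real_le_rsqrt) simp

lemma \<theta>_bound: "z \<in> space cylinder \<Longrightarrow> \<bar>\<theta> j z\<bar> \<le> sqrt K"
  using order_trans[OF \<theta>_le_c[of "fst z" "snd z" j] c_le[of "snd z" j]] by (auto simp: space_cylinder)

lemma sq_le: "a \<in> space M \<Longrightarrow> \<bar>x\<bar> \<le> c j a \<Longrightarrow> x\<^sup>2 \<le> (c j a)\<^sup>2"
  by (metis abs_ge_zero power2_abs power_mono)

text \<open>Truncating the \<open>L\<^sup>1\<close>-approximation at the level \<open>c j\<close> keeps it adapted, because \<open>c j\<close> is known at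
  the initial time, and turns closeness in \<open>L\<^sup>1\<close> into closeness in \<open>L\<^sup>2\<close>.\<close>

lemma approximation_one:
  assumes e: "0 < e"
  obtains n \<eta> where "\<And>k. k < 2 ^ n \<Longrightarrow> \<eta> k \<in> borel_measurable (F (pt n k))"
    "\<And>k \<omega>. \<omega> \<in> space M \<Longrightarrow> \<bar>\<eta> k \<omega>\<bar> \<le> c j \<omega>"
    "(LINT z|cylinder. (\<theta> j z - step_fun n \<eta> z)\<^sup>2) < e"
proof -
  define R where "R = sqrt K"
  have R: "0 \<le> R" using K_nonneg by (simp add: R_def)
  have "integrable cylinder (\<theta> j)"
    using \<theta>_bound by (intro cyl.integrable_const_bound[where B=R] AE_I2) (auto simp: R_def)
  then have "approximable (\<theta> j)" by (rule predictable_approximable[OF \<theta>_predictable])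
  moreover have "0 < e / (2 * R + 1)" using e R by simp
  ultimately obtain n \<eta> where \<eta>: "\<And>k. k < 2^n \<Longrightarrow> \<eta> k \<in> borel_measurable (F (pt n k))"
     "integrable cylinder (step_fun n \<eta>)" "(LINT z|cylinder. \<bar>\<theta> j z - step_fun n \<eta> z\<bar>) < e / (2 * R + 1)"
    unfolding approximable_def by blast
  define \<xi> where "\<xi> k \<omega> = max (- c j \<omega>) (min (c j \<omega>) (\<eta> k \<omega>))" for k \<omega>
  have \<xi>_meas: "\<xi> k \<in> borel_measurable (F (pt n k))" if "k < 2 ^ n" for k
  proof -
    have "c j \<in> borel_measurable (F (pt n k))"
      by (rule measurable_mono[OF order_refl _ _ c_initial]) (use gridpt_in[OF t0T, of k n] that in auto)
    then show ?thesis using \<eta>(1)[OF that] unfolding \<xi>_def[abs_def] by measurable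
  qed
  have \<xi>_le: "\<bar>\<xi> k \<omega>\<bar> \<le> c j \<omega>" if "\<omega> \<in> space M" for k \<omega>
    using c_nonneg[OF that, of j] by (auto simp: \<xi>_def)
  have \<xi>_m: "step_fun n \<xi> \<in> borel_measurable cylinder" by (rule step_fun_cylinder_measurable[OF \<xi>_meas])
  have pw: "(\<theta> j z - step_fun n \<xi> z)\<^sup>2 \<le> 2 * R * \<bar>\<theta> j z - step_fun n \<eta> z\<bar>" if z: "z \<in> space cylinder" for z
  proof -
    obtain r \<omega> where z': "z = (r, \<omega>)" "r \<in> {t\<^sub>0<..T}" "\<omega> \<in> space M" using z by (cases z) (auto simp: space_cylinder)
    have cl: "(x - max (- a) (min a y))\<^sup>2 \<le> 2 * R * \<bar>x - y\<bar>" if "\<bar>x\<bar> \<le> a" "a \<le> R" for x y a :: real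
    proof -
      have "\<bar>x - max (- a) (min a y)\<bar> \<le> \<bar>x - y\<bar>" "\<bar>x - max (- a) (min a y)\<bar> \<le> 2 * R"
        using that by (auto simp: max_def min_def)
      then have "\<bar>x - max (- a) (min a y)\<bar> * \<bar>x - max (- a) (min a y)\<bar> \<le> 2 * R * \<bar>x - y\<bar>"
        by (intro mult_mono) auto
      then show ?thesis by (simp add: power2_eq_square)
    qed
    show ?thesis using cl[OF \<theta>_le_c[OF z'(2,3)] c_le[OF z'(3), folded R_def]]
      by (simp add: z' step_fun_def \<xi>_def)
  qed
  have "(LINT z|cylinder. (\<theta> j z - step_fun n \<xi> z)\<^sup>2) \<le> (LINT z|cylinder. 2 * R * \<bar>\<theta> j z - step_fun n \<eta> z\<bar>)"
  proof (rule integral_mono_AE')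
    show "integrable cylinder (\<lambda>z. 2 * R * \<bar>\<theta> j z - step_fun n \<eta> z\<bar>)"
      using \<eta>(2) \<open>integrable cylinder (\<theta> j)\<close> by auto
  qed (use pw R in auto)
  also have "\<dots> = 2 * R * (LINT z|cylinder. \<bar>\<theta> j z - step_fun n \<eta> z\<bar>)" by simp
  also have "\<dots> \<le> (2 * R + 1) * (LINT z|cylinder. \<bar>\<theta> j z - step_fun n \<eta> z\<bar>)"
    by (intro mult_right_mono) auto
  also have "\<dots> < e" using \<eta>(3) R by (simp add: pos_less_divide_eq mult.commute)
  finally show ?thesis using \<xi>_meas \<xi>_le that by blast
qed

lemma step_fun_cong_refine:
  "(LINT z|cylinder. (\<theta> j z - step_fun (n + p) (\<lambda>k. \<eta> (k div 2 ^ p)) z)\<^sup>2) = (LINT z|cylinder. (\<theta> j z - step_fun n \<eta> z)\<^sup>2)"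
  by (intro Bochner_Integration.integral_cong refl) (simp add: step_fun_refine)

text \<open>Approximations on different grids are moved to a common refinement.\<close>

lemma approximation_finite:
  assumes J: "finite J" and e: "0 < e"
  shows "\<exists>n \<beta>. (\<forall>k<2 ^ n. \<forall>j\<in>J. \<beta> k j \<in> borel_measurable (F (pt n k)))
    \<and> (\<forall>k. \<forall>j\<in>J. \<forall>\<omega>\<in>space M. \<bar>\<beta> k j \<omega>\<bar> \<le> c j \<omega>)
    \<and> (\<forall>j\<in>J. (LINT z|cylinder. (\<theta> j z - step_fun n (\<lambda>k. \<beta> k j) z)\<^sup>2) < e)"
  using J
proof (induction J)
  case empty
  then show ?case by simp
next
  case (insert a J)
  obtain n \<beta> where \<beta>: "\<And>k j. k < 2 ^ n \<Longrightarrow> j \<in> J \<Longrightarrow> \<beta> k j \<in> borel_measurable (F (pt n k))"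
    "\<And>k j \<omega>. j \<in> J \<Longrightarrow> \<omega> \<in> space M \<Longrightarrow> \<bar>\<beta> k j \<omega>\<bar> \<le> c j \<omega>"
    "\<And>j. j \<in> J \<Longrightarrow> (LINT z|cylinder. (\<theta> j z - step_fun n (\<lambda>k. \<beta> k j) z)\<^sup>2) < e"
    using insert.IH by blast
  obtain m \<eta> where \<eta>: "\<And>k. k < 2 ^ m \<Longrightarrow> \<eta> k \<in> borel_measurable (F (pt m k))"
    "\<And>k \<omega>. \<omega> \<in> space M \<Longrightarrow> \<bar>\<eta> k \<omega>\<bar> \<le> c a \<omega>"
    "(LINT z|cylinder. (\<theta> a z - step_fun m \<eta> z)\<^sup>2) < e"
    using approximation_one[OF e, of a] by blast
  define \<gamma> where "\<gamma> k j = (if j = a then \<eta> (k div 2 ^ n) else \<beta> (k div 2 ^ m) j)" for k j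
  have "\<gamma> k j \<in> borel_measurable (F (pt (n + m) k))" if "k < 2 ^ (n + m)" "j \<in> insert a J" for k j
    using adapted_refine[of m \<eta> borel k n] adapted_refine[of n "\<lambda>k. \<beta> k j" borel k m] \<eta>(1) \<beta>(1) that
    by (auto simp: \<gamma>_def add.commute)
  moreover have "\<bar>\<gamma> k j \<omega>\<bar> \<le> c j \<omega>" if "j \<in> insert a J" "\<omega> \<in> space M" for k j \<omega>
    using that \<eta>(2) \<beta>(2) by (auto simp: \<gamma>_def)
  moreover have "(LINT z|cylinder. (\<theta> j z - step_fun (n + m) (\<lambda>k. \<gamma> k j) z)\<^sup>2) < e" if "j \<in> insert a J" for j
  proof (cases "j = a")
    case True
    then show ?thesis using \<eta>(3) step_fun_cong_refine[of a m n \<eta>] by (simp add: \<gamma>_def add.commute)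
  next
    case False
    then show ?thesis using \<beta>(3)[of j] that step_fun_cong_refine[of j n m "\<lambda>k. \<beta> k j"] by (simp add: \<gamma>_def)
  qed
  ultimately show ?case by blast
qed

lemma \<theta>_sq_integrable: "integrable cylinder (\<lambda>z. (\<theta> j z)\<^sup>2)"
proof (intro cyl.integrable_const_bound[where B=K] AE_I2)
  fix z assume "z \<in> space cylinder"
  then have "\<bar>\<theta> j z\<bar> \<le> sqrt K" by (rule \<theta>_bound)
  then have "(\<theta> j z)\<^sup>2 \<le> K" using K_nonneg by (metis abs_ge_zero power2_abs power_mono real_sqrt_pow2)
  then show "norm ((\<theta> j z)\<^sup>2) \<le> K" by simp
qed auto

text \<open>The energies of the components are summable, because all finite partial sums are bounded by the
  integral of \<open>K\<close>.\<close>

lemma tail_small: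
  assumes e: "0 < e" and J0: "finite J\<^sub>0"
  obtains J where "finite J" "J\<^sub>0 \<subseteq> J"
    "\<And>J'. finite J' \<Longrightarrow> J' \<inter> J = {} \<Longrightarrow> (\<Sum>j\<in>J'. LINT z|cylinder. (\<theta> j z)\<^sup>2) \<le> e"
proof -
  define \<gamma> where "\<gamma> j = (LINT z|cylinder. (\<theta> j z)\<^sup>2)" for j
  have \<gamma>: "0 \<le> \<gamma> j" for j by (simp add: \<gamma>_def)
  define S where "S = {(\<Sum>j\<in>J. \<gamma> j) | J. finite J}"
  have bnd: "(\<Sum>j\<in>J. \<gamma> j) \<le> (LINT z|cylinder. K)" if J: "finite J" for J
  proof -
    have "(\<Sum>j\<in>J. \<gamma> j) = (LINT z|cylinder. (\<Sum>j\<in>J. (\<theta> j z)\<^sup>2))"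
      unfolding \<gamma>_def using \<theta>_sq_integrable by (simp add: Bochner_Integration.integral_sum)
    also have "\<dots> \<le> (LINT z|cylinder. K)"
    proof (rule integral_mono)
      fix z assume "z \<in> space cylinder"
      then obtain r \<omega> where z: "z = (r, \<omega>)" "r \<in> {t\<^sub>0<..T}" "\<omega> \<in> space M" by (cases z) (auto simp: space_cylinder)
      have "(\<Sum>j\<in>J. (\<theta> j z)\<^sup>2) \<le> (\<Sum>j\<in>J. (c j \<omega>)\<^sup>2)"
        unfolding z(1) by (intro sum_mono sq_le \<theta>_le_c z)
      then show "(\<Sum>j\<in>J. (\<theta> j z)\<^sup>2) \<le> K" using c_sum[OF J z(3)] by linarith
    qed (use \<theta>_sq_integrable in \<open>auto intro!: Bochner_Integration.integrable_sum\<close>)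
    finally show ?thesis .
  qed
  then have bdd: "bdd_above S" by (auto simp: S_def intro!: bdd_aboveI)
  have "S \<noteq> {}" by (auto simp: S_def)
  then obtain x where "x \<in> S" "Sup S - e < x"
    using less_cSup_iff[OF _ bdd, of "Sup S - e"] e by auto
  then obtain J1 where J1: "finite J1" "Sup S - e < (\<Sum>j\<in>J1. \<gamma> j)" by (auto simp: S_def)
  show ?thesis
  proof
    show "finite (J1 \<union> J\<^sub>0)" "J\<^sub>0 \<subseteq> J1 \<union> J\<^sub>0" using J1 J0 by auto
    fix J' assume J': "finite J'" "J' \<inter> (J1 \<union> J\<^sub>0) = {}"
    have "(\<Sum>j\<in>J1. \<gamma> j) + (\<Sum>j\<in>J'. \<gamma> j) = (\<Sum>j\<in>J1 \<union> J'. \<gamma> j)"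
      using J1 J' by (intro sum.union_disjoint[symmetric]) auto
    also have "\<dots> \<le> Sup S" using J1 J' by (intro cSup_upper bdd) (auto simp: S_def)
    finally show "(\<Sum>j\<in>J'. LINT z|cylinder. (\<theta> j z)\<^sup>2) \<le> e" using J1 by (simp add: \<gamma>_def)
  qed
qed

text \<open>A step process with finitely many nonzero components, close to \<open>\<theta>\<close> in \<open>L\<^sup>2\<close> over all components at
  once: the last clause counts the error over arbitrarily large finite sets \<open>J'\<close>, hence includes
  the energy of \<open>\<theta>\<close> outside \<open>J\<close>.\<close>

definition good_approx :: "real \<Rightarrow> nat \<Rightarrow> 'b set \<Rightarrow> (nat \<Rightarrow> 'b \<Rightarrow> 'a \<Rightarrow> real) \<Rightarrow> bool" where
  "good_approx e n J \<beta> \<longleftrightarrow> finite J \<and> (\<forall>k<2 ^ n. \<forall>j. \<beta> k j \<in> borel_measurable (F (pt n k)))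
    \<and> (\<forall>k j. \<forall>\<omega>\<in>space M. \<bar>\<beta> k j \<omega>\<bar> \<le> c j \<omega>) \<and> (\<forall>k j \<omega>. j \<notin> J \<longrightarrow> \<beta> k j \<omega> = 0)
    \<and> (\<forall>J'. finite J' \<longrightarrow> J \<subseteq> J' \<longrightarrow> (\<Sum>j\<in>J'. LINT z|cylinder. (\<theta> j z - step_fun n (\<lambda>k. \<beta> k j) z)\<^sup>2) \<le> e)"

lemma good_approx_exists:
  assumes e: "0 < e" and J0: "finite J\<^sub>0"
  obtains n J \<beta> where "J\<^sub>0 \<subseteq> J" "good_approx e n J \<beta>"
proof -
  obtain J where J: "finite J" "J\<^sub>0 \<subseteq> J"
    and tail: "\<And>J'. finite J' \<Longrightarrow> J' \<inter> J = {} \<Longrightarrow> (\<Sum>j\<in>J'. LINT z|cylinder. (\<theta> j z)\<^sup>2) \<le> e / 2"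
    using tail_small[of "e / 2" J\<^sub>0] e J0 by auto
  define d where "d = e / (2 * (real (card J) + 1))"
  have d: "0 < d" using e by (simp add: d_def)
  obtain n \<eta> where \<eta>: "\<And>k j. k < 2 ^ n \<Longrightarrow> j \<in> J \<Longrightarrow> \<eta> k j \<in> borel_measurable (F (pt n k))"
    "\<And>k j \<omega>. j \<in> J \<Longrightarrow> \<omega> \<in> space M \<Longrightarrow> \<bar>\<eta> k j \<omega>\<bar> \<le> c j \<omega>"
    "\<And>j. j \<in> J \<Longrightarrow> (LINT z|cylinder. (\<theta> j z - step_fun n (\<lambda>k. \<eta> k j) z)\<^sup>2) < d"
    using approximation_finite[OF J(1) d] by blast
  define \<beta> where "\<beta> k j = (if j \<in> J then \<eta> k j else (\<lambda>_. 0))" for k j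
  have "(\<Sum>j\<in>J'. LINT z|cylinder. (\<theta> j z - step_fun n (\<lambda>k. \<beta> k j) z)\<^sup>2) \<le> e" if J': "finite J'" "J \<subseteq> J'" for J'
  proof -
    let ?d = "\<lambda>j. LINT z|cylinder. (\<theta> j z - step_fun n (\<lambda>k. \<beta> k j) z)\<^sup>2"
    have "(\<Sum>j\<in>J'. ?d j) = (\<Sum>j\<in>J' - J. ?d j) + (\<Sum>j\<in>J. ?d j)"
      using J' by (rule sum.subset_diff[rotated])
    also have "(\<Sum>j\<in>J' - J. ?d j) = (\<Sum>j\<in>J' - J. LINT z|cylinder. (\<theta> j z)\<^sup>2)"
      by (intro sum.cong refl) (simp add: \<beta>_def step_fun_def case_prod_beta)
    also have "\<dots> \<le> e / 2" using J' by (intro tail) auto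
    also have "(\<Sum>j\<in>J. ?d j) \<le> (\<Sum>j\<in>J. d)"
      using \<eta>(3) by (intro sum_mono) (simp add: \<beta>_def less_imp_le)
    also have "\<dots> \<le> (real (card J) + 1) * d" using d by simp
    also have "\<dots> = e / 2" by (simp add: d_def field_simps)
    finally show ?thesis by simp
  qed
  moreover have "\<beta> k j \<in> borel_measurable (F (pt n k))" if "k < 2 ^ n" for k j
    using \<eta>(1)[OF that, of j] by (simp add: \<beta>_def)
  moreover have "\<bar>\<beta> k j \<omega>\<bar> \<le> c j \<omega>" if "\<omega> \<in> space M" for k j \<omega>
    using \<eta>(2)[OF _ that] c_nonneg[OF that] by (simp add: \<beta>_def)
  ultimately have "good_approx e n J \<beta>"
    using J(1) by (auto simp: good_approx_def \<beta>_def)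
  then show ?thesis using that J(2) by blast
qed

lemma good_approx_refine:
  assumes "good_approx e n J \<beta>"
  shows "good_approx e (n + p) J (\<lambda>k. \<beta> (k div 2 ^ p))"
proof -
  have "\<beta> (k div 2 ^ p) j \<in> borel_measurable (F (pt (n + p) k))" if "k < 2 ^ (n + p)" for k j
  proof (rule adapted_refine[of n "\<lambda>k. \<beta> k j", OF _ that])
    show "\<beta> k j \<in> borel_measurable (F (pt n k))" if "k < 2 ^ n" for k
      using assms that unfolding good_approx_def by blast
  qed
  moreover have "(LINT z|cylinder. (\<theta> j z - step_fun (n + p) (\<lambda>k. \<beta> (k div 2 ^ p) j) z)\<^sup>2)
      = (LINT z|cylinder. (\<theta> j z - step_fun n (\<lambda>k. \<beta> k j) z)\<^sup>2)" for j
    by (rule step_fun_cong_refine)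
  ultimately show ?thesis using assms unfolding good_approx_def by simp
qed

lemma good_approx_step_process: "good_approx e n J \<beta> \<Longrightarrow> finite J' \<Longrightarrow> step_process n J' \<beta>"
  by (auto simp: good_approx_def step_process_def)

lemma good_approx_bound:
  assumes "good_approx e n J \<beta>" "finite J'" "\<omega> \<in> space M"
  shows "(\<Sum>j\<in>J'. (\<beta> k j \<omega>)\<^sup>2) \<le> K"
proof -
  have "(\<Sum>j\<in>J'. (\<beta> k j \<omega>)\<^sup>2) \<le> (\<Sum>j\<in>J'. (c j \<omega>)\<^sup>2)"
    using assms by (intro sum_mono sq_le) (auto simp: good_approx_def)
  then show ?thesis using c_sum[OF assms(2,3)] by linarith
qed

lemma good_approx_le:
  assumes "good_approx e n J \<beta>" "\<omega> \<in> space M"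
  shows "\<bar>\<beta> k j \<omega>\<bar> \<le> sqrt K"
proof -
  have "\<bar>\<beta> k j \<omega>\<bar> \<le> c j \<omega>" using assms unfolding good_approx_def by blast
  then show ?thesis using c_le[OF assms(2), of j] by linarith
qed

lemma good_approx_density:
  assumes "good_approx e n J \<beta>" "finite J'" "J \<subseteq> J'"
  shows "step_density n J' \<beta> = step_density n J \<beta>"
proof
  fix \<omega>
  have z: "\<beta> k j \<omega> = 0" if "j \<notin> J" for k j using assms(1) that unfolding good_approx_def by blast
  have "(\<Sum>j\<in>J'. \<beta> k j \<omega> * incr n k j \<omega> - (\<beta> k j \<omega>)\<^sup>2 * mesh n / 2)
      = (\<Sum>j\<in>J. \<beta> k j \<omega> * incr n k j \<omega> - (\<beta> k j \<omega>)\<^sup>2 * mesh n / 2)" for k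
    by (rule sum.mono_neutral_right[OF assms(2,3)]) (simp add: z)
  then show "step_density n J' \<beta> \<omega> = step_density n J \<beta> \<omega>" unfolding step_density_def by simp
qed

lemma good_approx_sq_integrable:
  assumes "good_approx e n J \<beta>"
  shows "integrable cylinder (\<lambda>z. (\<theta> j z - step_fun n (\<lambda>k. \<beta> k j) z)\<^sup>2)"
proof (intro cyl.integrable_const_bound[where B="(2 * sqrt K)\<^sup>2"] AE_I2)
  have [measurable]: "step_fun n (\<lambda>k. \<beta> k j) \<in> borel_measurable cylinder"
    using assms by (intro step_fun_cylinder_measurable) (simp add: good_approx_def)
  show "(\<lambda>z. (\<theta> j z - step_fun n (\<lambda>k. \<beta> k j) z)\<^sup>2) \<in> borel_measurable cylinder" by measurable
  fix z assume z: "z \<in> space cylinder"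
  then obtain r \<omega> where z': "z = (r, \<omega>)" "r \<in> {t\<^sub>0<..T}" "\<omega> \<in> space M" by (cases z) (auto simp: space_cylinder)
  have "\<bar>step_fun n (\<lambda>k. \<beta> k j) z\<bar> \<le> sqrt K"
    using good_approx_le[OF assms z'(3)] by (simp add: step_fun_def z')
  then have "\<bar>\<theta> j z - step_fun n (\<lambda>k. \<beta> k j) z\<bar> \<le> 2 * sqrt K" using \<theta>_bound[OF z, of j] by linarith
  then have "(\<theta> j z - step_fun n (\<lambda>k. \<beta> k j) z)\<^sup>2 \<le> (2 * sqrt K)\<^sup>2"
    by (metis abs_ge_zero power2_abs power_mono)
  then show "norm ((\<theta> j z - step_fun n (\<lambda>k. \<beta> k j) z)\<^sup>2) \<le> (2 * sqrt K)\<^sup>2" by simp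
qed

text \<open>Both step processes are compared with \<open>\<theta>\<close> over the common index set \<open>J \<union> J'\<close>, where
  \<open>(x - y)\<^sup>2 \<le> 2 (x - z)\<^sup>2 + 2 (y - z)\<^sup>2\<close>.\<close>

lemma good_approx_dist:
  assumes 1: "good_approx e n J \<beta>" and 2: "good_approx e' n J' \<gamma>"
  shows "(LINT \<omega>|M. step_dist n (J \<union> J') \<beta> \<gamma> \<omega>) \<le> 2 * e + 2 * e'"
proof -
  have fin: "finite J" "finite J'" using 1 2 by (auto simp: good_approx_def)
  have pw: "(x - y)\<^sup>2 \<le> 2 * (u - x)\<^sup>2 + 2 * (u - y)\<^sup>2" for x y u :: real
    using zero_le_power2[of "(u - x) + (u - y)"] by (simp add: power2_eq_square algebra_simps)
  note i1 = good_approx_sq_integrable[OF 1] and i2 = good_approx_sq_integrable[OF 2]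
  let ?g = "\<lambda>j k \<omega>. (\<beta> k j \<omega> - \<gamma> k j \<omega>)\<^sup>2"
  have gm: "?g j k \<in> borel_measurable (F (pt n k))" if "k < 2 ^ n" for j k
  proof -
    have [measurable]: "\<beta> k j \<in> borel_measurable (F (pt n k))" "\<gamma> k j \<in> borel_measurable (F (pt n k))"
      using 1 2 that by (auto simp: good_approx_def)
    show ?thesis by measurable
  qed
  have gb: "\<bar>?g j k \<omega>\<bar> \<le> (2 * sqrt K)\<^sup>2" if "\<omega> \<in> space M" for j k \<omega>
  proof -
    have "\<bar>\<beta> k j \<omega>\<bar> \<le> sqrt K" "\<bar>\<gamma> k j \<omega>\<bar> \<le> sqrt K"
      by (rule good_approx_le[OF 1 that], rule good_approx_le[OF 2 that])
    then have "\<bar>\<beta> k j \<omega> - \<gamma> k j \<omega>\<bar> \<le> 2 * sqrt K" by linarith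
    then have "(\<beta> k j \<omega> - \<gamma> k j \<omega>)\<^sup>2 \<le> (2 * sqrt K)\<^sup>2" by (metis abs_ge_zero power2_abs power_mono)
    then show ?thesis by simp
  qed
  have sf: "step_fun n (?g j) z = (step_fun n (\<lambda>k. \<beta> k j) z - step_fun n (\<lambda>k. \<gamma> k j) z)\<^sup>2" for j z
    by (simp add: step_fun_def case_prod_beta)
  have gint: "integrable M (\<lambda>\<omega>. mesh n * (\<Sum>k<2 ^ n. ?g j k \<omega>))" for j
  proof (intro integrable_mult_right Bochner_Integration.integrable_sum integrable_const_bound[where B="(2 * sqrt K)\<^sup>2"] AE_I2)
    show "norm (?g j k \<omega>) \<le> (2 * sqrt K)\<^sup>2" if "\<omega> \<in> space M" for k \<omega>
      using gb[OF that] by simp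
    show "?g j k \<in> borel_measurable M" if "k \<in> {..<2 ^ n}" for k
      by (rule measurable_F_M[OF gridpt_in[OF t0T, of k n] gm]) (use that in auto)
  qed
  have "(LINT \<omega>|M. step_dist n (J \<union> J') \<beta> \<gamma> \<omega>) = (LINT \<omega>|M. (\<Sum>j\<in>J \<union> J'. mesh n * (\<Sum>k<2 ^ n. ?g j k \<omega>)))"
    unfolding step_dist_def sum_distrib_left by (subst sum.swap) simp
  also have "\<dots> = (\<Sum>j\<in>J \<union> J'. LINT \<omega>|M. mesh n * (\<Sum>k<2 ^ n. ?g j k \<omega>))"
    using gint by (rule Bochner_Integration.integral_sum)
  also have "\<dots> = (\<Sum>j\<in>J \<union> J'. LINT z|cylinder. step_fun n (?g j) z)"
    by (intro sum.cong refl step_fun_integral[symmetric, where R="(2 * sqrt K)\<^sup>2"] gm gb)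
  also have "\<dots> \<le> (\<Sum>j\<in>J \<union> J'. (LINT z|cylinder. 2 * (\<theta> j z - step_fun n (\<lambda>k. \<beta> k j) z)\<^sup>2 + 2 * (\<theta> j z - step_fun n (\<lambda>k. \<gamma> k j) z)\<^sup>2))"
    unfolding sf by (intro sum_mono integral_mono_AE' AE_I2 pw Bochner_Integration.integrable_add integrable_mult_right i1 i2)
      auto
  also have "\<dots> = 2 * (\<Sum>j\<in>J \<union> J'. LINT z|cylinder. (\<theta> j z - step_fun n (\<lambda>k. \<beta> k j) z)\<^sup>2)
      + 2 * (\<Sum>j\<in>J \<union> J'. LINT z|cylinder. (\<theta> j z - step_fun n (\<lambda>k. \<gamma> k j) z)\<^sup>2)"
    using i1 i2 by (simp add: sum.distrib sum_distrib_left)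
  also have "\<dots> \<le> 2 * e + 2 * e'"
  proof (intro add_mono mult_left_mono)
    show "(\<Sum>j\<in>J \<union> J'. LINT z|cylinder. (\<theta> j z - step_fun n (\<lambda>k. \<beta> k j) z)\<^sup>2) \<le> e"
      using 1 fin unfolding good_approx_def by blast
    show "(\<Sum>j\<in>J \<union> J'. LINT z|cylinder. (\<theta> j z - step_fun n (\<lambda>k. \<gamma> k j) z)\<^sup>2) \<le> e'"
      using 2 fin unfolding good_approx_def by blast
  qed auto
  finally show ?thesis .
qed

definition density_const :: real where
  "density_const = 2 + (exp (K * (T - t\<^sub>0)) + 4 * K * (T - t\<^sub>0)) / 16"

lemma density_const_nonneg: "0 \<le> density_const"
  using K_nonneg t0T by (simp add: density_const_def)

text \<open>Passing to a common grid and a common index set changes neither density, so the \<open>L\<^sup>1\<close> estimate for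
  step processes applies.\<close>

lemma good_approx_density_dist:
  assumes 1: "good_approx e n J \<beta>" and 2: "good_approx e' n' J' \<gamma>" and d: "0 < d" "2 * e + 2 * e' \<le> d ^ 4"
  shows "(LINT \<omega>|M. \<bar>step_density n J \<beta> \<omega> - step_density n' J' \<gamma> \<omega>\<bar>) \<le> d * density_const"
proof -
  have fin: "finite (J \<union> J')" using 1 2 by (auto simp: good_approx_def)
  let ?\<beta> = "\<lambda>k. \<beta> (k div 2 ^ n')" and ?\<gamma> = "\<lambda>k. \<gamma> (k div 2 ^ n)"
  have g1: "good_approx e (n + n') J ?\<beta>" by (rule good_approx_refine[OF 1])
  have g2: "good_approx e' (n + n') J' ?\<gamma>" using good_approx_refine[OF 2, of n] by (simp add: add.commute)
  have D1: "step_density n J \<beta> = step_density (n + n') (J \<union> J') ?\<beta>"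
    using good_approx_density[OF g1 fin] step_density_refine[of n n' J \<beta>] by (simp add: fun_eq_iff)
  have D2: "step_density n' J' \<gamma> = step_density (n + n') (J \<union> J') ?\<gamma>"
    using good_approx_density[OF g2 fin] step_density_refine[of n' n J' \<gamma>] by (simp add: fun_eq_iff add.commute)
  show ?thesis
    unfolding D1 D2 density_const_def
    by (rule step_density_L1_dist[OF good_approx_step_process[OF g1 fin] good_approx_step_process[OF g2 fin]
        good_approx_bound[OF g1 fin] good_approx_bound[OF g2 fin] d(1)
        order_trans[OF good_approx_dist[OF g1 g2] d(2)]])
qed

end

section \<open>The Girsanov transformation\<close>

lemma bounded_path_integral:
  fixes g :: "real \<Rightarrow> real"
  assumes g: "g \<in> borel_measurable (restrict_space lborel {s<..u})" and R: "\<And>r. r \<in> {s<..u} \<Longrightarrow> \<bar>g r\<bar> \<le> R"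
    and ab: "s \<le> a" "a \<le> b" "b \<le> u"
  shows "set_integrable lborel {a<..b} g" and "\<bar>LINT r:{a<..b}|lborel. g r\<bar> \<le> R * (b - a)"
    and "(LINT r:{s<..b}|lborel. g r) - (LINT r:{s<..a}|lborel. g r) = (LINT r:{a<..b}|lborel. g r)"
proof -
  have [measurable]: "(\<lambda>r. indicator {s<..u} r *\<^sub>R g r) \<in> borel_measurable lborel"
    using g by (subst (asm) borel_measurable_restrict_space_iff) auto
  have int: "set_integrable lborel {x<..y} g" if "s \<le> x" "x \<le> y" "y \<le> u" for x y
    unfolding set_integrable_def
  proof (rule Bochner_Integration.integrable_bound[where f="\<lambda>r. R * indicator {x<..y} r"])
    show "integrable lborel (\<lambda>r. R * indicator {x<..y} r)"
      using that by (intro integrable_mult_right) (simp add: integrable_indicator_iff)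
    have eq: "(\<lambda>r. indicator {x<..y} r *\<^sub>R g r) = (\<lambda>r. indicator {x<..y} r *\<^sub>R (indicator {s<..u} r *\<^sub>R g r))"
      using that by (auto simp: indicator_def fun_eq_iff)
    show "(\<lambda>r. indicator {x<..y} r *\<^sub>R g r) \<in> borel_measurable lborel"
      unfolding eq by measurable
    show "AE r in lborel. norm (indicator {x<..y} r *\<^sub>R g r) \<le> norm (R * indicator {x<..y} r)"
      using R that by (intro AE_I2) (auto simp: indicator_def intro!: order_trans[OF R])
  qed
  show i: "set_integrable lborel {a<..b} g" by (rule int[OF ab])
  have "\<bar>LINT r:{a<..b}|lborel. g r\<bar> \<le> (LINT r:{a<..b}|lborel. \<bar>g r\<bar>)"
    unfolding set_lebesgue_integral_def
    by (rule order_trans[OF integral_abs_bound]) (simp add: abs_mult)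
  also have "\<dots> \<le> (LINT r:{a<..b}|lborel. R)"
  proof (rule set_integral_mono)
    show "set_integrable lborel {a<..b} (\<lambda>r. \<bar>g r\<bar>)" using i by (rule set_integrable_abs)
    show "set_integrable lborel {a<..b} (\<lambda>r. R)"
      using ab by (auto simp: set_integrable_def integrable_indicator_iff)
  qed (use R ab in auto)
  also have "\<dots> = R * (b - a)" using ab by (simp add: set_lebesgue_integral_def)
  finally show "\<bar>LINT r:{a<..b}|lborel. g r\<bar> \<le> R * (b - a)" .
  have "{s<..b} = {s<..a} \<union> {a<..b}" using ab by auto
  then have "(LINT r:{s<..b}|lborel. g r) = (LINT r:{s<..a}|lborel. g r) + (LINT r:{a<..b}|lborel. g r)"
    using int[of s a] i ab by (simp only:) (rule set_integral_Un, auto)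
  then show "(LINT r:{s<..b}|lborel. g r) - (LINT r:{s<..a}|lborel. g r) = (LINT r:{a<..b}|lborel. g r)" by simp
qed

lemma bounded_path_integral_continuous:
  fixes g :: "real \<Rightarrow> real"
  assumes g: "g \<in> borel_measurable (restrict_space lborel {s<..u})" and R: "\<And>r. r \<in> {s<..u} \<Longrightarrow> \<bar>g r\<bar> \<le> R"
    and R0: "0 \<le> R"
  shows "continuous_on {s..u} (\<lambda>t. LINT r:{s<..t}|lborel. g r)"
proof -
  let ?I = "\<lambda>t. LINT r:{s<..t}|lborel. g r"
  have le: "\<bar>?I b - ?I a\<bar> \<le> R * (b - a)" if "s \<le> a" "a \<le> b" "b \<le> u" for a b
    using bounded_path_integral(2,3)[OF g R that] by simp
  have "R-lipschitz_on {s..u} ?I"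
  proof (rule lipschitz_onI)
    fix a b assume ab: "a \<in> {s..u}" "b \<in> {s..u}"
    show "dist (?I a) (?I b) \<le> R * dist a b"
    proof (cases "a \<le> b")
      case True
      then show ?thesis using le[of a b] ab by (simp add: dist_real_def abs_minus_commute)
    next
      case False
      then show ?thesis using le[of b a] ab by (simp add: dist_real_def abs_minus_commute)
    qed
  qed (rule R0)
  then show ?thesis by (rule lipschitz_on_continuous_on)
qed

context bounded_drift
begin

text \<open>The errors \<open>((1/2)\<^sup>i)\<^sup>4 / 4\<close> make consecutive densities differ by at most a constant times \<open>(1/2)\<^sup>i\<close> in
  \<open>L\<^sup>1\<close>, so they converge there. Countability of the index type lets the finite sets \<open>J i\<close> absorb every
  index.\<close>

lemma limit_density:
  assumes countable: "countable (UNIV :: 'b set)"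
  obtains D N J \<beta> where "D \<in> borel_measurable M" "\<And>\<omega>. 0 \<le> D \<omega>" "integrable M D"
    "\<And>i. good_approx (((1/2) ^ i) ^ 4 / 4) (N i) (J i) (\<beta> i)" "\<And>j. \<forall>\<^sub>F i in sequentially. j \<in> J i"
    "(\<lambda>i. LINT \<omega>|M. \<bar>step_density (N i) (J i) (\<beta> i) \<omega> - D \<omega>\<bar>) \<longlonglongrightarrow> 0"
proof -
  define e where "e i = ((1/2) ^ i) ^ 4 / (4::real)" for i :: nat
  have "\<exists>n J \<beta>. {j. to_nat_on UNIV j < i} \<subseteq> J \<and> good_approx (e i) n J \<beta>" for i
  proof -
    have "finite {j::'b. to_nat_on UNIV j < i}"
    proof (rule finite_imageD)
      show "finite (to_nat_on UNIV ` {j::'b. to_nat_on UNIV j < i})"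
        by (rule finite_subset[of _ "{..<i}"]) auto
      show "inj_on (to_nat_on UNIV) {j::'b. to_nat_on UNIV j < i}"
        using inj_on_to_nat_on[OF countable] by (rule inj_on_subset) simp
    qed
    then show ?thesis using good_approx_exists[of "e i"] by (metis e_def zero_less_power half_gt_zero_iff zero_less_one zero_less_divide_iff zero_less_numeral)
  qed
  then obtain N J \<beta> where J: "\<And>i. {j. to_nat_on UNIV j < i} \<subseteq> J i"
    and ga: "\<And>i. good_approx (e i) (N i) (J i) (\<beta> i)" by metis
  define d where "d i = step_density (N i) (J i) (\<beta> i)" for i
  have fin: "finite (J i)" for i using ga by (simp add: good_approx_def)
  have sp: "step_process (N i) (J i) (\<beta> i)" for i by (rule good_approx_step_process[OF ga fin])
  have d_int: "integrable M (d i)" for i unfolding d_def by (rule step_density_integrable[OF sp])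
  have d_pos: "0 < d i \<omega>" for i \<omega> by (simp add: d_def step_density_pos)
  have e_mono: "e k \<le> e i" if "i \<le> k" for i k
    using that unfolding e_def by (intro divide_right_mono power_mono power_decreasing) auto
  have dist: "(LINT \<omega>|M. \<bar>d i \<omega> - d k \<omega>\<bar>) \<le> (1/2) ^ i * density_const" if "i \<le> k" for i k
    unfolding d_def
  proof (rule good_approx_density_dist[OF ga ga])
    have "2 * e i + 2 * e k \<le> 4 * e i" using e_mono[OF that] by linarith
    also have "4 * e i = ((1/2) ^ i) ^ 4" by (simp add: e_def)
    finally show "2 * e i + 2 * e k \<le> ((1/2) ^ i) ^ 4" .
  qed simp
  have half: "(\<lambda>i. (1/2) ^ i * density_const) \<longlonglongrightarrow> 0"
    by (auto intro!: tendsto_mult_left_zero LIMSEQ_realpow_zero)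
  have cauchy: "\<exists>n. \<forall>i\<ge>n. \<forall>k\<ge>n. (LINT \<omega>|M. norm (d i \<omega> - d k \<omega>)) < \<epsilon>" if eps: "0 < \<epsilon>" for \<epsilon>
  proof -
    obtain n where n: "\<And>i. n \<le> i \<Longrightarrow> (1/2) ^ i * density_const < \<epsilon>"
      using order_tendstoD(2)[OF half eps] by (auto simp: eventually_sequentially)
    have "(LINT \<omega>|M. \<bar>d i \<omega> - d k \<omega>\<bar>) < \<epsilon>" if "n \<le> i" "n \<le> k" for i k
    proof (cases "i \<le> k")
      case True
      then show ?thesis using dist[OF True] n[OF that(1)] by linarith
    next
      case False
      then show ?thesis using dist[of k i] n[OF that(2)] by (simp add: abs_minus_commute)
    qed
    then show ?thesis by auto
  qed
  obtain r where r: "strict_mono r" "AE \<omega> in M. Cauchy (\<lambda>i. d (r i) \<omega>)"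
    by (rule cauchy_L1_AE_cauchy_subseq[of M d, OF d_int cauchy])
  have [measurable]: "d i \<in> borel_measurable M" for i using d_int by auto
  define D where "D \<omega> = max 0 (lim (\<lambda>i. d (r i) \<omega>))" for \<omega>
  have D_meas[measurable]: "D \<in> borel_measurable M"
    unfolding D_def[abs_def] by measurable
  have conv: "AE \<omega> in M. (\<lambda>i. d (r i) \<omega>) \<longlonglongrightarrow> D \<omega>"
    using r(2)
  proof eventually_elim
    case (elim \<omega>)
    then have "convergent (\<lambda>i. d (r i) \<omega>)" by (rule Cauchy_convergent)
    then have l: "(\<lambda>i. d (r i) \<omega>) \<longlonglongrightarrow> lim (\<lambda>i. d (r i) \<omega>)" by (simp add: convergent_LIMSEQ_iff)
    then have "0 \<le> lim (\<lambda>i. d (r i) \<omega>)" using d_pos by (intro LIMSEQ_le_const) (auto intro: less_imp_le)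
    then show ?case using l by (simp add: D_def)
  qed
  have nn: "(\<integral>\<^sup>+\<omega>. ennreal \<bar>d i \<omega> - D \<omega>\<bar> \<partial>M) \<le> ennreal ((1/2) ^ i * density_const)" for i
  proof -
    have "(\<integral>\<^sup>+\<omega>. ennreal \<bar>d i \<omega> - D \<omega>\<bar> \<partial>M) = (\<integral>\<^sup>+\<omega>. liminf (\<lambda>k. ennreal \<bar>d i \<omega> - d (r k) \<omega>\<bar>) \<partial>M)"
    proof (rule nn_integral_cong_AE)
      show "AE \<omega> in M. ennreal \<bar>d i \<omega> - D \<omega>\<bar> = liminf (\<lambda>k. ennreal \<bar>d i \<omega> - d (r k) \<omega>\<bar>)"
        using conv
      proof eventually_elim
        case (elim \<omega>)
        then have "(\<lambda>k. ennreal \<bar>d i \<omega> - d (r k) \<omega>\<bar>) \<longlonglongrightarrow> ennreal \<bar>d i \<omega> - D \<omega>\<bar>"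
          by (intro tendsto_ennrealI tendsto_intros)
        then show ?case by (intro lim_imp_Liminf[symmetric]) auto
      qed
    qed
    also have "\<dots> \<le> liminf (\<lambda>k. \<integral>\<^sup>+\<omega>. ennreal \<bar>d i \<omega> - d (r k) \<omega>\<bar> \<partial>M)"
      by (rule nn_integral_liminf) measurable
    also have "\<dots> \<le> ennreal ((1/2) ^ i * density_const)"
    proof (rule Liminf_le)
      have "(\<integral>\<^sup>+\<omega>. ennreal \<bar>d i \<omega> - d (r k) \<omega>\<bar> \<partial>M) \<le> ennreal ((1/2) ^ i * density_const)" if "i \<le> k" for k
      proof -
        have "i \<le> r k" using seq_suble[OF r(1), of k] that by simp
        then show ?thesis using dist[of i "r k"] d_int by (subst nn_integral_eq_integral) (auto intro!: ennreal_leI)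
      qed
      then show "\<forall>\<^sub>F k in sequentially. (\<integral>\<^sup>+\<omega>. ennreal \<bar>d i \<omega> - d (r k) \<omega>\<bar> \<partial>M) \<le> ennreal ((1/2) ^ i * density_const)"
        by (auto simp: eventually_sequentially)
    qed simp
    finally show ?thesis .
  qed
  have diff_int: "integrable M (\<lambda>\<omega>. d i \<omega> - D \<omega>)" for i
    using le_less_trans[OF nn[of i]] by (intro integrableI_bounded) auto
  have D_int: "integrable M D"
    using Bochner_Integration.integrable_diff[OF d_int[of 0] diff_int[of 0]] by simp
  have L1: "(LINT \<omega>|M. \<bar>d i \<omega> - D \<omega>\<bar>) \<le> (1/2) ^ i * density_const" for i
  proof -
    have "ennreal (LINT \<omega>|M. \<bar>d i \<omega> - D \<omega>\<bar>) \<le> ennreal ((1/2) ^ i * density_const)"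
      using nn[of i] diff_int[of i] by (subst (asm) nn_integral_eq_integral) auto
    then show ?thesis using density_const_nonneg by (subst (asm) ennreal_le_iff) auto
  qed
  show ?thesis
  proof
    show "D \<in> borel_measurable M" "\<And>\<omega>. 0 \<le> D \<omega>" "integrable M D" by (auto simp: D_meas D_int) (simp add: D_def)
    show "good_approx (((1/2) ^ i) ^ 4 / 4) (N i) (J i) (\<beta> i)" for i using ga by (simp add: e_def)
    show "\<forall>\<^sub>F i in sequentially. j \<in> J i" for j
    proof (rule eventually_sequentiallyI)
      show "j \<in> J i" if "Suc (to_nat_on UNIV j) \<le> i" for i using J[of i] that by auto
    qed
    show "(\<lambda>i. LINT \<omega>|M. \<bar>step_density (N i) (J i) (\<beta> i) \<omega> - D \<omega>\<bar>) \<longlonglongrightarrow> 0"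
      by (rule tendsto_sandwich[OF _ _ tendsto_const half]) (auto simp: L1[unfolded d_def] intro!: always_eventually)
  qed
qed

definition drift_integral :: "'b \<Rightarrow> real \<Rightarrow> 'a \<Rightarrow> real" where
  "drift_integral j t \<omega> = (LINT r:{t\<^sub>0<..t}|lborel. \<theta> j (r, \<omega>))"

lemma path_measurable: "\<omega> \<in> space M \<Longrightarrow> (\<lambda>r. \<theta> j (r, \<omega>)) \<in> borel_measurable (restrict_space lborel {t\<^sub>0<..T})"
  using measurable_compose[OF measurable_Pair2' \<theta>_measurable[unfolded cylinder_def time_measure_def]] .

lemma path_bound: "\<omega> \<in> space M \<Longrightarrow> r \<in> {t\<^sub>0<..T} \<Longrightarrow> \<bar>\<theta> j (r, \<omega>)\<bar> \<le> sqrt K"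
  using \<theta>_bound[of "(r, \<omega>)" j] by (simp add: space_cylinder)

lemma drift_integral_adapted: "t \<in> {t\<^sub>0..T} \<Longrightarrow> drift_integral j t \<in> borel_measurable (F t)"
  unfolding drift_integral_def[abs_def] by (rule predictable_integral_adapted[OF \<theta>_predictable])

text \<open>From \<open>L\<^sup>2\<close> to \<open>L\<^sup>1\<close> by \<open>\<bar>x\<bar> \<le> d + x\<^sup>2 / d\<close>.\<close>

lemma good_approx_L1:
  assumes ga: "good_approx e n J \<beta>" and j: "j \<in> J" and d: "0 < d"
  shows "integrable cylinder (\<lambda>z. \<bar>\<theta> j z - step_fun n (\<lambda>k. \<beta> k j) z\<bar>)"
    and "(LINT z|cylinder. \<bar>\<theta> j z - step_fun n (\<lambda>k. \<beta> k j) z\<bar>) \<le> d * measure cylinder (space cylinder) + e / d"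
proof -
  let ?x = "\<lambda>z. \<theta> j z - step_fun n (\<lambda>k. \<beta> k j) z"
  note sq = good_approx_sq_integrable[OF ga, of j]
  have [measurable]: "step_fun n (\<lambda>k. \<beta> k j) \<in> borel_measurable cylinder"
    using ga by (intro step_fun_cylinder_measurable) (simp add: good_approx_def)
  have pw: "\<bar>x\<bar> \<le> d + x\<^sup>2 / d" for x :: real
  proof -
    have "0 \<le> (\<bar>x\<bar> - d)\<^sup>2" "0 \<le> \<bar>x\<bar> * d" using d by auto
    then have "\<bar>x\<bar> * d \<le> d\<^sup>2 + x\<^sup>2" by (simp add: power2_diff)
    then show ?thesis using d by (simp add: field_simps power2_eq_square)
  qed
  have i: "integrable cylinder (\<lambda>z. d + (?x z)\<^sup>2 / d)" using sq by auto
  show i2: "integrable cylinder (\<lambda>z. \<bar>?x z\<bar>)"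
    by (rule Bochner_Integration.integrable_bound[OF i]) (use pw d in \<open>auto intro!: AE_I2\<close>)
  have "(LINT z|cylinder. \<bar>?x z\<bar>) \<le> (LINT z|cylinder. d + (?x z)\<^sup>2 / d)"
    by (rule integral_mono[OF i2 i pw])
  also have "\<dots> = d * measure cylinder (space cylinder) + (LINT z|cylinder. (?x z)\<^sup>2) / d"
    using sq by simp
  also have "(LINT z|cylinder. (?x z)\<^sup>2) \<le> (\<Sum>j\<in>J. (LINT z|cylinder. (\<theta> j z - step_fun n (\<lambda>k. \<beta> k j) z)\<^sup>2))"
    using ga j by (intro member_le_sum) (auto simp: good_approx_def)
  also have "\<dots> \<le> e" using ga unfolding good_approx_def by blast
  finally show "(LINT z|cylinder. \<bar>?x z\<bar>) \<le> d * measure cylinder (space cylinder) + e / d"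
    using d by (simp add: divide_right_mono)
qed

lemma step_path_distance:
  assumes ga: "good_approx e n J \<beta>" and j: "j \<in> J" and ab: "a \<le> b" "b \<le> 2 ^ n" and \<omega>: "\<omega> \<in> space M"
  shows "\<bar>(LINT r:{pt n a<..pt n b}|lborel. \<theta> j (r, \<omega>)) - mesh n * (\<Sum>k=a..<b. \<beta> k j \<omega>)\<bar>
     \<le> (LINT r|time_measure. \<bar>\<theta> j (r, \<omega>) - step_fun n (\<lambda>k. \<beta> k j) (r, \<omega>)\<bar>)"
proof -
  let ?S = "\<lambda>r. \<beta> (cell n r) j \<omega>"
  have pts: "t\<^sub>0 \<le> pt n a" "pt n a \<le> pt n b" "pt n b \<le> T"
    using gridpt_in[OF t0T, of a n] gridpt_in[OF t0T, of b n] gridpt_mono[OF t0T ab(1)] ab by auto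
  note i1 = bounded_path_integral(1)[OF path_measurable[OF \<omega>] path_bound[OF \<omega>] pts]
  note i2 = cell_integral(1)[OF ab, of "\<lambda>k. \<beta> k j \<omega>"]
  have full: "set_integrable lborel {t\<^sub>0<..T} (\<lambda>r. \<theta> j (r, \<omega>) - ?S r)"
    using bounded_path_integral(1)[OF path_measurable[OF \<omega>] path_bound[OF \<omega>] order_refl less_imp_le[OF t0T] order_refl, of j]
      cell_integral(1)[of 0 "2^n" n "\<lambda>k. \<beta> k j \<omega>"] by (intro set_integral_diff) auto
  have "(LINT r:{pt n a<..pt n b}|lborel. \<theta> j (r, \<omega>)) - mesh n * (\<Sum>k=a..<b. \<beta> k j \<omega>)
      = (LINT r:{pt n a<..pt n b}|lborel. \<theta> j (r, \<omega>) - ?S r)"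
    using i1 i2 cell_integral(2)[OF ab, of "\<lambda>k. \<beta> k j \<omega>"] by (simp add: set_integral_diff)
  also have "\<bar>\<dots>\<bar> \<le> (LINT r:{pt n a<..pt n b}|lborel. \<bar>\<theta> j (r, \<omega>) - ?S r\<bar>)"
    unfolding set_lebesgue_integral_def
    by (rule order_trans[OF integral_abs_bound]) (simp add: abs_mult)
  also have "\<dots> \<le> (LINT r:{t\<^sub>0<..T}|lborel. \<bar>\<theta> j (r, \<omega>) - ?S r\<bar>)"
    unfolding set_lebesgue_integral_def
    using set_integrable_abs[OF full, unfolded set_integrable_def] pts
    by (intro integral_mono') (auto simp: indicator_def)
  also have "\<dots> = (LINT r|time_measure. \<bar>\<theta> j (r, \<omega>) - step_fun n (\<lambda>k. \<beta> k j) (r, \<omega>)\<bar>)"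
    unfolding time_measure_def set_lebesgue_integral_def by (simp add: integral_restrict_space step_fun_def)
  finally show ?thesis .
qed

text \<open>The density is the \<open>L\<^sup>1\<close>-limit \<open>D\<close> of the densities \<open>d i\<close> of the approximating step processes. For these,
  the characteristic function of the compensated increments \<open>Y i\<close> is known exactly. Along a subsequence
  \<open>Y i\<close> converges almost surely to the increment \<open>X\<close> of \<open>B - \<integral>\<theta>\<close>, and since the exponentials have modulus 1,
  the identity passes to the limit.\<close>

theorem girsanov:
  assumes countable: "countable (UNIV :: 'b set)"
  obtains D :: "'a \<Rightarrow> real" where "D \<in> borel_measurable M" "\<And>\<omega>. 0 \<le> D \<omega>"
    "\<And>A. A \<in> sets (F t\<^sub>0) \<Longrightarrow> emeasure (density M (\<lambda>\<omega>. ennreal (D \<omega>))) A = emeasure M A"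
    "brownian_family (density M (\<lambda>\<omega>. ennreal (D \<omega>))) F (\<lambda>j t \<omega>. B j t \<omega> - drift_integral j t \<omega>) t\<^sub>0 T"
proof -
  obtain D N J \<beta> where D_meas[measurable]: "D \<in> borel_measurable M" and D_nonneg: "\<And>\<omega>. 0 \<le> D \<omega>"
    and D_int: "integrable M D"
    and ga: "\<And>i. good_approx (((1/2) ^ i) ^ 4 / 4) (N i) (J i) (\<beta> i)" and J: "\<And>j. \<forall>\<^sub>F i in sequentially. j \<in> J i"
    and L1: "(\<lambda>i. LINT \<omega>|M. \<bar>step_density (N i) (J i) (\<beta> i) \<omega> - D \<omega>\<bar>) \<longlonglongrightarrow> 0"
    using limit_density[OF countable] by blast
  define d where "d i = step_density (N i) (J i) (\<beta> i)" for i
  have fin: "finite (J i)" for i using ga by (simp add: good_approx_def)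
  have sp: "step_process (N i) (J i) (\<beta> i)" for i by (rule good_approx_step_process[OF ga fin])
  have d_int: "integrable M (d i)" for i unfolding d_def by (rule step_density_integrable[OF sp])
  note L1' = L1[folded d_def]
  have [measurable]: "d i \<in> borel_measurable M" for i using d_int by auto
  \<comment> \<open>convergence in \<open>L\<^sup>1\<close> tested against functions that may vary with \<open>i\<close>\<close>
  have weak: "(\<lambda>i. (LINT \<omega>|M. d i \<omega> *\<^sub>R h i \<omega>) - (LINT \<omega>|M. D \<omega> *\<^sub>R h i \<omega>)) \<longlonglongrightarrow> 0"
    if [measurable]: "\<And>i. h i \<in> borel_measurable M" and h: "\<And>i \<omega>. norm (h i \<omega>) \<le> 1" for h :: "nat \<Rightarrow> 'a \<Rightarrow> complex"
  proof (rule tendsto_0_le[OF L1', where K=1], intro always_eventually allI)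
    fix i
    have bnd: "integrable M (\<lambda>\<omega>. f \<omega> *\<^sub>R h i \<omega>)" if "integrable M f" for f :: "'a \<Rightarrow> real"
      by (rule Bochner_Integration.integrable_bound[OF that])
        (use that h in \<open>auto intro!: AE_I2 mult_left_le\<close>)
    have "norm ((LINT \<omega>|M. d i \<omega> *\<^sub>R h i \<omega>) - (LINT \<omega>|M. D \<omega> *\<^sub>R h i \<omega>)) = norm (LINT \<omega>|M. (d i \<omega> - D \<omega>) *\<^sub>R h i \<omega>)"
      using bnd[OF d_int] bnd[OF D_int] by (simp add: scaleR_diff_left)
    also have "\<dots> \<le> (LINT \<omega>|M. norm ((d i \<omega> - D \<omega>) *\<^sub>R h i \<omega>))" by (rule integral_norm_bound)
    also have "\<dots> \<le> (LINT \<omega>|M. \<bar>d i \<omega> - D \<omega>\<bar>)"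
      using d_int D_int h by (intro integral_mono integrable_norm bnd) (auto intro!: mult_left_le)
    finally show "norm ((LINT \<omega>|M. d i \<omega> *\<^sub>R h i \<omega>) - (LINT \<omega>|M. D \<omega> *\<^sub>R h i \<omega>))
        \<le> norm (LINT \<omega>|M. \<bar>d i \<omega> - D \<omega>\<bar>) * 1" by simp
  qed
  have weak_set: "(\<lambda>i. LINT \<omega>|M. d i \<omega> * indicator A \<omega>) \<longlonglongrightarrow> (LINT \<omega>|M. D \<omega> * indicator A \<omega>)"
    if [measurable]: "A \<in> sets M" for A
  proof -
    have "(\<lambda>i. complex_of_real (LINT \<omega>|M. d i \<omega> * indicator A \<omega>) - complex_of_real (LINT \<omega>|M. D \<omega> * indicator A \<omega>)) \<longlonglongrightarrow> 0"
      unfolding integral_complex_of_real[symmetric]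
      using weak[of "\<lambda>_ \<omega>. complex_of_real (indicator A \<omega>)"] by (simp add: scaleR_conv_of_real indicator_def)
    then have "(\<lambda>i. (LINT \<omega>|M. d i \<omega> * indicator A \<omega>) - (LINT \<omega>|M. D \<omega> * indicator A \<omega>)) \<longlonglongrightarrow> 0"
      unfolding of_real_diff[symmetric] by (simp only: tendsto_of_real_iff[where 'a=complex, of _ 0, simplified])
    then show ?thesis by (rule LIM_zero_cancel)
  qed
  define Q where "Q = density M (\<lambda>\<omega>. ennreal (D \<omega>))"
  have emQ: "emeasure Q A = ennreal (LINT \<omega>|M. D \<omega> * indicator A \<omega>)" if AM[measurable]: "A \<in> sets M" for A
  proof -
    have i: "integrable M (\<lambda>\<omega>. D \<omega> * indicator A \<omega>)"
      using integrable_mult_indicator[OF AM D_int] by (simp add: mult.commute)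
    have "emeasure Q A = (\<integral>\<^sup>+\<omega>. ennreal (D \<omega> * indicator A \<omega>) \<partial>M)"
      unfolding Q_def
      by (subst emeasure_density[OF _ AM]) (auto intro!: nn_integral_cong simp: indicator_def)
    also have "\<dots> = ennreal (LINT \<omega>|M. D \<omega> * indicator A \<omega>)"
      using D_nonneg by (intro nn_integral_eq_integral[OF i]) simp
    finally show ?thesis .
  qed
  have initial: "emeasure Q A = emeasure M A" if A: "A \<in> sets (F t\<^sub>0)" for A
  proof -
    have AM: "A \<in> sets M" using sets_F_M[OF _ A] t0T by simp
    have "(LINT \<omega>|M. d i \<omega> * indicator A \<omega>) = prob A" for i
      unfolding d_def by (rule step_density_past(2)[OF sp A])
    then have "(LINT \<omega>|M. D \<omega> * indicator A \<omega>) = prob A"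
      using weak_set[OF AM] by (simp add: LIMSEQ_const_iff)
    then show ?thesis by (simp add: emQ[OF AM] emeasure_eq_measure)
  qed
  have space_F0: "space M \<in> sets (F t\<^sub>0)" using sets.top[of "F t\<^sub>0"] space_F[of t\<^sub>0] t0T by simp
  interpret Q: prob_space Q
    using initial[OF space_F0] emeasure_space_1 by (intro prob_spaceI) (simp add: Q_def)
  define W where "W j t \<omega> = B j t \<omega> - drift_integral j t \<omega>" for j t \<omega>
  have subQ: "subalgebra Q (F t)" if "t \<in> {t\<^sub>0..T}" for t
    using subalg[OF that] by (simp add: Q_def subalgebra_def)
  interpret AQ: adapted_family Q F W t\<^sub>0 T
  proof
    show "t\<^sub>0 < T" by (rule t0T)
    show "filtered_prob_space t\<^sub>0 T Q F"
      using filt subQ Q.prob_space_axioms by (auto simp: filtered_prob_space_def)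
    show "W j t \<in> borel_measurable (F t)" if "t \<in> {t\<^sub>0..T}" for j t
      unfolding W_def[abs_def] using adapted[OF that] drift_integral_adapted[OF that] by (intro borel_measurable_diff)
    show "W j t\<^sub>0 \<omega> = 0" if "\<omega> \<in> space Q" for \<omega> j
      using start[of \<omega> j] that by (simp add: W_def drift_integral_def Q_def set_lebesgue_integral_def)
    show "continuous_on {t\<^sub>0..T} (\<lambda>t. W j t \<omega>)" if "\<omega> \<in> space Q" for \<omega> j
    proof -
      have \<omega>: "\<omega> \<in> space M" using that by (simp add: Q_def)
      show ?thesis unfolding W_def drift_integral_def
        by (intro continuous_on_diff cont[OF \<omega>] bounded_path_integral_continuous[OF path_measurable[OF \<omega>] path_bound[OF \<omega>]])
          (auto simp: K_nonneg)
    qed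
  qed
  have grid: "gaussian_increments Q (sets (F (pt m a))) W (pt m a) (pt m b)" if ab: "a < b" "b \<le> 2 ^ m" for m a b
    unfolding gaussian_increments_def
  proof (intro ballI allI impI)
    fix A and J0 :: "'b set" and l assume A: "A \<in> sets (F (pt m a))" and J0: "finite J0"
    have pa: "pt m a \<in> {t\<^sub>0..T}" and pb: "pt m b \<in> {t\<^sub>0..T}" using ab by (intro gridpt_in[OF t0T], simp)+
    have pab: "pt m a \<le> pt m b" using ab by (intro gridpt_mono[OF t0T]) simp
    have AM[measurable]: "A \<in> sets M" by (rule sets_F_M[OF pa A])
    define E where "E = exp (- ((pt m b - pt m a) * (\<Sum>j\<in>J0. (l j)\<^sup>2)) / 2)"
    \<comment> \<open>a common refinement of the grid \<open>m\<close> and the \<open>i\<close>-th approximation\<close>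
    define n where "n i = m + N i" for i
    define \<gamma> where "\<gamma> i k = \<beta> i (k div 2 ^ m)" for i k
    define a' where "a' i = 2 ^ N i * a" for i
    define b' where "b' i = 2 ^ N i * b" for i
    have ab': "a' i \<le> b' i" "b' i \<le> 2 ^ n i" for i
      using ab by (auto simp: a'_def b'_def n_def power_add mult.commute)
    have pts: "pt (n i) (a' i) = pt m a" "pt (n i) (b' i) = pt m b" for i
      by (simp_all add: n_def a'_def b'_def gridpt_refine)
    have gg: "good_approx (((1/2) ^ i) ^ 4 / 4) (n i) (J i) (\<gamma> i)" for i
      using good_approx_refine[OF ga, of i m] by (simp add: n_def \<gamma>_def[abs_def] add.commute)
    have dd: "d i \<omega> = step_density (n i) (J i) (\<gamma> i) \<omega>" for i \<omega>
      using step_density_refine[of "N i" m "J i" "\<beta> i" \<omega>] by (simp add: d_def n_def \<gamma>_def[abs_def] add.commute)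
    define X where "X \<omega> = (\<Sum>j\<in>J0. l j * (W j (pt m b) \<omega> - W j (pt m a) \<omega>))" for \<omega>
    define Y where "Y i \<omega> = (\<Sum>j\<in>J0. l j * (\<Sum>k=a' i..<b' i. incr (n i) k j \<omega> - \<gamma> i k j \<omega> * mesh (n i)))" for i \<omega>
    have ev: "\<forall>\<^sub>F i in sequentially. J0 \<subseteq> J i"
      using J J0 by (simp add: subset_eq eventually_ball_finite_distrib)
    have WM[measurable]: "W j t \<in> borel_measurable M" if "t \<in> {t\<^sub>0..T}" for j t
      by (rule measurable_F_M[OF that AQ.adapted[OF that]])
    have X_meas[measurable]: "X \<in> borel_measurable M" unfolding X_def[abs_def] using pa pb by measurable
    have Y_meas[measurable]: "Y i \<in> borel_measurable M" for i
    proof -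
      have "incr (n i) k j \<in> borel_measurable M" "\<gamma> i k j \<in> borel_measurable M" if "k \<in> {a' i..<b' i}" for k j
      proof -
        have k: "k < 2 ^ n i" using that ab'(2)[of i] by simp
        then show "incr (n i) k j \<in> borel_measurable M" by (intro incr_measurable_M) simp
        have "\<gamma> i k j \<in> borel_measurable (F (pt (n i) k))" using gg[of i] k unfolding good_approx_def by blast
        then show "\<gamma> i k j \<in> borel_measurable M" by (rule measurable_F_M[OF gridpt_in[OF t0T less_imp_le[OF k]]])
      qed
      then show ?thesis unfolding Y_def[abs_def] by measurable
    qed
    have char: "(LINT \<omega>|M. (d i \<omega> * indicator A \<omega>) *\<^sub>R iexp (Y i \<omega>))
        = complex_of_real ((LINT \<omega>|M. d i \<omega> * indicator A \<omega>) * E)" if elim: "J0 \<subseteq> J i" for i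
    proof -
      \<comment> \<open>the identity for the approximating density involves all of \<open>J i\<close>\<close>
    define l' where "l' j = (if j \<in> J0 then l j else 0)" for j
      have s1: "(\<Sum>j\<in>J i. l' j * g j) = (\<Sum>j\<in>J0. l j * g j)" for g
        using elim fin[of i] by (intro sum.mono_neutral_cong_right) (auto simp: l'_def)
      have s2: "(\<Sum>j\<in>J i. (l' j)\<^sup>2) = (\<Sum>j\<in>J0. (l j)\<^sup>2)"
        using elim fin[of i] by (intro sum.mono_neutral_cong_right) (auto simp: l'_def)
      have A': "A \<in> sets (F (pt (n i) (a' i)))" using A by (simp add: pts)
      from step_density_char[where l=l', OF good_approx_step_process[OF gg fin[of i]] ab' A']
      show ?thesis unfolding s1 s2 pts dd Y_def E_def .
    qed
    define c1 where "c1 = measure cylinder (space cylinder)"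
    define \<rho> where "\<rho> i = (1/2::real) ^ i * c1 + (1/2) ^ i" for i :: nat
    define L where "L = (\<Sum>j\<in>J0. \<bar>l j\<bar>)"
    have dist: "integrable M (\<lambda>\<omega>. Y i \<omega> - X \<omega>) \<and> (LINT \<omega>|M. norm (Y i \<omega> - X \<omega>)) \<le> L * \<rho> i"
      if elim: "J0 \<subseteq> J i" for i
    proof -
      interpret P: pair_sigma_finite time_measure M by (rule pair_time)
        let ?d = "\<lambda>j z. \<bar>\<theta> j z - step_fun (n i) (\<lambda>k. \<gamma> i k j) z\<bar>"
        have half: "0 < (1/2::real) ^ i" by simp
        have E: "integrable M (\<lambda>\<omega>. LINT r|time_measure. ?d j (r, \<omega>))"
          "(LINT \<omega>|M. (LINT r|time_measure. ?d j (r, \<omega>))) \<le> \<rho> i" if j: "j \<in> J0" for j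
        proof -
          have jj: "j \<in> J i" using j elim by auto
          have eta: "(\<lambda>(r, \<omega>). ?d j (r, \<omega>)) = ?d j" by (rule ext) (simp add: case_prod_beta)
          have i1: "integrable (time_measure \<Otimes>\<^sub>M M) (\<lambda>(r, \<omega>). ?d j (r, \<omega>))"
            using good_approx_L1(1)[OF gg jj half] unfolding eta cylinder_def .
          show "integrable M (\<lambda>\<omega>. LINT r|time_measure. ?d j (r, \<omega>))"
            using P.integrable_snd[OF i1] by simp
          have "(LINT \<omega>|M. (LINT r|time_measure. ?d j (r, \<omega>))) = (LINT z|cylinder. ?d j z)"
            using P.integral_snd[OF i1] unfolding eta cylinder_def .
          also have "\<dots> \<le> (1/2) ^ i * c1 + ((1/2) ^ i) ^ 4 / 4 / (1/2) ^ i"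
            unfolding c1_def by (rule good_approx_L1(2)[OF gg jj half])
          also have "((1/2) ^ i) ^ 4 / 4 / (1/2) ^ i \<le> (1/2::real) ^ i"
          proof -
            have "((1/2::real) ^ i) ^ 4 / 4 / (1/2) ^ i = (1/2) ^ i * (((1/2) ^ i) ^ 2 / 4)"
              by (simp add: field_simps power4_eq_xxxx power2_eq_square)
            also have "\<dots> \<le> (1/2) ^ i * 1"
            proof (rule mult_left_mono)
              have "((1/2::real) ^ i) ^ 2 \<le> 1" by (intro power_le_one) auto
              then show "((1/2::real) ^ i) ^ 2 / 4 \<le> 1" by simp
            qed simp
            finally show ?thesis by simp
          qed
          finally show "(LINT \<omega>|M. (LINT r|time_measure. ?d j (r, \<omega>))) \<le> \<rho> i" by (simp add: \<rho>_def)
        qed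
        have le: "norm (Y i \<omega> - X \<omega>) \<le> (\<Sum>j\<in>J0. \<bar>l j\<bar> * (LINT r|time_measure. ?d j (r, \<omega>)))" if \<omega>: "\<omega> \<in> space M" for \<omega>
        proof -
          have "Y i \<omega> - X \<omega> = (\<Sum>j\<in>J0. l j * ((LINT r:{pt m a<..pt m b}|lborel. \<theta> j (r, \<omega>)) - mesh (n i) * (\<Sum>k=a' i..<b' i. \<gamma> i k j \<omega>)))"
            unfolding X_def Y_def sum_subtractf[symmetric] right_diff_distrib[symmetric]
          proof (intro sum.cong refl arg_cong2[where f="(*)"])
            fix j
            have "(\<Sum>k=a' i..<b' i. incr (n i) k j \<omega>) = B j (pt m b) \<omega> - B j (pt m a) \<omega>"
              unfolding incr_def using sum_Suc_diff'[OF ab'(1)[of i], of "\<lambda>k. B j (pt (n i) k) \<omega>"] by (simp add: pts)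
            moreover have "drift_integral j (pt m b) \<omega> - drift_integral j (pt m a) \<omega> = (LINT r:{pt m a<..pt m b}|lborel. \<theta> j (r, \<omega>))"
              unfolding drift_integral_def using pa pb pab
              by (intro bounded_path_integral(3)[OF path_measurable[OF \<omega>] path_bound[OF \<omega>]]) auto
            ultimately show "(\<Sum>k=a' i..<b' i. incr (n i) k j \<omega> - \<gamma> i k j \<omega> * mesh (n i)) - (W j (pt m b) \<omega> - W j (pt m a) \<omega>)
               = (LINT r:{pt m a<..pt m b}|lborel. \<theta> j (r, \<omega>)) - mesh (n i) * (\<Sum>k=a' i..<b' i. \<gamma> i k j \<omega>)"
              by (simp add: W_def sum_subtractf sum_distrib_left mult.commute)
          qed
          also have "norm \<dots> \<le> (\<Sum>j\<in>J0. \<bar>l j\<bar> * (LINT r|time_measure. ?d j (r, \<omega>)))"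
          proof (rule sum_norm_le)
            fix j assume "j \<in> J0"
            then have "j \<in> J i" using elim by auto
            from step_path_distance[OF gg this ab' \<omega>, unfolded pts]
            show "norm (l j * ((LINT r:{pt m a<..pt m b}|lborel. \<theta> j (r, \<omega>)) - mesh (n i) * (\<Sum>k=a' i..<b' i. \<gamma> i k j \<omega>)))
               \<le> \<bar>l j\<bar> * (LINT r|time_measure. ?d j (r, \<omega>))"
              by (simp add: abs_mult mult_left_mono)
          qed
          finally show ?thesis .
        qed
        have dom: "integrable M (\<lambda>\<omega>. \<Sum>j\<in>J0. \<bar>l j\<bar> * (LINT r|time_measure. ?d j (r, \<omega>)))"
          using E(1) by (intro Bochner_Integration.integrable_sum integrable_mult_right)
        have int: "integrable M (\<lambda>\<omega>. Y i \<omega> - X \<omega>)"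
          by (rule Bochner_Integration.integrable_bound[OF dom]) (use order_trans[OF le abs_ge_self] in \<open>auto intro!: AE_I2\<close>)
        have "(LINT \<omega>|M. norm (Y i \<omega> - X \<omega>)) \<le> (LINT \<omega>|M. (\<Sum>j\<in>J0. \<bar>l j\<bar> * (LINT r|time_measure. ?d j (r, \<omega>))))"
          by (rule integral_mono[OF integrable_norm[OF int] dom le])
        also have "\<dots> = (\<Sum>j\<in>J0. \<bar>l j\<bar> * (LINT \<omega>|M. (LINT r|time_measure. ?d j (r, \<omega>))))"
          using E(1) by (subst Bochner_Integration.integral_sum) auto
        also have "\<dots> \<le> (\<Sum>j\<in>J0. \<bar>l j\<bar> * \<rho> i)" by (intro sum_mono mult_left_mono E(2)) auto
        also have "\<dots> = L * \<rho> i" by (simp add: L_def sum_distrib_right)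
        finally show ?thesis using int by blast
    qed
    obtain i0 where i0: "\<And>i. i0 \<le> i \<Longrightarrow> J0 \<subseteq> J i"
      using ev by (auto simp: eventually_sequentially)
    have "(\<lambda>i. LINT \<omega>|M. norm (Y (i + i0) \<omega> - X \<omega>)) \<longlonglongrightarrow> 0"
    proof (rule tendsto_sandwich[OF _ _ tendsto_const])
      have "(\<lambda>i. L * \<rho> i) \<longlonglongrightarrow> L * (0 * c1 + 0)"
        unfolding \<rho>_def by (intro tendsto_intros LIMSEQ_realpow_zero) auto
      then show "(\<lambda>i. L * \<rho> (i + i0)) \<longlonglongrightarrow> 0" using LIMSEQ_ignore_initial_segment by fastforce
      show "\<forall>\<^sub>F i in sequentially. (LINT \<omega>|M. norm (Y (i + i0) \<omega> - X \<omega>)) \<le> L * \<rho> (i + i0)"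
        using dist[OF i0] by (intro always_eventually allI) simp
    qed auto
    moreover have "integrable M (\<lambda>\<omega>. Y (i + i0) \<omega> - X \<omega>)" for i using dist[OF i0, of "i + i0"] by simp
    ultimately obtain s where s: "strict_mono s" "AE \<omega> in M. (\<lambda>i. Y (s i + i0) \<omega> - X \<omega>) \<longlonglongrightarrow> 0"
      using tendsto_L1_AE_subseq[of M "\<lambda>i \<omega>. Y (i + i0) \<omega> - X \<omega>"] by blast
    define \<tau> where "\<tau> i = s i + i0" for i
    have \<tau>: "filterlim \<tau> sequentially sequentially"
      unfolding \<tau>_def[abs_def] by (intro filterlim_add_const_nat_at_top[THEN filterlim_compose] filterlim_subseq s(1))
    define h where "h i \<omega> = indicator A \<omega> *\<^sub>R iexp (Y i \<omega>)" for i \<omega>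
    have h_meas[measurable]: "h i \<in> borel_measurable M" for i unfolding h_def[abs_def] by measurable
    \<comment> \<open>the density is exchanged first, and then the increment by dominated convergence\<close>
    have lim1: "(\<lambda>i. (LINT \<omega>|M. d (\<tau> i) \<omega> *\<^sub>R h (\<tau> i) \<omega>) - (LINT \<omega>|M. D \<omega> *\<^sub>R h (\<tau> i) \<omega>)) \<longlonglongrightarrow> 0"
      by (rule filterlim_compose[OF weak \<tau>]) (auto simp: h_def indicator_def)
    have lim2: "(\<lambda>i. LINT \<omega>|M. D \<omega> *\<^sub>R h (\<tau> i) \<omega>) \<longlonglongrightarrow> (LINT \<omega>|M. D \<omega> *\<^sub>R (indicator A \<omega> *\<^sub>R iexp (X \<omega>)))"
    proof (rule integral_dominated_convergence[where w=D])
      show "AE \<omega> in M. (\<lambda>i. D \<omega> *\<^sub>R h (\<tau> i) \<omega>) \<longlonglongrightarrow> D \<omega> *\<^sub>R (indicator A \<omega> *\<^sub>R iexp (X \<omega>))"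
        using s(2)
      proof eventually_elim
        case (elim \<omega>)
        then have "(\<lambda>i. Y (\<tau> i) \<omega>) \<longlonglongrightarrow> X \<omega>" unfolding \<tau>_def by (rule LIM_zero_cancel)
        then show ?case unfolding h_def by (intro tendsto_intros)
      qed
    qed (use D_int D_nonneg in \<open>auto simp: h_def indicator_def\<close>)
    have lim3: "(\<lambda>i. LINT \<omega>|M. d (\<tau> i) \<omega> *\<^sub>R h (\<tau> i) \<omega>) \<longlonglongrightarrow> (LINT \<omega>|M. D \<omega> *\<^sub>R (indicator A \<omega> *\<^sub>R iexp (X \<omega>)))"
      using tendsto_add[OF lim1 lim2] by simp
    have "(\<lambda>i. complex_of_real ((LINT \<omega>|M. d (\<tau> i) \<omega> * indicator A \<omega>) * E)) \<longlonglongrightarrow> complex_of_real ((LINT \<omega>|M. D \<omega> * indicator A \<omega>) * E)"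
      by (intro tendsto_intros filterlim_compose[OF weak_set[OF AM] \<tau>])
    moreover have "(\<lambda>i. complex_of_real ((LINT \<omega>|M. d (\<tau> i) \<omega> * indicator A \<omega>) * E)) = (\<lambda>i. LINT \<omega>|M. d (\<tau> i) \<omega> *\<^sub>R h (\<tau> i) \<omega>)"
      using char[OF i0] by (auto simp: \<tau>_def h_def fun_eq_iff)
    ultimately have eq: "(LINT \<omega>|M. D \<omega> *\<^sub>R (indicator A \<omega> *\<^sub>R iexp (X \<omega>))) = complex_of_real ((LINT \<omega>|M. D \<omega> * indicator A \<omega>) * E)"
      using LIMSEQ_unique[OF lim3] by simp
    have "measure Q A = (LINT \<omega>|M. D \<omega> * indicator A \<omega>)"
      using emQ[OF AM] D_nonneg by (simp add: measure_def)
    moreover have "(LINT \<omega>|Q. indicator A \<omega> *\<^sub>R iexp (X \<omega>)) = (LINT \<omega>|M. D \<omega> *\<^sub>R (indicator A \<omega> *\<^sub>R iexp (X \<omega>)))"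
      unfolding Q_def using D_nonneg by (intro integral_density) auto
    ultimately show "(LINT \<omega>|Q. indicator A \<omega> *\<^sub>R iexp (\<Sum>j\<in>J0. l j * (W j (pt m b) \<omega> - W j (pt m a) \<omega>)))
       = complex_of_real (measure Q A * exp (- ((pt m b - pt m a) * (\<Sum>j\<in>J0. (l j)\<^sup>2)) / 2))"
      using eq by (simp add: X_def E_def)
  qed
  have bf: "brownian_family Q F W t\<^sub>0 T"
  proof (rule brownian_family.intro[OF AQ.adapted_family_axioms], rule brownian_family_axioms.intro)
    show "gaussian_increments Q (sets (F r)) W r t" if "t\<^sub>0 \<le> r" "r < t" "t \<le> T" for r t
      by (rule AQ.gaussian_increments_from_grid[OF grid that])
  qed
  have W_eq: "W = (\<lambda>j t \<omega>. B j t \<omega> - drift_integral j t \<omega>)" by (intro ext) (rule W_def)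
  show ?thesis
  proof (rule that[OF D_meas D_nonneg])
    show "emeasure (density M (\<lambda>\<omega>. ennreal (D \<omega>))) A = emeasure M A" if "A \<in> sets (F t\<^sub>0)" for A
      using initial[OF that] unfolding Q_def .
    show "brownian_family (density M (\<lambda>\<omega>. ennreal (D \<omega>))) F (\<lambda>j t \<omega>. B j t \<omega> - drift_integral j t \<omega>) t\<^sub>0 T"
      using bf unfolding Q_def W_eq .
  qed
qed

end

section \<open>From scalar families to independent Brownian motions\<close>

context adapted_family
begin

text \<open>The events that describe finitely many components of the path up to time \<open>r\<close> through their increments on one
  grid.\<close>

definition increment_rects :: "real \<Rightarrow> 'j set \<Rightarrow> nat \<Rightarrow> 'w set set" where
  "increment_rects r K n = {{\<omega>\<in>space M. \<forall>k<2 ^ n. \<forall>j\<in>K. pt n (Suc k) \<le> r \<longrightarrow> incr n k j \<omega> \<in> C k j} | C.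
     \<forall>k j. C k j \<in> sets borel}"

definition path_sets :: "real \<Rightarrow> 'j set \<Rightarrow> 'w set set" where
  "path_sets r K = (\<Union>n. sigma_sets (space M) (increment_rects r K n))"

lemma increment_rectsI:
  "(\<And>k j. C k j \<in> sets borel) \<Longrightarrow>
   {\<omega>\<in>space M. \<forall>k<2 ^ n. \<forall>j\<in>K. pt n (Suc k) \<le> r \<longrightarrow> incr n k j \<omega> \<in> C k j} \<in> increment_rects r K n"
  unfolding increment_rects_def mem_Collect_eq by (intro exI conjI, rule refl) simp

lemma increment_rectsE:
  assumes "E \<in> increment_rects r K n"
  obtains C where "E = {\<omega>\<in>space M. \<forall>k<2 ^ n. \<forall>j\<in>K. pt n (Suc k) \<le> r \<longrightarrow> incr n k j \<omega> \<in> C k j}"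
    "\<forall>k j. C k j \<in> sets borel"
  using assms unfolding increment_rects_def mem_Collect_eq by (elim exE conjE) simp

lemma increment_rects_sub: "increment_rects r K n \<subseteq> Pow (space M)"
  by (auto simp: increment_rects_def)

lemma increment_rects_subset_sets:
  assumes K: "finite K" and S: "space S = space M"
    and m: "\<And>k j. k < 2 ^ n \<Longrightarrow> j \<in> K \<Longrightarrow> pt n (Suc k) \<le> r \<Longrightarrow> incr n k j \<in> borel_measurable S"
  shows "increment_rects r K n \<subseteq> sets S"
proof
  fix E assume "E \<in> increment_rects r K n"
  then obtain C where E: "E = {\<omega>\<in>space M. \<forall>k<2 ^ n. \<forall>j\<in>K. pt n (Suc k) \<le> r \<longrightarrow> incr n k j \<omega> \<in> C k j}"
    and C: "\<forall>k j. C k j \<in> sets borel"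
    by (rule increment_rectsE)
  let ?I = "{p \<in> {..<(2::nat) ^ n} \<times> K. pt n (Suc (fst p)) \<le> r}"
  have I: "finite ?I" using K by simp
  have "(\<lambda>\<omega>. incr n (fst p) (snd p) \<omega>) -` C (fst p) (snd p) \<inter> space S \<in> sets S" if "p \<in> ?I" for p
    using that C m[of "fst p" "snd p"] by (intro measurable_sets[of _ S borel]) auto
  then have I_sets: "(\<Inter>p\<in>?I. incr n (fst p) (snd p) -` C (fst p) (snd p) \<inter> space S) \<in> sets S" if "?I \<noteq> {}"
    using I that by (intro sets.finite_INT) auto
  show "E \<in> sets S"
  proof (cases "?I = {}")
    case True
    then have "\<not> pt n (Suc k) \<le> r" if "k < 2 ^ n" "j \<in> K" for k j using that by fastforce
    then have "E = space S" using E S by auto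
    then show ?thesis by simp
  next
    case False
    then have "E = (\<Inter>p\<in>?I. incr n (fst p) (snd p) -` C (fst p) (snd p) \<inter> space S)"
      unfolding E S by auto
    then show ?thesis using I_sets[OF False] by simp
  qed
qed

lemma increment_rects_events: "finite K \<Longrightarrow> increment_rects r K n \<subseteq> sets M"
  by (rule increment_rects_subset_sets) (auto intro: incr_measurable_M)

lemma increment_rects_measurable:
  assumes "k < 2 ^ n" "j \<in> K" "pt n (Suc k) \<le> r"
  shows "incr n k j \<in> borel_measurable (sigma (space M) (increment_rects r K n))"
proof (rule measurableI)
  fix D :: "real set" assume D: "D \<in> sets borel"
  have "incr n k j -` D \<inter> space M
    = {\<omega>\<in>space M. \<forall>k'<2 ^ n. \<forall>j'\<in>K. pt n (Suc k') \<le> r \<longrightarrow> incr n k' j' \<omega> \<in> (if k' = k \<and> j' = j then D else UNIV)}"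
    (is "_ = ?R")
  proof (intro set_eqI iffI)
    fix \<omega> assume \<omega>: "\<omega> \<in> ?R"
    then have "incr n k j \<omega> \<in> (if k = k \<and> j = j then D else UNIV)" using assms by blast
    then show "\<omega> \<in> incr n k j -` D \<inter> space M" using \<omega> by simp
  qed auto
  also have "\<dots> \<in> increment_rects r K n"
    by (rule increment_rectsI) (use D in simp)
  finally show "incr n k j -` D \<inter> space (sigma (space M) (increment_rects r K n)) \<in> sets (sigma (space M) (increment_rects r K n))"
    using increment_rects_sub by (simp add: sets_measure_of space_measure_of sigma_sets.Basic)
qed simp

text \<open>Increments on a coarse grid are sums of increments on a finer one.\<close>

lemma increment_sigma_mono:
  assumes K: "finite K" and L: "finite L" "K \<subseteq> L"
  shows "sigma_sets (space M) (increment_rects r K n) \<subseteq> sigma_sets (space M) (increment_rects r L (n + p))"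
proof -
  let ?S = "sigma (space M) (increment_rects r L (n + p))"
  have S: "sets ?S = sigma_sets (space M) (increment_rects r L (n + p))" "space ?S = space M"
    using increment_rects_sub by (simp_all add: sets_measure_of space_measure_of)
  have m: "incr n k j \<in> borel_measurable ?S" if k: "k < 2 ^ n" and j: "j \<in> K" and r: "pt n (Suc k) \<le> r" for k j
  proof -
    have "incr (n + p) m j \<in> borel_measurable ?S" if m: "m \<in> {2 ^ p * k..<2 ^ p * Suc k}" for m
    proof (rule increment_rects_measurable)
      have "m < 2 ^ p * Suc k" using m by simp
      also have "\<dots> \<le> 2 ^ p * 2 ^ n" using k by (intro mult_left_mono) auto
      finally show "m < 2 ^ (n + p)" by (simp add: power_add mult.commute)
      have "pt (n + p) (Suc m) \<le> pt (n + p) (2 ^ p * Suc k)" using m by (intro gridpt_mono[OF t0T]) simp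
      then show "pt (n + p) (Suc m) \<le> r" using r by (simp only: gridpt_refine)
      show "j \<in> L" using j L by auto
    qed
    then have "(\<lambda>\<omega>. \<Sum>m=2 ^ p * k..<2 ^ p * Suc k. incr (n + p) m j \<omega>) \<in> borel_measurable ?S"
      by (intro borel_measurable_sum)
    then show ?thesis by (simp only: incr_refine)
  qed
  have "increment_rects r K n \<subseteq> sets ?S" by (rule increment_rects_subset_sets[OF K S(2) m])
  then show ?thesis using sets.sigma_sets_subset[of "increment_rects r K n" ?S] S by simp
qed

lemma Int_stable_increment_rects: "Int_stable (increment_rects r K n)"
proof (rule Int_stableI)
  fix a b assume a: "a \<in> increment_rects r K n" and b: "b \<in> increment_rects r K n"
  obtain C where C: "a = {\<omega>\<in>space M. \<forall>k<2 ^ n. \<forall>j\<in>K. pt n (Suc k) \<le> r \<longrightarrow> incr n k j \<omega> \<in> C k j}" "\<forall>k j. C k j \<in> sets borel"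
    using a by (rule increment_rectsE)
  obtain D where D: "b = {\<omega>\<in>space M. \<forall>k<2 ^ n. \<forall>j\<in>K. pt n (Suc k) \<le> r \<longrightarrow> incr n k j \<omega> \<in> D k j}" "\<forall>k j. D k j \<in> sets borel"
    using b by (rule increment_rectsE)
  have "a \<inter> b = {\<omega>\<in>space M. \<forall>k<2 ^ n. \<forall>j\<in>K. pt n (Suc k) \<le> r \<longrightarrow> incr n k j \<omega> \<in> C k j \<inter> D k j}"
    unfolding C(1) D(1) by auto
  also have "\<dots> \<in> increment_rects r K n" by (rule increment_rectsI) (use C(2) D(2) in auto)
  finally show "a \<inter> b \<in> increment_rects r K n" .
qed

lemma path_sets_sub: "path_sets r K \<subseteq> Pow (space M)"
  unfolding path_sets_def by (intro UN_least subsetI PowI sigma_sets_into_sp[OF increment_rects_sub])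

text \<open>Although \<open>path_sets\<close> is a union over the grids, refinement makes that union directed.\<close>

lemma path_sets_Int:
  assumes K: "finite K" and L: "finite L" and a: "a \<in> path_sets r K" and b: "b \<in> path_sets r L"
  shows "a \<inter> b \<in> path_sets r (K \<union> L)"
proof -
  have KL: "finite (K \<union> L)" using K L by simp
  obtain n where n: "a \<in> sigma_sets (space M) (increment_rects r K n)" using a by (auto simp: path_sets_def)
  obtain m where m: "b \<in> sigma_sets (space M) (increment_rects r L m)" using b by (auto simp: path_sets_def)
  have a': "a \<in> sigma_sets (space M) (increment_rects r (K \<union> L) (n + m))"
    by (rule subsetD[OF increment_sigma_mono[OF K KL Un_upper1] n])
  have "b \<in> sigma_sets (space M) (increment_rects r (K \<union> L) (m + n))"
    by (rule subsetD[OF increment_sigma_mono[OF L KL Un_upper2] m])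
  then have b': "b \<in> sigma_sets (space M) (increment_rects r (K \<union> L) (n + m))" by (simp only: add.commute)
  interpret S: sigma_algebra "space M" "sigma_sets (space M) (increment_rects r (K \<union> L) (n + m))"
    by (rule sigma_algebra_sigma_sets[OF increment_rects_sub])
  show ?thesis unfolding path_sets_def using S.Int[OF a' b'] by blast
qed

lemma path_sets_Int_stable: "finite K \<Longrightarrow> Int_stable (path_sets r K)"
  using path_sets_Int[of K K] by (auto intro: Int_stableI)

text \<open>At grid points the path is a sum of increments, and other times follow by continuity; this is how
  countably many increments come to determine the path.\<close>

lemma B_path_sets:
  assumes S: "space S = space M" "path_sets r K \<subseteq> sets S"
    and K: "finite K" and j: "j \<in> K" and t: "t\<^sub>0 \<le> t" "t \<le> r" "t \<le> T"
  shows "B j t \<in> borel_measurable S"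
proof -
  have inc: "incr n k j \<in> borel_measurable S" if "k < 2 ^ n" "pt n (Suc k) \<le> r" for n k
  proof (rule measurable_from_subalg[OF _ increment_rects_measurable[OF that(1) j that(2)]])
    show "subalgebra S (sigma (space M) (increment_rects r K n))"
    proof -
      have "sigma_sets (space M) (increment_rects r K n) \<subseteq> sets S"
        by (rule order_trans[OF _ S(2)]) (unfold path_sets_def, blast)
      then show ?thesis
        using increment_rects_sub[of r K n] S(1) by (simp add: subalgebra_def sets_measure_of space_measure_of)
    qed
  qed
  have grid: "B j (pt n k) \<in> borel_measurable S" if k: "k \<le> 2 ^ n" "pt n k \<le> r" for n k
  proof -
    have "incr n m j \<in> borel_measurable S" if "m \<in> {0..<k}" for m
    proof (rule inc)
      show "m < 2 ^ n" using that k by simp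
      have "pt n (Suc m) \<le> pt n k" using that by (intro gridpt_mono[OF t0T]) simp
      then show "pt n (Suc m) \<le> r" using k by simp
    qed
    then have "(\<lambda>\<omega>. \<Sum>m=0..<k. incr n m j \<omega>) \<in> borel_measurable S" by (intro borel_measurable_sum)
    moreover have "(\<Sum>m=0..<k. incr n m j \<omega>) = B j (pt n k) \<omega>" if "\<omega> \<in> space S" for \<omega>
      unfolding incr_def using start[of \<omega> j] that S by (subst sum_Suc_diff') auto
    ultimately show ?thesis by (subst (asm) measurable_cong)
  qed
  show ?thesis
  proof (cases "t = t\<^sub>0")
    case True
    then show ?thesis using start S(1) by (subst measurable_cong[where g="\<lambda>_. 0"]) auto
  next
    case False
    then have t': "t \<in> {t\<^sub>0<..T}" using t by auto
    show ?thesis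
    proof (rule borel_measurable_LIMSEQ_real)
      show "B j (pt n (cell n t)) \<in> borel_measurable S" for n
        using gridcell_less[OF t0T t', of n] gridcell_lower[OF t0T t', of n] t by (intro grid) auto
      show "(\<lambda>n. B j (pt n (cell n t)) \<omega>) \<longlonglongrightarrow> B j t \<omega>" if "\<omega> \<in> space S" for \<omega>
      proof (rule continuous_on_tendsto_compose[OF cont gridpt_cell_tendsto[OF t0T t']])
        show "\<omega> \<in> space M" using that S by simp
        show "t \<in> {t\<^sub>0..T}" using t by simp
        show "\<forall>\<^sub>F n in sequentially. pt n (cell n t) \<in> {t\<^sub>0..T}"
          using gridcell_less[OF t0T t'] by (intro always_eventually allI gridpt_in[OF t0T]) (simp add: less_imp_le)
      qed
    qed
  qed
qed

end

context brownian_family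
begin

lemma increment_rects_T: "increment_rects T K n = {{\<omega>\<in>space M. \<forall>k<2 ^ n. \<forall>j\<in>K. incr n k j \<omega> \<in> C k j} | C. \<forall>k j. C k j \<in> sets borel}"
proof -
  have "pt n (Suc k) \<le> T" if "k < 2 ^ n" for k using gridpt_in[OF t0T, of "Suc k" n] that by simp
  then have "{\<omega>\<in>space M. \<forall>k<2 ^ n. \<forall>j\<in>K. pt n (Suc k) \<le> T \<longrightarrow> incr n k j \<omega> \<in> C k j}
    = {\<omega>\<in>space M. \<forall>k<2 ^ n. \<forall>j\<in>K. incr n k j \<omega> \<in> C k j}" for C by auto
  then show ?thesis unfolding increment_rects_def by simp
qed

lemma increment_rects_TI:
  "(\<And>k j. C k j \<in> sets borel) \<Longrightarrow> {\<omega>\<in>space M. \<forall>k<2 ^ n. \<forall>j\<in>K. incr n k j \<omega> \<in> C k j} \<in> increment_rects T K n"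
  unfolding increment_rects_T mem_Collect_eq by (intro exI conjI, rule refl) simp

lemma increment_rects_TE:
  assumes "E \<in> increment_rects T K n"
  obtains C where "E = {\<omega>\<in>space M. \<forall>k<2 ^ n. \<forall>j\<in>K. incr n k j \<omega> \<in> C k j}" "\<forall>k j. C k j \<in> sets borel"
  using assms unfolding increment_rects_T mem_Collect_eq by (elim exE conjE) simp

lemma prob_eq_integral: "A \<in> events \<Longrightarrow> prob A = (LINT \<omega>|M. indicat_real A \<omega>)"
  by simp

text \<open>With drift 0, \<open>gaussian_telescope\<close> is the joint characteristic function of all increments on the
  grid, and \<open>gaussian_vector_from_char\<close> turns it into their law.\<close>

lemma grid_law:
  assumes J: "finite J" and C: "\<And>k j. C k j \<in> sets borel"
  shows "prob {\<omega>\<in>space M. \<forall>k<2 ^ n. \<forall>j\<in>J. incr n k j \<omega> \<in> C k j}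
    = (\<Prod>k<2 ^ n. \<Prod>j\<in>J. measure std_normal_distribution {x. sqrt (mesh n) * x \<in> C k j})"
proof -
  let ?I = "{..<(2::nat) ^ n} \<times> J"
  let ?Y = "\<lambda>(k, j) \<omega>. incr n k j \<omega> / sqrt (mesh n)"
  let ?C = "\<lambda>(k, j). {x. sqrt (mesh n) * x \<in> C k j}"
  have m: "0 < sqrt (mesh n)" using mesh_pos by simp
  have C': "{x. sqrt (mesh n) * x \<in> C k j} \<in> sets borel" for k j
    using measurable_sets[of "\<lambda>x. sqrt (mesh n) * x" borel borel "C k j"] C by (simp add: vimage_def)
  have Ym: "?Y p \<in> borel_measurable M" if "p \<in> ?I" for p
    using that by (auto intro!: borel_measurable_divide incr_measurable_M)
  have char: "(LINT \<omega>|M. 1 *\<^sub>R iexp (\<Sum>p\<in>?I. l p * ?Y p \<omega>)) = complex_of_real (1 * exp (- (\<Sum>p\<in>?I. (l p)\<^sup>2) / 2))" for l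
  proof -
    let ?l = "\<lambda>k j. l (k, j) / sqrt (mesh n)"
    have one: "(\<lambda>_. 1::complex) \<in> borel_measurable (F (pt n 0))" "integrable M (\<lambda>_. 1::complex)" by simp_all
    have prod: "(\<Prod>k=0..<2 ^ n. \<Prod>j\<in>J. shifted_factor (mesh n) 0 (?l k j) (incr n k j \<omega>)) = iexp (\<Sum>p\<in>?I. l p * ?Y p \<omega>)" for \<omega>
      using J by (subst prod_shifted_factor) (auto simp: sum.cartesian_product case_prod_beta atLeast0LessThan)
    have sq: "- mesh n * (\<Sum>k=0..<2 ^ n. \<Sum>j\<in>J. (?l k j)\<^sup>2) / 2 = - (\<Sum>p\<in>?I. (l p)\<^sup>2) / 2"
      using mesh_pos[of n] by (simp add: power_divide sum.cartesian_product case_prod_beta atLeast0LessThan flip: sum_divide_distrib)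
    have "(LINT \<omega>|M. 1 * (\<Prod>k=0..<2 ^ n. \<Prod>j\<in>J. shifted_factor (mesh n) 0 (?l k j) (incr n k j \<omega>)))
        = (LINT \<omega>|M. 1) * complex_of_real (exp (- mesh n * (\<Sum>k=0..<2 ^ n. \<Sum>j\<in>J. (?l k j)\<^sup>2) / 2))"
      by (rule gaussian_telescope[where \<beta>="\<lambda>_ _ _. 0" and l="?l", OF le0 order_refl J one, THEN conjunct2, THEN conjunct2]) simp
    then show ?thesis unfolding prod sq by (simp add: prob_space)
  qed
  have law: "(LINT \<omega>|M. 1 * (\<Prod>p\<in>?I. indicator (?C p) (?Y p \<omega>))) = 1 * (\<Prod>p\<in>?I. measure std_normal_distribution (?C p))"
    by (rule gaussian_vector_from_char[OF _ Ym _ _ char]) (use J C' in auto)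
  have event: "(LINT \<omega>|M. 1 * (\<Prod>p\<in>?I. indicator (?C p) (?Y p \<omega>)))
     = (LINT \<omega>|M. indicat_real {\<omega>\<in>space M. \<forall>k<2 ^ n. \<forall>j\<in>J. incr n k j \<omega> \<in> C k j} \<omega>)"
  proof (intro Bochner_Integration.integral_cong refl)
    fix \<omega> assume \<omega>: "\<omega> \<in> space M"
    let ?P = "\<forall>k<2 ^ n. \<forall>j\<in>J. incr n k j \<omega> \<in> C k j"
    have ind: "indicator (?C (k, j)) (?Y (k, j) \<omega>) = (if incr n k j \<omega> \<in> C k j then 1 else 0 :: real)" for k j
    proof -
      have "sqrt (mesh n) * (incr n k j \<omega> / sqrt (mesh n)) = incr n k j \<omega>" using m by simp
      then show ?thesis unfolding indicator_def by (simp only: prod.case mem_Collect_eq of_bool_def)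
    qed
    have "(\<Prod>p\<in>?I. indicator (?C p) (?Y p \<omega>)) = (if ?P then 1 else 0 :: real)"
    proof (cases ?P)
      case True
      have "indicator (?C p) (?Y p \<omega>) = (1::real)" if "p \<in> ?I" for p
        using that True ind[of "fst p" "snd p"] by (cases p) auto
      then have "(\<Prod>p\<in>?I. indicator (?C p) (?Y p \<omega>)) = (1::real)" by (rule prod.neutral[rule_format])
      then show ?thesis by (simp only: if_P[OF True])
    next
      case False
      then obtain k j where kj: "k < 2 ^ n" "j \<in> J" "incr n k j \<omega> \<notin> C k j" by blast
      have "(\<Prod>p\<in>?I. indicator (?C p) (?Y p \<omega>)) = (0::real)"
      proof (rule prod_zero)
        show "\<exists>p\<in>?I. indicator (?C p) (?Y p \<omega>) = (0::real)"
          using kj ind[of k j] by (intro bexI[of _ "(k, j)"]) auto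
      qed (use J in auto)
      then show ?thesis by (simp only: if_not_P[OF False])
    qed
    then show "1 * (\<Prod>p\<in>?I. indicator (?C p) (?Y p \<omega>)) = indicat_real {\<omega>\<in>space M. \<forall>k<2 ^ n. \<forall>j\<in>J. incr n k j \<omega> \<in> C k j} \<omega>"
      using \<omega> by (simp add: indicator_def)
  qed
  have "{\<omega>\<in>space M. \<forall>k<2 ^ n. \<forall>j\<in>J. incr n k j \<omega> \<in> C k j} \<in> sets M"
    by (rule subsetD[OF increment_rects_events[OF J] increment_rects_TI[OF C]])
  then have "prob {\<omega>\<in>space M. \<forall>k<2 ^ n. \<forall>j\<in>J. incr n k j \<omega> \<in> C k j}
      = (LINT \<omega>|M. indicat_real {\<omega>\<in>space M. \<forall>k<2 ^ n. \<forall>j\<in>J. incr n k j \<omega> \<in> C k j} \<omega>)"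
    by (rule prob_eq_integral)
  also have "\<dots> = (\<Prod>p\<in>?I. measure std_normal_distribution (?C p))"
    unfolding event[symmetric] law by (rule mult_1_left)
  also have "\<dots> = (\<Prod>k<2 ^ n. \<Prod>j\<in>J. measure std_normal_distribution {x. sqrt (mesh n) * x \<in> C k j})"
  proof -
    have "(\<Prod>k<2 ^ n. \<Prod>j\<in>J. measure std_normal_distribution {x. sqrt (mesh n) * x \<in> C k j})
       = (\<Prod>(k, j)\<in>?I. measure std_normal_distribution {x. sqrt (mesh n) * x \<in> C k j})"
      by (rule prod.cartesian_product)
    also have "\<dots> = (\<Prod>p\<in>?I. measure std_normal_distribution (?C p))"
      by (intro prod.cong refl) (simp add: case_prod_beta)
    finally show ?thesis by (rule sym)
  qed
  finally show ?thesis .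
qed

lemma indep_increments:
  assumes K: "\<And>i. finite (K i)" and disj: "disjoint_family K"
  shows "indep_sets (\<lambda>i. increment_rects T (K i) n) UNIV"
proof (rule indep_setsI)
  show "increment_rects T (K i) n \<subseteq> events" for i by (rule increment_rects_events[OF K])
  fix A J assume J: "J \<noteq> {}" "J \<subseteq> UNIV" "finite J" and A: "\<forall>i\<in>J. A i \<in> increment_rects T (K i) n"
  have "\<exists>C. \<forall>i\<in>J. A i = {\<omega>\<in>space M. \<forall>k<2 ^ n. \<forall>j\<in>K i. incr n k j \<omega> \<in> C i k j} \<and> (\<forall>k j. C i k j \<in> sets borel)"
  proof (rule bchoice, rule ballI)
    fix i assume "i \<in> J"
    then have "A i \<in> increment_rects T (K i) n" using A by blast
    then obtain C where "A i = {\<omega>\<in>space M. \<forall>k<2 ^ n. \<forall>j\<in>K i. incr n k j \<omega> \<in> C k j}" "\<forall>k j. C k j \<in> sets borel"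
      by (rule increment_rects_TE)
    then show "\<exists>C. A i = {\<omega>\<in>space M. \<forall>k<2 ^ n. \<forall>j\<in>K i. incr n k j \<omega> \<in> C k j} \<and> (\<forall>k j. C k j \<in> sets borel)"
      by (intro exI[of _ C] conjI)
  qed
  then obtain C where Aeq: "\<And>i. i \<in> J \<Longrightarrow> A i = {\<omega>\<in>space M. \<forall>k<2 ^ n. \<forall>j\<in>K i. incr n k j \<omega> \<in> C i k j}"
    and C: "\<And>i k j. i \<in> J \<Longrightarrow> C i k j \<in> sets borel" by blast
  define idx where "idx j = (SOME i. i \<in> J \<and> j \<in> K i)" for j
  have idx: "idx j = i" if "i \<in> J" "j \<in> K i" for i j
  proof -
    have "idx j \<in> J \<and> j \<in> K (idx j)" unfolding idx_def using that by (intro someI[of "\<lambda>i. i \<in> J \<and> j \<in> K i"]) simp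
    then show ?thesis using disj that by (auto simp: disjoint_family_on_def)
  qed
  define D where "D k j = (if idx j \<in> J then C (idx j) k j else UNIV)" for k j
  have D: "D k j \<in> sets borel" for k j using C by (simp add: D_def)
  let ?s = "\<lambda>D k j. measure std_normal_distribution {x. sqrt (mesh n) * x \<in> D k j}"
  have "(\<Inter>i\<in>J. A i) = {\<omega>\<in>space M. \<forall>k<2 ^ n. \<forall>j\<in>(\<Union>i\<in>J. K i). incr n k j \<omega> \<in> D k j}"
    using J(1) Aeq idx by (auto simp: D_def)
  then have "prob (\<Inter>i\<in>J. A i) = (\<Prod>k<2 ^ n. \<Prod>j\<in>(\<Union>i\<in>J. K i). ?s D k j)"
    using grid_law[of "\<Union>i\<in>J. K i" D n] J K D by simp
  also have "\<dots> = (\<Prod>k<2 ^ n. \<Prod>i\<in>J. \<Prod>j\<in>K i. ?s D k j)"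
    using J K disj by (intro prod.cong refl prod.UNION_disjoint) (auto simp: disjoint_family_on_def)
  also have "\<dots> = (\<Prod>i\<in>J. \<Prod>k<2 ^ n. \<Prod>j\<in>K i. ?s D k j)" by (rule prod.swap)
  also have "\<dots> = (\<Prod>i\<in>J. prob (A i))"
  proof (intro prod.cong refl)
    fix i assume i: "i \<in> J"
    have "(\<Prod>k<2 ^ n. \<Prod>j\<in>K i. ?s D k j) = (\<Prod>k<2 ^ n. \<Prod>j\<in>K i. ?s (C i) k j)"
      using idx[OF i] i by (intro prod.cong refl) (simp add: D_def)
    also have "\<dots> = prob (A i)" unfolding Aeq[OF i] by (rule grid_law[symmetric, OF K C[OF i]])
    finally show "(\<Prod>k<2 ^ n. \<Prod>j\<in>K i. ?s D k j) = prob (A i)" .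
  qed
  finally show "prob (\<Inter>i\<in>J. A i) = (\<Prod>i\<in>J. prob (A i))" .
qed

text \<open>Independence holds on each grid by the product formula \<open>grid_law\<close>, and any finitely many events of
  \<open>path_sets\<close> live on a common grid.\<close>

lemma indep_paths:
  assumes K: "\<And>i::nat. finite (K i)" and disj: "disjoint_family K"
  shows "indep_sets (\<lambda>i. sigma_sets (space M) (path_sets T (K i))) UNIV"
proof (rule indep_sets_sigma)
  show "Int_stable (path_sets T (K i))" for i by (rule path_sets_Int_stable[OF K])
  have ind: "indep_sets (\<lambda>i. sigma_sets (space M) (increment_rects T (K i) n)) UNIV" for n
    by (intro indep_sets_sigma indep_increments K disj Int_stable_increment_rects)
  show "indep_sets (\<lambda>i. path_sets T (K i)) UNIV"
  proof (rule indep_setsI)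
    show "path_sets T (K i) \<subseteq> events" for i
      unfolding path_sets_def using sets.sigma_sets_subset[OF increment_rects_events[OF K]] by blast
    fix A and J :: "nat set" assume J: "J \<noteq> {}" "J \<subseteq> UNIV" "finite J" and A: "\<forall>i\<in>J. A i \<in> path_sets T (K i)"
    have "\<forall>i\<in>J. \<exists>n. A i \<in> sigma_sets (space M) (increment_rects T (K i) n)" using A by (auto simp: path_sets_def)
    then obtain n where n: "\<And>i. i \<in> J \<Longrightarrow> A i \<in> sigma_sets (space M) (increment_rects T (K i) (n i))" by metis
    define m where "m = Max (n ` J)"
    have "A i \<in> sigma_sets (space M) (increment_rects T (K i) m)" if i: "i \<in> J" for i
    proof -
      have "n i \<le> m" unfolding m_def using J i by (intro Max_ge) auto
      then show ?thesis using n[OF i] increment_sigma_mono[OF K K subset_refl, of T i "n i" "m - n i"] by auto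
    qed
    then show "prob (\<Inter>i\<in>J. A i) = (\<Prod>i\<in>J. prob (A i))"
      using J by (intro indep_setsD[OF ind[of m]]) auto
  qed
qed

end

lemma prod_Basis_vec:
  fixes h :: "real ^ 'd::finite \<Rightarrow> 'c::comm_monoid_mult"
  shows "(\<Prod>c\<in>Basis. h c) = (\<Prod>k\<in>UNIV. h (axis k 1))"
proof -
  have B: "(Basis :: (real ^ 'd) set) = range (\<lambda>k. axis k 1)" by (auto simp: Basis_vec_def)
  have I: "inj (\<lambda>k::'d. axis k (1::real))" by (auto simp: inj_on_def axis_eq_axis)
  show ?thesis unfolding B by (subst prod.reindex[OF I]) (simp add: comp_def)
qed

lemma borel_measurable_vec_lambda:
  fixes f :: "'d::finite \<Rightarrow> 'w \<Rightarrow> real"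
  assumes "\<And>k. f k \<in> borel_measurable N"
  shows "(\<lambda>x. \<chi> k. f k x) \<in> borel_measurable N"
proof (subst borel_measurable_euclidean_space, intro ballI)
  fix i :: "real ^ 'd" assume "i \<in> Basis"
  then obtain k where "i = axis k 1" by (auto simp: Basis_vec_def)
  then show "(\<lambda>x. (\<chi> k. f k x) \<bullet> i) \<in> borel_measurable N" using assms by (simp add: inner_axis)
qed

lemma std_normal_scale:
  assumes s: "0 < s" and C: "C \<in> sets borel"
  shows "emeasure std_normal_distribution {x. s * x \<in> C} = (\<integral>\<^sup>+x. ennreal (normal_density 0 s x) * indicator C x \<partial>lborel)"
proof -
  interpret std: prob_space std_normal_distribution by (simp add: prob_space_normal_density)
  have "distributed std_normal_distribution lborel (\<lambda>x. x) std_normal_density"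
    by (auto simp: distributed_def distr_id[of "std_normal_distribution", unfolded id_def] intro!: measure_eqI
      simp: emeasure_distr)
  from std.normal_density_affine[OF this, of s 0] s
  have "distributed std_normal_distribution lborel (\<lambda>x. s * x) (normal_density 0 s)" by simp
  from distributed_emeasure[OF this, of C] C show ?thesis by (simp add: vimage_def)
qed

text \<open>The vector increments have the product Gaussian density because the two measures agree on boxes; the
  same computation with an event of the past gives the independence from the past.\<close>

lemma brownian_family_processes:
  fixes B :: "nat \<times> 'd::finite \<Rightarrow> real \<Rightarrow> 'w \<Rightarrow> real"
  assumes "brownian_family M F B t\<^sub>0 T"
  defines "W \<equiv> \<lambda>i t \<omega>. \<chi> k. B (i, k) t \<omega>"
  shows "brownian_motion t\<^sub>0 T M F (W i)" and "independent_processes t\<^sub>0 T M W"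
proof -
  interpret brownian_family M F B t\<^sub>0 T by fact
  show "independent_processes t\<^sub>0 T M W"
    unfolding independent_processes_def indep_vars_def2
  proof (intro conjI ballI)
    let ?K = "\<lambda>i::nat. {i} \<times> (UNIV :: 'd set)"
    have W_path: "(\<lambda>\<omega>. \<lambda>t\<in>{t\<^sub>0..T}. W i t \<omega>) \<in> measurable (sigma (space M) (path_sets T (?K i))) (\<Pi>\<^sub>M t\<in>{t\<^sub>0..T}. borel)" for i
    proof -
      have S: "space (sigma (space M) (path_sets T (?K i))) = space M"
          "path_sets T (?K i) \<subseteq> sets (sigma (space M) (path_sets T (?K i)))"
        using path_sets_sub[of T "?K i"] by (auto simp: space_measure_of sets_measure_of intro: sigma_sets.Basic)
      show ?thesis
        unfolding W_def by (intro measurable_restrict borel_measurable_vec_lambda B_path_sets[OF S]) auto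
    qed
    have W_M: "W i t \<in> borel_measurable M" if "t \<in> {t\<^sub>0..T}" for i t
      unfolding W_def using that by (intro borel_measurable_vec_lambda B_measurable)
    show "(\<lambda>\<omega>. \<lambda>t\<in>{t\<^sub>0..T}. W i t \<omega>) \<in> measurable M (\<Pi>\<^sub>M t\<in>{t\<^sub>0..T}. borel)" for i
      using W_M by (intro measurable_restrict)
    have "indep_sets (\<lambda>i. sigma_sets (space M) (path_sets T (?K i))) UNIV"
      by (rule indep_paths) (auto simp: disjoint_family_on_def)
    then show "indep_sets (\<lambda>i. {(\<lambda>\<omega>. \<lambda>t\<in>{t\<^sub>0..T}. W i t \<omega>) -` A \<inter> space M |A. A \<in> sets (\<Pi>\<^sub>M t\<in>{t\<^sub>0..T}. borel)}) UNIV"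
    proof (rule indep_sets_mono_sets)
      fix i :: nat
      have sub: "path_sets T (?K i) \<subseteq> Pow (space M)"
        by (rule path_sets_sub)
      show "{(\<lambda>\<omega>. \<lambda>t\<in>{t\<^sub>0..T}. W i t \<omega>) -` A \<inter> space M |A. A \<in> sets (\<Pi>\<^sub>M t\<in>{t\<^sub>0..T}. borel)}
          \<subseteq> sigma_sets (space M) (path_sets T (?K i))"
        using measurable_sets[OF W_path[of i]] sub by (auto simp: sets_measure_of space_measure_of)
    qed
  qed
  show "brownian_motion t\<^sub>0 T M F (W i)"
    unfolding brownian_motion_def
  proof (intro conjI ballI allI impI)
    show "W i t \<in> borel_measurable (F t)" if "t \<in> {t\<^sub>0..T}" for t
      unfolding W_def using that by (intro borel_measurable_vec_lambda adapted)
    show "W i t\<^sub>0 \<omega> = 0" if "\<omega> \<in> space M" for \<omega>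
      using start[OF that] by (simp add: W_def vec_eq_iff)
    show "continuous_on {t\<^sub>0..T} (\<lambda>t. W i t \<omega>)" if "\<omega> \<in> space M" for \<omega>
      unfolding W_def by (intro continuous_on_vec_lambda cont that)
    fix r t assume "t\<^sub>0 \<le> r \<and> r < t \<and> t \<le> T"
    then have rt: "t\<^sub>0 \<le> r" "r < t" "t \<le> T" by auto
    have r: "r \<in> {t\<^sub>0..T}" and t: "t \<in> {t\<^sub>0..T}" using rt by auto
    define s where "s = sqrt (t - r)"
    have s: "0 < s" using rt by (simp add: s_def)
    define Y where "Y \<omega> = W i t \<omega> - W i r \<omega>" for \<omega>
    have W_M[measurable]: "W i u \<in> borel_measurable M" if "u \<in> {t\<^sub>0..T}" for u
      unfolding W_def using that by (intro borel_measurable_vec_lambda B_measurable)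
    have Y[measurable]: "Y \<in> borel_measurable M" unfolding Y_def[abs_def] using r t by measurable
    define g where "g z = ennreal (\<Prod>k\<in>UNIV. normal_density 0 s (z $ k))" for z :: "real ^ 'd"
    have g_meas[measurable]: "g \<in> borel_measurable borel"
      unfolding g_def[abs_def] by measurable
    have gbox: "emeasure (density lborel g) (box a b) = ennreal (\<Prod>k\<in>UNIV. measure std_normal_distribution {x. s * x \<in> {a $ k<..<b $ k}})" for a b :: "real ^ 'd"
    proof -
      interpret std: prob_space std_normal_distribution by (simp add: prob_space_normal_density)
      have "emeasure (density lborel g) (box a b) = (\<integral>\<^sup>+z. (\<Prod>c\<in>Basis. ennreal (normal_density 0 s (z \<bullet> c)) * indicator {a \<bullet> c<..<b \<bullet> c} (z \<bullet> c)) \<partial>lborel)"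
      proof (subst emeasure_density)
        have "g z * indicator (box a b) z = (\<Prod>c\<in>Basis. ennreal (normal_density 0 s (z \<bullet> c)) * indicator {a \<bullet> c<..<b \<bullet> c} (z \<bullet> c))" for z
        proof -
          have "(\<Prod>c\<in>(Basis :: (real ^ 'd) set). ennreal (normal_density 0 s (z \<bullet> c))) = g z"
            by (simp add: prod_Basis_vec g_def inner_axis prod_ennreal normal_density_nonneg)
          moreover have "(\<Prod>c\<in>Basis. indicator {a \<bullet> c<..<b \<bullet> c} (z \<bullet> c)) = (indicator (box a b) z :: ennreal)"
            by (auto simp: indicator_def mem_box prod_zero_iff intro!: prod.neutral)
          ultimately show ?thesis by (simp add: prod.distrib)
        qed
        then show "(\<integral>\<^sup>+z. g z * indicator (box a b) z \<partial>lborel) = (\<integral>\<^sup>+z. (\<Prod>c\<in>Basis. ennreal (normal_density 0 s (z \<bullet> c)) * indicator {a \<bullet> c<..<b \<bullet> c} (z \<bullet> c)) \<partial>lborel)"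
          by simp
      qed auto
      also have "\<dots> = (\<Prod>c\<in>Basis. \<integral>\<^sup>+x. ennreal (normal_density 0 s x) * indicator {a \<bullet> c<..<b \<bullet> c} x \<partial>lborel)"
        by (rule nn_integral_lborel_prod) auto
      also have "\<dots> = (\<Prod>c\<in>Basis. emeasure std_normal_distribution {x. s * x \<in> {a \<bullet> c<..<b \<bullet> c}})"
        by (intro prod.cong refl std_normal_scale[symmetric] s) auto
      also have "\<dots> = (\<Prod>k\<in>UNIV. emeasure std_normal_distribution {x. s * x \<in> {a $ k<..<b $ k}})"
        by (simp only: prod_Basis_vec inner_axis inner_real_def mult_1_right)
      finally show ?thesis by (simp only: std.emeasure_eq_measure prod_ennreal measure_nonneg)
    qed
    have law: "emeasure M (A \<inter> (Y -` C \<inter> space M)) = emeasure M A * emeasure (density lborel g) C"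
      if A: "A \<in> sets (F r)" and C: "C \<in> sets borel" for A C
    proof -
      have AM[measurable]: "A \<in> sets M" by (rule sets_F_M[OF r A])
      define \<mu> where "\<mu> = distr (density M (indicator A)) borel Y"
      have \<mu>: "emeasure \<mu> E = emeasure M (A \<inter> (Y -` E \<inter> space M))" if [measurable]: "E \<in> sets borel" for E
        unfolding \<mu>_def by (subst emeasure_distr, simp, simp, subst emeasure_density)
          (auto simp: indicator_inter_arith[symmetric] intro!: arg_cong[where f="emeasure M"] simp flip: indicator_inter_arith)
      have "\<mu> = scale_measure (emeasure M A) (density lborel g)"
      proof (rule measure_eqI_generator_eq[where E="range (\<lambda>(a, b). box a b)" and \<Omega>=UNIV and A="\<lambda>n. box (- (real n *\<^sub>R One)) (real n *\<^sub>R One)"])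
        show "Int_stable (range (\<lambda>(a, b). box a b :: (real ^ 'd) set))"
        proof (rule Int_stableI)
          fix u v :: "(real ^ 'd) set" assume "u \<in> range (\<lambda>(a, b). box a b)" "v \<in> range (\<lambda>(a, b). box a b)"
          then obtain a b c d where "u = box a b" "v = box c d" by auto
          moreover have "box x y \<in> range (\<lambda>(a, b). box a b)" for x y :: "real ^ 'd"
            by (rule range_eqI[of _ _ "(x, y)"]) simp
          ultimately show "u \<inter> v \<in> range (\<lambda>(a, b). box a b)" by (simp only: box_Int_box)
        qed
        show "sets \<mu> = sigma_sets UNIV (range (\<lambda>(a, b). box a b))"
          by (simp add: \<mu>_def borel_eq_box)
        show "sets (scale_measure (emeasure M A) (density lborel g)) = sigma_sets UNIV (range (\<lambda>(a, b). box a b))"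
          by (simp add: borel_eq_box)
        show "(\<Union>n. box (- (real n *\<^sub>R One)) (real n *\<^sub>R One) :: (real ^ 'd) set) = UNIV"
          by (rule UN_box_eq_UNIV)
        show "emeasure \<mu> (box (- (real n *\<^sub>R One)) (real n *\<^sub>R One)) \<noteq> \<infinity>" for n
          by (subst \<mu>) (auto simp: emeasure_eq_measure)
        fix E :: "(real ^ 'd) set" assume "E \<in> range (\<lambda>(a, b). box a b)"
        then obtain a b where E: "E = box a b" by auto
        have set_eq: "A \<inter> (Y -` E \<inter> space M) = {\<omega>\<in>space M. \<omega> \<in> A \<and> (\<forall>k\<in>UNIV. (B (i, k) t \<omega> - B (i, k) r \<omega>) / s \<in> {x. s * x \<in> {a $ k<..<b $ k}})}"
          using s by (auto simp: E Y_def W_def mem_box_cart)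
        have ind: "indicator (A \<inter> (Y -` E \<inter> space M)) \<omega> = (indicator A \<omega> * (\<Prod>p\<in>{i} \<times> UNIV. indicator {x. s * x \<in> {a $ snd p<..<b $ snd p}} ((B p t \<omega> - B p r \<omega>) / s)) :: real)"
          if "\<omega> \<in> space M" for \<omega>
          unfolding set_eq using that s by (auto simp: indicator_def prod_zero_iff intro!: prod.neutral)
        have "prob (A \<inter> (Y -` E \<inter> space M)) = (LINT \<omega>|M. indicator A \<omega> * (\<Prod>p\<in>{i} \<times> UNIV. indicator {x. s * x \<in> {a $ snd p<..<b $ snd p}} ((B p t \<omega> - B p r \<omega>) / s)))"
        proof -
          have "A \<inter> (Y -` E \<inter> space M) \<in> events" unfolding E by measurable
          then have "prob (A \<inter> (Y -` E \<inter> space M)) = (LINT \<omega>|M. indicator (A \<inter> (Y -` E \<inter> space M)) \<omega>)" by simp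
          also have "\<dots> = (LINT \<omega>|M. indicator A \<omega> * (\<Prod>p\<in>{i} \<times> UNIV. indicator {x. s * x \<in> {a $ snd p<..<b $ snd p}} ((B p t \<omega> - B p r \<omega>) / s)))"
            by (intro Bochner_Integration.integral_cong refl ind)
          finally show ?thesis .
        qed
        also have "\<dots> = prob A * (\<Prod>p\<in>{i} \<times> (UNIV::'d set). measure std_normal_distribution {x. s * x \<in> {a $ snd p<..<b $ snd p}})"
          unfolding s_def
        proof (rule past_future_rectangle[OF rt _ A])
          show "{x. sqrt (t - r) * x \<in> {a $ snd p<..<b $ snd p}} \<in> sets borel" for p :: "nat \<times> 'd" by measurable
        qed simp
        also have "(\<Prod>p\<in>{i} \<times> (UNIV::'d set). measure std_normal_distribution {x. s * x \<in> {a $ snd p<..<b $ snd p}})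
            = (\<Prod>k\<in>UNIV. measure std_normal_distribution {x. s * x \<in> {a $ k<..<b $ k}})"
          by (rule prod.reindex_bij_witness[of _ "Pair i" snd]) auto
        finally show "emeasure \<mu> E = emeasure (scale_measure (emeasure M A) (density lborel g)) E"
          unfolding E using \<mu>[of "box a b"] gbox[of a b]
          by (simp add: emeasure_eq_measure ennreal_mult prod_nonneg)
      qed auto
      then show ?thesis using \<mu>[OF C] by simp
    qed
    have SM: "space M \<in> sets (F r)" using sets.top[of "F r"] space_F[OF r] by simp
    have lawM: "emeasure M (Y -` C \<inter> space M) = emeasure (density lborel g) C" if "C \<in> sets borel" for C
      using law[OF SM that] emeasure_space_1 by (simp add: Int_absorb1)
    have "distributed M lborel Y g"
      unfolding distributed_def
    proof (intro conjI)
      show "distr M lborel Y = density lborel g"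
        by (rule measure_eqI) (auto simp: emeasure_distr lawM)
    qed (auto simp: g_meas)
    then show "distributed M lborel (\<lambda>\<omega>. W i t \<omega> - W i r \<omega>) (\<lambda>z. ennreal (\<Prod>k\<in>UNIV. normal_density 0 (sqrt (t - r)) (z $ k)))"
      unfolding Y_def[abs_def] g_def[abs_def] s_def .
    show "indep_set (sets (F r)) (sets (vimage_algebra (space M) (\<lambda>\<omega>. W i t \<omega> - W i r \<omega>) borel))"
      unfolding Y_def[symmetric]
    proof (rule indep_setI)
      show "sets (F r) \<subseteq> events" using sets_F_M[OF r] by auto
      have v: "sets (vimage_algebra (space M) Y borel) = {Y -` C \<inter> space M | C. C \<in> sets borel}"
        by (rule sets_vimage_algebra2) auto
      show "sets (vimage_algebra (space M) Y borel) \<subseteq> events" unfolding v by auto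
      fix A D assume A: "A \<in> sets (F r)" and "D \<in> sets (vimage_algebra (space M) Y borel)"
      then obtain C where D: "D = Y -` C \<inter> space M" "C \<in> sets borel" unfolding v by auto
      have "emeasure M (A \<inter> D) = emeasure M A * emeasure M D" using law[OF A D(2)] lawM[OF D(2)] by (simp add: D)
      then show "prob (A \<inter> D) = prob A * prob D" by (simp add: measure_def enn2real_mult)
    qed
  qed
qed

section \<open>Levy's construction of a continuous path\<close>

text \<open>The tent over \<open>[0, 1]\<close> with peak 1 at \<open>1/2\<close>.\<close>

definition hat :: "real \<Rightarrow> real" where
  "hat v = max 0 (1 - \<bar>2 * v - 1\<bar>)"

text \<open>Level \<open>n\<close> of Levy's series uses the coefficients with indices in \<open>[2\<^sup>n, 2\<^sup>n\<^sup>+\<^sup>1)\<close>. The tents of one level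
  have disjoint supports.\<close>

definition hat_level :: "(nat \<Rightarrow> real) \<Rightarrow> nat \<Rightarrow> real \<Rightarrow> real" where
  "hat_level x n u = sqrt ((1/2) ^ n) / 2 * (\<Sum>k<2 ^ n. x (2 ^ n + k) * hat (2 ^ n * u - real k))"

definition levy_path :: "(nat \<Rightarrow> real) \<Rightarrow> real \<Rightarrow> real" where
  "levy_path x u = x 0 * u + (\<Sum>n. hat_level x n u)"

text \<open>A growth condition that makes the series converge uniformly and that independent Gaussian
  coefficients satisfy almost surely: their fourth powers have mean 3, and \<open>(3/8)\<^sup>n \<cdot> 2\<^sup>n\<close> is summable.
  The exponent 4 is large enough to beat the number of tents on a level.\<close>

definition tame :: "(nat \<Rightarrow> real) \<Rightarrow> bool" where
  "tame x \<longleftrightarrow> (\<exists>C::nat. \<forall>n. (3/8) ^ n * (\<Sum>k<2 ^ n. (x (2 ^ n + k)) ^ 4) \<le> real C)"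

lemma hat_bounds: "0 \<le> hat v" "hat v \<le> 1"
  by (simp_all add: hat_def)

lemma hat_outside: "v \<le> 0 \<or> 1 \<le> v \<Longrightarrow> hat v = 0"
  by (auto simp: hat_def)

lemma hat_of_int [simp]: "hat (of_int i) = 0"
  by (cases "i \<le> 0") (auto intro: hat_outside)

lemma hat_half: "hat (1/2) = 1"
  by (simp add: hat_def)

text \<open>Tents are affine on half-cells, so the midpoint of a finer dyadic interval sees the average of the
  end points.\<close>

lemma hat_midpoint:
  fixes i :: int
  assumes p: "1 \<le> p"
  shows "hat ((2 * of_int i + 1) / 2 ^ (p + 1)) = (hat (of_int i / 2 ^ p) + hat ((of_int i + 1) / 2 ^ p)) / 2"
proof -
  obtain m where m: "p = Suc m" using p by (cases p) auto
  define q :: int where "q = 2 ^ m"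
  define Q :: real where "Q = 2 ^ m"
  have q: "real_of_int q = Q" "0 < Q" by (simp_all add: q_def Q_def)
  define a where "a = of_int i / (2 * Q)"
  define b where "b = (of_int i + 1) / (2 * Q)"
  have ab: "(2 * of_int i + 1) / 2 ^ (p + 1) = (a + b) / 2" "of_int i / 2 ^ p = a" "(of_int i + 1) / 2 ^ p = b"
    using q(2) by (simp_all add: m a_def b_def Q_def field_simps)
  have "a \<le> b" unfolding a_def b_def using q(2) by (intro divide_right_mono) auto
  consider "i + 1 \<le> 0" | "0 \<le> i \<and> i + 1 \<le> q" | "q \<le> i \<and> i + 1 \<le> 2 * q" | "2 * q \<le> i" by linarith
  then have "b \<le> 0 \<or> (0 \<le> a \<and> b \<le> 1/2) \<or> (1/2 \<le> a \<and> b \<le> 1) \<or> 1 \<le> a"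
  proof cases
    case 1
    then have "real_of_int i + 1 \<le> 0" by linarith
    then show ?thesis using q(2) by (simp add: b_def divide_le_0_iff)
  next
    case 2
    then have "0 \<le> real_of_int i" "real_of_int i + 1 \<le> Q" using q(1) by linarith+
    then show ?thesis using q(2) by (simp add: a_def b_def field_simps)
  next
    case 3
    then have "Q \<le> real_of_int i" "real_of_int i + 1 \<le> 2 * Q" using q(1) by linarith+
    then show ?thesis using q(2) by (simp add: a_def b_def field_simps)
  next
    case 4
    then have "2 * Q \<le> real_of_int i" using q(1) by linarith
    then show ?thesis using q(2) by (simp add: a_def field_simps)
  qed
  then show ?thesis
    unfolding ab using \<open>a \<le> b\<close> by (auto simp: hat_def max_def abs_if field_simps)
qed

lemma hat_level_midpoint:
  assumes "n < N"
  shows "hat_level x n ((2 * real k + 1) / 2 ^ (N + 1))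
    = (hat_level x n (real k / 2 ^ N) + hat_level x n ((real k + 1) / 2 ^ N)) / 2"
proof -
  define p where "p = N - n"
  have N: "N = n + p" "1 \<le> p" using assms by (auto simp: p_def)
  have "hat (2 ^ n * ((2 * real k + 1) / 2 ^ (N + 1)) - real m)
    = (hat (2 ^ n * (real k / 2 ^ N) - real m) + hat (2 ^ n * ((real k + 1) / 2 ^ N) - real m)) / 2" for m
  proof -
    let ?i = "int k - int m * 2 ^ p"
    have "2 ^ n * ((2 * real k + 1) / 2 ^ (N + 1)) - real m = (2 * of_int ?i + 1) / 2 ^ (p + 1)"
      "2 ^ n * (real k / 2 ^ N) - real m = of_int ?i / 2 ^ p"
      "2 ^ n * ((real k + 1) / 2 ^ N) - real m = (of_int ?i + 1) / 2 ^ p"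
      by (simp_all add: N power_add field_simps)
    then show ?thesis using hat_midpoint[OF N(2), of ?i] by simp
  qed
  then have e: "(\<Sum>m<2 ^ n. x (2 ^ n + m) * hat (2 ^ n * ((2 * real k + 1) / 2 ^ (N + 1)) - real m))
    = ((\<Sum>m<2 ^ n. x (2 ^ n + m) * hat (2 ^ n * (real k / 2 ^ N) - real m))
     + (\<Sum>m<2 ^ n. x (2 ^ n + m) * hat (2 ^ n * ((real k + 1) / 2 ^ N) - real m))) / 2"
    unfolding sum.distrib[symmetric] sum_divide_distrib
    by (intro sum.cong refl) (simp only: times_divide_eq_right distrib_left)
  show ?thesis unfolding hat_level_def e by (simp only: times_divide_eq_right distrib_left)
qed

lemma hat_level_grid: "N \<le> n \<Longrightarrow> hat_level x n (real k / 2 ^ N) = 0"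
proof -
  assume "N \<le> n"
  then obtain p where n: "n = N + p" using le_Suc_ex by blast
  have "hat (2 ^ n * (real k / 2 ^ N) - real m) = 0" for m
  proof -
    have "2 ^ n * (real k / 2 ^ N) - real m = of_int (2 ^ p * int k - int m)" by (simp add: n power_add)
    then show ?thesis by (simp only: hat_of_int)
  qed
  then show ?thesis by (simp add: hat_level_def)
qed

lemma hat_level_centre:
  assumes k: "k < 2 ^ N"
  shows "hat_level x N ((2 * real k + 1) / 2 ^ (N + 1)) = sqrt ((1/2) ^ N) / 2 * x (2 ^ N + k)"
proof -
  have "hat (2 ^ N * ((2 * real k + 1) / 2 ^ (N + 1)) - real m) = (if m = k then 1 else 0)" for m
  proof -
    have eq: "2 ^ N * ((2 * real k + 1) / 2 ^ (N + 1)) - real m = real k + 1/2 - real m" by (simp add: field_simps)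
    show ?thesis
    proof (cases "m = k")
      case True
      then show ?thesis unfolding eq by (simp add: hat_half)
    next
      case False
      then have "real k + 1 \<le> real m \<or> real m + 1 \<le> real k" by linarith
      then have "hat (real k + 1/2 - real m) = 0" by (intro hat_outside) linarith
      then show ?thesis unfolding eq using False by simp
    qed
  qed
  then show ?thesis using k by (simp add: hat_level_def if_distrib[of "\<lambda>y. _ * y"] cong: if_cong)
qed

lemma levy_path_grid: "levy_path x (real k / 2 ^ N) = x 0 * (real k / 2 ^ N) + (\<Sum>n<N. hat_level x n (real k / 2 ^ N))"
  unfolding levy_path_def by (subst suminf_finite[of "{..<N}"]) (auto simp: hat_level_grid)

definition levy_incr :: "(nat \<Rightarrow> real) \<Rightarrow> nat \<Rightarrow> nat \<Rightarrow> real" where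
  "levy_incr x N k = levy_path x (real (Suc k) / 2 ^ N) - levy_path x (real k / 2 ^ N)"

text \<open>Refining the grid cuts an increment in half and displaces the midpoint by one new coefficient.\<close>

lemma levy_incr_split:
  assumes k: "k < 2 ^ N"
  shows "levy_incr x (Suc N) (2 * k) = levy_incr x N k / 2 + sqrt ((1/2) ^ N) / 2 * x (2 ^ N + k)"
    and "levy_incr x (Suc N) (Suc (2 * k)) = levy_incr x N k / 2 - sqrt ((1/2) ^ N) / 2 * x (2 ^ N + k)"
proof -
  let ?m = "(2 * real k + 1) / 2 ^ (N + 1)"
  have pts: "real (2 * k) / 2 ^ Suc N = real k / 2 ^ N" "real (Suc (Suc (2 * k))) / 2 ^ Suc N = real (Suc k) / 2 ^ N"
    "real (Suc (2 * k)) / 2 ^ Suc N = ?m"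
    by (simp_all add: field_simps)
  have "levy_path x ?m = x 0 * ?m + (\<Sum>n<Suc N. hat_level x n ?m)"
    using levy_path_grid[of x "Suc (2 * k)" "Suc N"] unfolding pts .
  also have "\<dots> = x 0 * ?m + (\<Sum>n<N. hat_level x n ?m) + sqrt ((1/2) ^ N) / 2 * x (2 ^ N + k)"
    using hat_level_centre[OF k, of x] by simp
  also have "(\<Sum>n<N. hat_level x n ?m) = (\<Sum>n<N. (hat_level x n (real k / 2 ^ N) + hat_level x n (real (Suc k) / 2 ^ N)) / 2)"
    by (intro sum.cong refl) (use hat_level_midpoint[of _ N x k] in \<open>simp add: add.commute\<close>)
  also have "x 0 * ?m = (x 0 * (real k / 2 ^ N) + x 0 * (real (Suc k) / 2 ^ N)) / 2"
    by (simp add: field_simps)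
  finally have mid: "levy_path x ?m = (levy_path x (real k / 2 ^ N) + levy_path x (real (Suc k) / 2 ^ N)) / 2
      + sqrt ((1/2) ^ N) / 2 * x (2 ^ N + k)"
    unfolding levy_path_grid by (simp add: sum.distrib sum_divide_distrib[symmetric] add_divide_distrib)
  show "levy_incr x (Suc N) (2 * k) = levy_incr x N k / 2 + sqrt ((1/2) ^ N) / 2 * x (2 ^ N + k)"
    unfolding levy_incr_def pts mid by (simp add: field_simps)
  show "levy_incr x (Suc N) (Suc (2 * k)) = levy_incr x N k / 2 - sqrt ((1/2) ^ N) / 2 * x (2 ^ N + k)"
    unfolding levy_incr_def pts mid by (simp add: field_simps)
qed

lemma sum_even_odd: "(\<Sum>k<2 * m. f k) = (\<Sum>k<m. f (2 * k) + f (Suc (2 * k)))" for f :: "nat \<Rightarrow> real"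
  by (induction m) simp_all

text \<open>The increments on the \<open>N\<close>-th grid are \<open>2\<^bsup>- N/2\<^esup>\<close> times an orthogonal image of the first \<open>2\<^sup>N\<close>
  coefficients. By \<open>levy_incr_split\<close> each refinement is a rotation by 45 degrees of
  the pairs (old increment, new coefficient), up to scaling.\<close>

lemma levy_incr_linear:
  "\<exists>\<alpha>. (\<forall>x. (\<Sum>k<2 ^ N. a k * levy_incr x N k) = (\<Sum>q<2 ^ N. \<alpha> q * x q))
     \<and> (\<Sum>q<2 ^ N. (\<alpha> q)\<^sup>2) = (\<Sum>k<2 ^ N. (a k)\<^sup>2) / 2 ^ N"
proof (induction N arbitrary: a)
  case 0
  have "levy_incr x 0 0 = x 0" for x
    using levy_path_grid[of x 0 0] levy_path_grid[of x 1 0] by (simp add: levy_incr_def)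
  then show ?case by (intro exI[of _ a]) simp
next
  case (Suc N)
  define s where "s = sqrt ((1/2) ^ N) / 2"
  have ss: "s\<^sup>2 = 1 / (4 * 2 ^ N)" by (simp add: s_def power_divide power_one_over)
  define a' where "a' k = (a (2 * k) + a (Suc (2 * k))) / 2" for k
  obtain \<alpha> where \<alpha>: "\<And>x. (\<Sum>k<2 ^ N. a' k * levy_incr x N k) = (\<Sum>q<2 ^ N. \<alpha> q * x q)"
    "(\<Sum>q<2 ^ N. (\<alpha> q)\<^sup>2) = (\<Sum>k<2 ^ N. (a' k)\<^sup>2) / 2 ^ N"
    using Suc.IH[of a'] by blast
  define d where "d k = s * (a (2 * k) - a (Suc (2 * k)))" for k
  define \<gamma> where "\<gamma> q = (if q < 2 ^ N then \<alpha> q else d (q - 2 ^ N))" for q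
  have split: "(\<Sum>q<2 ^ Suc N. g q) = (\<Sum>q<2 ^ N. g q) + (\<Sum>k<2 ^ N. g (2 ^ N + k))" for g :: "nat \<Rightarrow> real"
  proof -
    have "(\<Sum>q<2 ^ Suc N. g q) = (\<Sum>q=0..<2 ^ N. g q) + (\<Sum>q=2 ^ N..<2 ^ N + 2 ^ N. g q)"
      by (subst sum.atLeastLessThan_concat) (auto simp: lessThan_atLeast0 mult_2)
    also have "(\<Sum>q=2 ^ N..<2 ^ N + 2 ^ N. g q) = (\<Sum>k=0..<2 ^ N. g (k + 2 ^ N))"
      using sum.shift_bounds_nat_ivl[of g 0 "2 ^ N" "2 ^ N"] by simp
    finally show ?thesis by (simp add: lessThan_atLeast0 add.commute)
  qed
  have "(\<Sum>k<2 ^ Suc N. a k * levy_incr x (Suc N) k) = (\<Sum>q<2 ^ Suc N. \<gamma> q * x q)" for x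
  proof -
    have "(\<Sum>k<2 ^ Suc N. a k * levy_incr x (Suc N) k)
      = (\<Sum>k<2 ^ N. a (2 * k) * levy_incr x (Suc N) (2 * k) + a (Suc (2 * k)) * levy_incr x (Suc N) (Suc (2 * k)))"
      unfolding power_Suc by (rule sum_even_odd)
    also have "\<dots> = (\<Sum>k<2 ^ N. a' k * levy_incr x N k + d k * x (2 ^ N + k))"
    proof (intro sum.cong refl)
      fix k assume "k \<in> {..<(2::nat) ^ N}"
      then have k: "k < 2 ^ N" by simp
      show "a (2 * k) * levy_incr x (Suc N) (2 * k) + a (Suc (2 * k)) * levy_incr x (Suc N) (Suc (2 * k))
          = a' k * levy_incr x N k + d k * x (2 ^ N + k)"
        unfolding levy_incr_split[OF k] a'_def d_def s_def[symmetric] by (simp add: field_simps)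
    qed
    also have "\<dots> = (\<Sum>q<2 ^ N. \<alpha> q * x q) + (\<Sum>k<2 ^ N. d k * x (2 ^ N + k))" by (simp add: sum.distrib \<alpha>(1))
    also have "\<dots> = (\<Sum>q<2 ^ Suc N. \<gamma> q * x q)" unfolding split by (simp add: \<gamma>_def)
    finally show ?thesis .
  qed
  moreover have "(\<Sum>q<2 ^ Suc N. (\<gamma> q)\<^sup>2) = (\<Sum>k<2 ^ Suc N. (a k)\<^sup>2) / 2 ^ Suc N"
  proof -
    have "(\<Sum>q<2 ^ Suc N. (\<gamma> q)\<^sup>2) = (\<Sum>q<2 ^ N. (\<alpha> q)\<^sup>2) + (\<Sum>k<2 ^ N. (d k)\<^sup>2)" unfolding split by (simp add: \<gamma>_def)
    also have "\<dots> = (\<Sum>k<2 ^ N. (a' k)\<^sup>2 / 2 ^ N + (d k)\<^sup>2)" by (simp add: \<alpha>(2) sum.distrib sum_divide_distrib)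
    also have "\<dots> = (\<Sum>k<2 ^ N. ((a (2 * k))\<^sup>2 + (a (Suc (2 * k)))\<^sup>2) / 2 ^ Suc N)"
    proof (intro sum.cong refl)
      fix k
      have "(d k)\<^sup>2 = 1 / (4 * 2 ^ N) * (a (2 * k) - a (Suc (2 * k)))\<^sup>2"
        unfolding d_def power_mult_distrib ss ..
      then show "(a' k)\<^sup>2 / 2 ^ N + (d k)\<^sup>2 = ((a (2 * k))\<^sup>2 + (a (Suc (2 * k)))\<^sup>2) / 2 ^ Suc N"
        by (simp add: a'_def field_simps power2_eq_square)
    qed
    also have "\<dots> = (\<Sum>k<2 ^ Suc N. (a k)\<^sup>2) / 2 ^ Suc N"
      unfolding power_Suc[of "2::nat"] sum_even_odd by (simp add: sum_divide_distrib)
    finally show ?thesis .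
  qed
  ultimately show ?case by blast
qed

text \<open>At a given time at most one tent of the level contributes, and its coefficient is bounded through the sum
  of fourth powers: \<open>(1/4)\<^sup>n \<cdot> C \<cdot> (8/3)\<^sup>n = C \<cdot> (2/3)\<^sup>n\<close> bounds the fourth power of the level.\<close>

lemma hat_level_bound:
  assumes C: "(3/8) ^ n * (\<Sum>k<2 ^ n. (x (2 ^ n + k)) ^ 4) \<le> C"
  shows "\<bar>hat_level x n u\<bar> \<le> root 4 C * root 4 (2/3) ^ n"
proof -
  let ?v = "2 ^ n * u"
  define k0 where "k0 = nat \<lfloor>?v\<rfloor>"
  define y where "y = (if k0 < 2 ^ n then x (2 ^ n + k0) * hat (?v - real k0) else 0)"
  have z: "hat (?v - real k) = 0" if "k \<noteq> k0" for k
  proof -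
    have "?v \<le> real k \<or> real k + 1 \<le> ?v"
    proof (rule ccontr)
      assume "\<not> (?v \<le> real k \<or> real k + 1 \<le> ?v)"
      then have "\<lfloor>?v\<rfloor> = int k" by (intro floor_unique) auto
      then show False using that by (simp add: k0_def)
    qed
    then show ?thesis by (intro hat_outside) auto
  qed
  have "(\<Sum>k<2 ^ n. x (2 ^ n + k) * hat (?v - real k)) = (\<Sum>k<2 ^ n. if k = k0 then x (2 ^ n + k0) * hat (?v - real k0) else 0)"
    by (intro sum.cong refl) (simp add: z)
  then have lev: "hat_level x n u = sqrt ((1/2) ^ n) / 2 * y" by (simp add: hat_level_def y_def)
  have "y ^ 4 \<le> (\<Sum>k<2 ^ n. (x (2 ^ n + k)) ^ 4)"
  proof (cases "k0 < 2 ^ n")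
    case True
    have "y ^ 4 = (x (2 ^ n + k0)) ^ 4 * (hat (?v - real k0)) ^ 4" using True by (simp add: y_def power_mult_distrib)
    also have "\<dots> \<le> (x (2 ^ n + k0)) ^ 4 * 1"
      using hat_bounds by (intro mult_left_mono power_le_one) (auto simp: zero_le_even_power)
    also have "\<dots> \<le> (\<Sum>k<2 ^ n. (x (2 ^ n + k)) ^ 4)"
      using True by (simp, intro member_le_sum) (auto simp: zero_le_even_power)
    finally show ?thesis .
  next
    case False
    then show ?thesis by (simp add: y_def sum_nonneg zero_le_even_power)
  qed
  then have "(3/8) ^ n * y ^ 4 \<le> C" using C by (meson mult_left_mono order_trans zero_le_divide_iff zero_le_numeral zero_le_power)
  then have "y ^ 4 * (1/4) ^ n \<le> C * (2/3) ^ n"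
    by (simp add: power_divide field_simps power_mult_distrib[symmetric])
  moreover have "(hat_level x n u) ^ 4 = y ^ 4 * (1/4) ^ n / 16"
  proof -
    have "(sqrt ((1/2) ^ n)) ^ 4 = ((sqrt ((1/2) ^ n))\<^sup>2)\<^sup>2" by (simp add: power2_eq_square power4_eq_xxxx)
    also have "\<dots> = (1/4) ^ n" by (simp add: power2_eq_square power_mult_distrib[symmetric])
    finally show ?thesis unfolding lev by (simp add: power_mult_distrib power_divide mult.commute)
  qed
  moreover have "0 \<le> y ^ 4 * (1/4) ^ n" by (simp add: zero_le_even_power)
  ultimately have "(hat_level x n u) ^ 4 \<le> C * (2/3) ^ n" by linarith
  then have "\<bar>hat_level x n u\<bar> ^ 4 \<le> C * (2/3) ^ n" by (simp add: power_even_abs)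
  then have "root 4 (\<bar>hat_level x n u\<bar> ^ 4) \<le> root 4 (C * (2/3) ^ n)" by simp
  moreover have "root 4 (\<bar>hat_level x n u\<bar> ^ 4) = \<bar>hat_level x n u\<bar>" by (rule real_root_pos2) auto
  moreover have "root 4 (C * (2/3) ^ n) = root 4 C * root 4 (2/3) ^ n"
    by (simp add: real_root_mult real_root_power)
  ultimately show ?thesis by simp
qed

lemma levy_path_continuous:
  assumes "tame x"
  shows "continuous_on UNIV (levy_path x)"
proof -
  obtain C :: nat where C: "\<And>n. (3/8) ^ n * (\<Sum>k<2 ^ n. (x (2 ^ n + k)) ^ 4) \<le> real C"
    using assms by (auto simp: tame_def)
  have rho: "0 \<le> root 4 (2/3::real)" "root 4 (2/3::real) < 1"
    using real_root_less_mono[of 4 "2/3" 1] by auto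
  have "summable (\<lambda>n. root 4 (real C) * root 4 (2/3) ^ n)"
    using rho by (intro summable_mult summable_geometric) auto
  then have "uniform_limit UNIV (\<lambda>n u. \<Sum>i<n. hat_level x i u) (\<lambda>u. \<Sum>i. hat_level x i u) sequentially"
    using hat_level_bound[OF C] by (intro Weierstrass_m_test) auto
  then have "continuous_on UNIV (\<lambda>u. \<Sum>i. hat_level x i u)"
  proof (rule uniform_limit_theorem[rotated])
    show "\<forall>\<^sub>F n in sequentially. continuous_on UNIV (\<lambda>u. \<Sum>i<n. hat_level x i u)"
      unfolding hat_level_def hat_def by (intro always_eventually allI continuous_intros)
  qed simp
  then show ?thesis unfolding levy_path_def[abs_def] by (intro continuous_intros)
qed

lemma sum_sum_restrict:
  fixes h :: "'a \<Rightarrow> 'b \<Rightarrow> 'c::comm_monoid_add"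
  assumes "finite U" "D \<subseteq> U" "finite L" "K \<subseteq> L"
  shows "(\<Sum>k\<in>U. \<Sum>j\<in>L. if k \<in> D \<and> j \<in> K then h k j else 0) = (\<Sum>k\<in>D. \<Sum>j\<in>K. h k j)"
proof -
  have "(\<Sum>j\<in>L. if k \<in> D \<and> j \<in> K then h k j else 0) = (if k \<in> D then \<Sum>j\<in>K. h k j else 0)" for k
    using sum.inter_restrict[OF assms(3), of "h k" K] assms(4) by (simp add: Int_absorb1)
  then show ?thesis
    using sum.inter_restrict[OF assms(1), of "\<lambda>k. \<Sum>j\<in>K. h k j" D] assms(2) by (simp add: Int_absorb1)
qed

section \<open>Brownian families from Gaussian noise\<close>

text \<open>If the vector \<open>Y\<close> is standard Gaussian and independent of \<open>S\<close> under the weight \<open>f\<close>, in the sense of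
  characteristic functions, then indicators of \<open>Y\<close> factor out of the characteristic function of \<open>S\<close>.
  Real and imaginary part are obtained from \<open>gaussian_vector_from_char\<close> for the weights \<open>f (1 + cos S)\<close> and
  \<open>f (1 + sin S)\<close>.\<close>

lemma gaussian_vector_factor:
  fixes f S :: "'w \<Rightarrow> real" and Y :: "'i \<Rightarrow> 'w \<Rightarrow> real"
  assumes J: "finite J"
    and Y: "\<And>j. j \<in> J \<Longrightarrow> Y j \<in> borel_measurable M" and S[measurable]: "S \<in> borel_measurable M"
    and f: "integrable M f" and f_nonneg: "\<And>\<omega>. \<omega> \<in> space M \<Longrightarrow> 0 \<le> f \<omega>"
    and char: "\<And>l u. (LINT \<omega>|M. f \<omega> *\<^sub>R iexp ((\<Sum>j\<in>J. l j * Y j \<omega>) + u * S \<omega>))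
          = complex_of_real (c * exp (- (\<Sum>j\<in>J. (l j)\<^sup>2) / 2) * \<psi> u)"
    and \<psi>: "\<psi> 0 = 1" "\<psi> (- 1) = \<psi> 1"
    and C: "\<And>j. j \<in> J \<Longrightarrow> C j \<in> sets borel"
  shows "(LINT \<omega>|M. (f \<omega> * (\<Prod>j\<in>J. indicator (C j) (Y j \<omega>))) *\<^sub>R iexp (S \<omega>))
          = complex_of_real (c * (\<Prod>j\<in>J. measure std_normal_distribution (C j)) * \<psi> 1)"
proof -
  have [measurable]: "f \<in> borel_measurable M" using f by auto
  define s where "s = (\<Prod>j\<in>J. measure std_normal_distribution (C j))"
  define I where "I \<omega> = (\<Prod>j\<in>J. indicator (C j) (Y j \<omega>) :: real)" for \<omega>
  have I_meas[measurable]: "I \<in> borel_measurable M"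
    unfolding I_def[abs_def]
    by (intro borel_measurable_prod measurable_compose[OF Y borel_measurable_indicator[OF C]])
  have I_bnd: "0 \<le> I \<omega>" "I \<omega> \<le> 1" for \<omega>
    unfolding I_def by (auto intro!: prod_nonneg prod_le_1 simp: indicator_def)
  let ?L = "\<lambda>l \<omega>. \<Sum>j\<in>J. l j * Y j \<omega>"
  define q where "q l = exp (- (\<Sum>j\<in>J. (l j :: real)\<^sup>2) / 2)" for l
  have L_meas[measurable]: "?L l \<in> borel_measurable M" for l using Y by measurable
  have int_b: "integrable M (\<lambda>\<omega>. f \<omega> * g \<omega>)" if "g \<in> borel_measurable M" "\<And>\<omega>. \<bar>g \<omega>\<bar> \<le> 2" for g
    by (rule Bochner_Integration.integrable_bound[where f="\<lambda>\<omega>. 2 * f \<omega>"])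
       (use f that in \<open>auto simp: abs_mult mult.commute intro!: AE_I2 mult_left_mono\<close>)
  have iint: "integrable M (\<lambda>\<omega>. f \<omega> *\<^sub>R iexp (X \<omega>))" if "X \<in> borel_measurable M" for X
    using f that by (rule integrable_scaleR_iexp)
  have c0: "(LINT \<omega>|M. f \<omega> *\<^sub>R iexp (?L l \<omega>)) = complex_of_real (c * q l)" for l
    using char[of l 0] by (simp add: \<psi> q_def)
  have c1: "(LINT \<omega>|M. f \<omega> *\<^sub>R iexp (?L l \<omega> + S \<omega>)) = complex_of_real (c * q l * \<psi> 1)"
    "(LINT \<omega>|M. f \<omega> *\<^sub>R iexp (?L l \<omega> - S \<omega>)) = complex_of_real (c * q l * \<psi> 1)" for l
    using char[of l 1] char[of l "-1"] by (simp_all add: \<psi> q_def)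
  have fc: "(f \<omega> * cos (S \<omega>)) *\<^sub>R iexp (?L l \<omega>) = (1/2) * (f \<omega> *\<^sub>R iexp (?L l \<omega> + S \<omega>) + f \<omega> *\<^sub>R iexp (?L l \<omega> - S \<omega>))" for l \<omega>
    by (intro complex_eqI) (simp_all add: Re_exp Im_exp cos_add sin_add cos_diff sin_diff algebra_simps add_divide_distrib diff_divide_distrib)
  have fs: "(f \<omega> * sin (S \<omega>)) *\<^sub>R iexp (?L l \<omega>) = (- \<i> / 2) * (f \<omega> *\<^sub>R iexp (?L l \<omega> + S \<omega>) - f \<omega> *\<^sub>R iexp (?L l \<omega> - S \<omega>))" for l \<omega>
    by (intro complex_eqI) (simp_all add: Re_exp Im_exp cos_add sin_add cos_diff sin_diff algebra_simps add_divide_distrib diff_divide_distrib)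
  have cosE: "(LINT \<omega>|M. (f \<omega> * cos (S \<omega>)) *\<^sub>R iexp (?L l \<omega>)) = complex_of_real (c * q l * \<psi> 1)" for l
    unfolding fc by (subst integral_mult_right_zero, subst Bochner_Integration.integral_add, (intro iint; measurable)+, simp only: c1, simp)
  have sinE: "(LINT \<omega>|M. (f \<omega> * sin (S \<omega>)) *\<^sub>R iexp (?L l \<omega>)) = 0" for l
    unfolding fs by (subst integral_mult_right_zero, subst Bochner_Integration.integral_diff, (intro iint; measurable)+, simp only: c1, simp)
  have int: "integrable M (\<lambda>\<omega>. (f \<omega> * cos (S \<omega>)) *\<^sub>R iexp (?L l \<omega>))" "integrable M (\<lambda>\<omega>. (f \<omega> * sin (S \<omega>)) *\<^sub>R iexp (?L l \<omega>))" for l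
    by (intro integrable_scaleR_iexp int_b L_meas; auto intro: order_trans[OF abs_cos_le_one] order_trans[OF abs_sin_le_one])+
  have nn: "0 \<le> 1 + cos x" "1 + cos x \<le> 2" "0 \<le> 1 + sin x" "1 + sin x \<le> 2" for x :: real
    using cos_ge_minus_one[of x] sin_ge_minus_one[of x] cos_le_one[of x] sin_le_one[of x] by linarith+
  have E0: "(LINT \<omega>|M. f \<omega> * I \<omega>) = c * s"
    unfolding I_def s_def by (rule gaussian_vector_from_char[OF J Y f f_nonneg _ C]) (simp_all only: c0 q_def)
  have Ec: "(LINT \<omega>|M. (f \<omega> * (1 + cos (S \<omega>))) * I \<omega>) = (c + c * \<psi> 1) * s"
    unfolding I_def s_def
  proof (rule gaussian_vector_from_char[OF J Y _ _ _ C])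
    show "integrable M (\<lambda>\<omega>. f \<omega> * (1 + cos (S \<omega>)))" using nn by (intro int_b) (auto simp: abs_of_nonneg)
    show "0 \<le> f \<omega> * (1 + cos (S \<omega>))" if "\<omega> \<in> space M" for \<omega> using f_nonneg[OF that] nn by simp
    show "(LINT \<omega>|M. (f \<omega> * (1 + cos (S \<omega>))) *\<^sub>R iexp (?L l \<omega>)) = complex_of_real ((c + c * \<psi> 1) * exp (- (\<Sum>j\<in>J. (l j)\<^sup>2) / 2))" for l
      using Bochner_Integration.integral_add[OF iint[OF L_meas[of l]] int(1)[of l]]
      by (simp only: cosE c0 q_def) (simp add: algebra_simps)
  qed
  have Es: "(LINT \<omega>|M. (f \<omega> * (1 + sin (S \<omega>))) * I \<omega>) = c * s"
    unfolding I_def s_def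
  proof (rule gaussian_vector_from_char[OF J Y _ _ _ C])
    show "integrable M (\<lambda>\<omega>. f \<omega> * (1 + sin (S \<omega>)))" using nn by (intro int_b) (auto simp: abs_of_nonneg)
    show "0 \<le> f \<omega> * (1 + sin (S \<omega>))" if "\<omega> \<in> space M" for \<omega> using f_nonneg[OF that] nn by simp
    show "(LINT \<omega>|M. (f \<omega> * (1 + sin (S \<omega>))) *\<^sub>R iexp (?L l \<omega>)) = complex_of_real (c * exp (- (\<Sum>j\<in>J. (l j)\<^sup>2) / 2))" for l
      using Bochner_Integration.integral_add[OF iint[OF L_meas[of l]] int(2)[of l]]
      by (simp only: sinE c0 q_def) (simp add: algebra_simps)
  qed
  have i3: "integrable M (\<lambda>\<omega>. f \<omega> * I \<omega>)" "integrable M (\<lambda>\<omega>. f \<omega> * (cos (S \<omega>) * I \<omega>))" "integrable M (\<lambda>\<omega>. f \<omega> * (sin (S \<omega>) * I \<omega>))"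
  proof -
    have I1: "\<bar>I \<omega>\<bar> \<le> 1" for \<omega> using I_bnd[of \<omega>] by simp
    have "\<bar>I \<omega>\<bar> \<le> 2" "\<bar>cos x * I \<omega>\<bar> \<le> 2" "\<bar>sin x * I \<omega>\<bar> \<le> 2" for x \<omega>
      using I1[of \<omega>] mult_mono[OF abs_cos_le_one[of x] I1[of \<omega>]] mult_mono[OF abs_sin_le_one[of x] I1[of \<omega>]]
      by (simp_all add: abs_mult)
    note bnd = this
    show "integrable M (\<lambda>\<omega>. f \<omega> * I \<omega>)" by (rule int_b[OF _ bnd(1)]) measurable
    show "integrable M (\<lambda>\<omega>. f \<omega> * (cos (S \<omega>) * I \<omega>))" by (rule int_b[OF _ bnd(2)]) measurable
    show "integrable M (\<lambda>\<omega>. f \<omega> * (sin (S \<omega>) * I \<omega>))" by (rule int_b[OF _ bnd(3)]) measurable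
  qed
  have cosI: "(LINT \<omega>|M. (f \<omega> * I \<omega>) * cos (S \<omega>)) = c * s * \<psi> 1"
    using Ec E0 Bochner_Integration.integral_add[OF i3(1,2)] by (simp add: algebra_simps)
  have sinI: "(LINT \<omega>|M. (f \<omega> * I \<omega>) * sin (S \<omega>)) = 0"
    using Es E0 Bochner_Integration.integral_add[OF i3(1,3)] by (simp add: algebra_simps)
  have "(LINT \<omega>|M. (f \<omega> * I \<omega>) *\<^sub>R iexp (S \<omega>)) = complex_of_real (c * s * \<psi> 1)"
  proof (rule complex_eqI)
    have ii: "integrable M (\<lambda>\<omega>. (f \<omega> * I \<omega>) *\<^sub>R iexp (S \<omega>))" by (intro integrable_scaleR_iexp i3 S)
    have re: "Re (r *\<^sub>R iexp x) = r * cos x" "Im (r *\<^sub>R iexp x) = r * sin x" for r x by (simp_all add: Re_exp Im_exp)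
    show "Re (LINT \<omega>|M. (f \<omega> * I \<omega>) *\<^sub>R iexp (S \<omega>)) = Re (complex_of_real (c * s * \<psi> 1))"
      unfolding integral_Re[OF ii, symmetric] re cosI Re_complex_of_real ..
    show "Im (LINT \<omega>|M. (f \<omega> * I \<omega>) *\<^sub>R iexp (S \<omega>)) = Im (complex_of_real (c * s * \<psi> 1))"
      unfolding integral_Im[OF ii, symmetric] re sinI Im_complex_of_real ..
  qed
  then show ?thesis unfolding I_def s_def .
qed

text \<open>For fixed \<open>X\<close> and \<open>z\<close> the events on which the characteristic function factors form a Dynkin system.\<close>

lemma (in prob_space) char_factor_dynkin:
  fixes X :: "'a \<Rightarrow> real"
  assumes X[measurable]: "X \<in> borel_measurable M" and D: "D \<in> events"
    and G: "Int_stable G" "G \<subseteq> events"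
    and base: "(LINT \<omega>|M. indicator D \<omega> *\<^sub>R iexp (X \<omega>)) = complex_of_real (prob D) * z"
    and gen: "\<And>A. A \<in> G \<Longrightarrow> (LINT \<omega>|M. indicator (D \<inter> A) \<omega> *\<^sub>R iexp (X \<omega>)) = complex_of_real (prob (D \<inter> A)) * z"
    and A: "A \<in> sigma_sets (space M) G"
  shows "(LINT \<omega>|M. indicator (D \<inter> A) \<omega> *\<^sub>R iexp (X \<omega>)) = complex_of_real (prob (D \<inter> A)) * z"
proof -
  let ?P = "\<lambda>A. (LINT \<omega>|M. indicator (D \<inter> A) \<omega> *\<^sub>R iexp (X \<omega>)) = complex_of_real (prob (D \<inter> A)) * z"
  have sub: "sigma_sets (space M) G \<subseteq> events" using G(2) by (rule sets.sigma_sets_subset)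
  have int: "integrable M (\<lambda>\<omega>. indicator E \<omega> *\<^sub>R iexp (X \<omega>))" if "E \<in> events" for E
    using that by (intro integrable_scaleR_iexp) (auto simp: emeasure_eq_measure)
  have G': "G \<subseteq> Pow (space M)" using G(2) sets.sets_into_space by auto
  from G(1) G' A show ?thesis
  proof (induction A rule: sigma_sets_induct_disjoint)
    case (basic A)
    then show ?case by (rule gen)
  next
    case empty
    then show ?case by simp
  next
    case (compl A)
    have AE: "A \<in> events" using compl sub by auto
    have ind: "indicator (D \<inter> (space M - A)) \<omega> *\<^sub>R iexp (X \<omega>) = indicator D \<omega> *\<^sub>R iexp (X \<omega>) - indicator (D \<inter> A) \<omega> *\<^sub>R iexp (X \<omega>)"
      if "\<omega> \<in> space M" for \<omega>
      using that by (auto simp: indicator_def)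
    have "(LINT \<omega>|M. indicator (D \<inter> (space M - A)) \<omega> *\<^sub>R iexp (X \<omega>))
        = (LINT \<omega>|M. indicator D \<omega> *\<^sub>R iexp (X \<omega>) - indicator (D \<inter> A) \<omega> *\<^sub>R iexp (X \<omega>))"
      by (intro Bochner_Integration.integral_cong refl ind)
    also have "\<dots> = complex_of_real (prob D) * z - complex_of_real (prob (D \<inter> A)) * z"
      using D AE by (subst Bochner_Integration.integral_diff) (auto intro!: int simp: base compl)
    also have "\<dots> = complex_of_real (prob D - prob (D \<inter> A)) * z" by (simp add: left_diff_distrib)
    also have "prob D - prob (D \<inter> A) = prob (D \<inter> (space M - A))"
    proof -
      have "D \<inter> (space M - A) = D - (D \<inter> A)" using sets.sets_into_space[OF D] by auto
      then show ?thesis using D AE by (simp add: finite_measure_Diff)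
    qed
    finally show ?case .
  next
    case (union A)
    have AE: "A i \<in> events" for i using union sub by auto
    have fin: "?P (\<Union>i<n. A i)" for n :: nat
    proof (induction n)
      case (Suc n)
      have disj: "(\<Union>i<n. A i) \<inter> A n = {}"
      proof -
        have "A i \<inter> A n = {}" if "i < n" for i using union(1) that by (simp add: disjoint_family_on_def)
        then show ?thesis by blast
      qed
      have un: "D \<inter> (\<Union>i<Suc n. A i) = (D \<inter> (\<Union>i<n. A i)) \<union> (D \<inter> A n)" by (auto simp: less_Suc_eq)
      have ind: "indicator (D \<inter> (\<Union>i<Suc n. A i)) \<omega> *\<^sub>R iexp (X \<omega>)
          = indicator (D \<inter> (\<Union>i<n. A i)) \<omega> *\<^sub>R iexp (X \<omega>) + indicator (D \<inter> A n) \<omega> *\<^sub>R iexp (X \<omega>)" for \<omega>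
        unfolding un using disj by (auto simp: indicator_def)
      have m: "D \<inter> (\<Union>i<n. A i) \<in> events" "D \<inter> A n \<in> events" using D AE by auto
      have "prob (D \<inter> (\<Union>i<Suc n. A i)) = prob (D \<inter> (\<Union>i<n. A i)) + prob (D \<inter> A n)"
        unfolding un using m disj by (intro finite_measure_Union) auto
      then show ?case
        unfolding ind using Suc union(3)[of n] m by (simp add: int distrib_right)
    qed simp
    have lim: "(\<lambda>n. LINT \<omega>|M. indicator (D \<inter> (\<Union>i<n. A i)) \<omega> *\<^sub>R iexp (Y \<omega>)) \<longlonglongrightarrow> (LINT \<omega>|M. indicator (D \<inter> (\<Union>i. A i)) \<omega> *\<^sub>R iexp (Y \<omega>))"
      if [measurable]: "Y \<in> borel_measurable M" for Y
    proof (rule integral_dominated_convergence[where w="\<lambda>_. 1"])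
      show "AE \<omega> in M. (\<lambda>n. indicator (D \<inter> (\<Union>i<n. A i)) \<omega> *\<^sub>R iexp (Y \<omega>)) \<longlonglongrightarrow> indicator (D \<inter> (\<Union>i. A i)) \<omega> *\<^sub>R iexp (Y \<omega>)"
      proof (rule AE_I2)
        fix \<omega>
        have "(\<lambda>n. indicator D \<omega> * indicator (\<Union>i<n. A i) \<omega> :: real) \<longlonglongrightarrow> indicator D \<omega> * indicator (\<Union>i. A i) \<omega>"
          by (intro tendsto_intros LIMSEQ_indicator_UN)
        then show "(\<lambda>n. indicator (D \<inter> (\<Union>i<n. A i)) \<omega> *\<^sub>R iexp (Y \<omega>)) \<longlonglongrightarrow> indicator (D \<inter> (\<Union>i. A i)) \<omega> *\<^sub>R iexp (Y \<omega>)"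
          unfolding indicator_inter_arith by (rule tendsto_scaleR) (rule tendsto_const)
      qed
      have "D \<inter> (\<Union>i. A i) \<in> events" "D \<inter> (\<Union>i<n. A i) \<in> events" for n :: nat using D AE by auto
      then show "(\<lambda>\<omega>. indicator (D \<inter> (\<Union>i. A i)) \<omega> *\<^sub>R iexp (Y \<omega>)) \<in> borel_measurable M"
        "(\<lambda>\<omega>. indicator (D \<inter> (\<Union>i<n. A i)) \<omega> *\<^sub>R iexp (Y \<omega>)) \<in> borel_measurable M" for n :: nat
        by measurable
    qed (auto simp: indicator_def)
    have eqp: "(LINT \<omega>|M. indicator E \<omega> *\<^sub>R iexp 0) = complex_of_real (prob E)" if "E \<in> events" for E
      using that by (simp add: scaleR_conv_of_real)
    have "D \<inter> (\<Union>i. A i) \<in> events" "D \<inter> (\<Union>i<n. A i) \<in> events" for n :: nat using D AE by auto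
    then have "(\<lambda>n. complex_of_real (prob (D \<inter> (\<Union>i<n. A i)))) \<longlonglongrightarrow> complex_of_real (prob (D \<inter> (\<Union>i. A i)))"
      using lim[of "\<lambda>_. 0"] by (simp only: eqp borel_measurable_const)
    then have "(\<lambda>n. complex_of_real (prob (D \<inter> (\<Union>i<n. A i))) * z) \<longlonglongrightarrow> complex_of_real (prob (D \<inter> (\<Union>i. A i))) * z"
      by (rule tendsto_mult) (rule tendsto_const)
    with lim[OF X] show ?case unfolding fin by (rule LIMSEQ_unique)
  qed
qed

text \<open>Independent standard Gaussian variables \<open>\<xi>\<close> that are independent of \<open>Z\<close>. Each \<open>j\<close> owns a sequence of
  them, from which its path is built.\<close>

locale gaussian_noise = prob_space M for M :: "'w measure" +
  fixes ZM :: "'z measure" and Z :: "'w \<Rightarrow> 'z" and \<xi> :: "'j \<times> nat \<Rightarrow> 'w \<Rightarrow> real" and t\<^sub>0 T :: real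
  assumes t0T: "t\<^sub>0 < T"
    and Z_measurable [measurable]: "Z \<in> measurable M ZM"
    and \<xi>_measurable [measurable]: "\<And>p. \<xi> p \<in> borel_measurable M"
    and noise_char: "\<And>A P \<alpha>. A \<in> sets ZM \<Longrightarrow> finite P \<Longrightarrow>
      (LINT \<omega>|M. indicator (Z -` A \<inter> space M) \<omega> *\<^sub>R iexp (\<Sum>p\<in>P. \<alpha> p * \<xi> p \<omega>))
        = complex_of_real (prob (Z -` A \<inter> space M) * exp (- (\<Sum>p\<in>P. (\<alpha> p)\<^sup>2) / 2))"
begin

definition coords :: "'j \<Rightarrow> 'w \<Rightarrow> nat \<Rightarrow> real" where
  "coords j \<omega> = (\<lambda>q. \<xi> (j, q) \<omega>)"

text \<open>On the null set of sequences that are not tame the path is set to 0, because continuity and the value at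
  \<open>t\<^sub>0\<close> are required for every \<open>\<omega>\<close>.\<close>

definition BM :: "'j \<Rightarrow> real \<Rightarrow> 'w \<Rightarrow> real" where
  "BM j t \<omega> = (if tame (coords j \<omega>) then sqrt (T - t\<^sub>0) * levy_path (coords j \<omega>) ((t - t\<^sub>0) / (T - t\<^sub>0)) else 0)"

text \<open>The filtration generated by the paths, enlarged by \<open>Z\<close> at the initial time.\<close>

definition noise_sets :: "real \<Rightarrow> 'w set set" where
  "noise_sets t = {Z -` A \<inter> space M | A. A \<in> sets ZM} \<union> {BM j u -` C \<inter> space M | j u C. u \<in> {t\<^sub>0..t} \<and> C \<in> sets borel}"

definition noise_filtration :: "real \<Rightarrow> 'w measure" where
  "noise_filtration t = sigma (space M) (noise_sets t)"

lemma space_ZM: "Z -` space ZM \<inter> space M = space M"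
  using measurable_space[OF Z_measurable] by auto

lemma \<xi>_law: "distr M borel (\<xi> p) = std_normal_distribution"
proof (rule Levy_uniqueness)
  show "real_distribution (distr M borel (\<xi> p))" by (rule real_distribution_distr) simp
  show "real_distribution std_normal_distribution" by (rule real_dist_normal_dist)
  show "char (distr M borel (\<xi> p)) = char std_normal_distribution"
  proof
    fix u
    have "char (distr M borel (\<xi> p)) u = (LINT \<omega>|M. iexp (u * \<xi> p \<omega>))"
      unfolding char_def by (subst integral_distr) auto
    also have "\<dots> = (LINT \<omega>|M. indicator (Z -` space ZM \<inter> space M) \<omega> *\<^sub>R iexp (\<Sum>p\<in>{p}. u * \<xi> p \<omega>))"
      unfolding space_ZM by (intro Bochner_Integration.integral_cong refl) simp
    also have "\<dots> = complex_of_real (exp (- u\<^sup>2 / 2))"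
      using noise_char[of "space ZM" "{p}" "\<lambda>_. u"] unfolding space_ZM by (simp add: prob_space)
    finally show "char (distr M borel (\<xi> p)) u = char std_normal_distribution u"
      by (simp add: char_std_normal_distribution)
  qed
qed

lemma \<xi>_fourth_moment: "(\<integral>\<^sup>+\<omega>. ennreal ((\<xi> p \<omega>) ^ 4) \<partial>M) = 3"
proof -
  have 4: "has_bochner_integral lborel (\<lambda>x. std_normal_density x * x ^ 4) (3::real)"
    using std_normal_moment_even[of 2] by (simp add: fact_numeral)
  have "(\<integral>\<^sup>+\<omega>. ennreal ((\<xi> p \<omega>) ^ 4) \<partial>M) = (\<integral>\<^sup>+x. ennreal (x ^ 4) \<partial>distr M borel (\<xi> p))"
    by (subst nn_integral_distr) auto
  also have "\<dots> = (\<integral>\<^sup>+x. ennreal (std_normal_density x * x ^ 4) \<partial>lborel)"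
    unfolding \<xi>_law by (subst nn_integral_density) (auto simp: ennreal_mult' normal_density_nonneg)
  also have "\<dots> = ennreal 3"
    using 4 by (subst nn_integral_eq_integral) (auto simp: has_bochner_integral_iff normal_density_nonneg zero_le_even_power)
  finally show ?thesis by simp
qed

lemma AE_tame: "AE \<omega> in M. tame (coords j \<omega>)"
proof -
  define f where "f n \<omega> = (3/8) ^ n * (\<Sum>k<2 ^ n. (\<xi> (j, 2 ^ n + k) \<omega>) ^ 4)" for n \<omega>
  have f_nonneg: "0 \<le> f n \<omega>" for n \<omega> by (simp add: f_def sum_nonneg zero_le_even_power)
  have f_meas[measurable]: "f n \<in> borel_measurable M" for n unfolding f_def[abs_def] by measurable
  have "(\<integral>\<^sup>+\<omega>. ennreal (f n \<omega>) \<partial>M) = ennreal (3 * (3/4) ^ n)" for n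
  proof -
    have "(\<integral>\<^sup>+\<omega>. ennreal (f n \<omega>) \<partial>M) = (\<integral>\<^sup>+\<omega>. ennreal ((3/8) ^ n) * (\<Sum>k<2 ^ n. ennreal ((\<xi> (j, 2 ^ n + k) \<omega>) ^ 4)) \<partial>M)"
      unfolding f_def by (intro nn_integral_cong) (subst sum_ennreal, auto simp: ennreal_mult sum_nonneg zero_le_even_power)
    also have "\<dots> = ennreal ((3/8) ^ n) * (\<Sum>k<(2::nat) ^ n. 3)"
      by (subst nn_integral_cmult, simp, subst nn_integral_sum) (auto simp: \<xi>_fourth_moment)
    also have "\<dots> = ennreal ((3/8) ^ n) * ennreal (2 ^ n * 3)"
      by (simp add: ennreal_mult ennreal_power[symmetric])
    also have "\<dots> = ennreal ((3/8) ^ n * (2 ^ n * 3))" by (simp add: ennreal_mult)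
    also have "(3/8) ^ n * (2 ^ n * 3) = 3 * (3/4 :: real) ^ n"
      by (simp add: mult.assoc[symmetric] power_mult_distrib[symmetric] mult.commute)
    finally show ?thesis .
  qed
  then have "(\<integral>\<^sup>+\<omega>. (\<Sum>n. ennreal (f n \<omega>)) \<partial>M) = (\<Sum>n. ennreal (3 * (3/4) ^ n))"
    by (subst nn_integral_suminf) auto
  also have "\<dots> = ennreal (\<Sum>n. 3 * (3/4) ^ n)"
    by (intro suminf_ennreal2 summable_mult summable_geometric) auto
  finally have "(\<integral>\<^sup>+\<omega>. (\<Sum>n. ennreal (f n \<omega>)) \<partial>M) \<noteq> \<infinity>" by simp
  then have "AE \<omega> in M. (\<Sum>n. ennreal (f n \<omega>)) \<noteq> \<infinity>"
    by (rule nn_integral_PInf_AE[rotated]) measurable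
  then show ?thesis
  proof eventually_elim
    case (elim \<omega>)
    then obtain s where s: "(\<Sum>n. ennreal (f n \<omega>)) = ennreal s" "0 \<le> s"
      by (cases "(\<Sum>n. ennreal (f n \<omega>))") auto
    have "f n \<omega> \<le> real (nat \<lceil>s\<rceil>)" for n
    proof -
      have "ennreal (f n \<omega>) \<le> (\<Sum>n. ennreal (f n \<omega>))"
        using sum_le_suminf[of "\<lambda>n. ennreal (f n \<omega>)" "{n}"] by simp
      then have "f n \<omega> \<le> s" unfolding s using s(2) by (simp add: ennreal_le_iff)
      then show ?thesis using s(2) by linarith
    qed
    then show ?case unfolding tame_def coords_def f_def by blast
  qed
qed

lemma BM_measurable [measurable]: "BM j t \<in> borel_measurable M"
proof -
  have [measurable]: "{\<omega> \<in> space M. tame (coords j \<omega>)} \<in> sets M"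
    unfolding tame_def coords_def by measurable
  have [measurable]: "(\<lambda>\<omega>. levy_path (coords j \<omega>) u) \<in> borel_measurable M" for u
    unfolding levy_path_def hat_level_def coords_def by measurable
  show ?thesis unfolding BM_def[abs_def] by (intro measurable_If) auto
qed

lemma noise_sets_Z: "A \<in> sets ZM \<Longrightarrow> Z -` A \<inter> space M \<in> noise_sets t"
  unfolding noise_sets_def by blast

lemma noise_sets_BM: "u \<in> {t\<^sub>0..t} \<Longrightarrow> C \<in> sets borel \<Longrightarrow> BM j u -` C \<inter> space M \<in> noise_sets t"
  unfolding noise_sets_def by blast

lemma noise_sets_events: "noise_sets t \<subseteq> events"
  unfolding noise_sets_def by auto

lemma sets_noise_filtration: "sets (noise_filtration t) = sigma_sets (space M) (noise_sets t)"
  and space_noise_filtration: "space (noise_filtration t) = space M"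
  using noise_sets_events[of t] sets.sets_into_space
  by (auto simp: noise_filtration_def intro!: sets_measure_of space_measure_of)

lemma noise_filtration_mono: "r \<le> t \<Longrightarrow> sets (noise_filtration r) \<subseteq> sets (noise_filtration t)"
proof -
  assume "r \<le> t"
  then have "{t\<^sub>0..r} \<subseteq> {t\<^sub>0..t}" by simp
  then have "noise_sets r \<subseteq> noise_sets t" unfolding noise_sets_def by blast
  then show ?thesis unfolding sets_noise_filtration by (rule sigma_sets_mono')
qed

lemma Z_initial: "Z \<in> measurable (noise_filtration t) ZM"
  using measurable_space[OF Z_measurable]
  by (intro measurableI) (auto simp: sets_noise_filtration space_noise_filtration intro!: sigma_sets.Basic noise_sets_Z)

sublocale adapted_family M noise_filtration BM t\<^sub>0 T
proof
  show "t\<^sub>0 < T" by (rule t0T)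
  show "filtered_prob_space t\<^sub>0 T M noise_filtration"
    unfolding filtered_prob_space_def subalgebra_def
    using sets.sigma_sets_subset[OF noise_sets_events] noise_filtration_mono prob_space_axioms
    by (auto simp: space_noise_filtration) (auto simp: sets_noise_filtration)
  show "BM j t \<in> borel_measurable (noise_filtration t)" if "t \<in> {t\<^sub>0..T}" for j t
    using that
    by (intro measurableI) (auto simp: sets_noise_filtration space_noise_filtration intro!: sigma_sets.Basic noise_sets_BM)
  show "BM j t\<^sub>0 \<omega> = 0" for j \<omega>
    using levy_path_grid[of "coords j \<omega>" 0 0] by (simp add: BM_def)
  show "continuous_on {t\<^sub>0..T} (\<lambda>t. BM j t \<omega>)" for j \<omega>
  proof (cases "tame (coords j \<omega>)")
    case True
    have "continuous_on {t\<^sub>0..T} (\<lambda>t. levy_path (coords j \<omega>) ((t - t\<^sub>0) / (T - t\<^sub>0)))"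
      by (rule continuous_on_compose2[OF levy_path_continuous[OF True]]) (use t0T in \<open>auto intro!: continuous_intros\<close>)
    then show ?thesis using True unfolding BM_def by (auto intro!: continuous_intros)
  next
    case False
    then show ?thesis by (simp add: BM_def)
  qed
qed

lemma incr_levy: "tame (coords j \<omega>) \<Longrightarrow> incr n k j \<omega> = sqrt (T - t\<^sub>0) * levy_incr (coords j \<omega>) n k"
proof -
  have "(pt n k - t\<^sub>0) / (T - t\<^sub>0) = real k / 2 ^ n" for k
    using t0T by (simp add: gridpt_def)
  then show "tame (coords j \<omega>) \<Longrightarrow> ?thesis"
    by (simp add: incr_def BM_def levy_incr_def right_diff_distrib del: of_nat_Suc)
qed

text \<open>By \<open>levy_incr_linear\<close> a linear combination of grid increments is one of finitely many \<open>\<xi>\<close>, whose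
  squared coefficients add up to the mesh times those of the combination.\<close>

lemma grid_char:
  assumes J: "finite J" and A: "A \<in> sets ZM"
  shows "(LINT \<omega>|M. indicator (Z -` A \<inter> space M) \<omega> *\<^sub>R iexp (\<Sum>k<2 ^ n. \<Sum>j\<in>J. g k j * incr n k j \<omega>))
    = complex_of_real (prob (Z -` A \<inter> space M) * exp (- (mesh n * (\<Sum>k<2 ^ n. \<Sum>j\<in>J. (g k j)\<^sup>2)) / 2))"
proof -
  have "\<forall>j. \<exists>\<alpha>. (\<forall>x. (\<Sum>k<2 ^ n. g k j * levy_incr x n k) = (\<Sum>q<2 ^ n. \<alpha> q * x q))
     \<and> (\<Sum>q<2 ^ n. (\<alpha> q)\<^sup>2) = (\<Sum>k<2 ^ n. (g k j)\<^sup>2) / 2 ^ n"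
    by (intro allI levy_incr_linear)
  then obtain \<alpha> where \<alpha>: "\<And>j x. (\<Sum>k<2 ^ n. g k j * levy_incr x n k) = (\<Sum>q<2 ^ n. \<alpha> j q * x q)"
    "\<And>j. (\<Sum>q<2 ^ n. (\<alpha> j q)\<^sup>2) = (\<Sum>k<2 ^ n. (g k j)\<^sup>2) / 2 ^ n" by metis
  let ?P = "J \<times> {..<(2::nat) ^ n}"
  define \<gamma> where "\<gamma> p = sqrt (T - t\<^sub>0) * \<alpha> (fst p) (snd p)" for p
  have "AE \<omega> in M. \<forall>j\<in>J. tame (coords j \<omega>)"
    using J AE_tame by (intro AE_finite_allI) auto
  then have eq: "AE \<omega> in M. (\<Sum>k<2 ^ n. \<Sum>j\<in>J. g k j * incr n k j \<omega>) = (\<Sum>p\<in>?P. \<gamma> p * \<xi> p \<omega>)"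
  proof eventually_elim
    case (elim \<omega>)
    have "(\<Sum>k<2 ^ n. \<Sum>j\<in>J. g k j * incr n k j \<omega>) = (\<Sum>j\<in>J. \<Sum>k<2 ^ n. g k j * incr n k j \<omega>)" by (rule sum.swap)
    also have "\<dots> = (\<Sum>j\<in>J. sqrt (T - t\<^sub>0) * (\<Sum>k<2 ^ n. g k j * levy_incr (coords j \<omega>) n k))"
      using elim by (intro sum.cong refl) (simp add: incr_levy sum_distrib_left mult.left_commute)
    also have "\<dots> = (\<Sum>j\<in>J. \<Sum>q<2 ^ n. \<gamma> (j, q) * \<xi> (j, q) \<omega>)"
      unfolding \<alpha> by (simp add: sum_distrib_left \<gamma>_def coords_def mult.assoc)
    also have "\<dots> = (\<Sum>p\<in>?P. \<gamma> p * \<xi> p \<omega>)" by (simp add: sum.cartesian_product case_prod_beta)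
    finally show ?case .
  qed
  have "(LINT \<omega>|M. indicator (Z -` A \<inter> space M) \<omega> *\<^sub>R iexp (\<Sum>k<2 ^ n. \<Sum>j\<in>J. g k j * incr n k j \<omega>))
    = (LINT \<omega>|M. indicator (Z -` A \<inter> space M) \<omega> *\<^sub>R iexp (\<Sum>p\<in>?P. \<gamma> p * \<xi> p \<omega>))"
  proof (intro integral_cong_AE)
    have [measurable]: "Z -` A \<inter> space M \<in> events" using A by measurable
    have [measurable]: "incr n k j \<in> borel_measurable M" for k j unfolding incr_def[abs_def] by measurable
    show "(\<lambda>\<omega>. indicator (Z -` A \<inter> space M) \<omega> *\<^sub>R iexp (\<Sum>k<2 ^ n. \<Sum>j\<in>J. g k j * incr n k j \<omega>)) \<in> borel_measurable M"
      "(\<lambda>\<omega>. indicator (Z -` A \<inter> space M) \<omega> *\<^sub>R iexp (\<Sum>p\<in>?P. \<gamma> p * \<xi> p \<omega>)) \<in> borel_measurable M"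
      by measurable
    show "AE \<omega> in M. indicator (Z -` A \<inter> space M) \<omega> *\<^sub>R iexp (\<Sum>k<2 ^ n. \<Sum>j\<in>J. g k j * incr n k j \<omega>)
        = indicator (Z -` A \<inter> space M) \<omega> *\<^sub>R iexp (\<Sum>p\<in>?P. \<gamma> p * \<xi> p \<omega>)"
      using eq by eventually_elim (simp only:)
  qed
  also have "\<dots> = complex_of_real (prob (Z -` A \<inter> space M) * exp (- (\<Sum>p\<in>?P. (\<gamma> p)\<^sup>2) / 2))"
    using J by (intro noise_char A) simp
  also have "(\<Sum>p\<in>?P. (\<gamma> p)\<^sup>2) = mesh n * (\<Sum>k<2 ^ n. \<Sum>j\<in>J. (g k j)\<^sup>2)"
  proof -
    have "(\<Sum>p\<in>?P. (\<gamma> p)\<^sup>2) = (\<Sum>j\<in>J. \<Sum>q<2 ^ n. (\<gamma> (j, q))\<^sup>2)" by (simp add: sum.cartesian_product case_prod_beta)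
    also have "\<dots> = (\<Sum>j\<in>J. (T - t\<^sub>0) * (\<Sum>q<2 ^ n. (\<alpha> j q)\<^sup>2))"
      using t0T by (simp add: \<gamma>_def power_mult_distrib sum_distrib_left)
    also have "\<dots> = (\<Sum>j\<in>J. mesh n * (\<Sum>k<2 ^ n. (g k j)\<^sup>2))" unfolding \<alpha> by (simp add: mesh_def)
    also have "\<dots> = mesh n * (\<Sum>k<2 ^ n. \<Sum>j\<in>J. (g k j)\<^sup>2)"
      by (subst sum.swap) (simp add: sum_distrib_left)
    finally show ?thesis .
  qed
  finally show ?thesis .
qed

text \<open>On a grid that contains both the times of the past event \<open>E\<close> and the interval \<open>[a, b]\<close>, past and future
  increments are distinct coordinates of one Gaussian vector, independent of \<open>Z\<close>. The probability of the
  event is the same computation for \<open>l = 0\<close>.\<close>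

lemma future_char_rect:
  assumes K: "finite K" and J: "finite J" and ab: "a < b" "b \<le> 2 ^ m" and A: "A \<in> sets ZM"
    and E: "E \<in> increment_rects (pt m a) K (m + p)"
  shows "(LINT \<omega>|M. indicator ((Z -` A \<inter> space M) \<inter> E) \<omega> *\<^sub>R iexp (\<Sum>j\<in>J. l j * (BM j (pt m b) \<omega> - BM j (pt m a) \<omega>)))
    = complex_of_real (prob ((Z -` A \<inter> space M) \<inter> E))
      * complex_of_real (exp (- ((pt m b - pt m a) * (\<Sum>j\<in>J. (l j)\<^sup>2)) / 2))"
proof -
  define n where "n = m + p"
  define a' where "a' = 2 ^ p * a"
  define b' where "b' = 2 ^ p * b"
  have pa: "pt m a = pt n a'" and pb: "pt m b = pt n b'"
    by (simp_all add: n_def a'_def b'_def gridpt_refine)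
  have "2 ^ p * b \<le> 2 ^ p * 2 ^ m" using ab(2) by (intro mult_left_mono) auto
  then have ab': "a' < b'" "b' \<le> 2 ^ n" using ab by (auto simp: a'_def b'_def n_def power_add mult.commute)
  define D where "D = Z -` A \<inter> space M"
  have D[measurable]: "D \<in> events" unfolding D_def using A by measurable
  obtain C where E: "E = {\<omega>\<in>space M. \<forall>k<2 ^ n. \<forall>j\<in>K. pt n (Suc k) \<le> pt m a \<longrightarrow> incr n k j \<omega> \<in> C k j}"
    and C: "\<forall>k j. C k j \<in> sets borel"
    using E unfolding n_def[symmetric] by (rule increment_rectsE)
  have le: "pt n (Suc k) \<le> pt m a \<longleftrightarrow> k < a'" for k
    unfolding pa using gridpt_mono[OF t0T, of "Suc k" a' n] gridpt_strict_mono[OF t0T, of a' "Suc k" n] by (metis Suc_leI not_le not_less_eq)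
  have incr_meas[measurable]: "incr n k j \<in> borel_measurable M" for k j unfolding incr_def[abs_def] by measurable
  define \<sigma> where "\<sigma> = sqrt (mesh n)"
  have \<sigma>: "0 < \<sigma>" "\<sigma>\<^sup>2 = mesh n" using mesh_pos[of n] by (simp_all add: \<sigma>_def)
  let ?I = "{..<a'} \<times> K"
  define Y where "Y q \<omega> = incr n (fst q) (snd q) \<omega> / \<sigma>" for q \<omega>
  define C' where "C' q = (\<lambda>y. \<sigma> * y) -` C (fst q) (snd q)" for q
  have C': "C' q \<in> sets borel" for q
    unfolding C'_def using measurable_sets[of "\<lambda>y. \<sigma> * y" borel borel "C (fst q) (snd q)"] C by simp
  have memE: "\<omega> \<in> E \<longleftrightarrow> (\<forall>q\<in>?I. Y q \<omega> \<in> C' q)" if "\<omega> \<in> space M" for \<omega>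
    using \<sigma>(1) that ab' by (auto simp: E le Y_def C'_def)
  have indE: "indicator (D \<inter> E) \<omega> = (indicator D \<omega> * (\<Prod>q\<in>?I. indicator (C' q) (Y q \<omega>)) :: real)" if "\<omega> \<in> space M" for \<omega>
  proof -
    have "(\<Prod>q\<in>?I. indicator (C' q) (Y q \<omega>)) = (if \<forall>q\<in>?I. Y q \<omega> \<in> C' q then 1 else 0 :: real)"
      using K by (auto simp: indicator_def intro!: prod.neutral prod_zero)
    then show ?thesis unfolding memE[OF that, symmetric] by (simp add: indicator_def)
  qed
  define s where "s = (\<Prod>q\<in>?I. measure std_normal_distribution (C' q))"
  have key: "(LINT \<omega>|M. indicator (D \<inter> E) \<omega> *\<^sub>R iexp (\<Sum>j\<in>J. l j * (BM j (pt m b) \<omega> - BM j (pt m a) \<omega>)))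
      = complex_of_real (prob D * s * exp (- ((1\<^sup>2 :: real) * ((pt m b - pt m a) * (\<Sum>j\<in>J. (l j)\<^sup>2))) / 2))" for l
  proof -
    let ?S = "\<lambda>\<omega>. \<Sum>j\<in>J. l j * (BM j (pt m b) \<omega> - BM j (pt m a) \<omega>)"
    have "(LINT \<omega>|M. indicator (D \<inter> E) \<omega> *\<^sub>R iexp (?S \<omega>))
      = (LINT \<omega>|M. (indicator D \<omega> * (\<Prod>q\<in>?I. indicator (C' q) (Y q \<omega>))) *\<^sub>R iexp (?S \<omega>))"
      by (intro Bochner_Integration.integral_cong refl) (simp only: indE)
    also have "\<dots> = complex_of_real (prob D * (\<Prod>q\<in>?I. measure std_normal_distribution (C' q))
        * exp (- ((1\<^sup>2 :: real) * ((pt m b - pt m a) * (\<Sum>j\<in>J. (l j)\<^sup>2))) / 2))"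
    proof (rule gaussian_vector_factor[where \<psi> = "\<lambda>u. exp (- (u\<^sup>2 * ((pt m b - pt m a) * (\<Sum>j\<in>J. (l j)\<^sup>2))) / 2)"])
      show "finite ?I" using K by simp
      show "Y q \<in> borel_measurable M" for q unfolding Y_def[abs_def] by measurable
      show "?S \<in> borel_measurable M" by measurable
      show "integrable M (indicat_real D)" by (simp add: emeasure_eq_measure)
      fix l' u
      \<comment> \<open>the coefficients of the past and of the future increments\<close>
      define g1 where "g1 k j = (if k \<in> {..<a'} \<and> j \<in> K then l' (k, j) / \<sigma> else 0)" for k j
      define g2 where "g2 k j = (if k \<in> {a'..<b'} \<and> j \<in> J then u * l j else 0)" for k j
      have sub: "{..<a'} \<subseteq> {..<(2::nat) ^ n}" "{a'..<b'} \<subseteq> {..<(2::nat) ^ n}" using ab' by auto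
      have fin: "finite {..<(2::nat) ^ n}" "finite (J \<union> K)" using J K by auto
      note restr = sum_sum_restrict[OF fin(1) sub(1) fin(2) Un_upper2] sum_sum_restrict[OF fin(1) sub(2) fin(2) Un_upper1]
      have lin: "(\<Sum>q\<in>?I. l' q * Y q \<omega>) + u * ?S \<omega> = (\<Sum>k<2 ^ n. \<Sum>j\<in>J \<union> K. (g1 k j + g2 k j) * incr n k j \<omega>)" for \<omega>
      proof -
        have "(\<Sum>k<2 ^ n. \<Sum>j\<in>J \<union> K. g1 k j * incr n k j \<omega>)
          = (\<Sum>k<2 ^ n. \<Sum>j\<in>J \<union> K. if k \<in> {..<a'} \<and> j \<in> K then l' (k, j) / \<sigma> * incr n k j \<omega> else 0)"
          by (intro sum.cong refl) (simp add: g1_def)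
        also have "\<dots> = (\<Sum>q\<in>?I. l' q * Y q \<omega>)"
          unfolding restr(1) unfolding sum.cartesian_product by (intro sum.cong refl) (simp add: Y_def case_prod_beta)
        finally have 1: "(\<Sum>k<2 ^ n. \<Sum>j\<in>J \<union> K. g1 k j * incr n k j \<omega>) = (\<Sum>q\<in>?I. l' q * Y q \<omega>)" .
        have "(\<Sum>k<2 ^ n. \<Sum>j\<in>J \<union> K. g2 k j * incr n k j \<omega>)
          = (\<Sum>k<2 ^ n. \<Sum>j\<in>J \<union> K. if k \<in> {a'..<b'} \<and> j \<in> J then u * l j * incr n k j \<omega> else 0)"
          by (intro sum.cong refl) (simp add: g2_def)
        also have "\<dots> = (\<Sum>j\<in>J. \<Sum>k=a'..<b'. u * l j * incr n k j \<omega>)"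
          unfolding restr by (rule sum.swap)
        also have "\<dots> = (\<Sum>j\<in>J. u * (l j * (BM j (pt m b) \<omega> - BM j (pt m a) \<omega>)))"
        proof (intro sum.cong refl)
          fix j
          have "(\<Sum>k=a'..<b'. incr n k j \<omega>) = BM j (pt m b) \<omega> - BM j (pt m a) \<omega>"
            unfolding incr_def pa pb using ab' by (intro sum_Suc_diff') simp
          then show "(\<Sum>k=a'..<b'. u * l j * incr n k j \<omega>) = u * (l j * (BM j (pt m b) \<omega> - BM j (pt m a) \<omega>))"
            by (simp add: sum_distrib_left[symmetric] mult.assoc)
        qed
        also have "\<dots> = u * ?S \<omega>" by (simp only: sum_distrib_left)
        finally show ?thesis using 1 by (simp add: distrib_right sum.distrib)
      qed
      have sq: "mesh n * (\<Sum>k<2 ^ n. \<Sum>j\<in>J \<union> K. (g1 k j + g2 k j)\<^sup>2)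
         = (\<Sum>q\<in>?I. (l' q)\<^sup>2) + u\<^sup>2 * ((pt m b - pt m a) * (\<Sum>j\<in>J. (l j)\<^sup>2))"
      proof -
        have "(\<Sum>k<2 ^ n. \<Sum>j\<in>J \<union> K. (g1 k j + g2 k j)\<^sup>2)
          = (\<Sum>k<2 ^ n. \<Sum>j\<in>J \<union> K. (if k \<in> {..<a'} \<and> j \<in> K then (l' (k, j) / \<sigma>)\<^sup>2 else 0)
              + (if k \<in> {a'..<b'} \<and> j \<in> J then (u * l j)\<^sup>2 else 0))"
          by (intro sum.cong refl) (auto simp: g1_def g2_def)
        also have "\<dots> = (\<Sum>k<a'. \<Sum>j\<in>K. (l' (k, j) / \<sigma>)\<^sup>2) + (\<Sum>k=a'..<b'. \<Sum>j\<in>J. (u * l j)\<^sup>2)"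
          unfolding sum.distrib restr ..
        also have "(\<Sum>k=a'..<b'. \<Sum>j\<in>J. (u * l j)\<^sup>2) = real (b' - a') * (u\<^sup>2 * (\<Sum>j\<in>J. (l j)\<^sup>2))"
          by (simp add: power_mult_distrib sum_distrib_left)
        also have "(\<Sum>k<a'. \<Sum>j\<in>K. (l' (k, j) / \<sigma>)\<^sup>2) = (\<Sum>q\<in>?I. (l' q)\<^sup>2) / mesh n"
          unfolding sum.cartesian_product by (simp add: power_divide \<sigma>(2) sum_divide_distrib case_prod_beta)
        finally show ?thesis
          unfolding pa pb pt_diff using mesh_pos[of n] ab' by (simp add: distrib_left of_nat_diff mult_ac)
      qed
      show "(LINT \<omega>|M. indicat_real D \<omega> *\<^sub>R iexp ((\<Sum>q\<in>?I. l' q * Y q \<omega>) + u * ?S \<omega>))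
        = complex_of_real (prob D * exp (- (\<Sum>q\<in>?I. (l' q)\<^sup>2) / 2) * exp (- (u\<^sup>2 * ((pt m b - pt m a) * (\<Sum>j\<in>J. (l j)\<^sup>2))) / 2))"
        unfolding lin D_def grid_char[OF fin(2) A] unfolding sq
        by (simp add: exp_add[symmetric] add_divide_distrib mult.assoc)
    qed (simp_all add: C')
    finally show ?thesis unfolding s_def .
  qed
  have "E \<in> events" using increment_rects_events[OF K] assms(6) by blast
  then have "D \<inter> E \<in> events" by simp
  then have "complex_of_real (prob (D \<inter> E)) = (LINT \<omega>|M. indicator (D \<inter> E) \<omega> *\<^sub>R iexp (\<Sum>j\<in>J. 0 * (BM j (pt m b) \<omega> - BM j (pt m a) \<omega>)))"
    by (simp add: scaleR_conv_of_real)
  also have "\<dots> = complex_of_real (prob D * s)" unfolding key by simp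
  finally show ?thesis unfolding key D_def[symmetric] by (simp only: of_real_mult) simp
qed

text \<open>Two Dynkin arguments extend \<open>future_char_rect\<close> to all events of the past: for fixed \<open>A\<close> from rectangles to
  path events, and then from the intersections of an event of \<open>Z\<close> with a path event, which generate the
  filtration.\<close>

lemma grid_increments:
  assumes ab: "a < b" "b \<le> 2 ^ m"
  shows "gaussian_increments M (sets (noise_filtration (pt m a))) BM (pt m a) (pt m b)"
  unfolding gaussian_increments_def
proof (intro ballI allI impI)
  fix A and J :: "'j set" and l :: "'j \<Rightarrow> real"
  assume A: "A \<in> sets (noise_filtration (pt m a))" and J: "finite J"
  define S where "S \<omega> = (\<Sum>j\<in>J. l j * (BM j (pt m b) \<omega> - BM j (pt m a) \<omega>))" for \<omega>
  have S[measurable]: "S \<in> borel_measurable M" unfolding S_def[abs_def] by measurable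
  define z where "z = complex_of_real (exp (- ((pt m b - pt m a) * (\<Sum>j\<in>J. (l j)\<^sup>2)) / 2))"
  let ?r = "pt m a"
  define G where "G = {(Z -` A \<inter> space M) \<inter> E | A E K. A \<in> sets ZM \<and> E \<in> path_sets ?r K \<and> finite K}"
  have GI: "(Z -` A \<inter> space M) \<inter> E \<in> G" if "A \<in> sets ZM" "E \<in> path_sets ?r K" "finite K" for A E K
    unfolding G_def using that by blast
  have rects: "(LINT \<omega>|M. indicator ((Z -` A \<inter> space M) \<inter> E) \<omega> *\<^sub>R iexp (S \<omega>)) = complex_of_real (prob ((Z -` A \<inter> space M) \<inter> E)) * z"
    if "A \<in> sets ZM" "finite K" "E \<in> increment_rects ?r K (m + p)" for A E K p
    unfolding S_def z_def by (rule future_char_rect[OF that(2) J ab that(1,3)])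
  have whole: "space M \<in> increment_rects ?r K q" for K q
    using increment_rectsI[of "\<lambda>_ _. UNIV" q K ?r] by simp
  have whole': "space M \<in> path_sets ?r K" for K
    unfolding path_sets_def using whole[of K 0] by (auto intro: sigma_sets.Basic)
  have D: "Z -` A \<inter> space M \<in> events" if "A \<in> sets ZM" for A using that by measurable
  have path_events: "path_sets ?r K \<subseteq> events" if "finite K" for K
    unfolding path_sets_def by (intro UN_least sets.sigma_sets_subset increment_rects_events that)
  have paths: "(LINT \<omega>|M. indicator ((Z -` A \<inter> space M) \<inter> E) \<omega> *\<^sub>R iexp (S \<omega>)) = complex_of_real (prob ((Z -` A \<inter> space M) \<inter> E)) * z"
    if A: "A \<in> sets ZM" and K: "finite K" and E: "E \<in> path_sets ?r K" for A E K
  proof -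
    obtain n where "E \<in> sigma_sets (space M) (increment_rects ?r K n)" using E by (auto simp: path_sets_def)
    then have "E \<in> sigma_sets (space M) (increment_rects ?r K (n + m))"
      by (rule subsetD[OF increment_sigma_mono[OF K K subset_refl]])
    then have E': "E \<in> sigma_sets (space M) (increment_rects ?r K (m + n))" by (simp only: add.commute)
    show ?thesis
    proof (rule char_factor_dynkin[OF S D[OF A] Int_stable_increment_rects increment_rects_events[OF K] _ _ E'])
      show "(LINT \<omega>|M. indicator (Z -` A \<inter> space M) \<omega> *\<^sub>R iexp (S \<omega>)) = complex_of_real (prob (Z -` A \<inter> space M)) * z"
        using rects[OF A K whole[of K "m + 0"]] by (simp only: Int_assoc Int_absorb)
    qed (rule rects[OF A K])
  qed
  have G_events: "G \<subseteq> events"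
  proof
    fix H assume "H \<in> G"
    then obtain A E K where H: "H = (Z -` A \<inter> space M) \<inter> E" "A \<in> sets ZM" "E \<in> path_sets ?r K" "finite K"
      unfolding G_def by blast
    show "H \<in> events" unfolding H(1) by (rule sets.Int[OF D[OF H(2)] subsetD[OF path_events[OF H(4)] H(3)]])
  qed
  have G_stable: "Int_stable G"
  proof (rule Int_stableI)
    fix H H' assume "H \<in> G" "H' \<in> G"
    then obtain A E K A' E' K' where H: "H = (Z -` A \<inter> space M) \<inter> E" "A \<in> sets ZM" "E \<in> path_sets ?r K" "finite K"
      and H': "H' = (Z -` A' \<inter> space M) \<inter> E'" "A' \<in> sets ZM" "E' \<in> path_sets ?r K'" "finite K'"
      unfolding G_def by blast
    have "H \<inter> H' = (Z -` (A \<inter> A') \<inter> space M) \<inter> (E \<inter> E')" unfolding H(1) H'(1) by blast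
    also have "\<dots> \<in> G"
      by (rule GI[OF sets.Int[OF H(2) H'(2)] path_sets_Int[OF H(4) H'(4) H(3) H'(3)] finite_UnI[OF H(4) H'(4)]])
    finally show "H \<inter> H' \<in> G" .
  qed
  have G_sub: "G \<subseteq> Pow (space M)" using G_events sets.sets_into_space by auto
  let ?S = "sigma (space M) G"
  have sS: "sets ?S = sigma_sets (space M) G" "space ?S = space M"
    using G_sub by (simp_all add: sets_measure_of space_measure_of)
  have path_S: "path_sets ?r K \<subseteq> sets ?S" if "finite K" for K
  proof
    fix E assume E: "E \<in> path_sets ?r K"
    then have "E \<subseteq> space M" using path_sets_sub by blast
    then have "E = (Z -` space ZM \<inter> space M) \<inter> E" unfolding space_ZM by blast
    then have "E \<in> G" using GI[OF sets.top E that] by simp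
    then show "E \<in> sets ?S" unfolding sS by (rule sigma_sets.Basic)
  qed
  have "a \<le> 2 ^ m" using ab by simp
  then have rT: "?r \<le> T" using gridpt_in[OF t0T, of a m] by simp
  have "noise_sets ?r \<subseteq> sets ?S"
  proof
    fix H assume "H \<in> noise_sets ?r"
    then consider A where "H = Z -` A \<inter> space M" "A \<in> sets ZM"
      | j u C where "H = BM j u -` C \<inter> space M" "u \<in> {t\<^sub>0..?r}" "C \<in> sets borel"
      unfolding noise_sets_def by blast
    then show "H \<in> sets ?S"
    proof cases
      case 1
      have "H = (Z -` A \<inter> space M) \<inter> space M" unfolding 1 by blast
      then have "H \<in> G" using GI[OF 1(2) whole', of "{}"] by simp
      then show ?thesis unfolding sS by (rule sigma_sets.Basic)
    next
      case 2
      have "BM j u \<in> borel_measurable ?S"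
        using 2(2) rT by (intro B_path_sets[OF sS(2) path_S, of "{j}"]) auto
      then show ?thesis using measurable_sets[of "BM j u" ?S borel C] 2(3) unfolding 2(1) sS(2) by blast
    qed
  qed
  then have A': "A \<in> sigma_sets (space M) G"
    using A sets.sigma_sets_subset[of "noise_sets ?r" ?S] unfolding sets_noise_filtration sS(2) unfolding sS(1) by blast
  have "(LINT \<omega>|M. indicator (space M \<inter> A) \<omega> *\<^sub>R iexp (S \<omega>)) = complex_of_real (prob (space M \<inter> A)) * z"
  proof (rule char_factor_dynkin[OF S sets.top G_stable G_events _ _ A'])
    show "(LINT \<omega>|M. indicator (space M) \<omega> *\<^sub>R iexp (S \<omega>)) = complex_of_real (prob (space M)) * z"
      using paths[OF sets.top finite.emptyI whole'] unfolding space_ZM Int_absorb .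
    fix H assume HG: "H \<in> G"
    then obtain A E K where H: "H = (Z -` A \<inter> space M) \<inter> E" "A \<in> sets ZM" "E \<in> path_sets ?r K" "finite K"
      unfolding G_def by blast
    have "space M \<inter> H = H" using HG G_sub by blast
    then show "(LINT \<omega>|M. indicator (space M \<inter> H) \<omega> *\<^sub>R iexp (S \<omega>)) = complex_of_real (prob (space M \<inter> H)) * z"
      using paths[OF H(2,4,3)] unfolding H(1) by simp
  qed
  moreover have "space M \<inter> A = A" using A' sigma_sets_into_sp[OF G_sub] by blast
  ultimately show "(LINT \<omega>|M. indicator A \<omega> *\<^sub>R iexp (\<Sum>j\<in>J. l j * (BM j (pt m b) \<omega> - BM j (pt m a) \<omega>)))
       = complex_of_real (prob A * exp (- ((pt m b - pt m a) * (\<Sum>j\<in>J. (l j)\<^sup>2)) / 2))"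
    unfolding S_def z_def by (simp only: of_real_mult)
qed

lemma brownian_family_BM: "brownian_family M noise_filtration BM t\<^sub>0 T"
proof
  show "gaussian_increments M (sets (noise_filtration r)) BM r t" if "t\<^sub>0 \<le> r" "r < t" "t \<le> T" for r t
  proof (rule gaussian_increments_from_grid[OF _ that])
    show "gaussian_increments M (sets (noise_filtration (pt n a))) BM (pt n a) (pt n b)"
      if "a < b" "b \<le> 2 ^ n" for n a b
      using that by (rule grid_increments)
  qed
qed

end

section \<open>Measurability of the coefficients\<close>

lemma proj_torus_continuous: "continuous_on A proj_torus"
  by (intro continuous_on_subset[OF iffD2[OF continuous_on_open_vimage[OF open_UNIV]] subset_UNIV])
     (simp add: open_torus_def)

lemma proj_torus_measurable [measurable]: "proj_torus \<in> borel_measurable borel"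
  by (intro borel_measurable_continuous_onI proj_torus_continuous)

lemma iota_proj_torus: "iota (proj_torus x) $ k = frac (x $ k)"
proof -
  have "lattice_equiv (\<chi> k. frac (x $ k)) x" by (simp add: lattice_equiv_def frac_def)
  then have "(\<forall>k. (\<chi> k. frac (x $ k)) $ k \<in> {0..<1}) \<and> proj_torus (\<chi> k. frac (x $ k)) = proj_torus x"
    by (simp add: torus.abs_eq_iff frac_lt_1)
  then have "iota (proj_torus x) = (\<chi> k. frac (x $ k))"
    unfolding iota_def by (rule the1_equality[OF ex1_representative])
  then show ?thesis by simp
qed

text \<open>The representative jumps across the boundary of the unit cube, but each set \<open>{p. a < iota p $ k}\<close> is
  open or everything.\<close>

lemma iota_component_measurable: "(\<lambda>p :: 'd::finite torus. iota p $ k) \<in> borel_measurable borel"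
proof (rule iffD2[OF borel_measurable_iff_greater], rule allI)
  fix a :: real
  show "{p \<in> space borel. a < iota (p :: 'd torus) $ k} \<in> sets borel"
  proof (cases "a < 0")
    case True
    have "a < iota p $ k" for p :: "'d torus" using iota_range[of p k] True by (simp del: iota_range)
    then show ?thesis by simp
  next
    case False
    have frac_iff: "a < frac v \<longleftrightarrow> (\<exists>n::int. of_int n + a < v \<and> v < of_int n + 1)" for v :: real
    proof
      assume "a < frac v"
      then show "\<exists>n::int. of_int n + a < v \<and> v < of_int n + 1"
        unfolding frac_def by (intro exI[of _ "\<lfloor>v\<rfloor>"] conjI; linarith)
    next
      assume "\<exists>n::int. of_int n + a < v \<and> v < of_int n + 1"
      then obtain n :: int where n: "of_int n + a < v" "v < of_int n + 1" by blast
      then have "\<lfloor>v\<rfloor> = n" using False by (intro floor_unique) auto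
      then show "a < frac v" using n by (simp add: frac_def)
    qed
    have "open {x :: real ^ 'd. \<exists>n::int. of_int n + a < x $ k \<and> x $ k < of_int n + 1}"
      by (intro open_Collect_ex open_Collect_conj open_Collect_less continuous_intros)
    then have "open (proj_torus -` {p :: 'd torus. a < iota p $ k})"
      by (simp add: vimage_def iota_proj_torus frac_iff)
    then have "open {p :: 'd torus. a < iota p $ k}" by (simp add: open_torus_def)
    then show ?thesis by simp
  qed
qed

lemma continuous_coordinate_fst:
  "continuous_on UNIV (\<lambda>z :: ('i \<Rightarrow> 'a::topological_space) \<times> 'b::topological_space. fst z i)"
  by (rule continuous_on_compose2[OF continuous_on_product_coordinates continuous_on_fst[OF continuous_on_id]]) simp

lemma continuous_coordinate_snd:
  "continuous_on UNIV (\<lambda>z :: 'b::topological_space \<times> ('i \<Rightarrow> 'a::topological_space). snd z i)"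
  by (rule continuous_on_compose2[OF continuous_on_product_coordinates continuous_on_snd[OF continuous_on_id]]) simp

lemma initial_data_mass: "(\<lambda>z. fst z i) \<in> borel_measurable initial_data"
  unfolding initial_data_def
  by (rule measurable_restrict_space1[OF borel_measurable_continuous_onI[OF continuous_coordinate_fst]])

lemma initial_data_point: "(\<lambda>z. snd z i) \<in> borel_measurable initial_data"
  unfolding initial_data_def
  by (rule measurable_restrict_space1[OF borel_measurable_continuous_onI[OF continuous_coordinate_snd]])

lemma mass_sequences_pos:
  assumes "s \<in> mass_sequences" shows "0 < s i" "s sums 1"
proof -
  have "s (Suc i) < s i" "0 \<le> s (Suc i)" using assms by (auto simp: mass_sequences_def)
  then show "0 < s i" by linarith
  show "s sums 1" using assms by (simp add: mass_sequences_def)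
qed

lemma initial_data_space: "z \<in> space initial_data \<Longrightarrow> fst z \<in> mass_sequences"
  by (auto simp: initial_data_def space_restrict_space)

text \<open>The empirical measure is the image of the counting measure with density \<open>s\<close> under the positions.\<close>

lemma integral_empirical_measure:
  fixes f :: "'d::finite torus \<Rightarrow> real"
  assumes s: "s \<in> mass_sequences" and f[measurable]: "f \<in> borel_measurable borel" and bnd: "\<And>x. \<bar>f x\<bar> \<le> C"
  shows "(\<integral>x. f x \<partial>empirical_measure s y) = (\<Sum>j. s j * f (proj_torus (y j)))"
proof -
  have s': "0 \<le> s j" "summable s" for j
    using mass_sequences_pos[OF s] by (auto intro: less_imp_le sums_summable)
  let ?D = "distr (density (count_space UNIV) (\<lambda>j. ennreal (s j))) borel (\<lambda>j. proj_torus (y j))"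
  have "empirical_measure s y = ?D"
  proof (rule measure_eqI)
    fix A assume "A \<in> sets (empirical_measure s y)"
    then have A: "A \<in> sets borel" by (simp add: sets_empirical_measure)
    have "emeasure ?D A = (\<integral>\<^sup>+j. ennreal (s j) * indicator ((\<lambda>j. proj_torus (y j)) -` A) j \<partial>count_space UNIV)"
      using A by (subst emeasure_distr) (auto simp: emeasure_density)
    also have "\<dots> = (\<Sum>j. ennreal (s j) * indicator A (proj_torus (y j)))"
      by (subst nn_integral_count_space_nat) (simp add: indicator_def)
    finally show "emeasure (empirical_measure s y) A = emeasure ?D A"
      using A by (simp add: emeasure_empirical_measure)
  qed (simp add: sets_empirical_measure)
  then have "(\<integral>x. f x \<partial>empirical_measure s y) = (\<integral>j. s j * f (proj_torus (y j)) \<partial>count_space UNIV)"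
    using s' by (simp add: integral_distr integral_density)
  also have "\<dots> = (\<Sum>j. s j * f (proj_torus (y j)))"
  proof (rule integral_count_space_nat)
    have "summable (\<lambda>j. norm (s j * f (proj_torus (y j))))"
    proof (rule summable_comparison_test')
      show "summable (\<lambda>j. s j * C)" using s'(2) by (rule summable_mult2)
      show "norm (norm (s j * f (proj_torus (y j)))) \<le> s j * C" if "j \<ge> 0" for j
        using bnd s'(1) by (simp add: abs_mult mult_left_mono)
    qed
    then show "integrable (count_space UNIV) (\<lambda>j. s j * f (proj_torus (y j)))"
      by (simp add: integrable_count_space_nat_iff)
  qed
  finally show ?thesis .
qed

text \<open>The tail beyond \<open>N\<close> is at most \<open>C (1 - \<Sum>j<N. s j)\<close>. This bound is not uniform in \<open>s\<close>, but it involves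
  finitely many coordinates only, hence is small in a whole neighbourhood of a point where it is
  small.\<close>

lemma mass_sum_continuous:
  fixes g :: "real ^ 'd::finite \<Rightarrow> real"
  assumes g: "continuous_on UNIV g" and bnd: "\<And>x. \<bar>g x\<bar> \<le> C"
  shows "continuous_on (mass_sequences \<times> UNIV) (\<lambda>q. \<Sum>j. fst q j * g (snd q j))"
  unfolding continuous_on_def
proof (intro ballI, rule tendstoI)
  fix p :: "(nat \<Rightarrow> real) \<times> (nat \<Rightarrow> real ^ 'd)" and e :: real
  assume p: "p \<in> mass_sequences \<times> UNIV" and e: "0 < e"
  let ?S = "mass_sequences \<times> (UNIV :: (nat \<Rightarrow> real ^ 'd) set)"
  let ?F = "at p within ?S"
  define h where "h q = (\<Sum>j. fst q j * g (snd q j))" for q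
  define hN where "hN N q = (\<Sum>j<N. fst q j * g (snd q j))" for N :: nat and q :: "(nat \<Rightarrow> real) \<times> (nat \<Rightarrow> real ^ 'd)"
  \<comment> \<open>the tail bound, as a function of finitely many masses\<close>
  define rN where "rN N q = 1 - (\<Sum>j<N. fst q j)" for N :: nat and q :: "(nat \<Rightarrow> real) \<times> (nat \<Rightarrow> real ^ 'd)"
  have tail: "\<bar>h q - hN N q\<bar> \<le> C * rN N q" if q: "q \<in> ?S" for q N
  proof -
    have s: "\<And>j. 0 \<le> fst q j" "fst q sums 1"
      using mass_sequences_pos[of "fst q"] q by (auto intro: less_imp_le)
    have sC: "summable (\<lambda>j. C * fst q j)" using s(2) by (intro summable_mult sums_summable)
    have le: "\<bar>fst q j * g (snd q j)\<bar> \<le> C * fst q j" for j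
      using mult_left_mono[OF bnd[of "snd q j"] s(1)[of j]] by (simp add: abs_mult s(1) mult.commute)
    have sm: "summable (\<lambda>j. fst q j * g (snd q j))"
      by (rule summable_comparison_test'[OF sC]) (simp only: real_norm_def le)
    have "h q - hN N q = (\<Sum>j. fst q (j + N) * g (snd q (j + N)))"
      unfolding h_def hN_def using suminf_minus_initial_segment[OF sm, of N] by simp
    also have "\<bar>\<dots>\<bar> \<le> (\<Sum>j. C * fst q (j + N))"
      using norm_suminf_le[of "\<lambda>j. fst q (j + N) * g (snd q (j + N))" "\<lambda>j. C * fst q (j + N)"] le
        summable_ignore_initial_segment[OF sC, of N] by simp
    also have "\<dots> = C * (\<Sum>j. fst q (j + N))"
      using s(2) by (intro suminf_mult summable_ignore_initial_segment sums_summable)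
    also have "(\<Sum>j. fst q (j + N)) = rN N q"
      using suminf_minus_initial_segment[OF sums_summable[OF s(2)], of N] sums_unique[OF s(2)] by (simp add: rN_def)
    finally show ?thesis .
  qed
  have "(\<lambda>N. 2 * (C * rN N p)) \<longlonglongrightarrow> 2 * (C * (1 - 1))"
    unfolding rN_def using mass_sequences_pos(2)[of "fst p"] p
    by (intro tendsto_intros) (auto simp: sums_def)
  then have "\<forall>\<^sub>F N in sequentially. 2 * (C * rN N p) < e"
    using e by (intro order_tendstoD(2)) auto
  then obtain N where N: "2 * (C * rN N p) < e" by (auto simp: eventually_sequentially)
  have coord: "((\<lambda>q. fst q j) \<longlongrightarrow> fst p j) ?F" "((\<lambda>q. g (snd q j)) \<longlongrightarrow> g (snd p j)) ?F" for j
  proof -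
    have c: "continuous_on UNIV (\<lambda>q :: (nat \<Rightarrow> real) \<times> (nat \<Rightarrow> real ^ 'd). fst q j)"
      "continuous_on UNIV (\<lambda>q :: (nat \<Rightarrow> real) \<times> (nat \<Rightarrow> real ^ 'd). g (snd q j))"
      by (rule continuous_coordinate_fst, rule continuous_on_compose2[OF g continuous_coordinate_snd]) simp
    then show "((\<lambda>q. fst q j) \<longlongrightarrow> fst p j) ?F" "((\<lambda>q. g (snd q j)) \<longlongrightarrow> g (snd p j)) ?F"
      by (simp_all only: continuous_on_eq_continuous_at[OF open_UNIV] continuous_at UNIV_I ball_simps Lim_at_imp_Lim_at_within)
  qed
  have "((\<lambda>q. \<bar>hN N q - hN N p\<bar> + C * rN N q + C * rN N p) \<longlongrightarrow> \<bar>hN N p - hN N p\<bar> + C * rN N p + C * rN N p) ?F"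
    unfolding hN_def rN_def by (intro tendsto_intros coord)
  then have "\<forall>\<^sub>F q in ?F. \<bar>hN N q - hN N p\<bar> + C * rN N q + C * rN N p < e"
    using N by (intro order_tendstoD(2)) auto
  moreover have "\<forall>\<^sub>F q in ?F. q \<in> ?S" by (simp add: eventually_at_filter)
  ultimately show "\<forall>\<^sub>F q in ?F. dist (\<Sum>j. fst q j * g (snd q j)) (\<Sum>j. fst p j * g (snd p j)) < e"
  proof eventually_elim
    case (elim q)
    show ?case using elim(1) tail[OF elim(2), of N] tail[OF p, of N] unfolding h_def[symmetric] dist_real_def by linarith
  qed
qed

lemma empirical_measure_continuous:
  "continuous_map (top_of_set (mass_sequences \<times> UNIV)) weak_topology
     (\<lambda>q. empirical_measure (fst q) (snd q :: nat \<Rightarrow> real ^ 'd::finite))"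
proof -
  let ?S = "mass_sequences \<times> (UNIV :: (nat \<Rightarrow> real ^ 'd) set)"
  let ?E = "\<lambda>q. empirical_measure (fst q) (snd q :: nat \<Rightarrow> real ^ 'd)"
  define G where "G = {{\<mu> \<in> prob_measures. (\<integral>x. f x \<partial>\<mu>) \<in> U} | (f :: 'd torus \<Rightarrow> real) U.
        continuous_on UNIV f \<and> bounded (range f) \<and> open U}"
  have wt: "weak_topology = topology_generated_by G" unfolding weak_topology_def G_def ..
  show ?thesis unfolding wt
  proof (rule continuous_on_generated_topo)
  fix U assume "U \<in> G"
  then obtain f :: "'d torus \<Rightarrow> real" and V where U: "U = {\<mu> \<in> prob_measures. (\<integral>x. f x \<partial>\<mu>) \<in> V}"
    and f: "continuous_on UNIV f" "bounded (range f)" "open V" unfolding G_def by blast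
  obtain C where C: "\<And>x. \<bar>f x\<bar> \<le> C" using f(2) by (auto simp: bounded_iff)
  have fm: "f \<in> borel_measurable borel" using f(1) by (rule borel_measurable_continuous_onI)
  let ?h = "\<lambda>q. \<Sum>j. fst q j * f (proj_torus (snd q j))"
  have "continuous_on ?S ?h"
    using C by (intro mass_sum_continuous[where g = "\<lambda>x. f (proj_torus x)"] continuous_on_compose2[OF f(1) proj_torus_continuous]) auto
  then have "openin (top_of_set ?S) (?S \<inter> ?h -` V)" using f(3) by (rule continuous_openin_preimage_gen)
  moreover have "?E -` U \<inter> topspace (top_of_set ?S) = ?S \<inter> ?h -` V"
    using integral_empirical_measure[OF _ fm C] empirical_measure_in_prob_measures by (auto simp: U)
  ultimately show "openin (top_of_set ?S) (?E -` U \<inter> topspace (top_of_set ?S))" by simp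
next
  show "?E ` topspace (top_of_set ?S) \<subseteq> \<Union> G"
    unfolding topology_generated_by_topspace[symmetric] wt[symmetric] topspace_weak_topology
    using empirical_measure_in_prob_measures by auto
  qed
qed

text \<open>Preimages of weakly open sets are relatively open in the product space, whose Borel sets are the
  product ones by second countability.\<close>

lemma empirical_measure_measurable:
  fixes y :: "'p \<Rightarrow> nat \<Rightarrow> real ^ 'd::finite"
  assumes s: "\<And>j. (\<lambda>p. s p j) \<in> borel_measurable N" and y: "\<And>j. (\<lambda>p. y p j) \<in> borel_measurable N"
    and mass: "\<And>p. p \<in> space N \<Longrightarrow> s p \<in> mass_sequences"
  shows "(\<lambda>p. empirical_measure (s p) (y p)) \<in> measurable N weak_borel"
proof -
  let ?S = "mass_sequences \<times> (UNIV :: (nat \<Rightarrow> real ^ 'd) set)"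
  have "(\<lambda>p. (s p, y p)) \<in> measurable N (borel \<Otimes>\<^sub>M borel)"
    using s y by (intro measurable_Pair measurable_coordinatewise_then_product)
  then have pair: "(\<lambda>p. (s p, y p)) \<in> borel_measurable N" by (simp add: borel_prod)
  show ?thesis
    unfolding weak_borel_def
  proof (rule measurable_measure_of)
    show "{U. openin weak_topology U} \<subseteq> Pow (prob_measures :: 'd torus measure set)"
      using openin_subset[of weak_topology] unfolding topspace_weak_topology by blast
    show "(\<lambda>p. empirical_measure (s p) (y p)) \<in> space N \<rightarrow> prob_measures"
      using mass empirical_measure_in_prob_measures by blast
    fix U :: "'d torus measure set" assume "U \<in> {U. openin weak_topology U}"
    then have "openin (top_of_set ?S) {q \<in> topspace (top_of_set ?S). empirical_measure (fst q) (snd q) \<in> U}"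
      by (intro openin_continuous_map_preimage[OF empirical_measure_continuous]) simp
    then obtain O' where O: "open O'" "{q \<in> ?S. empirical_measure (fst q) (snd q) \<in> U} = ?S \<inter> O'"
      by (auto simp: openin_open)
    have "(\<lambda>p. empirical_measure (s p) (y p)) -` U \<inter> space N = (\<lambda>p. (s p, y p)) -` O' \<inter> space N"
    proof (intro set_eqI)
      fix p
      have "p \<in> space N \<Longrightarrow> empirical_measure (s p) (y p) \<in> U \<longleftrightarrow> (s p, y p) \<in> O'"
        using arg_cong[OF O(2), of "\<lambda>A. (s p, y p) \<in> A"] mass[of p] by simp
      then show "p \<in> (\<lambda>p. empirical_measure (s p) (y p)) -` U \<inter> space N \<longleftrightarrow> p \<in> (\<lambda>p. (s p, y p)) -` O' \<inter> space N"
        by auto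
    qed
    then show "(\<lambda>p. empirical_measure (s p) (y p)) -` U \<inter> space N \<in> sets N"
      using measurable_sets[OF pair borel_open[OF O(1)]] by simp
  qed
qed

section \<open>The infinite system\<close>

text \<open>Position of particle \<open>i\<close> in the driftless system, for the initial datum \<open>z\<close> and the values \<open>w\<close> of the
  Brownian motions.\<close>

definition particle :: "((nat \<Rightarrow> real) \<times> (nat \<Rightarrow> 'd::finite torus)) \<Rightarrow> (nat \<Rightarrow> real ^ 'd) \<Rightarrow> nat \<Rightarrow> real ^ 'd" where
  "particle z w i = iota (snd z i) + sqrt (2 / fst z i) *\<^sub>R w i"

lemma particle_measurable:
  assumes z: "z \<in> measurable N initial_data" and w: "\<And>k. (\<lambda>p. w p i $ k) \<in> borel_measurable N"
  shows "(\<lambda>p. particle (z p) (w p) i) \<in> borel_measurable N"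
proof -
  note [measurable] = measurable_compose[OF z initial_data_mass] w
    measurable_compose[OF measurable_compose[OF z initial_data_point] iota_component_measurable]
  have "(\<lambda>p. \<chi> k. iota (snd (z p) i) $ k + sqrt (2 / fst (z p) i) * w p i $ k) \<in> borel_measurable N"
    by (rule borel_measurable_vec_lambda) measurable
  moreover have "(\<chi> k. iota (snd (z p) i) $ k + sqrt (2 / fst (z p) i) * w p i $ k) = particle (z p) (w p) i" for p
    by (simp add: particle_def vec_eq_iff)
  ultimately show ?thesis by simp
qed

lemma interaction_measurable:
  fixes b :: "nat \<Rightarrow> real \<Rightarrow> 'd::finite torus measure \<Rightarrow> 'd torus \<Rightarrow> real ^ 'd"
  assumes b: "(\<lambda>(t, \<mu>, x). b i t \<mu> x) \<in> borel_measurable (restrict_space borel {0..T} \<Otimes>\<^sub>M (weak_borel \<Otimes>\<^sub>M borel))"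
    and r: "r \<in> borel_measurable N" "\<And>p. p \<in> space N \<Longrightarrow> r p \<in> {0..T}"
    and z: "z \<in> measurable N initial_data"
    and y: "\<And>j. (\<lambda>p. y p j) \<in> borel_measurable N"
  shows "(\<lambda>p. b i (r p) (empirical_measure (fst (z p)) (y p)) (proj_torus (y p i))) \<in> borel_measurable N"
proof -
  have "(\<lambda>p. empirical_measure (fst (z p)) (y p)) \<in> measurable N weak_borel"
    using measurable_space[OF z] initial_data_space
    by (intro empirical_measure_measurable y measurable_compose[OF z initial_data_mass]) blast
  then have "(\<lambda>p. (r p, empirical_measure (fst (z p)) (y p), proj_torus (y p i)))
      \<in> measurable N (restrict_space borel {0..T} \<Otimes>\<^sub>M (weak_borel \<Otimes>\<^sub>M borel))"
    using r by (intro measurable_Pair measurable_restrict_space2 measurable_compose[OF y proj_torus_measurable]) auto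
  from measurable_compose[OF this b] show ?thesis by simp
qed

lemma left_endpoint_integral:
  fixes f :: "real \<Rightarrow> 'a::euclidean_space"
  assumes f: "set_integrable lborel {a<..b} f" and ab: "a \<le> b"
  shows "set_integrable lborel {a..b} f" "(LINT r:{a..b}|lborel. f r) = (LINT r:{a<..b}|lborel. f r)"
proof -
  have Un: "{a..b} = {a} \<union> {a<..b}" using ab by auto
  have ind: "indicator {a} r *\<^sub>R f r = indicator {a} r *\<^sub>R f a" for r by (auto simp: indicator_def)
  have pt: "set_integrable lborel {a} f" unfolding set_integrable_def ind by simp
  have "(LINT r:{a}|lborel. f r) = 0" unfolding set_lebesgue_integral_def ind by simp
  then show "set_integrable lborel {a..b} f" "(LINT r:{a..b}|lborel. f r) = (LINT r:{a<..b}|lborel. f r)"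
    unfolding Un using set_integrable_Un[OF pt f] set_integral_Un[OF _ pt f] by simp_all
qed

text \<open>This is where the total mass 1 bounds the energy of the whole system.\<close>

lemma sum_mass_le:
  assumes s: "s \<in> mass_sequences" and J: "finite (J :: (nat \<times> 'd::finite) set)"
  shows "(\<Sum>j\<in>J. (C * sqrt (s (fst j) / 2))\<^sup>2) \<le> real CARD('d) * C\<^sup>2 / 2"
proof -
  have s': "\<And>i. 0 \<le> s i" "s sums 1" using mass_sequences_pos[OF s] by (auto intro: less_imp_le)
  have eq: "(C * sqrt (s (fst j) / 2))\<^sup>2 = C\<^sup>2 / 2 * s (fst j)" for j :: "nat \<times> 'd"
    using s'(1) by (simp add: power_mult_distrib)
  have "(\<Sum>j\<in>J. C\<^sup>2 / 2 * s (fst j)) \<le> (\<Sum>j\<in>(fst ` J) \<times> (UNIV :: 'd set). C\<^sup>2 / 2 * s (fst j))"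
    using J s'(1) by (intro sum_mono2) force+
  also have "\<dots> = (\<Sum>i\<in>fst ` J. \<Sum>k\<in>(UNIV :: 'd set). C\<^sup>2 / 2 * s i)"
    unfolding sum.cartesian_product by (intro sum.cong refl) (simp add: case_prod_beta)
  also have "\<dots> = real CARD('d) * C\<^sup>2 / 2 * (\<Sum>i\<in>fst ` J. s i)"
    by (simp add: sum_distrib_left mult.assoc)
  also have "\<dots> \<le> real CARD('d) * C\<^sup>2 / 2 * 1"
  proof (rule mult_left_mono)
    show "(\<Sum>i\<in>fst ` J. s i) \<le> 1"
      using sum_le_suminf[OF sums_summable[OF s'(2)], of "fst ` J"] J s' sums_unique[OF s'(2)] by simp
  qed simp
  finally show ?thesis unfolding eq by simp
qed

text \<open>The drift seen by the noise, evaluated along the driftless particles \<open>X\<close>, is \<open>\<theta>\<close>; Girsanov turns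
  \<open>B - \<integral>\<theta>\<close> into a Brownian family, and \<open>X\<close>, rewritten in terms of it, is the equation.\<close>

theorem weak_solution_from_noise:
  fixes b :: "nat \<Rightarrow> real \<Rightarrow> 'd::finite torus measure \<Rightarrow> 'd torus \<Rightarrow> real ^ 'd"
    and \<xi> :: "(nat \<times> 'd) \<times> nat \<Rightarrow> 'w \<Rightarrow> real"
  assumes noise: "gaussian_noise M initial_data Z \<xi> t\<^sub>0 T" and t0: "0 \<le> t\<^sub>0"
    and bnd: "\<And>i t \<mu> x. t \<in> {0..T} \<Longrightarrow> \<mu> \<in> prob_measures \<Longrightarrow> norm (b i t \<mu> x) \<le> C"
    and meas: "\<And>i. (\<lambda>(t, \<mu>, x). b i t \<mu> x) \<in>
          borel_measurable (restrict_space borel {0..T} \<Otimes>\<^sub>M (weak_borel \<Otimes>\<^sub>M borel))"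
  shows "\<exists>Q F X W. weak_solution b t\<^sub>0 T (distr M initial_data Z) Q F Z X W"
proof -
  interpret N: gaussian_noise M initial_data Z \<xi> t\<^sub>0 T by fact
  interpret BF: brownian_family M N.noise_filtration N.BM t\<^sub>0 T by (rule N.brownian_family_BM)
  let ?F = N.noise_filtration
  have t0T: "t\<^sub>0 < T" by (rule N.t0T)
  define X where "X i t \<omega> = particle (Z \<omega>) (\<lambda>j. \<chi> k. N.BM (j, k) t \<omega>) i" for i t \<omega>
  define dr where "dr i r \<omega> = b i r (empirical_measure (fst (Z \<omega>)) (\<lambda>j. X j r \<omega>)) (proj_torus (X i r \<omega>))" for i r \<omega>
  define \<theta> where "\<theta> j z = sqrt (fst (Z (snd z)) (fst j) / 2) * dr (fst j) (fst z) (snd z) $ (snd j)" for j z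
  define c where "c j \<omega> = C * sqrt (fst (Z \<omega>) (fst j) / 2)" for j :: "nat \<times> 'd" and \<omega>
  have mass: "fst (Z \<omega>) \<in> mass_sequences" if "\<omega> \<in> space M" for \<omega>
    using measurable_space[OF N.Z_measurable that] by (rule initial_data_space)
  have dr_bnd: "norm (dr i r \<omega>) \<le> C" if "r \<in> {t\<^sub>0..T}" "\<omega> \<in> space M" for i r \<omega>
    unfolding dr_def using that t0 by (intro bnd empirical_measure_in_prob_measures mass) auto
  have C: "0 \<le> C"
  proof -
    obtain \<omega> where "\<omega> \<in> space M" using N.not_empty by blast
    then show ?thesis using order_trans[OF norm_ge_zero dr_bnd[of T \<omega> 0]] t0T by simp
  qed
  have Zp: "(\<lambda>z. Z (snd z)) \<in> measurable N.predictable initial_data"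
    using N.initial_predictable[OF N.Z_initial] by (simp add: case_prod_beta')
  have Bp: "(\<lambda>z. N.BM j (fst z) (snd z)) \<in> borel_measurable N.predictable" for j
    using N.B_predictable[of j] by (simp add: case_prod_beta')
  have Xp: "(\<lambda>z. X i (fst z) (snd z)) \<in> borel_measurable N.predictable" for i
    unfolding X_def by (rule particle_measurable[OF Zp]) (simp add: Bp)
  have drp: "(\<lambda>z. dr i (fst z) (snd z)) \<in> borel_measurable N.predictable" for i
    unfolding dr_def
  proof (rule interaction_measurable[OF meas N.time_predictable _ Zp Xp])
    show "fst z \<in> {0..T}" if "z \<in> space N.predictable" for z
      using that t0 by (auto simp: N.space_predictable)
  qed
  have \<theta>p: "\<theta> j \<in> borel_measurable N.predictable" for j
  proof -
    have [measurable]: "(\<lambda>z. dr i (fst z) (snd z) $ k) \<in> borel_measurable N.predictable" for i k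
      using measurable_compose[OF drp[of i] borel_measurable_nth[of k]] .
    have [measurable]: "(\<lambda>z. fst (Z (snd z)) i) \<in> borel_measurable N.predictable" for i
      using measurable_compose[OF Zp initial_data_mass] .
    show ?thesis unfolding \<theta>_def[abs_def] by measurable
  qed
  interpret bounded_drift M ?F N.BM t\<^sub>0 T \<theta> c "real CARD('d) * C\<^sup>2 / 2"
  proof
    show "\<theta> j \<in> borel_measurable N.predictable" for j by (rule \<theta>p)
    show "c j \<in> borel_measurable (?F t\<^sub>0)" for j
    proof -
      have [measurable]: "(\<lambda>\<omega>. fst (Z \<omega>) (fst j)) \<in> borel_measurable (?F t\<^sub>0)"
        using measurable_compose[OF N.Z_initial initial_data_mass] .
      show ?thesis unfolding c_def[abs_def] by measurable
    qed
    show "\<bar>\<theta> j (r, \<omega>)\<bar> \<le> c j \<omega>" if "r \<in> {t\<^sub>0<..T}" "\<omega> \<in> space M" for j r \<omega>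
    proof -
      have "\<bar>dr (fst j) r \<omega> $ snd j\<bar> \<le> C"
        using order_trans[OF component_le_norm_cart dr_bnd[of r \<omega> "fst j"]] that by simp
      moreover have s: "0 \<le> sqrt (fst (Z \<omega>) (fst j) / 2)"
        using mass_sequences_pos(1)[OF mass[OF that(2)], of "fst j"] by simp
      ultimately have "\<bar>dr (fst j) r \<omega> $ snd j\<bar> * sqrt (fst (Z \<omega>) (fst j) / 2) \<le> C * sqrt (fst (Z \<omega>) (fst j) / 2)"
        by (rule mult_right_mono)
      then show ?thesis unfolding \<theta>_def c_def fst_conv snd_conv abs_mult abs_of_nonneg[OF s] by (simp only: mult.commute)
    qed
    show "(\<Sum>j\<in>J. (c j \<omega>)\<^sup>2) \<le> real CARD('d) * C\<^sup>2 / 2" if "finite J" "\<omega> \<in> space M" for J \<omega>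
      unfolding c_def using mass[OF that(2)] that(1) by (rule sum_mass_le)
  qed
  obtain D where D: "D \<in> borel_measurable M" "\<And>\<omega>. 0 \<le> D \<omega>"
    and init: "\<And>A. A \<in> sets (?F t\<^sub>0) \<Longrightarrow> emeasure (density M (\<lambda>\<omega>. ennreal (D \<omega>))) A = emeasure M A"
    and bf: "brownian_family (density M (\<lambda>\<omega>. ennreal (D \<omega>))) ?F (\<lambda>j t \<omega>. N.BM j t \<omega> - drift_integral j t \<omega>) t\<^sub>0 T"
    using girsanov by auto
  define Q where "Q = density M (\<lambda>\<omega>. ennreal (D \<omega>))"
  define W where "W i t \<omega> = (\<chi> k. N.BM (i, k) t \<omega> - drift_integral (i, k) t \<omega>)" for i t \<omega>
  interpret Q: brownian_family Q ?F "\<lambda>j t \<omega>. N.BM j t \<omega> - drift_integral j t \<omega>" t\<^sub>0 T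
    unfolding Q_def by (rule bf)
  have space_Q: "space Q = space M" by (simp add: Q_def)
  have path: "set_integrable lborel {t\<^sub>0<..t} (\<lambda>r. dr i r \<omega>)" if t: "t \<in> {t\<^sub>0..T}" and \<omega>: "\<omega> \<in> space M" for i t \<omega>
  proof -
    have "(\<lambda>z. dr i (fst z) (snd z)) \<in> borel_measurable (restrict_space lborel {t\<^sub>0<..T} \<Otimes>\<^sub>M M)"
      using N.predictable_cylinder[OF drp] unfolding N.cylinder_def N.time_measure_def .
    from measurable_compose[OF measurable_Pair2'[OF \<omega>] this]
    have "(\<lambda>r. dr i r \<omega>) \<in> borel_measurable (restrict_space lborel {t\<^sub>0<..T})"
      by (simp only: fst_conv snd_conv)
    then have m: "(\<lambda>r. indicator {t\<^sub>0<..T} r *\<^sub>R dr i r \<omega>) \<in> borel_measurable lborel"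
      by (rule iffD1[OF borel_measurable_restrict_space_iff, rotated]) simp
    have "integrable lborel (\<lambda>r. indicator {t\<^sub>0<..T} r *\<^sub>R dr i r \<omega>)"
    proof (rule Bochner_Integration.integrable_bound[OF _ m])
      show "integrable lborel (\<lambda>r. C * indicator {t\<^sub>0<..T} r)"
        using t0T by (intro Bochner_Integration.integrable_mult_right integrable_real_indicator) simp_all
      have "norm (indicator {t\<^sub>0<..T} r *\<^sub>R dr i r \<omega>) \<le> norm (C * indicator {t\<^sub>0<..T} r)" for r
        using dr_bnd[of r \<omega> i] \<omega> C by (cases "r \<in> {t\<^sub>0<..T}") simp_all
      then show "AE r in lborel. norm (indicator {t\<^sub>0<..T} r *\<^sub>R dr i r \<omega>) \<le> norm (C * indicator {t\<^sub>0<..T} r)"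
        by (rule AE_I2)
    qed
    then have "set_integrable lborel {t\<^sub>0<..T} (\<lambda>r. dr i r \<omega>)" unfolding set_integrable_def .
    then show ?thesis by (rule set_integrable_subset) (use t in auto)
  qed
  have drift: "sqrt (2 / fst (Z \<omega>) i) * drift_integral (i, k) t \<omega> = (LINT r:{t\<^sub>0..t}|lborel. dr i r \<omega>) $ k"
    if t: "t \<in> {t\<^sub>0..T}" and \<omega>: "\<omega> \<in> space M" for i k t \<omega>
  proof -
    let ?s = "fst (Z \<omega>) i"
    have s: "0 < ?s" by (rule mass_sequences_pos(1)[OF mass[OF \<omega>]])
    have "(LINT r:{t\<^sub>0..t}|lborel. dr i r \<omega>) $ k = (LINT r:{t\<^sub>0<..t}|lborel. dr i r \<omega>) $ k"
      using left_endpoint_integral(2)[OF path[OF that]] t by simp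
    also have "\<dots> = (LINT r:{t\<^sub>0<..t}|lborel. dr i r \<omega> $ k)"
      unfolding set_lebesgue_integral_def
      using integral_bounded_linear[OF bounded_linear_vec_nth[of k] path[OF that, of i, unfolded set_integrable_def]]
      by simp
    finally have 1: "(LINT r:{t\<^sub>0..t}|lborel. dr i r \<omega>) $ k = (LINT r:{t\<^sub>0<..t}|lborel. dr i r \<omega> $ k)" .
    have "drift_integral (i, k) t \<omega> = sqrt (?s / 2) * (LINT r:{t\<^sub>0<..t}|lborel. dr i r \<omega> $ k)"
      unfolding drift_integral_def \<theta>_def by simp
    moreover have "sqrt (2 / ?s) * sqrt (?s / 2) = 1" using s by (simp flip: real_sqrt_mult)
    ultimately show ?thesis unfolding 1 by (simp flip: mult.assoc)
  qed
  have "weak_solution b t\<^sub>0 T (distr M initial_data Z) Q ?F Z X W"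
    unfolding weak_solution_def
  proof (intro conjI allI ballI)
    show "filtered_prob_space t\<^sub>0 T Q ?F" by (rule Q.filt)
    show "brownian_motion t\<^sub>0 T Q ?F (W i)" for i
      unfolding W_def[abs_def] by (rule brownian_family_processes(1)[OF Q.brownian_family_axioms])
    show "independent_processes t\<^sub>0 T Q W"
      unfolding W_def[abs_def] by (rule brownian_family_processes(2)[OF Q.brownian_family_axioms])
    show "Z \<in> measurable (?F t\<^sub>0) initial_data" by (rule N.Z_initial)
    show "distr Q initial_data Z = distr M initial_data Z"
    proof (rule measure_eqI)
      fix A assume "A \<in> sets (distr Q initial_data Z)"
      then have A: "A \<in> sets initial_data" by simp
      have ZQ: "Z \<in> measurable Q initial_data" using N.Z_measurable by (simp add: Q_def)
      have "Z -` A \<inter> space M \<in> sets (?F t\<^sub>0)"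
        using measurable_sets[OF N.Z_initial A] by (simp add: N.space_noise_filtration)
      then show "emeasure (distr Q initial_data Z) A = emeasure (distr M initial_data Z) A"
        unfolding emeasure_distr[OF ZQ A] emeasure_distr[OF N.Z_measurable A] space_Q unfolding Q_def by (rule init)
    qed simp
    show "X i t \<in> borel_measurable (?F t)" if "t \<in> {t\<^sub>0..T}" for i t
      unfolding X_def[abs_def]
      by (rule particle_measurable[OF N.Z_initial]) (simp add: N.adapted[OF that])
    show "AE \<omega> in Q. \<forall>i.
        let s = fst (Z \<omega>); x = snd (Z \<omega>);
            drift = (\<lambda>r. b i r (empirical_measure s (\<lambda>j. X j r \<omega>)) (proj_torus (X i r \<omega>)))
        in set_integrable lborel {t\<^sub>0..T} drift \<and>
           (\<forall>t\<in>{t\<^sub>0..T}.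
              X i t \<omega> = iota (x i) + (LINT r:{t\<^sub>0..t}|lborel. drift r) + sqrt (2 / s i) *\<^sub>R W i t \<omega>)"
      unfolding Let_def dr_def[symmetric]
    proof (intro AE_I2 allI conjI ballI)
      fix \<omega> i assume "\<omega> \<in> space Q"
      then have \<omega>: "\<omega> \<in> space M" by (simp add: space_Q)
      show "set_integrable lborel {t\<^sub>0..T} (\<lambda>r. dr i r \<omega>)"
        using t0T by (intro left_endpoint_integral(1) path \<omega>) auto
      fix t assume t: "t \<in> {t\<^sub>0..T}"
      show "X i t \<omega> = iota (snd (Z \<omega>) i) + (LINT r:{t\<^sub>0..t}|lborel. dr i r \<omega>) + sqrt (2 / fst (Z \<omega>) i) *\<^sub>R W i t \<omega>"
        by (simp add: vec_eq_iff X_def particle_def W_def drift[OF t \<omega>, symmetric] right_diff_distrib)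
    qed
  qed
  then show ?thesis by blast
qed

lemma gaussian_product_char:
  assumes fin: "finite P"
  shows "(LINT x|PiM UNIV (\<lambda>_::'p. std_normal_distribution). iexp (\<Sum>p\<in>P. \<alpha> p * x p))
    = complex_of_real (exp (- (\<Sum>p\<in>P. (\<alpha> p)\<^sup>2) / 2))"
proof -
  let ?M = "\<lambda>_::'p. std_normal_distribution"
  have ps: "prob_space std_normal_distribution" by (rule prob_space_normal_density) simp
  interpret product_prob_space ?M UNIV
    using ps by (simp add: product_prob_space_def product_prob_space_axioms_def product_sigma_finite_def prob_space_imp_sigma_finite)
  have "(LINT x|PiM UNIV ?M. iexp (\<Sum>p\<in>P. \<alpha> p * x p))
      = (LINT x|PiM UNIV ?M. (\<Prod>p\<in>P. iexp (\<alpha> p * restrict x P p)))"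
    using fin by (intro Bochner_Integration.integral_cong refl) (simp add: exp_sum sum_distrib_left)
  also have "\<dots> = (LINT x|distr (PiM UNIV ?M) (PiM P ?M) (\<lambda>x. restrict x P). (\<Prod>p\<in>P. iexp (\<alpha> p * x p)))"
    by (subst integral_distr) (auto intro!: measurable_restrict_subset)
  also have "\<dots> = (LINT x|PiM P ?M. (\<Prod>p\<in>P. iexp (\<alpha> p * x p)))"
    using fin by (simp add: distr_PiM_restrict_finite)
  also have "\<dots> = (\<Prod>p\<in>P. (LINT y|std_normal_distribution. iexp (\<alpha> p * y)))"
    using fin by (intro product_integral_prod finite_measure.integrable_const_bound[OF prob_space.finite_measure[OF ps], of _ 1]) auto
  also have "\<dots> = (\<Prod>p\<in>P. complex_of_real (exp (- (\<alpha> p)\<^sup>2 / 2)))"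
    using char_std_normal_distribution by (simp add: char_def fun_eq_iff)
  also have "\<dots> = complex_of_real (exp (- (\<Sum>p\<in>P. (\<alpha> p)\<^sup>2) / 2))"
    using fin by (simp add: exp_sum[symmetric] sum_negf sum_divide_distrib flip: of_real_prod)
  finally show ?thesis .
qed

text \<open>The product of \<open>\<mm>\<close> and countably many standard Gaussians, transported to a space of vector-valued functions
  of time: \<open>emb\<close> stores the \<open>q\<close>-th variable of component \<open>k\<close> of particle \<open>i\<close> in the \<open>k\<close>-th
  coordinate at time \<open>q\<close>, and \<open>dec\<close> reads it off.\<close>

lemma gaussian_noise_exists:
  fixes \<mm> :: "'z measure"
  assumes \<mm>: "prob_space \<mm>" and t0T: "t\<^sub>0 < T"
  obtains M :: "('z \<times> (nat \<Rightarrow> real \<Rightarrow> real ^ 'd::finite)) measure" and \<xi>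
  where "gaussian_noise M \<mm> fst (\<xi> :: (nat \<times> 'd) \<times> nat \<Rightarrow> _) t\<^sub>0 T" "distr M \<mm> fst = \<mm>"
proof -
  define N where "N = PiM UNIV (\<lambda>_ :: (nat \<times> 'd) \<times> nat. std_normal_distribution)"
  define P where "P = \<mm> \<Otimes>\<^sub>M N"
  have ps: "prob_space std_normal_distribution" by (rule prob_space_normal_density) simp
  interpret \<mm>: prob_space \<mm> by fact
  interpret N: prob_space N unfolding N_def by (rule prob_space_PiM) (rule ps)
  interpret pp: pair_prob_space \<mm> N ..
  interpret P: prob_space P unfolding P_def by (rule pp.prob_space_axioms)
  define dec where "dec w = (\<lambda>p :: (nat \<times> 'd) \<times> nat. w (fst (fst p)) (real (snd p)) $ snd (fst p))"
    for w :: "nat \<Rightarrow> real \<Rightarrow> real ^ 'd"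
  define emb where "emb x = (\<lambda>i (r :: real). \<chi> k. x ((i, k), nat \<lfloor>r\<rfloor>))" for x :: "(nat \<times> 'd) \<times> nat \<Rightarrow> real"
  have dec_emb: "dec (emb x) = x" for x by (auto simp: dec_def emb_def)
  \<comment> \<open>the \<open>\<sigma>\<close>-algebra is pulled back along \<open>\<phi>\<close>, a left inverse of \<open>\<psi>\<close>, so that \<open>\<phi>\<close> has law \<open>P\<close>\<close>
  define \<phi> where "\<phi> \<omega> = (fst \<omega>, dec (snd \<omega>))" for \<omega> :: "'z \<times> (nat \<Rightarrow> real \<Rightarrow> real ^ 'd)"
  define \<psi> where "\<psi> y = (fst y, emb (snd y))" for y :: "'z \<times> ((nat \<times> 'd) \<times> nat \<Rightarrow> real)"
  have \<phi>\<psi>: "\<phi> (\<psi> y) = y" for y by (simp add: \<phi>_def \<psi>_def dec_emb)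
  define X where "X = \<phi> -` space P"
  define M where "M = distr P (vimage_algebra X \<phi> P) \<psi>"
  have \<psi>_meas: "\<psi> \<in> measurable P (vimage_algebra X \<phi> P)"
    by (rule measurable_vimage_algebra2) (auto simp: X_def \<phi>\<psi>)
  have \<phi>_meas: "\<phi> \<in> measurable M P"
  proof -
    have "\<phi> \<in> measurable (vimage_algebra X \<phi> P) P"
      by (rule measurable_vimage_algebra1) (auto simp: X_def)
    then show ?thesis unfolding M_def by simp
  qed
  have distr: "distr M P \<phi> = P"
  proof -
    have "\<phi> \<in> measurable (vimage_algebra X \<phi> P) P" using \<phi>_meas unfolding M_def by simp
    then have "distr M P \<phi> = distr P P (\<phi> \<circ> \<psi>)" unfolding M_def by (rule distr_distr[OF _ \<psi>_meas])
    also have "\<phi> \<circ> \<psi> = (\<lambda>y. y)" by (auto simp: \<phi>\<psi>)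
    finally show ?thesis by (simp add: distr_id2)
  qed
  have M: "prob_space M" unfolding M_def by (rule P.prob_space_distr[OF \<psi>_meas])
  interpret M: prob_space M by fact
  have fst_P: "fst \<in> measurable P \<mm>" and snd_P: "(\<lambda>y. snd y p) \<in> borel_measurable P" for p
  proof -
    show "fst \<in> measurable P \<mm>" unfolding P_def by simp
    have "(\<lambda>x. x p) \<in> measurable N std_normal_distribution" unfolding N_def by simp
    then have "(\<lambda>x. x p) \<in> borel_measurable N" by simp
    then show "(\<lambda>y. snd y p) \<in> borel_measurable P" unfolding P_def by measurable
  qed
  have fst_M: "fst \<in> measurable M \<mm>"
    using measurable_compose[OF \<phi>_meas fst_P] by (simp add: \<phi>_def)
  define \<xi> where "\<xi> p \<omega> = dec (snd \<omega>) p" for p and \<omega> :: "'z \<times> (nat \<Rightarrow> real \<Rightarrow> real ^ 'd)"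
  have \<xi>_M: "\<xi> p \<in> borel_measurable M" for p
    using measurable_compose[OF \<phi>_meas snd_P[of p]] by (simp add: \<phi>_def \<xi>_def[abs_def])
  have law: "distr M \<mm> fst = \<mm>"
  proof -
    have "distr M \<mm> (fst \<circ> \<phi>) = distr P \<mm> fst"
      using distr_distr[OF fst_P \<phi>_meas] unfolding distr by simp
    also have "\<dots> = \<mm>" unfolding P_def by (rule N.distr_pair_fst)
    finally show ?thesis by (simp add: \<phi>_def comp_def)
  qed
  have "gaussian_noise M \<mm> fst \<xi> t\<^sub>0 T"
  proof
    fix A and I :: "((nat \<times> 'd) \<times> nat) set" and \<alpha> assume A: "A \<in> sets \<mm>" and I: "finite I"
    let ?e = "\<lambda>x. iexp (\<Sum>p\<in>I. \<alpha> p * x p)"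
    have [measurable]: "(\<lambda>x. x p) \<in> borel_measurable N" for p
    proof -
      have "(\<lambda>x. x p) \<in> measurable N std_normal_distribution" unfolding N_def by simp
      then show ?thesis by simp
    qed
    have [measurable]: "A \<in> sets \<mm>" by (rule A)
    have int: "integrable (\<mm> \<Otimes>\<^sub>M N) (\<lambda>y. indicat_real A (fst y) *\<^sub>R ?e (snd y))"
      by (rule pp.integrable_const_bound[of _ 1]) (auto simp: indicator_def)
    have "(LINT \<omega>|M. indicat_real (fst -` A \<inter> space M) \<omega> *\<^sub>R iexp (\<Sum>p\<in>I. \<alpha> p * \<xi> p \<omega>))
        = (LINT \<omega>|M. (\<lambda>y. indicat_real A (fst y) *\<^sub>R ?e (snd y)) (\<phi> \<omega>))"
      by (intro Bochner_Integration.integral_cong refl) (simp add: \<phi>_def \<xi>_def indicator_def)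
    also have "\<dots> = (LINT y|distr M P \<phi>. indicat_real A (fst y) *\<^sub>R ?e (snd y))"
      using int by (subst integral_distr[OF \<phi>_meas]) (auto simp: P_def)
    also have "\<dots> = (LINT y|(\<mm> \<Otimes>\<^sub>M N). indicat_real A (fst y) *\<^sub>R ?e (snd y))"
      unfolding distr unfolding P_def ..
    also have "\<dots> = (LINT z|\<mm>. (LINT x|N. indicat_real A z *\<^sub>R ?e x))"
      using pp.integral_fst'[OF int] by simp
    also have "\<dots> = (LINT z|\<mm>. indicat_real A z *\<^sub>R complex_of_real (exp (- (\<Sum>p\<in>I. (\<alpha> p)\<^sup>2) / 2)))"
      unfolding integral_scaleR_right N_def gaussian_product_char[OF I] ..
    also have "\<dots> = complex_of_real (\<mm>.prob A * exp (- (\<Sum>p\<in>I. (\<alpha> p)\<^sup>2) / 2))"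
      by (subst integral_scaleR_left) (auto simp: \<mm>.emeasure_eq_measure scaleR_conv_of_real)
    also have "\<mm>.prob A = M.prob (fst -` A \<inter> space M)"
      using measure_distr[OF fst_M A] unfolding law .
    finally show "(LINT \<omega>|M. indicat_real (fst -` A \<inter> space M) \<omega> *\<^sub>R iexp (\<Sum>p\<in>I. \<alpha> p * \<xi> p \<omega>))
        = complex_of_real (M.prob (fst -` A \<inter> space M) * exp (- (\<Sum>p\<in>I. (\<alpha> p)\<^sup>2) / 2))" .
  qed (fact t0T fst_M \<xi>_M)+
  then show thesis using law by (rule that)
qed

theorem proposition4p1:
  fixes b :: "nat \<Rightarrow> real \<Rightarrow> 'd::finite torus measure \<Rightarrow> 'd torus \<Rightarrow> real ^ 'd"
    and T t\<^sub>0 :: real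
    and \<mm> :: "((nat \<Rightarrow> real) \<times> (nat \<Rightarrow> 'd torus)) measure"
  assumes dim: "CARD('d) \<ge> 2"
    and T: "T > 0"
    and t0: "t\<^sub>0 \<in> {0..<T}"
    and bounded: "\<exists>C. \<forall>i. \<forall>t\<in>{0..T}. \<forall>\<mu>\<in>prob_measures. \<forall>x. norm (b i t \<mu> x) \<le> C"
    and measurable: "\<And>i. (\<lambda>(t, \<mu>, x). b i t \<mu> x) \<in>
          borel_measurable (restrict_space borel {0..T} \<Otimes>\<^sub>M (weak_borel \<Otimes>\<^sub>M borel))"
    and prob: "prob_space \<mm>"
    and sets: "sets \<mm> = sets initial_data"
  shows "\<exists>(Q :: (((nat \<Rightarrow> real) \<times> (nat \<Rightarrow> 'd torus)) \<times> (nat \<Rightarrow> real \<Rightarrow> real ^ 'd)) measure)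
           F Z X W. weak_solution b t\<^sub>0 T \<mm> Q F Z X W"
proof -
  have t: "t\<^sub>0 < T" "0 \<le> t\<^sub>0" using t0 by auto
  obtain C where C: "\<And>i t \<mu> x. t \<in> {0..T} \<Longrightarrow> \<mu> \<in> prob_measures \<Longrightarrow> norm (b i t \<mu> x) \<le> C"
    using bounded by blast
  obtain M :: "(((nat \<Rightarrow> real) \<times> (nat \<Rightarrow> 'd torus)) \<times> (nat \<Rightarrow> real \<Rightarrow> real ^ 'd)) measure"
    and \<xi> :: "(nat \<times> 'd) \<times> nat \<Rightarrow> _"
    where noise: "gaussian_noise M \<mm> fst \<xi> t\<^sub>0 T" and law: "distr M \<mm> fst = \<mm>"
    using gaussian_noise_exists[OF prob t(1)] .
  have "gaussian_noise M initial_data fst \<xi> t\<^sub>0 T"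
    using noise unfolding gaussian_noise_def gaussian_noise_axioms_def sets measurable_cong_sets[OF refl sets] .
  then have "\<exists>(Q :: (((nat \<Rightarrow> real) \<times> (nat \<Rightarrow> 'd torus)) \<times> (nat \<Rightarrow> real \<Rightarrow> real ^ 'd)) measure) F X W.
      weak_solution b t\<^sub>0 T (distr M initial_data fst) Q F fst X W"
  proof (rule weak_solution_from_noise)
    show "norm (b i r \<mu> x) \<le> C" if "r \<in> {0..T}" "\<mu> \<in> prob_measures" for i r \<mu> x
      using that by (rule C)
  qed (fact t(2) measurable)+
  moreover have "distr M initial_data fst = \<mm>"
    using distr_cong[OF refl sets refl, of M fst] law by simp
  ultimately show ?thesis by blast
qed

end
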